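(* Let $m\le n$ be positive integers, let $U$ be an open subset of $\mathbb R^n$, let $V$ be an $m$-dimensional varifold in $U$ such that $\|\delta V\|$ is a Radon measure and $\Theta^m(\|V\|,z)\ge1$ for $\|V\|$ almost all $z$; if $m>1$ suppose additionally that $\mathbf h(V;\cdot)\in\mathbf L_m^{\mathrm{loc}}(\|V\|,\mathbb R^n)$ and $\delta V(g)=-\int g(z)\bullet\mathbf h(V;z)\,d\|V\|z$ for $g\in C_c^\infty(U,\mathbb R^n)$. Let $K$ be a compact subset of $U$, $0<\varepsilon<\operatorname{dist}(K,\mathbb R^n\setminus U)$. Let $\Gamma_{SP}(2n)$ denote the positive, finite number furnished, for $M=2n$, by the Sobolev–Poincaré theorem, i.e. a number having the property $SP(2n)$ stated in the context. Suppose that either (1) $1=m=q$ and $\lambda=2^{m+5}\alpha(m)^{-1}\,\Gamma_{SP}(2n)\,\sup\{\Theta^1(\|V\|,a):a\in K\}$, or (2) $1<m<q$ and $\lambda=\varepsilon$. Then there exists a positive, finite number $\Gamma$ with the following property. If $l$ is a positive integer, $f:\operatorname{spt}\|V\|\to\mathbb R^l$ is a continuous function, $f\in\mathbf T(V,\mathbb R^l)$, and $\gamma=\sup\{(\|V\|\llcorner B(a,\varepsilon))_{(q)}(V\mathbf Df):a\in K\}$, then $$|f(z)-f(w)|\le l^{1/2}\lambda\gamma\quad\text{whenever }z,w\in K\cap\operatorname{spt}\|V\|\text{ and }|z-w|\le\Gamma^{-1}.$$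
   Context: **Notation.** $\mathbf G(n,m)$ is the set of $m$-dimensional linear subspaces of $\mathbb R^n$; $S_\natural$ is the orthogonal projection onto $S$; $\sigma\bullet\tau=\operatorname{trace}(\sigma^*\circ\tau)$, $|\sigma|^2=\sigma\bullet\sigma$; $\langle v,\lambda\rangle=\lambda(v)$. $U(z,r)$ and $B(z,r)$ are the open and closed balls; $\alpha(m)$ is the Lebesgue measure of the unit ball of $\mathbb R^m$; $\Theta^m(\phi,z)=\lim_{r\to0+}\phi(B(z,r))/(\alpha(m)r^m)$. For a measure $\phi$, $\phi_{(q)}(f)=(\int|f|^q\,d\phi)^{1/q}$ for $1\le q<\infty$ and $\phi_{(\infty)}(f)$ is the essential supremum of $|f|$; $\phi\llcorner A$ is restriction. $\operatorname{spt}$ is the support relative to $U$. $\mathbf L^{\mathrm{loc}}_p$ means $p$-th power integrable on compact subsets of $U$. $\operatorname{Bdry}$ is the topological boundary. **Varifolds.** An $m$-dimensional varifold $V$ in $U$ is a Radon measure over $U\times\mathbf G(n,m)$, with weight $\|V\|(A)=V(A\times\mathbf G(n,m))$; first variation $\delta V(g)=\int Dg(z)\bullet S_\natural\,dV(z,S)$ for $g\in C_c^\infty(U,\mathbb R^n)$, with total variation measure $\|\delta V\|$; if the latter is Radon, $\delta V$ is extended by $\mathbf L_1(\|\delta V\|)$-continuity. (Varifolds as in the claim are automatically rectifiable; for $m=1$ the density $\Theta^1(\|V\|,\cdot)$ exists and is finite everywhere in $U$.) $\mathbf h(V;\cdot)$ is the generalised mean curvature vector, i.e. $-\mathbf h(V;\cdot)\|V\|$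 is the part of $\delta V$ absolutely continuous with respect to $\|V\|$. **Weakly differentiable functions.** $\mathbf T(V,\mathbb R^l)$ is the set of $\mathbb R^l$ valued $\|V\|+\|\delta V\|$ measurable functions $f$ with domain contained in $U$ for which there is a $\|V\|$ measurable $\operatorname{Hom}(\mathbb R^n,\mathbb R^l)$ valued $F$ such that (i) $\int_{K\cap\{|f|\le s\}}|F|\,d\|V\|<\infty$ for compact $K\subset U$, $0\le s<\infty$; (ii) for $\theta\in C_c^\infty(U,\mathbb R^n)$ and $\eta\in C^\infty(\mathbb R^l,\mathbb R)$ with $\operatorname{spt}D\eta$ compact, $$\delta V((\eta\circ f)\theta)=\int\eta(f(z))S_\natural\bullet D\theta(z)\,dV(z,S)+\int\langle\theta(z),D\eta(f(z))\circ F(z)\rangle\,d\|V\|z.$$ $F$ is $\|V\|$ almost unique and is denoted $V\mathbf Df$. **Zero boundary values.** For a $\|V\|+\|\delta V\|$ measurable set $E$, $V\partial E=(\delta V)\llcorner E-\delta(V\llcorner (E\times\mathbf G(n,m)))$, with total variation $\|V\partial E\|$. For $G$ relatively open in $\operatorname{Bdry}U$ and $B=(\operatorname{Bdry}U)\setminus G$, $\mathbf T_G(V,\mathbb R^l)$ is the set of $f\in\mathbf T(V,\mathbb R^l)$ such that, with $E(t)=\{z:|f(z)|>t\}$, for Lebesgue almost all $0<t<\infty$: $\|V\|(E(t)\cap K)+\|\delta V\|(E(t)\cap K)+\|V\partial E(t)\|(U\cap K)<\infty$ for every compact $K\subset\mathbb R^n\setminus B$, and $\int_{E(t)\times\mathbf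 G(n,m)}D\theta(z)\bullet S_\natural\,dV(z,S)=((\delta V)\llcorner E(t))(\theta|U)-(V\partial E(t))(\theta|U)$ for every $\theta\in C_c^\infty(\mathbb R^n\setminus B,\mathbb R^n)$. **The property $SP(M)$** ($1\le M<\infty$) of a positive, finite number $\Gamma_0$. (The Sobolev–Poincaré theorem asserts that for each such $M$ a number with this property exists; the number it furnishes is denoted $\Gamma_{SP}(M)$.) The letters below are local to this property. Whenever $l,m,n$ are positive integers, $m\le n\le M$, $1\le p\le m$, $U\subset\mathbb R^n$ is open, $V$ is an $m$-dimensional varifold in $U$, $\|\delta V\|$ is Radon, $\Theta^m(\|V\|,z)\ge1$ for $\|V\|$ almost all $z$, in case $p>1$ also $\mathbf h(V;\cdot)\in\mathbf L_p^{\mathrm{loc}}(\|V\|,\mathbb R^n)$ and $\delta V(g)=-\int g\bullet\mathbf h(V;\cdot)\,d\|V\|$ for $g\in C_c^\infty(U,\mathbb R^n)$, $\psi=\|\delta V\|$ if $p=1$ and $\psi=|\mathbf h(V;\cdot)|^p\|V\|$ if $p>1$, $G$ is relatively open in $\operatorname{Bdry}U$, $B=(\operatorname{Bdry}U)\setminus G$, $f\in\mathbf T_G(V,\mathbb R^l)$, and $E=U\cap\{z:f(z)\ne0\}$, then the following two statements hold. (I) Suppose $1\le Q\le M$, $0<r<\infty$, $\|V\|(E)\le(Q-M^{-1})\alpha(m)r^m$, $\|V\|(E\cap\{z:\Theta^m(\|V\|,z)<Q\})\le\Gamma_0^{-1}r^m$, and $A=U\cap\{z:U(z,r)\subset\mathbb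 R^n\setminus B\}$. Then: (a) if $p=1$, and $\beta=\infty$ if $m=1$, $\beta=m/(m-1)$ if $m>1$, then $(\|V\|\llcorner A)_{(\beta)}(f)\le\Gamma_0\big(\|V\|_{(1)}(V\mathbf Df)+\|\delta V\|_{(1)}(f)\big)$; (b) if $p=m=1$ and $\psi(E)\le\Gamma_0^{-1}$, then $(\|V\|\llcorner A)_{(\infty)}(f)\le\Gamma_0\|V\|_{(1)}(V\mathbf Df)$; (c) if $1\le q<m=p$ and $\psi(E)\le\Gamma_0^{-1}$, then $(\|V\|\llcorner A)_{(mq/(m-q))}(f)\le\Gamma_0(m-q)^{-1}\|V\|_{(q)}(V\mathbf Df)$; (d) if $1<p=m<q\le\infty$ and $\psi(E)\le\Gamma_0^{-1}$, then $(\|V\|\llcorner A)_{(\infty)}(f)\le\Gamma_0^{1/(1/m-1/q)}\|V\|(E)^{1/m-1/q}\|V\|_{(q)}(V\mathbf Df)$. (II) If $G=\operatorname{Bdry}U$ and $\|V\|(E)<\infty$, then the four implications (a)–(d) hold with $\|V\|\llcorner A$ replaced by $\|V\|$. *)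

theory Defs
  imports
    "HOL-Analysis.Analysis"
    "HOL-Library.Poly_Mapping"
    "HOL-Probability.Essential_Supremum"
begin

section \<open>Euclidean spaces of varying dimension\<close>

text \<open>
  The Sobolev--Poincare property quantifies over all dimensions \<open>n \<le> M\<close> and all \<open>l\<close>, so dimensions
  must be terms. We realise every \<open>\<real>\<^sup>n\<close> as the subspace of those finitely supported sequences
  that vanish from index \<open>n\<close> on, inside the inner product space of all finitely supported sequences.
\<close>

instantiation poly_mapping :: (type, real_vector) real_vector
begin

lift_definition scaleR_poly_mapping :: "real \<Rightarrow> ('a \<Rightarrow>\<^sub>0 'b) \<Rightarrow> ('a \<Rightarrow>\<^sub>0 'b)"
  is "\<lambda>r f i. r *\<^sub>R f i"
  by (auto elim!: rev_finite_subset)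

instance
  by standard (transfer, simp add: fun_eq_iff scaleR_add_right scaleR_add_left)+

end

instantiation poly_mapping :: (type, real_inner) real_inner
begin

definition inner_poly_mapping :: "('a \<Rightarrow>\<^sub>0 'b) \<Rightarrow> ('a \<Rightarrow>\<^sub>0 'b) \<Rightarrow> real"
  where "inner_poly_mapping x y =
    (\<Sum>i\<in>Poly_Mapping.keys x. inner (Poly_Mapping.lookup x i) (Poly_Mapping.lookup y i))"

definition norm_poly_mapping :: "('a \<Rightarrow>\<^sub>0 'b) \<Rightarrow> real"
  where "norm_poly_mapping x = sqrt (inner x x)"

definition sgn_poly_mapping :: "('a \<Rightarrow>\<^sub>0 'b) \<Rightarrow> ('a \<Rightarrow>\<^sub>0 'b)"
  where "sgn_poly_mapping x = x /\<^sub>R norm x"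

definition dist_poly_mapping :: "('a \<Rightarrow>\<^sub>0 'b) \<Rightarrow> ('a \<Rightarrow>\<^sub>0 'b) \<Rightarrow> real"
  where "dist_poly_mapping x y = norm (x - y)"

definition uniformity_poly_mapping :: "(('a \<Rightarrow>\<^sub>0 'b) \<times> ('a \<Rightarrow>\<^sub>0 'b)) filter"
  where "uniformity_poly_mapping = (INF e\<in>{0 <..}. principal {(x, y). dist x y < e})"

definition open_poly_mapping :: "('a \<Rightarrow>\<^sub>0 'b) set \<Rightarrow> bool"
  where "open_poly_mapping S =
    (\<forall>x\<in>S. eventually (\<lambda>(x', y). x' = x \<longrightarrow> y \<in> S) uniformity)"

lemma inner_poly_mapping_superset:
  assumes "finite A" "Poly_Mapping.keys x \<subseteq> A"
  shows "inner x y = (\<Sum>i\<in>A. inner (Poly_Mapping.lookup x i) (Poly_Mapping.lookup y i))"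
  unfolding inner_poly_mapping_def
  using assms by (intro sum.mono_neutral_left) (auto simp: in_keys_iff)

instance
proof
  fix x y z :: "'a \<Rightarrow>\<^sub>0 'b" and r :: real and S :: "('a \<Rightarrow>\<^sub>0 'b) set"
  show "dist x y = norm (x - y)"
    by (rule dist_poly_mapping_def)
  show "sgn x = x /\<^sub>R norm x"
    by (rule sgn_poly_mapping_def)
  show "uniformity = (INF e\<in>{0 <..}. principal {(x, y). dist (x::'a \<Rightarrow>\<^sub>0 'b) y < e})"
    by (rule uniformity_poly_mapping_def)
  show "open S = (\<forall>x\<in>S. eventually (\<lambda>(x', y). x' = x \<longrightarrow> y \<in> S) uniformity)"
    by (rule open_poly_mapping_def)
  show "norm x = sqrt (inner x x)"
    by (rule norm_poly_mapping_def)
  let ?A = "Poly_Mapping.keys x \<union> Poly_Mapping.keys y"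
  show "inner x y = inner y x"
    by (subst (1 2) inner_poly_mapping_superset[of ?A]) (auto simp: inner_commute)
  have "Poly_Mapping.keys (x + y) \<subseteq> ?A"
    by (rule keys_add)
  then show "inner (x + y) z = inner x z + inner y z"
    by (subst (1 2 3) inner_poly_mapping_superset[of ?A])
      (auto simp: lookup_add inner_add_left sum.distrib)
  have "Poly_Mapping.keys (r *\<^sub>R x) \<subseteq> Poly_Mapping.keys x"
    by (auto simp: in_keys_iff scaleR_poly_mapping.rep_eq)
  then show "inner (r *\<^sub>R x) y = r * inner x y"
    by (subst (1 2) inner_poly_mapping_superset[of "Poly_Mapping.keys x"])
      (auto simp: scaleR_poly_mapping.rep_eq sum_distrib_left)
  show "0 \<le> inner x x"
    unfolding inner_poly_mapping_def by (intro sum_nonneg) auto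
  show "(inner x x = 0) = (x = 0)"
    unfolding inner_poly_mapping_def
    by (subst sum_nonneg_eq_0_iff) (auto simp: in_keys_iff intro!: poly_mapping_eqI)
qed

end

type_synonym vec = "nat \<Rightarrow>\<^sub>0 real"

definition Rn :: "nat \<Rightarrow> vec set"
  where "Rn n = {x. Poly_Mapping.keys x \<subseteq> {..<n}}"

definition unit_vec :: "nat \<Rightarrow> vec"
  where "unit_vec i = Poly_Mapping.single i 1"


section \<open>Linear maps, Grassmannians, smooth functions\<close>

text \<open>\<open>Hom(\<real>\<^sup>n, \<real>\<^sup>l)\<close>; each map is extended by zero to the remaining coordinates.\<close>

definition Hom :: "nat \<Rightarrow> nat \<Rightarrow> (vec \<Rightarrow> vec) set"
  where "Hom n l = {L. linear L \<and> L ` Rn n \<subseteq> Rn l \<and> (\<forall>i\<ge>n. L (unit_vec i) = 0)}"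

text \<open>\<open>\<sigma> \<bullet> \<tau> = trace (\<sigma>\<^sup>* \<circ> \<tau>)\<close>, the trace being computed in the standard basis of \<open>\<real>\<^sup>n\<close>.\<close>

definition hs_inner :: "nat \<Rightarrow> (vec \<Rightarrow> vec) \<Rightarrow> (vec \<Rightarrow> vec) \<Rightarrow> real"
  where "hs_inner n \<sigma> \<tau> = (\<Sum>i<n. inner (\<sigma> (unit_vec i)) (\<tau> (unit_vec i)))"

definition hs_norm :: "nat \<Rightarrow> (vec \<Rightarrow> vec) \<Rightarrow> real"
  where "hs_norm n \<sigma> = sqrt (hs_inner n \<sigma> \<sigma>)"

definition orth_proj :: "vec set \<Rightarrow> vec \<Rightarrow> vec"
  where "orth_proj S x = (THE y. y \<in> S \<and> (\<forall>w\<in>S. inner (x - y) w = 0))"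

definition Grass :: "nat \<Rightarrow> nat \<Rightarrow> vec set set"
  where "Grass n m = {S. subspace S \<and> S \<subseteq> Rn n \<and> dim S = m}"

text \<open>The topology in which planes are close when the entries of their projection matrices are.\<close>

definition Grass_top :: "nat \<Rightarrow> nat \<Rightarrow> vec set topology"
  where "Grass_top n m = pullback_topology (Grass n m)
    (\<lambda>S i j. Poly_Mapping.lookup (orth_proj S (unit_vec j)) i) euclidean"

definition Deriv :: "nat \<Rightarrow> (vec \<Rightarrow> 'b::real_normed_vector) \<Rightarrow> vec \<Rightarrow> vec \<Rightarrow> 'b"
  where "Deriv n g z = frechet_derivative g (at z within Rn n)"

text \<open>\<open>Ck k n W g\<close>: \<open>g\<close> is of class \<open>k\<close> on the open subset \<open>W\<close> of \<open>\<real>\<^sup>n\<close>. Of the derivative only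
  its values on \<open>\<real>\<^sup>n\<close> are determined, hence the recursion over partial derivatives.\<close>

primrec Ck :: "nat \<Rightarrow> nat \<Rightarrow> vec set \<Rightarrow> (vec \<Rightarrow> 'b::real_normed_vector) \<Rightarrow> bool" where
  "Ck 0 n W g \<longleftrightarrow> continuous_on W g"
| "Ck (Suc k) n W g \<longleftrightarrow>
    (\<forall>z\<in>W. g differentiable (at z within Rn n)) \<and>
    (\<forall>i<n. Ck k n W (\<lambda>z. Deriv n g z (unit_vec i)))"

definition smooth :: "nat \<Rightarrow> vec set \<Rightarrow> (vec \<Rightarrow> 'b::real_normed_vector) \<Rightarrow> bool"
  where "smooth n W g \<longleftrightarrow> (\<forall>k. Ck k n W g)"

text \<open>\<open>C\<^sub>c\<^sup>\<infinity>(W, \<real>\<^sup>l)\<close> for \<open>W\<close> open in \<open>\<real>\<^sup>n\<close>; its members are extended by zero.\<close>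

definition Ccinf :: "nat \<Rightarrow> vec set \<Rightarrow> nat \<Rightarrow> (vec \<Rightarrow> vec) set"
  where "Ccinf n W l = {g. smooth n W g \<and> range g \<subseteq> Rn l \<and>
    (\<exists>C. compact C \<and> C \<subseteq> W \<and> (\<forall>z. z \<notin> C \<longrightarrow> g z = 0))}"


section \<open>Measures\<close>

text \<open>
  Radon measures are represented by Borel measures that are finite on compact sets; on the locally
  compact, second countable spaces occurring here these correspond. Measurability with respect to
  the Radon measure is measurability with respect to the completion.
\<close>

definition add_measure :: "'a measure \<Rightarrow> 'a measure \<Rightarrow> 'a measure"
  where "add_measure M N = measure_of (space M) (sets M) (\<lambda>A. emeasure M A + emeasure N A)"

definition epow :: "ennreal \<Rightarrow> real \<Rightarrow> ennreal"
  where "epow x a = (if x = \<infinity> then \<infinity> else ennreal (enn2real x powr a))"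

text \<open>\<open>\<phi>\<^bsub>(q)\<^esub>(f)\<close> for \<open>1 \<le> q \<le> \<infinity>\<close> and real valued \<open>f\<close>; possibly infinite.\<close>

definition Lnorm :: "'a measure \<Rightarrow> ennreal \<Rightarrow> ('a \<Rightarrow> real) \<Rightarrow> ennreal"
  where "Lnorm \<phi> q f =
    (if q = \<infinity> then esssup \<phi> (\<lambda>z. ennreal \<bar>f z\<bar>)
     else epow (\<integral>\<^sup>+z. ennreal (\<bar>f z\<bar> powr enn2real q) \<partial>\<phi>) (1 / enn2real q))"

definition restr :: "'a measure \<Rightarrow> 'a set \<Rightarrow> 'a measure"
  where "restr \<phi> A = density \<phi> (indicator A)"

definition dens_ratio :: "vec measure \<Rightarrow> nat \<Rightarrow> vec \<Rightarrow> real \<Rightarrow> ennreal"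
  where "dens_ratio \<phi> m z r =
    emeasure \<phi> (cball z r \<inter> space \<phi>) / ennreal (unit_ball_vol (real m) * r ^ m)"

text \<open>Meaningful only where the limit exists.\<close>

definition mdens :: "vec measure \<Rightarrow> nat \<Rightarrow> vec \<Rightarrow> ennreal"
  where "mdens \<phi> m z = Lim (at_right 0) (dens_ratio \<phi> m z)"

definition has_mdens :: "vec measure \<Rightarrow> nat \<Rightarrow> vec \<Rightarrow> bool"
  where "has_mdens \<phi> m z \<longleftrightarrow> (dens_ratio \<phi> m z \<longlongrightarrow> mdens \<phi> m z) (at_right 0)"

definition spt :: "vec set \<Rightarrow> vec measure \<Rightarrow> vec set"
  where "spt U \<phi> = U - \<Union>{W. openin (top_of_set U) W \<and> emeasure \<phi> W = 0}"


section \<open>Vector distributions and their total variation\<close>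

text \<open>In this section \<open>U\<close> is open in \<open>\<real>\<^sup>n\<close> and \<open>T\<close> is a linear functional on \<open>Ccinf n U n\<close>.\<close>

definition total_var :: "nat \<Rightarrow> vec set \<Rightarrow> ((vec \<Rightarrow> vec) \<Rightarrow> real) \<Rightarrow> vec set \<Rightarrow> ennreal"
  where "total_var n U T A =
    (INF W\<in>{W. openin (top_of_set U) W \<and> A \<subseteq> W}.
       SUP g\<in>{g \<in> Ccinf n W n. \<forall>z. norm (g z) \<le> 1}. ennreal (T g))"

definition total_var_measure :: "nat \<Rightarrow> vec set \<Rightarrow> ((vec \<Rightarrow> vec) \<Rightarrow> real) \<Rightarrow> vec measure"
  where "total_var_measure n U T =
    measure_of U (sets (restrict_space borel U)) (total_var n U T)"

definition radon_var :: "nat \<Rightarrow> vec set \<Rightarrow> ((vec \<Rightarrow> vec) \<Rightarrow> real) \<Rightarrow> bool"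
  where "radon_var n U T \<longleftrightarrow> (\<forall>C. compact C \<and> C \<subseteq> U \<longrightarrow> total_var n U T C < \<infinity>)"

text \<open>The extension of \<open>T\<close> by continuity to functions integrable with respect to its total variation
  measure; only the restriction of \<open>g\<close> to \<open>U\<close> matters.\<close>

definition ext :: "nat \<Rightarrow> vec set \<Rightarrow> ((vec \<Rightarrow> vec) \<Rightarrow> real) \<Rightarrow> (vec \<Rightarrow> vec) \<Rightarrow> real"
  where "ext n U T g = (THE c. \<exists>gs. (\<forall>k. gs k \<in> Ccinf n U n) \<and>
    (\<lambda>k. \<integral>\<^sup>+z. ennreal (norm (gs k z - g z)) \<partial>completion (total_var_measure n U T))
      \<longlonglongrightarrow> 0 \<and>
    (\<lambda>k::nat. T (gs k)) \<longlonglongrightarrow> c)"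


section \<open>Varifolds\<close>

definition varifold :: "nat \<Rightarrow> nat \<Rightarrow> vec set \<Rightarrow> (vec \<times> vec set) measure \<Rightarrow> bool"
  where "varifold n m U V \<longleftrightarrow>
    (let X = prod_topology (top_of_set U) (Grass_top n m) in
      space V = U \<times> Grass n m \<and>
      sets V = sigma_sets (U \<times> Grass n m) {W. openin X W} \<and>
      (\<forall>C. compactin X C \<longrightarrow> emeasure V C < \<infinity>))"

definition weight :: "vec set \<Rightarrow> (vec \<times> vec set) measure \<Rightarrow> vec measure"
  where "weight U V = distr V (restrict_space borel U) fst"

definition first_var :: "nat \<Rightarrow> (vec \<times> vec set) measure \<Rightarrow> (vec \<Rightarrow> vec) \<Rightarrow> real"
  where "first_var n V g = (\<integral>(z, S). hs_inner n (Deriv n g z) (orth_proj S) \<partial>V)"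

abbreviation var_measure :: "nat \<Rightarrow> vec set \<Rightarrow> (vec \<times> vec set) measure \<Rightarrow> vec measure"
  where "var_measure n U V \<equiv> total_var_measure n U (first_var n V)"

text \<open>\<open>-h \<parallel>V\<parallel>\<close> is the absolutely continuous part of \<open>\<delta>V\<close>: off some \<open>\<parallel>V\<parallel>\<close> null set \<open>N\<close>, which
  carries the singular part, \<open>\<delta>V\<close> is given by \<open>-h\<close>.\<close>

definition is_mean_curv ::
    "nat \<Rightarrow> vec set \<Rightarrow> (vec \<times> vec set) measure \<Rightarrow> (vec \<Rightarrow> vec) \<Rightarrow> bool"
  where "is_mean_curv n U V h \<longleftrightarrow>
    h \<in> completion (weight U V) \<rightarrow>\<^sub>M borel \<and> h ` U \<subseteq> Rn n \<and>
    (\<forall>C. compact C \<and> C \<subseteq> U \<longrightarrow>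
      (\<integral>\<^sup>+z\<in>C. ennreal (norm (h z)) \<partial>completion (weight U V)) < \<infinity>) \<and>
    (\<exists>N \<in> null_sets (weight U V). \<forall>g \<in> Ccinf n U n.
      ext n U (first_var n V) (\<lambda>z. indicator (U - N) z *\<^sub>R g z) =
        - (\<integral>z. inner (g z) (h z) \<partial>completion (weight U V)))"

definition mean_curv :: "nat \<Rightarrow> vec set \<Rightarrow> (vec \<times> vec set) measure \<Rightarrow> vec \<Rightarrow> vec"
  where "mean_curv n U V = (SOME h. is_mean_curv n U V h)"

definition mean_curv_hyp :: "nat \<Rightarrow> vec set \<Rightarrow> (vec \<times> vec set) measure \<Rightarrow> real \<Rightarrow> bool"
  where "mean_curv_hyp n U V p \<longleftrightarrow>
    (\<forall>C. compact C \<and> C \<subseteq> U \<longrightarrow>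
      (\<integral>\<^sup>+z\<in>C. ennreal (norm (mean_curv n U V z) powr p) \<partial>completion (weight U V)) < \<infinity>) \<and>
    (\<forall>g \<in> Ccinf n U n. first_var n V g =
      - (\<integral>z. inner (g z) (mean_curv n U V z) \<partial>completion (weight U V)))"

definition bdry_var ::
    "nat \<Rightarrow> vec set \<Rightarrow> (vec \<times> vec set) measure \<Rightarrow> vec set \<Rightarrow> (vec \<Rightarrow> vec) \<Rightarrow> real"
  where "bdry_var n U V E g =
    ext n U (first_var n V) (\<lambda>z. indicator E z *\<^sub>R g z) -
    (\<integral>(z, S). indicator E z * hs_inner n (Deriv n g z) (orth_proj S) \<partial>completion V)"


section \<open>Weakly differentiable functions\<close>

text \<open>
  A partial function defined almost everywhere is represented by a total one with values in \<open>\<real>\<^sup>l\<close> on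
  all of \<open>U\<close>; all notions below are invariant under changes on \<open>\<parallel>V\<parallel> + \<parallel>\<delta>V\<parallel>\<close> null sets.
\<close>

definition is_weak_deriv ::
    "nat \<Rightarrow> nat \<Rightarrow> vec set \<Rightarrow> (vec \<times> vec set) measure \<Rightarrow> (vec \<Rightarrow> vec) \<Rightarrow>
      (vec \<Rightarrow> vec \<Rightarrow> vec) \<Rightarrow> bool"
  where "is_weak_deriv n l U V f F \<longleftrightarrow>
    F ` U \<subseteq> Hom n l \<and>
    (\<forall>i<n. (\<lambda>z. F z (unit_vec i)) \<in> completion (weight U V) \<rightarrow>\<^sub>M borel) \<and>
    (\<forall>C s. compact C \<and> C \<subseteq> U \<and> 0 \<le> s \<longrightarrow>
      (\<integral>\<^sup>+z\<in>C \<inter> {z. norm (f z) \<le> s}. ennreal (hs_norm n (F z)) \<partial>completion (weight U V))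
        < \<infinity>) \<and>
    (\<forall>\<theta> \<in> Ccinf n U n. \<forall>\<eta> :: vec \<Rightarrow> real.
      smooth l (Rn l) \<eta> \<and>
      (\<exists>C. compact C \<and> C \<subseteq> Rn l \<and> (\<forall>y\<in>Rn l - C. \<forall>v\<in>Rn l. Deriv l \<eta> y v = 0)) \<longrightarrow>
      ext n U (first_var n V) (\<lambda>z. \<eta> (f z) *\<^sub>R \<theta> z) =
        (\<integral>(z, S). \<eta> (f z) * hs_inner n (orth_proj S) (Deriv n \<theta> z) \<partial>completion V) +
        (\<integral>z. Deriv l \<eta> (f z) (F z (\<theta> z)) \<partial>completion (weight U V)))"

definition TV :: "nat \<Rightarrow> nat \<Rightarrow> vec set \<Rightarrow> (vec \<times> vec set) measure \<Rightarrow> (vec \<Rightarrow> vec) set"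
  where "TV n l U V = {f.
    f \<in> completion (add_measure (weight U V) (var_measure n U V)) \<rightarrow>\<^sub>M borel \<and>
    f ` U \<subseteq> Rn l \<and> (\<exists>F. is_weak_deriv n l U V f F)}"

definition weak_deriv ::
    "nat \<Rightarrow> nat \<Rightarrow> vec set \<Rightarrow> (vec \<times> vec set) measure \<Rightarrow> (vec \<Rightarrow> vec) \<Rightarrow> vec \<Rightarrow> vec \<Rightarrow> vec"
  where "weak_deriv n l U V f = (SOME F. is_weak_deriv n l U V f F)"

abbreviation Bdry :: "nat \<Rightarrow> vec set \<Rightarrow> vec set"
  where "Bdry n U \<equiv> top_of_set (Rn n) frontier_of U"

definition TG ::
    "nat \<Rightarrow> nat \<Rightarrow> vec set \<Rightarrow> (vec \<times> vec set) measure \<Rightarrow> vec set \<Rightarrow> (vec \<Rightarrow> vec) set"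
  where "TG n l U V G = {f \<in> TV n l U V. AE t in lborel. 0 < t \<longrightarrow>
    (let B = Bdry n U - G; E = {z \<in> U. t < norm (f z)} in
      (\<forall>C. compact C \<and> C \<subseteq> Rn n - B \<longrightarrow>
        emeasure (completion (weight U V)) (E \<inter> C) +
        emeasure (completion (var_measure n U V)) (E \<inter> C) +
        total_var n U (bdry_var n U V E) (U \<inter> C) < \<infinity>) \<and>
      (\<forall>\<theta> \<in> Ccinf n (Rn n - B) n.
        (\<integral>(z, S). indicator E z * hs_inner n (Deriv n \<theta> z) (orth_proj S) \<partial>completion V) =
        ext n U (first_var n V) (\<lambda>z. indicator E z *\<^sub>R \<theta> z) - ext n U (bdry_var n U V E) \<theta>))}"


section \<open>The Sobolev--Poincare property\<close>

definition psi_measure :: "nat \<Rightarrow> vec set \<Rightarrow> (vec \<times> vec set) measure \<Rightarrow> real \<Rightarrow> vec measure"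
  where "psi_measure n U V p =
    (if p = 1 then completion (var_measure n U V)
     else density (completion (weight U V)) (\<lambda>z. ennreal (norm (mean_curv n U V z) powr p)))"

text \<open>The four implications (a)--(d), with the measure \<open>\<phi>\<close> on the left hand sides.\<close>

definition SP_implications ::
    "real \<Rightarrow> nat \<Rightarrow> nat \<Rightarrow> nat \<Rightarrow> real \<Rightarrow> vec set \<Rightarrow> (vec \<times> vec set) measure \<Rightarrow> (vec \<Rightarrow> vec) \<Rightarrow>
      vec measure \<Rightarrow> bool"
  where "SP_implications \<Gamma>\<^sub>0 l m n p U V f \<phi> \<longleftrightarrow>
    (let W = completion (weight U V);
         E = {z \<in> U. f z \<noteq> 0};
         small = (emeasure (psi_measure n U V p) E \<le> ennreal (1 / \<Gamma>\<^sub>0));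
         u = (\<lambda>z. norm (f z));
         Du = (\<lambda>z. hs_norm n (weak_deriv n l U V f z)) in
      (p = 1 \<longrightarrow>
        Lnorm \<phi> (if m = 1 then \<infinity> else ennreal (real m / (real m - 1))) u
          \<le> ennreal \<Gamma>\<^sub>0 * (Lnorm W 1 Du + Lnorm (completion (var_measure n U V)) 1 u)) \<and>
      (p = 1 \<and> m = 1 \<and> small \<longrightarrow>
        Lnorm \<phi> \<infinity> u \<le> ennreal \<Gamma>\<^sub>0 * Lnorm W 1 Du) \<and>
      (\<forall>q::real. 1 \<le> q \<and> q < real m \<and> p = real m \<and> small \<longrightarrow>
        Lnorm \<phi> (ennreal (real m * q / (real m - q))) u
          \<le> ennreal (\<Gamma>\<^sub>0 / (real m - q)) * Lnorm W (ennreal q) Du) \<and>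
      (\<forall>q::ennreal. 1 < p \<and> p = real m \<and> ennreal (real m) < q \<and> small \<longrightarrow>
        (let a = 1 / real m - enn2real (1 / q) in
          Lnorm \<phi> \<infinity> u
            \<le> ennreal (\<Gamma>\<^sub>0 powr (1 / a)) * epow (emeasure W E) a * Lnorm W q Du)))"

definition SP :: "real \<Rightarrow> real \<Rightarrow> bool"
  where "SP M \<Gamma>\<^sub>0 \<longleftrightarrow> 0 < \<Gamma>\<^sub>0 \<and>
    (\<forall>(l::nat) (m::nat) (n::nat) (p::real) U V G f.
      let W = completion (weight U V);
          B = Bdry n U - G;
          E = {z \<in> U. f z \<noteq> 0} in
      1 \<le> l \<and> 1 \<le> m \<and> m \<le> n \<and> real n \<le> M \<and> 1 \<le> p \<and> p \<le> real m \<and>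
      openin (top_of_set (Rn n)) U \<and> varifold n m U V \<and> radon_var n U (first_var n V) \<and>
      (AE z in weight U V. has_mdens (weight U V) m z \<and> 1 \<le> mdens (weight U V) m z) \<and>
      (1 < p \<longrightarrow> mean_curv_hyp n U V p) \<and>
      openin (top_of_set (Bdry n U)) G \<and> f \<in> TG n l U V G
      \<longrightarrow>
      (\<forall>Q r.
        1 \<le> Q \<and> Q \<le> M \<and> 0 < r \<and>
        emeasure W E \<le> ennreal ((Q - 1 / M) * unit_ball_vol (real m) * r ^ m) \<and>
        emeasure W (E \<inter> {z. mdens (weight U V) m z < ennreal Q}) \<le> ennreal (r ^ m / \<Gamma>\<^sub>0)
        \<longrightarrow>
        SP_implications \<Gamma>\<^sub>0 l m n p U V f
          (restr W {z \<in> U. ball z r \<inter> Rn n \<subseteq> Rn n - B})) \<and>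
      (G = Bdry n U \<and> emeasure W E < \<infinity> \<longrightarrow> SP_implications \<Gamma>\<^sub>0 l m n p U V f W))"


section \<open>Distance of sets\<close>

text \<open>Unlike the library function \<open>setdist\<close>, this is infinite if one of the sets is empty.\<close>

definition eset_dist :: "vec set \<Rightarrow> vec set \<Rightarrow> ennreal"
  where "eset_dist A B = (INF x\<in>A. INF y\<in>B. ennreal (dist x y))"

end

theory Submission
 imports Defs
begin

text \<open>Write mu for the weight of V, Sp for its support and Gamma for the Sobolev-Poincare
  number. The core is a local oscillation bound: every point a of Sp has a radius sigma > 0, the
  same for all f, such that |f_i(z) - f_i(a)| <= c N_a(f) for each coordinate i and each z in Sp
  with |z - a| < sigma. Here N_a(f) is the q-norm of the weak derivative of f over B(a, epsilon),
  and c is 4 Gamma if m = 1 (\<open>oscillation_1\<close>) and epsilon/2 if m > 1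
  (\<open>oscillation_2\<close>). A Lebesgue number of the cover of K by such balls, the triangle
  inequality through a, and the passage from coordinates to the norm of R^l give the assertion with
  2c in place of lambda (\<open>modulus_of_continuity\<close>). If m > 1, then 2c = epsilon =
  lambda. If m = 1, then 2c = 8 Gamma = 32 Gamma / 4 and 2^(m+5) / alpha(m) = 32, so 2c <= lambda as
  soon as the density is at least 1/4 at every point of Sp (\<open>density_lower_bound\<close>);
  this comes from a monotonicity inequality for mu(B(a,r))/r (\<open>monotonicity\<close>), applied
  at nearby points of density at least one.

  The oscillation bound has two ingredients, both obtained by feeding suitable functions to the
  Sobolev-Poincare inequality on balls around a that have small psi measure once a is removed. The
  first is a local intermediate value property (\<open>local_ivt\<close>): if z is close enough to
  a, then a continuous function on Sp attains, in Sp near a, every value between its values at a and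
  z. A skipped value would split off a relatively clopen piece of Sp that misses a but comes close
  to it. Such a piece carries a cutoff function whose gradient on Sp is bounded and vanishes outside
  the piece, so the inequality bounds the mass of the piece from below (\<open>clop_mass\<close>).
  Since balls have finite mass, pieces cannot come arbitrarily close to a
  (\<open>clop_avoid\<close>).

  The second ingredient is an estimate on strips (\<open>strip_estimate\<close>). The interval
  between f_i(a) and f_i(z), of length d, is cut into N strips of length L = d/N. For each strip one
  takes a profile eta of the i-th coordinate, of slope at most one and of height at least L/4 in the
  middle, and the product w of eta(f) with a spatial cutoff xi. It vanishes at a, it reaches L/4
  because the middle value is attained, and its weak derivative is at most |VDf| + L K on the part A
  of a ball that f_i maps into the strip, and zero elsewhere on Sp. For m = 1, implication (b)
  summed over the strips gives d/4 <= Gamma (N_a(f) + d K b / N), with b the mass of the ball, and N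
  tends to infinity. For m > 1, implication (d) is used on a strip whose set A has mass at most the
  average; N is chosen so that the term L K can be absorbed, and the remaining coefficient tends to
  zero with the radius because mu(B(a,r)) <= C r^(m - delta) (\<open>growth\<close>).

  To apply the inequality to w one needs that w is weakly differentiable, what its weak derivative
  is, and that it has zero boundary values. The definition for f is tested with eta^k and xi^k
  theta; this yields the identity for the powers w^k (\<open>E_power\<close>), hence for polynomials
  and, by approximation in C^1, for all C^1 functions of w (\<open>E_psi\<close>). The derivative of
  xi along V is expressed by the barycentre \<open>P\<close> of the tangent projections over a
  point. Uniqueness of the weak derivative (\<open>weak_deriv_unique\<close>) follows from a
  fundamental lemma. As to boundary values (\<open>g_TG\<close>), the superlevel sets of w lie in
  the compact support of xi, and for almost every level their boundary has finite total variation,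
  by comparison with steep ramps of w and Fatou's lemma. Underneath lies the fact that the total
  variation of a vector distribution is a Borel measure controlling the distribution up to a
  constant, so that the extension \<open>ext\<close> is well defined and obeys dominated convergence
  (\<open>vdist\<close>).\<close>

subsection \<open>The coordinate spaces\<close>

abbreviation "uv \<equiv> unit_vec"
abbreviation "ind \<equiv> indicator"
abbreviation "bmeas \<equiv> borel_measurable"
abbreviation "emeas \<equiv> emeasure"
abbreviation "enn \<equiv> ennreal"
abbreviation real_deriv :: "(real \<Rightarrow> real) \<Rightarrow> real \<Rightarrow> real filter \<Rightarrow> bool" (infix "hrd" 50)
 where "(f hrd D) F \<equiv> (f has_field_derivative D) F"

abbreviation lk :: "vec => nat => real" where "lk \<equiv> Poly_Mapping.lookup"

lemma lk_scaleR [simp]: "lk (r *\<^sub>R x) i = r*lk x i" by (simp add: scaleR_poly_mapping.rep_eq)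

lemma lk_uminus [simp]: "lk (- x) i = - lk x i" by (simp add: uminus_poly_mapping.rep_eq)

lemma lk_add [simp]: "lk (x+y) i = lk x i+lk y i" by (simp add: lookup_add)

lemma lk_diff [simp]: "lk (x - y) i = lk x i - lk y i" by (simp add: lookup_minus)

lemma lk_zero [simp]: "lk 0 i = 0" by simp

lemma lk_sum [simp]: "lk (sum f A) i = (\<Sum>a\<in>A. lk (f a) i)" by (rule lookup_sum)

lemma lk_unit_vec [simp]: "lk (uv i) j = (if i = j then 1 else 0)" by (simp add: unit_vec_def lookup_single when_def)

lemma inner_unit_vec: "inner x (uv i) = lk x i"
proof -
 have "inner x (uv i) = (\<Sum>j\<in>Poly_Mapping.keys x Un {i}. lk x j*lk (uv i) j)" by (subst inner_poly_mapping_superset[of "Poly_Mapping.keys x Un {i}"]) auto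
 also have "... = (\<Sum>j\<in>Poly_Mapping.keys x Un {i}. if j = i then lk x i else 0)" by (rule sum.cong) auto
 also have "... = lk x i" by (subst sum.delta) auto
 finally show ?thesis .
qed

lemma inner_unit_vec_left: "inner (uv i) x = lk x i" by (simp add: inner_commute inner_unit_vec)

lemma norm_unit_vec [simp]: "norm (uv i) = 1" by (simp add: norm_eq_sqrt_inner inner_unit_vec)

lemma bounded_linear_lk: "bounded_linear (%x. lk x i)"
 using bounded_linear_inner_left[of "uv i"] by (simp add: inner_unit_vec)

lemma continuous_lk [continuous_intros]: "continuous_on S f==>continuous_on S (%x. lk (f x) i)"
 using bounded_linear.continuous_on[OF bounded_linear_lk] .

lemma lk_measurable [measurable]: "(%x. lk x i) : bmeas borel" by (intro borel_measurable_continuous_onI continuous_intros)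

lemma abs_lk_le_norm: "\<bar>lk x i\<bar> <= norm x"
 using Cauchy_Schwarz_ineq2[of x "uv i"] by (simp add: inner_unit_vec)

lemma lk_Rn: "x : Rn n==>n <= i==>lk x i = 0" by (auto simp: Rn_def in_keys_iff subset_iff)

lemma Rn_iff: "x : Rn n \<longleftrightarrow> (ALL i>=n. lk x i = 0)" by (auto simp: Rn_def in_keys_iff subset_iff) (meson lessThan_iff not_le)+

lemma subspace_Rn: "subspace (Rn n)" by (auto simp: subspace_def Rn_iff)

lemma Rn_add [intro]: "x : Rn n==>y : Rn n==>x+y : Rn n"
 and Rn_diff [intro]: "x : Rn n==>y : Rn n==>x - y : Rn n"
 and Rn_scaleR [intro]: "x : Rn n==>r *\<^sub>R x : Rn n"
 and Rn_zero [simp, intro]: "0 : Rn n" by (auto simp: Rn_iff)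

lemma Rn_sum: "(!!i. i : I==>f i : Rn n)==>sum f I : Rn n" by (simp add: Rn_iff)

lemma unit_vec_Rn [simp, intro]: "i < n==>uv i : Rn n" by (auto simp: Rn_iff)

lemma vec_eqI: "(!!i. lk x i = lk y i)==>x = y" by (rule poly_mapping_eqI) simp

text \<open>Coordinate projection onto \<open>Rn n\<close>. Describing \<open>Rn n\<close> as its
  fixed point set shows that \<open>Rn n\<close> is closed and Borel.\<close>

definition tr :: "nat => vec => vec" where
 "tr n x = (\<Sum>i<n. lk x i *\<^sub>R uv i)"

lemma lk_tr: "lk (tr n x) j = (if j < n then lk x j else 0)"
proof -
 have "lk (tr n x) j = (\<Sum>i<n. if i = j then lk x j else 0)"
  unfolding tr_def lk_sum by (rule sum.cong) auto
 thus ?thesis by simp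
qed

lemma tr_Rn [simp]: "tr n x : Rn n" by (simp add: Rn_iff lk_tr)

lemma tr_id: "x : Rn n==>tr n x = x" by (rule vec_eqI) (simp add: lk_tr Rn_iff)

lemma Rn_expand: "x : Rn n==>x = (\<Sum>i<n. lk x i *\<^sub>R uv i)"
 using tr_id[of x n] by (simp add: tr_def)

lemma Rn_eq_tr: "Rn n = {x. tr n x = x}"
 using tr_id tr_Rn by (metis (mono_tags, lifting) Collect_cong mem_Collect_eq Collect_mem_eq)

lemma bounded_linear_tr: "bounded_linear (tr n)"
proof -
 have "bounded_linear (%x. \<Sum>i<n. lk x i *\<^sub>R uv i)" by (intro bounded_linear_sum bounded_linear_compose[OF bounded_linear_scaleR_left bounded_linear_lk])
 thus ?thesis by (simp add: tr_def[abs_def])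
qed

lemma continuous_tr [continuous_intros]: "continuous_on S f==>continuous_on S (%x. tr n (f x))"
 using bounded_linear.continuous_on[OF bounded_linear_tr] .

lemma closed_Rn: "closed (Rn n)"
 unfolding Rn_eq_tr by (rule closed_Collect_eq) (intro continuous_intros)+

lemma Rn_borel [measurable]: "Rn n : sets borel"
 using closed_Rn by simp

lemma inner_Rn: assumes "x : Rn n" shows "inner x y = (\<Sum>i<n. lk x i*lk y i)"
 using assms by (subst inner_poly_mapping_superset[of "{..<n}"]) (auto simp: Rn_def)

lemma inner_Rn2: assumes "y : Rn n" shows "inner x y = (\<Sum>i<n. lk x i*lk y i)"
 using inner_Rn[OF assms, of x] by (simp add: inner_commute mult.commute)

lemma norm_Rn: "x : Rn n==>norm x = sqrt (\<Sum>i<n. (lk x i)^2)" by (simp add: norm_eq_sqrt_inner inner_Rn power2_eq_square)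

lemma norm_Rn_le: "x : Rn n==>norm x <= (\<Sum>i<n. \<bar>lk x i\<bar>)" by (subst Rn_expand, assumption) (rule order_trans[OF norm_sum], simp)

text \<open>Bounded closed subsets of the ambient sequence space need not be compact, so the
  Heine-Borel property is built up one coordinate at a time: the ball of \<open>Rn (Suc n)\<close>
  lies in the continuous image of a ball of \<open>Rn n\<close> times an interval.\<close>

lemma compact_cball_Rn0: "compact (cball 0 r Int Rn n)"
proof (induction n arbitrary: r)
 case 0
 have "Rn 0 = {0}" by (auto simp: Rn_iff intro!: vec_eqI)
 thus ?case by (simp add: finite_imp_compact)
next
 case (Suc n)
 have cnt: "continuous_on A (%p::vec \<times> real. fst p+snd p *\<^sub>R uv n)" for A by (intro continuous_intros)
 have cp: "compact ((%p. fst p+snd p *\<^sub>R uv n) ` ((cball 0 r Int Rn n) \<times> cball (0::real) r))" by (intro compact_continuous_image cnt compact_Times Suc.IH compact_cball)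
 have sub: "cball 0 r Int Rn (Suc n) <= (%p. fst p+snd p *\<^sub>R uv n) ` ((cball 0 r Int Rn n) \<times> cball (0::real) r)"
 proof
  fix x assume x: "x : cball 0 r Int Rn (Suc n)"
  have e: "x = tr n x+lk x n *\<^sub>R uv n"
   using Rn_expand[of x "Suc n"] x by (simp add: tr_def)
  have "norm (tr n x) <= norm x"
   using x by (subst norm_Rn[of _ n], simp, subst norm_Rn[of x "Suc n"])
     (auto intro!: real_sqrt_le_mono simp: lk_tr)
  moreover have "\<bar>lk x n\<bar> <= norm x" by (rule abs_lk_le_norm)
  ultimately have "(tr n x, lk x n) : (cball 0 r Int Rn n) \<times> cball 0 r"
   using x by (auto simp: dist_norm)
  thus "x : (%p. fst p+snd p *\<^sub>R uv n) ` ((cball 0 r Int Rn n) \<times> cball (0::real) r)"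
   using e by (intro image_eqI[of _ _ "(tr n x, lk x n)"]) auto
 qed
 have "compact (((%p. fst p+snd p *\<^sub>R uv n) ` ((cball 0 r Int Rn n) \<times> cball (0::real) r)) Int (cball 0 r Int Rn (Suc n)))" by (intro compact_Int_closed cp closed_Int closed_Rn) auto
 thus ?case using sub by (simp add: Int_absorb1)
qed

lemma compact_Rn: assumes "closed C" "bounded C" "C <= Rn n" shows "compact C"
proof -
 obtain r where "ALL x:C. norm x <= r" using assms(2) bounded_iff by blast
 hence "C <= cball 0 r Int Rn n" using assms by (auto simp: dist_norm)
 thus ?thesis using compact_Int_closed[OF compact_cball_Rn0 assms(1), of r n] by (simp add: Int_absorb1)
qed

lemma compact_cball_Rn: "compact (cball z r Int Rn n)" by (rule compact_Rn[of _ n]) (auto intro: closed_Rn bounded_subset[OF bounded_cball])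

abbreviation opn :: "nat => vec set => bool" where
 "opn n W \<equiv> openin (top_of_set (Rn n)) W"

lemma opn_subset: "opn n W==>W <= Rn n"
 using openin_imp_subset by blast

lemma opn_cball: assumes "opn n W" "z : W" obtains r where "0 < r" "cball z r Int Rn n <= W"
proof -
 obtain e where e: "e > 0" "ball z e Int Rn n <= W" using assms openin_contains_ball[of "Rn n" W] by auto
 have "cball z (e/2) <= ball z e" using e by auto
 thus ?thesis using e that[of "e/2"] by fastforce
qed

lemma opn_borel [measurable_dest]: "opn n W==>W : sets borel" by (metis Rn_borel borel_open openin_open sets.Int)

lemma opn_trans: "opn n U==>openin (top_of_set U) W==>opn n W"
 using openin_trans by blast

lemma opn_openin: "opn n U==>openin (top_of_set U) W \<longleftrightarrow> opn n W & W <= U" by (metis openin_imp_subset openin_subset_trans openin_trans)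

lemma opn_Int_open: "opn n W==>open H==>opn n (W Int H)" by (simp add: openin_Int_open)

lemma opn_Diff_closed: "opn n W==>closed C==>opn n (W - C)"
 using opn_Int_open[of n W "- C"] by (simp add: Diff_eq open_Compl)

text \<open>The k-th set consists of the points of norm at most k whose distance from the complement
  of an ambient open set cutting out W is at least 1/(k+1). Sigma-finiteness and inner approximation
  by compact sets are read off from this exhaustion.\<close>

lemma opn_exhaust:
 assumes "opn n W"
 obtains C :: "nat => vec set" where "!!k. compact (C k)" "incseq C" "(\<Union>k. C k) = W"
  "!!K. compact K==>K <= W==>EX k. K <= C k"
proof -
 obtain H where H: "open H" "W = Rn n Int H" using assms by (auto simp: openin_open)
 define C where "C k = cball 0 (real k) Int Rn n Int {x. ALL y. y : - H --> 1/real (Suc k) <= dist x y}" for k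
 have cl: "closed {x::vec. ALL y. y : - H --> 1/real (Suc k) <= dist x y}" for k
 proof -
  have "{x::vec. ALL y. y : - H --> 1/real (Suc k) <= dist x y}
   = (\<Inter>y\<in>-H. {x. 1/real (Suc k) <= dist x y})" by auto
  also have "closed ..." by (intro closed_INT ballI closed_Collect_le continuous_intros)
  finally show ?thesis .
 qed
 have 1: "compact (C k)" for k unfolding C_def by (intro compact_Int_closed cl compact_cball_Rn)
 have 2: "incseq C"
 proof (rule incseq_SucI, rule subsetI)
  fix k x assume x: "x : C k"
  have "1/real (Suc (Suc k)) <= 1/real (Suc k)" by (simp add: frac_le)
  thus "x : C (Suc k)" using x unfolding C_def by (auto simp del: of_nat_Suc intro: order_trans)
 qed
 have 3: "EX k. K <= C k" if K: "compact K" "K <= W" for K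
 proof -
  obtain r where r: "ALL x:K. norm x <= r" using compact_imp_bounded[OF K(1)] bounded_iff by blast
  \<comment> \<open>A Lebesgue number of the one-element cover of K by H bounds the distance from K
    to the complement from below.\<close>
  have "EX d>0. ALL x:K. ball x d <= H"
  proof -
   obtain d where "0 < d" "!!x. x : K==>EX G:{H}. ball x d <= G"
    using Heine_Borel_lemma[of K "{H}"] K H by auto
   thus ?thesis by auto
  qed
  hence "EX d>0. ALL x:K. ALL y:-H. d <= dist x y" by (metis ComplD mem_ball not_le subsetD)
  then obtain d where d: "d > 0" "ALL x:K. ALL y:-H. d <= dist x y" by blast
  obtain k1 where k1: "r <= real k1" using real_arch_simple by blast
  obtain k2 where k2: "inverse (real (Suc k2)) < d" using reals_Archimedean d(1) by blast
  let ?k = "max k1 k2"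
  have "1/real (Suc ?k) <= 1/real (Suc k2)" by (simp add: frac_le)
  hence "1/real (Suc ?k) <= d" using k2 by (simp add: inverse_eq_divide)
  moreover have "r <= real ?k" using k1 by simp
  ultimately have b: "!!x. x : K==>norm x <= real ?k" 
   "!!x y. x : K==>y : - H==>1/real (Suc ?k) <= dist x y"
   using r d order_trans by blast+
  have "K <= Rn n" using K H by blast
  hence "K <= C ?k" unfolding C_def using b by (intro subsetI IntI CollectI allI impI) (simp_all add: subset_iff del: of_nat_Suc)
  thus ?thesis by blast
 qed
 have 4: "(\<Union>k. C k) = W"
 proof
  show "(\<Union>k. C k) <= W" 
  proof (rule UN_least, rule subsetI)
   fix k x assume x: "x : C k"
   have "x : H" proof (rule ccontr)
    assume "x ~: H" hence "1/real (Suc k) <= dist x x" using x unfolding C_def by blast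
    thus False by simp
   qed
   thus "x : W" using x H unfolding C_def by auto
  qed
  show "W <= (\<Union>k. C k)" 
  proof
   fix x assume "x : W" 
   hence "EX k. {x} <= C k" using 3[of "{x}"] by simp
   thus "x : (\<Union>k. C k)" by auto
  qed
 qed
 show ?thesis using that[OF 1 2 4 3] by blast
qed

subsection \<open>Projections and the Grassmannian\<close>

definition orthon :: "nat => (nat => vec) => bool" where
 "orthon m v \<longleftrightarrow> (ALL i<m. ALL j<m. inner (v i) (v j) = (if i = j then 1 else 0))"

lemma orthon_proj_residual:
 assumes "orthon m v" "k < m"
 shows "inner (x - (\<Sum>i<m. inner x (v i) *\<^sub>R v i)) (v k) = 0"
proof -
 have "inner (\<Sum>i<m. inner x (v i) *\<^sub>R v i) (v k) = (\<Sum>i<m. if i = k then inner x (v k) else 0)"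
  unfolding inner_sum_left using assms by (intro sum.cong) (auto simp: orthon_def)
 also have "... = inner x (v k)" using assms by simp
 finally show ?thesis by (simp add: inner_diff_left)
qed

lemma inner_span_zero: assumes "!!y. y : B==>inner x y = 0" "w : span B" shows "inner (x::vec) w = 0"
 using assms(2) by (induction rule: span_induct_alt) (auto simp: assms inner_add_right)

text \<open>The right-hand side lies in S and leaves a residual orthogonal to S, and such a point is
  unique; so the definite description in \<open>orth_proj\<close> denotes it.\<close>

lemma orth_proj_orthon:
 assumes o: "orthon m v" and S: "S = span (v ` {..<m})"
 shows "orth_proj S x = (\<Sum>i<m. inner x (v i) *\<^sub>R v i)"
proof -
 let ?y = "\<Sum>i<m. inner x (v i) *\<^sub>R v i"
 have 1: "?y : S" unfolding S by (intro span_sum span_scale span_base) auto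
 have 2: "ALL w:S. inner (x - ?y) w = 0"
 proof
  fix w assume "w : S"
  hence w: "w : span (v ` {..<m})" using S by simp
  show "inner (x - ?y) w = 0" by (rule inner_span_zero[OF _ w]) (use orthon_proj_residual[OF o] in blast)
 qed
 show ?thesis unfolding orth_proj_def
 proof (rule the_equality)
  show "?y : S & (ALL w:S. inner (x - ?y) w = 0)" using 1 2 by blast
  fix y assume y: "y : S & (ALL w:S. inner (x - y) w = 0)"
  have d: "y - ?y : S" using y 1 S span_diff by blast
  have "inner (y - ?y) (y - ?y) = inner (x - ?y) (y - ?y) - inner (x - y) (y - ?y)" by (simp add: algebra_simps)
  also have "... = 0" using d 2 y by simp
  finally show "y = ?y" by simp
 qed
qed

lemma orthon_independent: assumes o: "orthon m v" shows "independent (v ` {..<m})" "inj_on v {..<m}"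
proof -
 show inj: "inj_on v {..<m}"
 proof (rule inj_onI)
  fix i j assume *: "i : {..<m}" "j : {..<m}" "v i = v j"
  hence "inner (v i) (v j) = 1" using o unfolding orthon_def by (metis lessThan_iff)
  moreover have "inner (v i) (v j) = (if i = j then 1 else 0)"
   using o *(1,2) unfolding orthon_def by blast
  ultimately show "i = j" by (metis zero_neq_one)
 qed
 show "independent (v ` {..<m})"
 proof (rule independent_if_scalars_zero)
  fix f x assume s: "(\<Sum>x\<in>v ` {..<m}. f x *\<^sub>R x) = 0" and x: "x : v ` {..<m}"
  obtain k where k: "k < m" "x = v k" using x by auto
  have "(\<Sum>i<m. f (v i) *\<^sub>R v i) = 0" using s inj by (simp add: sum.reindex)
  hence "inner (\<Sum>i<m. f (v i) *\<^sub>R v i) (v k) = 0" by simp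
  hence "(\<Sum>i<m. if i = k then f (v k) else 0) = 0"
   unfolding inner_sum_left using o k by (subst (asm) sum.cong[OF refl, of _ _ "%i. if i = k then f (v k) else 0"])
    (auto simp: orthon_def)
  thus "f x = 0" using k by simp
 qed simp
qed

text \<open>One Gram-Schmidt step: the residual of x, normalised.\<close>

lemma orthon_extend:
 assumes o: "orthon k v" and x: "x ~: span (v ` {..<k})"
 obtains u where "orthon (Suc k) (v(k := u))" "u : span (insert x (v ` {..<k}))"
proof -
 let ?S = "span (v ` {..<k})"
 define y where "y = x - (\<Sum>i<k. inner x (v i) *\<^sub>R v i)"
 have sp: "(\<Sum>i<k. inner x (v i) *\<^sub>R v i) : ?S" by (intro span_sum span_scale span_base) auto
 have y0: "y ~= 0" using x sp unfolding y_def by auto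
 define u where "u = y /\<^sub>R norm y"
 have "inverse (norm y)*(inverse (norm y)*(norm y*norm y)) = 1" using y0 by (simp add: field_simps)
 hence "orthon (Suc k) (v(k := u))"
  using o y0 orthon_proj_residual[OF o, of _ x]
  unfolding orthon_def u_def y_def[symmetric] by (auto simp: less_Suc_eq inner_commute[of _ y] power2_norm_eq_inner[symmetric] power2_eq_square)
 moreover have "u : span (insert x (v ` {..<k}))"
  unfolding u_def y_def using sp by (intro span_scale span_diff) (auto intro: span_base subsetD[OF span_mono, of "v ` {..<k}"])
 ultimately show ?thesis by (rule that)
qed

text \<open>Gram-Schmidt steps inside S are possible as long as fewer than m vectors are present,
  since fewer than m vectors cannot span S. The m vectors found do span S: otherwise one more step
  would give m + 1 independent vectors in S, more than a basis has.\<close>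

lemma Grass_frame:
 assumes "S : Grass n m"
 obtains v where "orthon m v" "!!i. i < m==>v i : Rn n" "S = span (v ` {..<m})"
proof -
 have S: "subspace S" "S <= Rn n" "dim S = m" using assms by (auto simp: Grass_def)
 have "EX v. orthon k v & v ` {..<k} <= S" if "k <= m" for k
  using that
 proof (induction k)
  case 0 show ?case by (auto simp: orthon_def)
 next
  case (Suc k)
  then obtain v where v: "orthon k v" "v ` {..<k} <= S" by auto
  have "\<not> S <= span (v ` {..<k})"
  proof
   assume "S <= span (v ` {..<k})"
   hence "dim S <= card (v ` {..<k})" by (intro dim_le_card) auto
   also have "... <= k" using card_image_le[of "{..<k}" v] by simp
   finally show False using S Suc.prems by simp
  qed
  then obtain x where x: "x : S" "x ~: span (v ` {..<k})" by blast
  obtain u where u: "orthon (Suc k) (v(k := u))" "u : span (insert x (v ` {..<k}))"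
   using orthon_extend[OF v(1) x(2)] by blast
  have "u : S" using u(2) span_minimal[of "insert x (v ` {..<k})" S] v x S by auto
  thus ?case using u(1) v(2) by (intro exI[of _ "v(k := u)"] conjI) (assumption, auto simp: less_Suc_eq)
 qed
 from this[of m] obtain v where v: "orthon m v" "v ` {..<m} <= S" by auto
 have "S <= span (v ` {..<m})"
 proof (rule ccontr)
  assume "\<not> S <= span (v ` {..<m})"
  then obtain x where x: "x : S" "x ~: span (v ` {..<m})" by blast
  obtain u where u: "orthon (Suc m) (v(m := u))" "u : span (insert x (v ` {..<m}))"
   using orthon_extend[OF v(1) x(2)] by blast
  have "u : S" using u(2) span_minimal[of "insert x (v ` {..<m})" S] v x S by auto
  hence sub: "(v(m := u)) ` {..<Suc m} <= S" using v(2) by (auto simp: less_Suc_eq)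
  have "card ((v(m := u)) ` {..<Suc m}) = Suc m"
   using card_image[OF orthon_independent(2)[OF u(1)]] by simp
  \<comment> \<open>Comparing the sizes of independent sets needs a finite spanning set; the unit
    vectors provide one.\<close>
  moreover have "S <= span (uv ` {..<n})" 
  proof
   fix x assume "x : S" hence "x = (\<Sum>i<n. lk x i *\<^sub>R uv i)" using S Rn_expand by blast
   thus "x : span (uv ` {..<n})" by (metis (no_types, lifting) span_sum span_scale span_base image_eqI)
  qed
  hence fin: "EX B. finite B & S <= span B" by blast
  obtain B where B: "B <= S" "independent B" "S <= span B" "card B = dim S" using basis_exists by blast
  have "finite B" using fin independent_span_bound[of _ B] B by (metis subset_trans finite.simps)
  hence "card ((v(m := u)) ` {..<Suc m}) <= card B"
   using independent_span_bound[OF _ orthon_independent(1)[OF u(1)], of B] sub B(3) by blast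
  ultimately show False using B S by simp
 qed
 moreover have "span (v ` {..<m}) <= S" using span_minimal v S by blast
 ultimately show ?thesis using that[of v] v S by blast
qed

lemma orthon_Grass:
 assumes "orthon m v" "!!i. i < m==>v i : Rn n"
 shows "span (v ` {..<m}) : Grass n m"
proof -
 have "span (v ` {..<m}) <= Rn n" using assms by (intro span_minimal subspace_Rn) auto
 moreover have "dim (span (v ` {..<m})) = m"
  using dim_span_eq_card_independent[OF orthon_independent(1)[OF assms(1)]] orthon_independent(2)[OF assms(1)] by (simp add: card_image)
 ultimately show ?thesis by (auto simp: Grass_def)
qed

text \<open>All parts are read off from the expansion in an orthonormal frame. The trace m in the
  last one is the source of the factor m in the first variation of radial fields.\<close>

lemma orth_proj_props:
 assumes "S : Grass n m"
 shows "linear (orth_proj S)" "orth_proj S x : Rn n" "inner (orth_proj S x) y = inner x (orth_proj S y)"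
  "inner x (orth_proj S x) = (norm (orth_proj S x))^2" "norm (orth_proj S x) <= norm x"
  "(\<Sum>i<n. inner (uv i) (orth_proj S (uv i))) = real m"
proof -
 obtain v where v: "orthon m v" "!!i. i < m==>v i : Rn n" "S = span (v ` {..<m})"
  using Grass_frame[OF assms] by blast
 have P: "orth_proj S = (%x. \<Sum>i<m. inner x (v i) *\<^sub>R v i)" using orth_proj_orthon[OF v(1,3)] by auto
 show "linear (orth_proj S)" unfolding P by (intro linearI) (auto simp: inner_add_left scaleR_add_left sum.distrib scaleR_sum_right)
 show "orth_proj S x : Rn n" unfolding P using v(2) by (intro Rn_sum Rn_scaleR) auto
 have sym: "inner (orth_proj S x) y = inner x (orth_proj S y)" for x y unfolding P by (simp add: inner_sum_left inner_sum_right inner_commute mult.commute)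
 show "inner (orth_proj S x) y = inner x (orth_proj S y)" by (rule sym)
 have res: "inner (x - orth_proj S x) (orth_proj S x) = 0" for x unfolding P by (subst inner_sum_right) (use orthon_proj_residual[OF v(1)] in auto)
 show e: "inner x (orth_proj S x) = (norm (orth_proj S x))^2" for x
  using res[of x] by (simp add: inner_diff_left power2_norm_eq_inner)
 show "norm (orth_proj S x) <= norm x"
 proof -
  have "(norm (orth_proj S x))^2 <= norm x*norm (orth_proj S x)" using e[of x] norm_cauchy_schwarz[of x "orth_proj S x"] by simp
  thus ?thesis by (cases "norm (orth_proj S x) = 0") (auto simp: power2_eq_square)
 qed
 have "(\<Sum>i<n. inner (uv i) (orth_proj S (uv i))) = (\<Sum>i<n. \<Sum>k<m. lk (v k) i*lk (v k) i)"
  unfolding P by (simp add: inner_sum_right inner_unit_vec_left)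
 also have "... = (\<Sum>k<m. \<Sum>i<n. lk (v k) i*lk (v k) i)" by (rule sum.swap)
 also have "... = (\<Sum>k<m. 1)" using v by (intro sum.cong refl) (auto simp: inner_Rn[symmetric] orthon_def)
 finally show "(\<Sum>i<n. inner (uv i) (orth_proj S (uv i))) = real m" by simp
qed

lemma topspace_Grass_top [simp]: "topspace (Grass_top n m) = Grass n m" by (simp add: Grass_top_def topspace_pullback_topology)

text \<open>The Grassmannian is the continuous image of the compact set of orthonormal frames.\<close>

lemma compact_Grass: "compact_space (Grass_top n m)"
proof -
 define X where "X = product_topology (%k::nat. top_of_set (cball 0 1 Int Rn n)) {..<m}"
 define A where "A = {v : topspace X. orthon m v}"
 have cX: "compact_space X" unfolding X_def by (simp add: compact_space_product_topology compact_space_subtopology compact_cball_Rn compactin_euclidean_iff)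
 have pr: "continuous_map X euclidean (%v. v k)" if "k < m" for k
  unfolding X_def using continuous_map_product_projection[of k "{..<m}" "%k. top_of_set (cball 0 1 Int Rn n)"] that by (simp add: continuous_map_in_subtopology)
 have cin: "continuous_map X euclideanreal (%v. inner (v i) (v j))" if "i < m" "j < m" for i j
 proof -
  have "continuous_map X (prod_topology euclidean euclidean) (%v. (v i, v j))"
   using pr[OF that(1)] pr[OF that(2)] by (subst continuous_map_pairwise) (simp add: o_def)
  moreover have "continuous_map (prod_topology euclidean euclidean) euclideanreal (%p::vec\<times>vec. inner (fst p) (snd p))" by (simp add: euclidean_product_topology continuous_on_inner continuous_on_fst continuous_on_snd)
  ultimately have "continuous_map X euclideanreal ((%p. inner (fst p) (snd p)) \<circ> (%v. (v i, v j)))" by (rule continuous_map_compose)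
  thus ?thesis by (simp add: o_def)
 qed
 have A: "A = topspace X Int (\<Inter>i\<in>{..<m}. \<Inter>j\<in>{..<m}. {v : topspace X. inner (v i) (v j) : {if i = j then 1 else 0}})" by (auto simp: A_def orthon_def)
 have "closedin X ({v : topspace X. inner (v i) (v j) : {if i = j then 1 else 0}})" if "i < m" "j < m" for i j
  using closedin_continuous_map_preimage[OF cin[OF that], of "{if i = j then 1 else 0}"] by simp
 hence "closedin X A" unfolding A  by (cases "m = 0") (auto intro!: closedin_Int closedin_INT)
 hence cA: "compactin X A" using cX closedin_compact_space by blast
 have cont: "continuous_map (subtopology X A) (Grass_top n m) (%v. span (v ` {..<m}))"
  unfolding Grass_top_def
 proof (rule continuous_map_pullback')
  have "(%v. span (v ` {..<m})) ` topspace (subtopology X A) <= Grass n m"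
   using orthon_Grass by (fastforce simp: A_def X_def PiE_iff)
  thus "topspace (subtopology X A) <= (%v. span (v ` {..<m})) -` Grass n m" by auto
  have eq: "lk (orth_proj (span (v ` {..<m})) (uv j)) i = (\<Sum>k<m. lk (v k) j*lk (v k) i)"
   if "v : topspace (subtopology X A)" for v i j
   using that by (subst orth_proj_orthon[OF _ refl]) (auto simp: A_def inner_unit_vec_left)
  have "continuous_map (subtopology X A) euclideanreal (%v. \<Sum>k<m. lk (v k) j*lk (v k) i)" for i j
  proof -
   have "continuous_map X euclideanreal (%v. lk (v k) j)" if "k < m" for k j
    using continuous_map_compose[OF pr[OF that], of euclideanreal "%x. lk x j"] by (simp add: o_def continuous_intros)
   hence "continuous_map X euclideanreal (%v. \<Sum>k<m. lk (v k) j*lk (v k) i)" by (intro continuous_map_sum continuous_map_real_mult) auto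
   thus ?thesis by (rule continuous_map_from_subtopology)
  qed
  hence "continuous_map (subtopology X A) euclideanreal
    (%v. lk (orth_proj (span (v ` {..<m})) (uv j)) i)" for i j by (rule continuous_map_eq) (use eq in auto)
  thus "continuous_map (subtopology X A) euclidean
    ((%S i j. lk (orth_proj S (uv j)) i) \<circ> (%v. span (v ` {..<m})))" by (simp add: euclidean_product_topology[symmetric] continuous_map_componentwise_UNIV o_def)
 qed
 have surj: "(%v. span (v ` {..<m})) ` A = Grass n m"
 proof
  show "(%v. span (v ` {..<m})) ` A <= Grass n m"
   using orthon_Grass by (fastforce simp: A_def X_def PiE_iff)
  show "Grass n m <= (%v. span (v ` {..<m})) ` A"
  proof
   fix S assume "S : Grass n m"
   then obtain v where v: "orthon m v" "!!i. i < m==>v i : Rn n" "S = span (v ` {..<m})"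
    using Grass_frame by blast
   \<comment> \<open>Points of the product topology are extensional functions, so the frame is cut
     off beyond m.\<close>
   let ?w = "restrict v {..<m}"
   have n1: "norm (v i) = 1" if "i < m" for i using v(1) that by (simp add: orthon_def norm_eq_sqrt_inner)
   have "?w : A" using v n1 by (auto simp: A_def X_def orthon_def)
   moreover have "?w ` {..<m} = v ` {..<m}" by auto
   ultimately show "S : (%v. span (v ` {..<m})) ` A" using v(3) by (metis image_eqI)
  qed
 qed
 have "compactin (subtopology X A) A" using cA by (simp add: compactin_subtopology)
 hence "compactin (Grass_top n m) ((%v. span (v ` {..<m})) ` A)"
  using cont image_compactin by blast
 thus ?thesis using surj by (simp add: compact_space_def)
qed

subsection \<open>Smooth functions of one real variable\<close>

text \<open>One-variable counterpart of \<open>Ck\<close>; smooth functions of vectors are produced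
  by composition with functions of this kind.\<close>

primrec Cr :: "nat => real set => (real => real) => bool" where
 "Cr 0 A s \<longleftrightarrow> continuous_on A s"
| "Cr (Suc k) A s \<longleftrightarrow> (ALL x:A. s differentiable at x) & Cr k A (deriv s)"

definition rsm :: "real set => (real => real) => bool" where
 "rsm A s \<longleftrightarrow> (ALL k. Cr k A s)"

lemma Cr_cong: "open A==>(!!x. x : A==>s x = t x)==>Cr k A s==>Cr k A t"
proof (induction k arbitrary: s t)
 case 0 thus ?case using continuous_on_cong[of A A s t] by simp
next
 case (Suc k)
 have d: "(t hrd deriv s x) (at x)" if x: "x : A" for x
 proof -
  have "(s hrd deriv s x) (at x)"
   using Suc.prems(3) x by (auto simp: DERIV_deriv_iff_real_differentiable)
  thus ?thesis using has_field_derivative_transform_within_open Suc.prems(1,2) x by blast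
 qed
 have "Cr k A (deriv t)" by (rule Suc.IH[OF Suc.prems(1), of "deriv s"]) (use Suc.prems(3) d in "auto intro: DERIV_imp_deriv[symmetric]")
 thus ?case using d by (auto simp: real_differentiable_def)
qed

text \<open>Lets any explicit derivative on A take the place of \<open>deriv\<close>, so that orders
  of differentiability can be raised by induction.\<close>

lemma Cr_SucI:
 assumes "open A" "!!x. x : A==>(s hrd s' x) (at x)" "Cr k A s'"
 shows "Cr (Suc k) A s"
 using assms by (auto simp: real_differentiable_def intro!: Cr_cong[OF assms(1) _ assms(3)] DERIV_imp_deriv[symmetric])

lemma Cr_SucD: "Cr (Suc k) A s==>x : A==>(s hrd deriv s x) (at x)" by (simp add: DERIV_deriv_iff_real_differentiable)

lemma Cr_less: "Cr (Suc k) A s==>Cr k A s"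
proof (induction k arbitrary: s)
 case 0 thus ?case by (auto intro!: continuous_at_imp_continuous_on dest: Cr_SucD[OF 0] DERIV_isCont)
next
 case (Suc k) thus ?case by auto
qed

lemma Cr_subset: "Cr k A s==>B <= A==>Cr k B s" by (induction k arbitrary: s) (auto intro: continuous_on_subset)

lemma Cr_Un: "open A==>open B==>Cr k A s==>Cr k B s==>Cr k (A Un B) s" by (induction k arbitrary: s) (auto intro: continuous_on_open_Un)

lemma Cr_const: "open A==>Cr k A (%x. c)"
proof (induction k arbitrary: c)
 case (Suc k) thus ?case by (intro Cr_SucI[where s' = "%x. 0"]) auto
qed simp

lemma Cr_add: "open A==>Cr k A s==>Cr k A t==>Cr k A (%x. s x+t x)"
proof (induction k arbitrary: s t)
 case 0 thus ?case by (auto intro: continuous_intros)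
next
 case (Suc k)
 show ?case by (rule Cr_SucI[where s' = "%x. deriv s x+deriv t x"])
   (use Suc in "auto intro!: DERIV_add Cr_SucD")
qed

lemma Cr_mult: "open A==>Cr k A s==>Cr k A t==>Cr k A (%x. s x*t x)"
proof (induction k arbitrary: s t)
 case 0 thus ?case by (auto intro: continuous_intros)
next
 case (Suc k)
 have "Cr k A (%x. deriv s x*t x+deriv t x * s x)"
  using Suc.prems by (intro Cr_add Suc.IH) (auto intro: Cr_less)
 thus ?case
  using Suc.prems by (intro Cr_SucI[where s' = "%x. deriv s x*t x+deriv t x * s x"] DERIV_mult)
   (simp_all add: Cr_SucD[of k A])
qed

lemma Cr_ident: "open A==>Cr k A (%x. x)"
proof (cases k)
 case (Suc j) assume "open A" thus ?thesis unfolding Suc by (intro Cr_SucI[where s' = "%x. 1"] Cr_const) auto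
qed (simp add: continuous_on_id)

lemma Cr_compose:
 "open A==>open B==>Cr k B s==>Cr k A t==>t ` A <= B==>Cr k A (%x. s (t x))"
proof (induction k arbitrary: s)
 case 0 thus ?case by (auto intro: continuous_on_compose2)
next
 case (Suc k)
 have "Cr k A (%x. deriv s (t x)*deriv t x)"
  using Suc.prems(3,4) by (intro Cr_mult Suc.prems(1) Suc.IH[OF Suc.prems(1,2) _ Cr_less[OF Suc.prems(4)] Suc.prems(5)]) simp_all
 moreover have "((%x. s (t x)) hrd deriv s (t x)*deriv t x) (at x)" if "x : A" for x by (rule DERIV_chain2[where f = s, OF Cr_SucD[OF Suc.prems(3)] Cr_SucD[OF Suc.prems(4) that]])
   (use Suc.prems that in auto)
 ultimately show ?case using Suc.prems by (intro Cr_SucI[where s' = "%x. deriv s (t x)*deriv t x"]) auto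
qed

lemma rsm_cong: "open A==>(!!x. x : A==>s x = t x)==>rsm A s==>rsm A t"
 unfolding rsm_def by (intro allI Cr_cong[of A s t]) auto

lemma rsmI: assumes "open A" "!!x. x : A==>(s hrd s' x) (at x)" "rsm A s'" shows "rsm A s"
 unfolding rsm_def
proof
 fix k show "Cr k A s" using Cr_SucI[OF assms(1,2), of k] assms(3) Cr_less by (auto simp: rsm_def)
qed

lemma rsm_deriv: "rsm A s==>rsm A (deriv s)" unfolding rsm_def using Cr.simps(2) by blast
lemma rsm_DERIV: "rsm A s==>x : A==>(s hrd deriv s x) (at x)" unfolding rsm_def by (rule Cr_SucD[of 0]) blast+
lemma rsm_cont: "rsm A s==>continuous_on A s" unfolding rsm_def using Cr.simps(1) by blast
lemma rsm_const: "open A==>rsm A (%x. c)" by (simp add: rsm_def Cr_const)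
lemma rsm_ident: "open A==>rsm A (%x. x)" by (simp add: rsm_def Cr_ident)
lemma rsm_add: "open A==>rsm A s==>rsm A t==>rsm A (%x. s x+t x)" by (simp add: rsm_def Cr_add)
lemma rsm_mult: "open A==>rsm A s==>rsm A t==>rsm A (%x. s x*t x)" by (simp add: rsm_def Cr_mult)
lemma rsm_cmult: "open A==>rsm A s==>rsm A (%x. c * s x)" by (simp add: rsm_mult rsm_const)
lemma rsm_minus: "open A==>rsm A s==>rsm A (%x. - s x)" using rsm_cmult[of A s "-1"] by simp
lemma rsm_diff: "open A==>rsm A s==>rsm A t==>rsm A (%x. s x - t x)"
 using rsm_add[of A s "%x. - t x"] rsm_minus by simp
lemma rsm_compose: "open A==>open B==>rsm B s==>rsm A t==>t ` A <= B==>rsm A (%x. s (t x))" by (simp add: rsm_def Cr_compose)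
lemma rsm_subset: "rsm A s==>B <= A==>rsm B s" unfolding rsm_def using Cr_subset by blast
lemma rsm_Un: "open A==>open B==>rsm A s==>rsm B s==>rsm (A Un B) s" by (simp add: rsm_def Cr_Un)
lemma rsm_affine: "rsm UNIV s==>rsm UNIV (%x. s (a*x+b))" by (rule rsm_compose[of UNIV UNIV s "%x. a*x+b"]) (auto intro!: rsm_add rsm_const rsm_cmult rsm_ident)

lemma rsm_powr: "rsm {-kp<..} (%t. c*(t+kp) powr p)"
 unfolding rsm_def
proof
 fix k show "Cr k {-kp<..} (%t. c*(t+kp) powr p)"
 proof (induction k arbitrary: c p)
  case 0 show ?case by (auto intro!: continuous_intros)
 next
  case (Suc k)
  show ?case by (rule Cr_SucI[OF _ _ Suc.IH[of "c*p" "p - 1"]]) (auto intro!: derivative_eq_intros simp: powr_diff)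
 qed
qed

lemma rsm_antideriv:
 assumes "rsm UNIV b" "!!x. x <= 0==>b x = 0"
 obtains I where "rsm UNIV I" "!!x. (I hrd b x) (at x)" "!!x. x <= 0==>I x = 0"
proof -
 \<comment> \<open>Starting at -1 keeps every x >= 0 in the interior of an interval of integration,
   and since b vanishes on the negative axis the primitive still vanishes there.\<close>
 define I where "I x = integral {-1..x} b" for x
 have c: "continuous_on S b" for S using rsm_cont[OF assms(1)] continuous_on_subset by blast
 have I0: "I x = 0" if "x <= 0" for x unfolding I_def
  using that assms(2) by (subst integral_cong[where g = "%x. 0"]) auto
 have d: "(I hrd b x) (at x)" for x
 proof (cases "x < 0")
  case True
  have "((%x. 0) hrd 0) (at x)" by simp
  hence "(I hrd 0) (at x)" by (rule has_field_derivative_transform_within_open[where S = "{..<0}"]) (use True I0 in auto)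
  thus ?thesis using assms(2)[of x] True by simp
 next
  case False
  have "(I hrd b x) (at x within {-1..x+1})" unfolding I_def by (rule integral_has_real_derivative) (use False c in auto)
  thus ?thesis using False by (subst (asm) at_within_interior) auto
 qed
 show ?thesis using that[of I] rsmI[OF _ d assms(1)] d I0 by auto
qed

subsection \<open>A smooth step\<close>

text \<open>The functions p(1/x) exp(-1/x), continued by zero. The family is closed under
  differentiation, which makes every member smooth by induction on the order; p = 1 is the classical
  flat function.\<close>

definition Ex :: "real poly => real => real" where
 "Ex p x = (if 0 < x then poly p (1/x)*exp (- (1/x)) else 0)"

lemma poly_exp_tendsto: "((%y. poly p y*exp (- y)) \<longlongrightarrow> (0::real)) at_top"
proof -
 have "((%y. \<Sum>i\<le>degree p. coeff p i*(y ^ i/exp y)) \<longlongrightarrow> (\<Sum>i\<le>degree p. coeff p i*0)) at_top" by (intro tendsto_sum tendsto_mult tendsto_const tendsto_power_div_exp_0)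
 thus ?thesis by (simp add: poly_altdef exp_minus sum_distrib_right field_simps sum_distrib_left)
qed

text \<open>With y = 1/x one has dy/dx = -y^2, so the derivative of p(y) exp(-y) is y^2 (p(y) -
  p'(y)) exp(-y). At 0 the difference quotient from the right is y p(y) exp(-y) with y tending to
  infinity.\<close>

lemma Ex_deriv: "(Ex p hrd Ex ([:0,0,1:]*(p - pderiv p)) x) (at x)"
proof -
 consider "x > 0" | "x < 0" | "x = 0" by linarith
 thus ?thesis
 proof cases
  case 1
  have "((%x. poly p (1/x)*exp (- (1/x))) hrd Ex ([:0,0,1:]*(p - pderiv p)) x) (at x)"
   using 1 by (auto intro!: derivative_eq_intros poly_DERIV DERIV_chain'[where g = "poly p"] simp: Ex_def field_simps power2_eq_square)
  thus ?thesis by (rule has_field_derivative_transform_within_open[where S = "{0<..}"]) (use 1 in "auto simp: Ex_def")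
 next
  case 2
  have "((%x. 0) hrd 0) (at x)" by simp
  hence "(Ex p hrd 0) (at x)" by (rule has_field_derivative_transform_within_open[where S = "{..<0}"]) (use 2 in "auto simp: Ex_def")
  thus ?thesis using 2 by (simp add: Ex_def)
 next
  case 3
  have "((%h. poly (pCons 0 p) (inverse h)*exp (- inverse h)) \<longlongrightarrow> 0) (at_right 0)"
   using filterlim_compose[OF poly_exp_tendsto filterlim_inverse_at_top_right] .
  hence r: "((%h. Ex p h/h) \<longlongrightarrow> 0) (at_right 0)" by (rule Lim_transform_eventually) (auto simp: eventually_at_right_less Ex_def inverse_eq_divide
     intro!: eventually_mono[OF eventually_at_right_less[of 0]])
  have l: "((%h. Ex p h/h) \<longlongrightarrow> 0) (at_left 0)" by (rule Lim_transform_eventually[OF tendsto_const])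
     (auto simp: Ex_def eventually_at_filter)
  have "((%h. Ex p h/h) \<longlongrightarrow> 0) (at 0)"
   using l r filterlim_split_at by blast
  thus ?thesis using 3 by (simp add: DERIV_def Ex_def)
 qed
qed

lemma rsm_Ex: "rsm UNIV (Ex p)"
 unfolding rsm_def
proof
 fix k show "Cr k UNIV (Ex p)"
 proof (induction k arbitrary: p)
  case 0 show ?case by (auto intro!: continuous_at_imp_continuous_on DERIV_isCont Ex_deriv)
 next
  case (Suc k) show ?case by (rule Cr_SucI[OF _ Ex_deriv Suc.IH]) auto
 qed
qed

text \<open>Normalised primitive of the bump \<open>b\<close>, which is supported in [0,1] and
  positive in the interior, so that its integral can be divided by.\<close>

lemma stp_exists: "EX s. rsm UNIV s & (ALL x<=0. s x = 0) & (ALL x>=1. s x = 1) & mono s"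
proof -
 define b where "b x = Ex 1 x*Ex 1 (1 - x)" for x
 have rb: "rsm UNIV b" unfolding b_def
  using rsm_affine[OF rsm_Ex[of 1], of "-1" 1] by (intro rsm_mult rsm_Ex) auto
 have b0: "b x = 0" if "x <= 0" for x using that by (simp add: b_def Ex_def)
 have b1: "b x = 0" if "x >= 1" for x using that by (simp add: b_def Ex_def)
 have bn: "b x >= 0" for x by (simp add: b_def Ex_def)
 obtain I where I: "rsm UNIV I" "!!x. (I hrd b x) (at x)" "!!x. x <= 0==>I x = 0"
  using rsm_antideriv[OF rb b0] by blast
 have mI: "I x <= I y" if "x <= y" for x y
  using DERIV_nonneg_imp_nondecreasing[OF that] I(2) bn by blast
 have "I (1/4) < I (3/4)" by (rule DERIV_pos_imp_increasing) (auto intro!: exI I(2) simp: b_def Ex_def)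
 hence pos: "I 1 > 0" using mI[of "3/4" 1] mI[of 0 "1/4"] I(3)[of 0] by simp
 have c: "I x = I 1" if "x >= 1" for x
 proof (rule antisym)
  show "I x <= I 1" using DERIV_nonpos_imp_nonincreasing[OF that] I(2) b1 by (metis order_refl)
 qed (use that mI in auto)
 have "rsm UNIV (%x. (1/I 1)*I x)" using I(1) by (intro rsm_cmult) auto
 moreover have "mono (%x. (1/I 1)*I x)" using mI pos by (intro monoI mult_left_mono) auto
 moreover have "(1/I 1)*I x = 1" if "x >= 1" for x using c[OF that] pos by simp
 moreover have "(1/I 1)*I x = 0" if "x <= 0" for x using I(3)[OF that] by simp
 ultimately show ?thesis by (intro exI[of _ "%x. (1/I 1)*I x"] conjI allI impI)
qed

definition stp :: "real => real" where
 "stp = (SOME s. rsm UNIV s & (ALL x<=0. s x = 0) & (ALL x>=1. s x = 1) & mono s)"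

lemma stp_props: "rsm UNIV stp" "x <= 0==>stp x = 0" "x >= 1==>stp x = 1" "mono stp"
 using someI_ex[OF stp_exists] unfolding stp_def[symmetric] by blast+

lemma stp_range: "0 <= stp x" "stp x <= 1"
proof -
 show "0 <= stp x" using stp_props(2)[of "min x 0"] monoD[OF stp_props(4), of "min x 0" x] by simp
 show "stp x <= 1" using stp_props(3)[of "max x 1"] monoD[OF stp_props(4), of x "max x 1"] by simp
qed

lemma stp_deriv: "(stp hrd deriv stp x) (at x)" using rsm_DERIV[OF stp_props(1)] by simp

lemma deriv_stp_nonneg: "0 <= deriv stp x"
proof (rule ccontr)
 assume "\<not> 0 <= deriv stp x"
 then obtain d where d: "d > 0" "ALL h>0. h < d --> stp (x+h) < stp x"
  using DERIV_neg_dec_right[OF stp_deriv, of x] by auto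
 hence "stp (x+d/2) < stp x" by simp
 moreover have "stp x <= stp (x+d/2)" using monoD[OF stp_props(4)] d by simp
 ultimately show False by simp
qed

lemma deriv_stp_zero: "x < 0 \<or> 1 < x==>deriv stp x = 0"
proof -
 assume "x < 0 \<or> 1 < x"
 then obtain c where "((%x. c) hrd 0) (at x) & (EX S. open S & x : S & (ALL y:S. c = stp y))"
 proof
  assume "x < 0" thus ?thesis using that[of 0] stp_props(2) by (intro that[of 0]) (auto intro!: exI[of _ "{..<0}"])
 next
  assume "1 < x" thus ?thesis using stp_props(3) by (intro that[of 1]) (auto intro!: exI[of _ "{1<..}"])
 qed
 hence "(stp hrd 0) (at x)" using has_field_derivative_transform_within_open by blast
 thus ?thesis by (rule DERIV_imp_deriv)
qed

lemma deriv_stp_bound: "EX L>0. ALL x. deriv stp x <= L"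
proof -
 have "continuous_on {0..1} (deriv stp)"
  using rsm_cont[OF rsm_deriv[OF stp_props(1)]] continuous_on_subset by blast
 hence "bounded (deriv stp ` {0..1})" by (intro compact_imp_bounded compact_continuous_image) auto
 then obtain L where L: "ALL y:deriv stp ` {0..1}. norm y <= L" using bounded_iff by blast
 have "deriv stp x <= max 1 L" for x
 proof (cases "x : {0..1}")
  case True hence "\<bar>deriv stp x\<bar> <= L" using L by auto
  thus ?thesis by simp
 next
  case False thus ?thesis using deriv_stp_zero[of x] by auto
 qed
 thus ?thesis by (intro exI[of _ "max 1 L"]) auto
qed

definition Lstp :: real where "Lstp = (SOME L. 0 < L & (ALL x. deriv stp x <= L))"

lemma Lstp: "0 < Lstp" "deriv stp x <= Lstp" "\<bar>deriv stp x\<bar> <= Lstp"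
 using someI_ex[OF deriv_stp_bound] deriv_stp_nonneg[of x] unfolding Lstp_def[symmetric] by auto

subsection \<open>Calculus on open subsets of the coordinate spaces\<close>

lemma opn_mem: "opn n W==>z : W==>z : Rn n"
 using opn_subset by blast

lemma at_within_opn: assumes "opn n W" "z : W" shows "at z within W = at z within Rn n"
proof -
 obtain H where "open H" "W = Rn n Int H" using assms by (auto simp: openin_open)
 thus ?thesis using assms(2) by (intro at_within_nhd[of z H]) auto
qed

lemma eventually_opn: assumes "opn n W" "z : W" shows "eventually (%x. x : W) (at z within Rn n)"
 using at_within_opn[OF assms] by (metis eventually_at_topological UNIV_I open_UNIV)

lemma continuous_on_opn: "opn n W==>continuous_on W g \<longleftrightarrow> (ALL z:W. continuous (at z within Rn n) g)" by (metis at_within_opn continuous_on_eq_continuous_within)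

text \<open>Within a proper subspace of the ambient space a Frechet derivative is unique only on
  directions of that subspace. There it is the derivative along a line, where uniqueness is the
  one-dimensional statement.\<close>

lemma Deriv_eq:
 assumes g: "(g has_derivative D) (at z within Rn n)" and z: "z : Rn n" and v: "v : Rn n"
 shows "Deriv n g z v = D v"
proof -
 have *: "D1 v = D2 v" if "(g has_derivative D1) (at z within Rn n)" "(g has_derivative D2) (at z within Rn n)" for D1 D2
 proof -
  have "((%t::real. g (z+t *\<^sub>R v)) has_derivative (%t. D (t *\<^sub>R v))) (at 0)"
   if "(g has_derivative D) (at z within Rn n)" for D
  proof -
   have l: "((%t::real. z+t *\<^sub>R v) has_derivative (%t. t *\<^sub>R v)) (at 0)" by (auto intro!: derivative_eq_intros)
   have "range (%t::real. z+t *\<^sub>R v) <= Rn n" using z v by auto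
   hence "(g has_derivative D) (at (z+0 *\<^sub>R v) within range (%t::real. z+t *\<^sub>R v))"
    using that has_derivative_subset by auto
   from has_derivative_in_compose[OF l this] show ?thesis by simp
  qed
  from has_derivative_unique[OF this[OF that(1)] this[OF that(2)]]
  show ?thesis by (metis scaleR_one)
 qed
 have "(g has_derivative Deriv n g z) (at z within Rn n)"
  unfolding Deriv_def using g by (metis differentiableI frechet_derivative_works)
 thus ?thesis using*g by blast
qed

lemma Deriv_works: "g differentiable (at z within Rn n)==>(g has_derivative Deriv n g z) (at z within Rn n)"
 unfolding Deriv_def using frechet_derivative_works by blast

lemma has_derivative_opn_cong:
 assumes "opn n W" "z : W" "!!x. x : W==>g x = h x" "(g has_derivative D) (at z within Rn n)"
 shows "(h has_derivative D) (at z within Rn n)" by (rule has_derivative_transform_eventually[OF assms(4)])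
   (use assms opn_mem in "auto intro: eventually_mono[OF eventually_opn[OF assms(1,2)]]")

lemma Deriv_cong:
 assumes "opn n W" "z : W" "!!x. x : W==>g x = h x" "g differentiable (at z within Rn n)" "v : Rn n"
 shows "Deriv n h z v = Deriv n g z v" by (rule Deriv_eq[OF has_derivative_opn_cong[OF assms(1-3) Deriv_works[OF assms(4)]]])
  (use assms opn_subset in auto)

lemma Ck_cong:
 "opn n W==>(!!x. x : W==>g x = h x)==>Ck k n W g==>Ck k n W h"
proof (induction k arbitrary: g h)
 case 0 thus ?case using continuous_on_cong[of W W g h] by simp
next
 case (Suc k)
 have d: "h differentiable (at z within Rn n)" if "z : W" for z
 proof -
  obtain D where "(g has_derivative D) (at z within Rn n)"
   using Suc.prems(3) \<open>z : W\<close> by (auto simp: differentiable_def)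
  from has_derivative_opn_cong[OF Suc.prems(1) \<open>z : W\<close> Suc.prems(2) this]
  show ?thesis by (auto simp: differentiable_def)
 qed
 have "Ck k n W (%z. Deriv n h z (uv i))" if i: "i < n" for i by (rule Suc.IH[OF Suc.prems(1), of "%z. Deriv n g z (uv i)"])
   (use Suc.prems(3) i in "auto intro: Deriv_cong[OF Suc.prems(1) _ Suc.prems(2), symmetric]")
 thus ?case using d by simp
qed

text \<open>Any family of derivatives may be used in place of \<open>Deriv\<close>, whose values off
  \<open>Rn n\<close> are an arbitrary choice; only partial derivatives enter.\<close>

lemma Ck_SucI:
 assumes W: "opn n W" and D: "!!z. z : W==>(g has_derivative D z) (at z within Rn n)"
  and p: "!!i. i < n==>Ck k n W (%z. D z (uv i))"
 shows "Ck (Suc k) n W g"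
proof -
 have "Ck k n W (%z. Deriv n g z (uv i))" if i: "i < n" for i by (rule Ck_cong[OF W _ p[OF i]]) (use D W opn_subset i in "auto intro!: Deriv_eq[symmetric]")
 thus ?thesis using D by (auto simp: differentiable_def)
qed

lemma Ck_SucD: "Ck (Suc k) n W g==>z : W==>(g has_derivative Deriv n g z) (at z within Rn n)" by (simp add: Deriv_works)

lemma Ck_less: "opn n W==>Ck (Suc k) n W g==>Ck k n W g"
proof (induction k arbitrary: g)
 case 0 thus ?case by (auto simp: continuous_on_opn intro: differentiable_imp_continuous_within)
next
 case (Suc k) thus ?case by auto
qed

lemma Ck_subset: "Ck k n W g==>W' <= W==>Ck k n W' g" by (induction k arbitrary: g) (auto intro: continuous_on_subset)

lemma Ck_Un: "opn n W==>opn n W'==>Ck k n W g==>Ck k n W' g==>Ck k n (W Un W') g"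
proof (induction k arbitrary: g)
 case 0 
 hence "opn n (W Un W')" by blast
 thus ?case using 0 by (simp add: continuous_on_opn) blast
next
 case (Suc k) thus ?case by auto
qed

lemma Ck_const: "opn n W==>Ck k n W (%x. c)"
proof (induction k arbitrary: c)
 case (Suc k) show ?case by (rule Ck_SucI[OF Suc.prems, where D = "%z v. 0"]) (use Suc in auto)
qed simp

lemma Ck_linear:
 assumes "opn n W" "bounded_linear L" shows "Ck k n W L"
proof (cases k)
 case 0 thus ?thesis using assms by (simp add: linear_continuous_on)
next
 case (Suc j)
 show ?thesis unfolding Suc by (rule Ck_SucI[OF assms(1), where D = "%z. L"])
   (use assms in "auto intro: bounded_linear_imp_has_derivative Ck_const")
qed

lemma Ck_add: "opn n W==>Ck k n W g==>Ck k n W h==>Ck k n W (%x. g x+h x)"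
proof (induction k arbitrary: g h)
 case 0 thus ?case by (auto intro: continuous_intros)
next
 case (Suc k)
 show ?case by (rule Ck_SucI[where D = "%z v. Deriv n g z v+Deriv n h z v"])
   (use Suc in "auto intro!: has_derivative_add Ck_SucD")
qed

lemma Ck_scaleR:
 fixes g :: "vec => real" and h :: "vec => 'b::real_normed_vector"
 shows "opn n W==>Ck k n W g==>Ck k n W h==>Ck k n W (%x. g x *\<^sub>R h x)"
proof (induction k arbitrary: g h)
 case 0 thus ?case by (auto intro: continuous_intros)
next
 case (Suc k)
 have "Ck k n W (%z. g z *\<^sub>R Deriv n h z (uv i)+Deriv n g z (uv i) *\<^sub>R h z)" if "i < n" for i
  using Suc.prems that Ck_less[OF Suc.prems(1,2)] Ck_less[OF Suc.prems(1,3)] by (intro Ck_add Suc.IH) auto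
 thus ?case
  using Suc.prems by (intro Ck_SucI[where D = "%z v. g z *\<^sub>R Deriv n h z v+Deriv n g z v *\<^sub>R h z"]
    has_derivative_scaleR) (simp_all add: Ck_SucD[of k n W])
qed

lemma Ck_compose:
 assumes "opn n W" "open A" "Ck k n W g" "g ` W <= A" "rsm A s"
 shows "Ck k n W (%x. s (g x))"
 using assms
proof (induction k arbitrary: s)
 case 0 thus ?case by (auto intro: continuous_on_compose2 rsm_cont)
next
 case (Suc k)
 have "Ck k n W (%z. deriv s (g z) *\<^sub>R Deriv n g z (uv i))" if "i < n" for i
  using Suc.prems(3) that by (intro Ck_scaleR Suc.prems(1) Suc.IH[OF Suc.prems(1,2) Ck_less[OF Suc.prems(1,3)] Suc.prems(4) rsm_deriv[OF Suc.prems(5)]]) simp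
 moreover have "((%x. s (g x)) has_derivative (%v. deriv s (g z) *\<^sub>R Deriv n g z v)) (at z within Rn n)" if "z : W" for z
 proof -
  have "(s has_derivative (*) (deriv s (g z))) (at (g z))"
   using rsm_DERIV[OF Suc.prems(5)] Suc.prems(4) that by (auto simp: has_field_derivative_def)
  from has_derivative_compose[OF Ck_SucD[OF Suc.prems(3) that] this] show ?thesis by simp
 qed
 ultimately show ?case using Suc.prems by (intro Ck_SucI[where D = "%z v. deriv s (g z) *\<^sub>R Deriv n g z v"]) auto
qed

lemma Ck_bl: 
 assumes "opn n W" "Ck k n W g" "bounded_linear L" shows "Ck k n W (%x. L (g x))"
 using assms
proof (induction k arbitrary: g)
 case 0 thus ?case by (auto intro: bounded_linear.continuous_on)
next
 case (Suc k)
 show ?case by (rule Ck_SucI[where D = "%z v. L (Deriv n g z v)"])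
   (use Suc in "auto intro!: bounded_linear.has_derivative[of L] Ck_SucD")
qed

lemma smooth_cong: "opn n W==>(!!x. x : W==>g x = h x)==>smooth n W g==>smooth n W h"
 unfolding smooth_def using Ck_cong by blast
lemma smooth_subset: "smooth n W g==>W' <= W==>smooth n W' g"
 unfolding smooth_def using Ck_subset by blast
lemma smooth_Un: "opn n W==>opn n W'==>smooth n W g==>smooth n W' g==>smooth n (W Un W') g"
 unfolding smooth_def using Ck_Un by blast
lemma smooth_const: "opn n W==>smooth n W (%x. c)" by (simp add: smooth_def Ck_const)
lemma smooth_linear: "opn n W==>bounded_linear L==>smooth n W L" by (simp add: smooth_def Ck_linear)
lemma smooth_add: "opn n W==>smooth n W g==>smooth n W h==>smooth n W (%x. g x+h x)" by (simp add: smooth_def Ck_add)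
lemma smooth_scaleR: "opn n W==>smooth n W g==>smooth n W h==>smooth n W (%x. g x *\<^sub>R h x)" by (simp add: smooth_def Ck_scaleR)
lemma smooth_mult: "opn n W==>smooth n W g==>smooth n W h==>smooth n W (%x. g x*h x :: real)"
 using smooth_scaleR[of n W g h] by simp
lemma smooth_compose: "opn n W==>open A==>smooth n W g==>g ` W <= A==>rsm A s==>smooth n W (%x. s (g x))"
 unfolding smooth_def using Ck_compose by blast
lemma smooth_bl: "opn n W==>smooth n W g==>bounded_linear L==>smooth n W (%x. L (g x))" by (simp add: smooth_def Ck_bl)
lemma smooth_minus: "opn n W==>smooth n W g==>smooth n W (%x. - g x)" by (rule smooth_bl) (auto intro: bounded_linear_minus bounded_linear_ident)
lemma smooth_diff: "opn n W==>smooth n W g==>smooth n W h==>smooth n W (%x. g x - h x)"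
 unfolding diff_conv_add_uminus by (intro smooth_add smooth_minus)
lemma smooth_sum: "opn n W==>(!!i. i : I==>smooth n W (g i))==>smooth n W (%x. \<Sum>i\<in>I. g i x)" by (induction I rule: infinite_finite_induct) (auto intro: smooth_add smooth_const)
lemma smooth_prod: "opn n W==>(!!i. i : I==>smooth n W (g i))==>smooth n W (%x. \<Prod>i\<in>I. g i x :: real)" by (induction I rule: infinite_finite_induct) (auto intro: smooth_mult smooth_const)
lemma smooth_power: "opn n W==>smooth n W g==>smooth n W (%x. g x ^ k :: real)" by (induction k) (auto intro: smooth_mult smooth_const)
lemma smooth_Deriv: "smooth n W g==>i < n==>smooth n W (%z. Deriv n g z (uv i))"
 unfolding smooth_def using Ck.simps(2) by blast
lemma smooth_continuous: "smooth n W g==>continuous_on W g"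
 unfolding smooth_def by (meson Ck.simps(1))
lemma smooth_has_derivative: "smooth n W g==>z : W==>(g has_derivative Deriv n g z) (at z within Rn n)"
 unfolding smooth_def using Ck_SucD by blast

lemma Deriv_linear: "smooth n W g==>z : W==>linear (Deriv n g z)"
 using smooth_has_derivative has_derivative_linear by blast

lemma Deriv_expand: "smooth n W g==>z : W==>v : Rn n ==>
  Deriv n g z v = (\<Sum>i<n. lk v i *\<^sub>R Deriv n g z (uv i))"
 using Deriv_linear[of n W g z] Rn_expand[of v n] by (metis (no_types, lifting) linear_scale linear_sum sum.cong)

lemma Deriv_smooth_cong:
 assumes "opn n W" "z : W" "!!x. x : W==>g x = h x" "smooth n W g" "v : Rn n"
 shows "Deriv n h z v = Deriv n g z v" by (rule Deriv_cong[OF assms(1-3) _ assms(5)]) (use assms smooth_has_derivative[OF assms(4,2)] in "auto simp: differentiable_def")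

lemma Deriv_add:
 assumes "opn n W" "z : W" "smooth n W g" "smooth n W h" "v : Rn n"
 shows "Deriv n (%x. g x+h x) z v = Deriv n g z v+Deriv n h z v" by (rule Deriv_eq[OF has_derivative_add]) (use assms smooth_has_derivative opn_mem in auto)

lemma Deriv_scaleR:
 fixes g :: "vec => real"
 assumes "opn n W" "z : W" "smooth n W g" "smooth n W h" "v : Rn n"
 shows "Deriv n (%x. g x *\<^sub>R h x) z v = g z *\<^sub>R Deriv n h z v+Deriv n g z v *\<^sub>R h z" by (rule Deriv_eq[OF has_derivative_scaleR]) (use assms smooth_has_derivative opn_mem in auto)

lemma Deriv_mult:
 fixes g h :: "vec => real"
 assumes "opn n W" "z : W" "smooth n W g" "smooth n W h" "v : Rn n"
 shows "Deriv n (%x. g x*h x) z v = g z*Deriv n h z v+Deriv n g z v * h z"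
 using Deriv_scaleR[OF assms] by simp

lemma Deriv_const:
 assumes "z : Rn n" "v : Rn n" shows "Deriv n (%x. c) z v = 0" by (rule Deriv_eq[OF has_derivative_const]) (use assms in auto)

lemma Deriv_bl:
 assumes "opn n W" "z : W" "smooth n W g" "bounded_linear L" "v : Rn n"
 shows "Deriv n (%x. L (g x)) z v = L (Deriv n g z v)" by (rule Deriv_eq[OF bounded_linear.has_derivative[OF assms(4)]]) (use assms smooth_has_derivative opn_mem in auto)

lemma Deriv_compose:
 assumes "opn n W" "z : W" "smooth n W g" "(s hrd s') (at (g z))" "v : Rn n"
 shows "Deriv n (%x. s (g x)) z v = s'*Deriv n g z v"
proof -
 have "(s has_derivative (*) s') (at (g z))" using assms(4) by (simp add: has_field_derivative_def)
 from has_derivative_compose[OF smooth_has_derivative[OF assms(3,2)] this]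
 show ?thesis by (intro Deriv_eq) (use assms opn_mem in auto)
qed

lemma Deriv_power:
 fixes g :: "vec => real"
 assumes "opn n W" "z : W" "smooth n W g" "v : Rn n"
 shows "Deriv n (%x. g x ^ k) z v = real k*g z ^ (k - 1)*Deriv n g z v" by (rule Deriv_compose[OF assms(1-3) _ assms(4)]) (auto intro!: derivative_eq_intros)

lemma smooth_normsq: "opn n W==>smooth n W (%x. (norm (x - z))^2)"
proof -
 assume W: "opn n W"
 have "Ck k n W (%x. (norm (x - z))^2)" for k
 proof (cases k)
  case 0 thus ?thesis by (auto intro!: continuous_intros)
 next
  case (Suc j)
  have "smooth n W (%x. 2*inner (uv i) (x - z))" for i
   using W by (intro smooth_mult smooth_const W
     smooth_bl[OF W smooth_diff[OF W smooth_linear[OF W bounded_linear_ident] smooth_const[OF W]] bounded_linear_inner_right])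
  hence "Ck j n W (%x. 2*inner (x - z) (uv i))" for i unfolding smooth_def by (simp add: inner_commute)
  thus ?thesis unfolding Suc by (intro Ck_SucI[OF W, where D = "%x v. 2*inner (x - z) v"])
    (auto intro!: derivative_eq_intros simp: power2_norm_eq_inner inner_commute)
 qed
 thus ?thesis by (simp add: smooth_def)
qed

lemma Deriv_normsq:
 assumes "x : Rn n" "v : Rn n" shows "Deriv n (%x. (norm (x - z))^2) x v = 2*inner (x - z) v" by (rule Deriv_eq[where D = "%v. 2*inner (x - z) v"])
  (use assms in "auto intro!: derivative_eq_intros simp: power2_norm_eq_inner inner_commute")

subsection \<open>Cutoff functions\<close>

definition Csc :: "nat => vec set => (vec => real) set" where
 "Csc n W = {g. smooth n W g & (EX C. compact C & C <= W & (ALL z. z ~: C --> g z = 0))}"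

text \<open>U is covered by the two relatively open sets W and U - C, and the function is zero on
  the second.\<close>

lemma smooth_extend:
 assumes "opn n W" "opn n U" "W <= U" "compact C" "C <= W" "!!z. z ~: C==>g z = 0" "smooth n W g"
 shows "smooth n U g"
proof -
 have o: "opn n (U - C)" using assms by (intro opn_Diff_closed compact_imp_closed)
 have "smooth n (U - C) g" by (rule smooth_cong[OF o _ smooth_const[OF o, of 0]]) (use assms in auto)
 hence "smooth n (W Un (U - C)) g" by (intro smooth_Un o assms)
 moreover have "W Un (U - C) = U" using assms by auto
 ultimately show ?thesis by simp
qed

lemma Csc_mono: "opn n W==>opn n U==>W <= U==>Csc n W <= Csc n U"
proof (rule subsetI)
 fix g assume *: "opn n W" "opn n U" "W <= U" and "g : Csc n W"
 then obtain C where C: "compact C" "C <= W" "!!z. z ~: C==>g z = 0" "smooth n W g"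
  unfolding Csc_def by blast
 from smooth_extend[OF*C(1) C(2) C(3) C(4)] show "g : Csc n U" using C*unfolding Csc_def by blast
qed

lemma Ccinf_mono: "opn n W==>opn n U==>W <= U==>Ccinf n W l <= Ccinf n U l"
proof (rule subsetI)
 fix g assume *: "opn n W" "opn n U" "W <= U" and "g : Ccinf n W l"
 then obtain C where C: "compact C" "C <= W" "!!z. z ~: C==>g z = 0" "smooth n W g" "range g <= Rn l"
  unfolding Ccinf_def by blast
 from smooth_extend[OF*C(1) C(2) C(3) C(4)] show "g : Ccinf n U l" using C*unfolding Ccinf_def by blast
qed

text \<open>Radial cutoff around z: one up to radius r, zero from radius s on. It is a function of
  the squared distance in order to be smooth at the centre.\<close>

definition bmp :: "vec => real => real => vec => real" where
 "bmp z r s x = 1 - stp (((norm (x - z))^2 - r\<^sup>2)/(s^2 - r\<^sup>2))"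

lemma bmp_smooth: "opn n W==>smooth n W (bmp z r s)"
proof -
 assume W: "opn n W"
 have "rsm UNIV (%t. 1 - stp ((1/(s^2 - r\<^sup>2))*t + - r\<^sup>2/(s^2 - r\<^sup>2)))" by (intro rsm_diff rsm_const rsm_affine stp_props) auto
 from smooth_compose[OF W _ smooth_normsq[OF W] _ this, of z]
 show ?thesis by (simp add: bmp_def[abs_def] diff_divide_distrib)
qed

lemma bmp_range: "0 <= bmp z r s x" "bmp z r s x <= 1" by (simp_all add: bmp_def stp_range)

lemma bmp_one: "0 <= r==>r < s==>norm (x - z) <= r==>bmp z r s x = 1"
 unfolding bmp_def by (simp add: stp_props(2) divide_le_0_iff power_mono power_strict_mono)

lemma bmp_zero: "0 <= r==>r < s==>s <= norm (x - z)==>bmp z r s x = 0"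
 unfolding bmp_def by (simp add: stp_props(3) le_divide_eq power_mono power_strict_mono)

text \<open>Chain rule: the gradient of the squared distance is 2(x - z), of length at most 2s
  inside radius s; beyond radius s the derivative of \<open>stp\<close> vanishes.\<close>

lemma bmp_deriv:
 assumes "0 <= r" "r < s" "x : Rn n" "v : Rn n"
 shows "\<bar>Deriv n (bmp z r s) x v\<bar> <= 2*Lstp * s/(s^2 - r\<^sup>2)*norm v"
proof -
 have p: "s^2 - r\<^sup>2 > 0" using assms by (simp add: power_strict_mono)
 let ?t = "((norm (x - z))^2 - r\<^sup>2)/(s^2 - r\<^sup>2)"
 have o: "opn n (Rn n)" by simp
 have "((%t. 1 - stp ((t - r\<^sup>2)/(s^2 - r\<^sup>2))) hrd - (deriv stp ?t/(s^2 - r\<^sup>2))) (at ((norm (x - z))^2))" by (auto intro!: derivative_eq_intros DERIV_chain2[OF stp_deriv] simp: divide_inverse)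
 from Deriv_compose[OF o assms(3) smooth_normsq[OF o] this assms(4)]
 have e: "Deriv n (bmp z r s) x v = - (deriv stp ?t/(s^2 - r\<^sup>2))*(2*inner (x - z) v)" by (simp add: bmp_def[abs_def] Deriv_normsq[OF assms(3,4)])
 show ?thesis
 proof (cases "norm (x - z) <= s")
  case True
  have "\<bar>Deriv n (bmp z r s) x v\<bar> = \<bar>deriv stp ?t\<bar>/(s^2 - r\<^sup>2)*(2*\<bar>inner (x - z) v\<bar>)"
   unfolding e using p by (simp add: abs_mult)
  also have "... <= Lstp/(s^2 - r\<^sup>2)*(2*(s*norm v))"
  proof (intro mult_mono divide_right_mono)
   show "\<bar>inner (x - z) v\<bar> <= s*norm v"
    using Cauchy_Schwarz_ineq2[of "x - z" v] mult_right_mono[OF True norm_ge_zero[of v]] by simp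
  qed (use p Lstp(1,3) less_imp_le[OF Lstp(1)] in auto)
  finally show ?thesis by (simp add: field_simps)
 next
  case False
  have "s^2 < (norm (x - z))^2" using False assms by (intro power_strict_mono) auto
  hence "?t > 1" using p by (simp add: less_divide_eq)
  hence "Deriv n (bmp z r s) x v = 0" unfolding e by (simp add: deriv_stp_zero)
  thus ?thesis using p assms Lstp(1) by simp
 qed
qed

lemma bmp_Csc:
 assumes "opn n U" "0 <= r" "r < s" "cball z s Int Rn n <= U"
 shows "(%x. if x : Rn n then bmp z r s x else 0) : Csc n U"
proof -
 have "smooth n U (%x. if x : Rn n then bmp z r s x else 0)" by (rule smooth_cong[OF assms(1) _ bmp_smooth[OF assms(1)]]) (use opn_subset[OF assms(1)] in auto)
 moreover have "compact (cball z s Int Rn n)" by (rule compact_cball_Rn)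
 ultimately show ?thesis using assms unfolding Csc_def by (auto intro!: exI[of _ "cball z s Int Rn n"] bmp_zero simp: dist_norm norm_minus_commute)
qed

text \<open>Finitely many balls cover C, and one minus the product of the complementary bumps is one
  wherever a single bump is one. The value one is attained on a whole neighbourhood H of C in
  \<open>Rn n\<close>, so that derivatives can be compared there.\<close>

lemma cutoff:
 assumes W: "opn n W" and C: "compact C" "C <= W"
 obtains xi H where "xi : Csc n W" "!!x. 0 <= xi x" "!!x. xi x <= 1" "open H" "C <= H"
  "!!x. x : H Int Rn n ==> xi x = 1"
proof -
 have "EX r>0. cball x (2*r) Int Rn n <= W" if "x : C" for x
 proof -
  have "x : W" using C(2) \<open>x : C\<close> by blast
  from opn_cball[OF W this] obtain r where "0 < r" "cball x r Int Rn n <= W" by blast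
  thus ?thesis by (intro exI[of _ "r/2"]) auto
 qed
 then obtain r where r: "!!x. x : C==>r x > 0 & cball x (2*r x) Int Rn n <= W" by metis
 have "EX F<=C. finite F & C <= (\<Union>x\<in>F. ball x (r x))" by (rule compactE_image[OF C(1), of C "%x. ball x (r x)"]) (use r in auto)
 then obtain F where F: "F <= C" "finite F" "C <= (\<Union>x\<in>F. ball x (r x))" by blast
 define xi where "xi x = (if x : Rn n then 1 - (\<Prod>y\<in>F. 1 - bmp y (r y) (2*r y) x) else 0)" for x
 define H where "H = (\<Union>x\<in>F. ball x (r x))"
 have sm: "smooth n W xi"
 proof (rule smooth_cong[OF W])
  show "smooth n W (%x. 1 - (\<Prod>y\<in>F. 1 - bmp y (r y) (2*r y) x))" by (intro smooth_diff smooth_const smooth_prod bmp_smooth W)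
 qed (use opn_mem[OF W] in "simp add: xi_def")
 have sup: "xi x = 0" if "x ~: (\<Union>y\<in>F. cball y (2*r y) Int Rn n)" for x
 proof (cases "x : Rn n")
  case True
  have "bmp y (r y) (2*r y) x = 0" if y: "y : F" for y
  proof (rule bmp_zero)
   have "r y > 0" using r F y by blast
   thus "0 <= r y" "r y < 2*r y" by auto
   show "2*r y <= norm (x - y)" using \<open>x ~: _\<close> y True by (auto simp: dist_norm norm_minus_commute not_le)
  qed
  thus ?thesis by (simp add: xi_def)
 qed (simp add: xi_def)
 have cp: "compact (\<Union>y\<in>F. cball y (2*r y) Int Rn n)"
  using F by (intro compact_UN compact_cball_Rn)
 have "(\<Union>y\<in>F. cball y (2*r y) Int Rn n) <= W" using r F by blast
 hence 1: "xi : Csc n W" unfolding Csc_def using sm sup cp by blast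
 have pr: "0 <= (\<Prod>y\<in>F. 1 - bmp y (r y) (2*r y) x)" "(\<Prod>y\<in>F. 1 - bmp y (r y) (2*r y) x) <= 1" for x by (auto intro!: prod_nonneg prod_le_1 simp: bmp_range)
 have 2: "0 <= xi x" "xi x <= 1" for x using pr[of x] by (auto simp: xi_def)
 have 3: "xi x = 1" if x: "x : H Int Rn n" for x
 proof -
  obtain y where y: "y : F" "x : ball y (r y)" using x H_def by auto
  hence "bmp y (r y) (2*r y) x = 1"
   using r F by (intro bmp_one) (auto simp: dist_norm norm_minus_commute less_imp_le subset_iff)
  hence "(\<Prod>y\<in>F. 1 - bmp y (r y) (2*r y) x) = 0" using y F by (intro prod_zero) auto
  thus ?thesis using x by (simp add: xi_def)
 qed
 have 4: "open H" "C <= H" using F by (auto simp: H_def)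
 show ?thesis by (rule that[OF 1 2 4 3])
qed

subsection \<open>Test fields\<close>

lemma CcinfE:
 assumes "g : Ccinf n W l"
 obtains C where "compact C" "C <= W" "!!z. z ~: C==>g z = 0" "smooth n W g" "!!z. g z : Rn l"
proof -
 have "EX C. compact C & C <= W & (ALL z. z ~: C --> g z = 0)" and 1: "smooth n W g" and r: "range g <= Rn l"
  using assms by (simp_all add: Ccinf_def)
 then obtain C where C: "compact C" "C <= W" "ALL z. z ~: C --> g z = 0" by blast
 have "g z : Rn l" for z using r by auto
 thus ?thesis using that[OF C(1,2) _ 1] C(3) by simp
qed

lemma CcinfI:
 assumes "compact C" "C <= W" "!!z. z ~: C==>g z = 0" "smooth n W g" "!!z. g z : Rn l"
 shows "g : Ccinf n W l"
proof -
 have "range g <= Rn l" using assms(5) by auto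
 thus ?thesis using assms(1-4) unfolding Ccinf_def by auto
qed

lemma CscE:
 assumes "g : Csc n W"
 obtains C where "compact C" "C <= W" "!!z. z ~: C==>g z = 0" "smooth n W g"
proof -
 have "EX C. compact C & C <= W & (ALL z. z ~: C --> g z = 0)" and 1: "smooth n W g"
  using assms by (simp_all add: Csc_def)
 then obtain C where C: "compact C" "C <= W" "ALL z. z ~: C --> g z = 0" by blast
 thus ?thesis using that[OF C(1,2) _ 1] by simp
qed

lemma CscI:
 assumes "compact C" "C <= W" "!!z. z ~: C==>g z = 0" "smooth n W g"
 shows "g : Csc n W"
 using assms unfolding Csc_def by auto

lemma Ccinf_zero: "opn n W==>(%z. 0) : Ccinf n W l" by (rule CcinfI[of "{}"]) (auto intro: smooth_const)

lemma Ccinf_add: assumes "opn n W" "g : Ccinf n W l" "h : Ccinf n W l"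
 shows "(%z. g z+h z) : Ccinf n W l"
proof -
 obtain C where C: "compact C" "C <= W" "!!z. z ~: C==>g z = 0" "smooth n W g" "!!z. g z : Rn l" using CcinfE[OF assms(2)] by blast
 obtain D where D: "compact D" "D <= W" "!!z. z ~: D==>h z = 0" "smooth n W h" "!!z. h z : Rn l" using CcinfE[OF assms(3)] by blast
 show ?thesis by (rule CcinfI[of "C Un D"]) (use C D assms in "auto intro: smooth_add")
qed

lemma Ccinf_mult: assumes "opn n W" "smooth n W f" "g : Ccinf n W l"
 shows "(%z. f z *\<^sub>R g z) : Ccinf n W l"
proof -
 obtain C where C: "compact C" "C <= W" "!!z. z ~: C==>g z = 0" "smooth n W g" "!!z. g z : Rn l" using CcinfE[OF assms(3)] by blast
 show ?thesis by (rule CcinfI[of C]) (use C assms in "auto intro: smooth_scaleR")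
qed

lemma Ccinf_Csc: assumes "opn n W" "f : Csc n W" "smooth n W g" "!!z. z : W==>g z : Rn l"
 shows "(%z. f z *\<^sub>R g z) : Ccinf n W l"
proof -
 obtain C where C: "compact C" "C <= W" "!!z. z ~: C==>f z = 0" "smooth n W f" using CscE[OF assms(2)] by blast
 have "f z *\<^sub>R g z : Rn l" for z using C assms(4) by (cases "z : C") auto
 thus ?thesis by (intro CcinfI[of C]) (use C assms in "auto intro: smooth_scaleR")
qed

lemma Ccinf_scale: "opn n W==>g : Ccinf n W l==>(%z. c *\<^sub>R g z) : Ccinf n W l" by (rule Ccinf_mult[OF _ smooth_const])

lemma Ccinf_sum: "opn n W==>(!!i. i : I==>g i : Ccinf n W l)==>(%z. \<Sum>i\<in>I. g i z) : Ccinf n W l" by (induction I rule: infinite_finite_induct) (auto intro: Ccinf_add Ccinf_zero)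

lemma Ccinf_diff: "opn n W==>g : Ccinf n W l==>h : Ccinf n W l==>(%z. g z - h z) : Ccinf n W l"
 using Ccinf_add[of n W g l "%z. (-1) *\<^sub>R h z"] Ccinf_scale[of n W h l "-1"] by simp

lemma smooth_inner_self: "opn n W==>smooth n W g==>(!!z. g z : Rn l)==>smooth n W (%z. (norm (g z))^2)"
proof -
 assume W: "opn n W" "smooth n W g" "!!z. g z : Rn l"
 have "smooth n W (%z. \<Sum>i<l. (lk (g z) i)^2)"
  using W by (intro smooth_sum smooth_power smooth_bl[OF _ _ bounded_linear_lk])
 moreover have "(norm (g z))^2 = (\<Sum>i<l. (lk (g z) i)^2)" for z
  using norm_Rn[OF W(3)[of z]] by (simp add: sum_nonneg)
 ultimately show ?thesis by simp
qed

lemma opn_Union: "(!!i. i : I==>opn n (W i))==>opn n (\<Union>i\<in>I. W i)" by (rule openin_Union) auto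

lemma opn_ne: assumes "opn n U" "continuous_on U f" "open A" shows "opn n {z : U. f z : A}"
proof -
 have "openin (top_of_set U) (U Int f -` A)" using assms(2,3) continuous_openin_preimage_gen by blast
 hence "opn n (U Int f -` A)" by (rule opn_trans[OF assms(1)])
 moreover have "U Int f -` A = {z : U. f z : A}" by auto
 ultimately show ?thesis by simp
qed

subsection \<open>The total variation of a vector distribution is a measure\<close>

lemma ennreal_add_le: "enn (a+b) <= enn a+enn b"
proof -
 have "enn (a+b) <= enn (max 0 a+max 0 b)" by (intro ennreal_leI) auto
 also have "... = enn a+enn b" by (simp add: ennreal_plus ennreal_max_0)
 finally show ?thesis .
qed

text \<open>Abstract setting: a linear functional on test fields with Radon total variation. It is
  instantiated by the first variation of V and, for superlevel sets E, by the boundary distribution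
  of E.\<close>

locale vdist =
 fixes n :: nat and U :: "vec set" and T :: "(vec => vec) => real"
 assumes U: "opn n U"
  and T_add: "g : Ccinf n U n==>h : Ccinf n U n==>T (%z. g z+h z) = T g+T h"
  and T_scale: "g : Ccinf n U n==>T (%z. c *\<^sub>R g z) = c*T g"
  and radon: "radon_var n U T"
begin

definition lam :: "vec set => ennreal" where
 "lam W = (SUP g\<in>{g : Ccinf n W n. ALL z. norm (g z) <= 1}. enn (T g))"

abbreviation "tv \<equiv> total_var n U T"
abbreviation "M \<equiv> total_var_measure n U T"

lemma tv_def: "tv A = (INF W\<in>{W. opn n W & W <= U & A <= W}. lam W)"
proof -
 have "{W. openin (top_of_set U) W & A <= W} = {W. opn n W & W <= U & A <= W}"
  using opn_openin[OF U] by auto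
 thus ?thesis unfolding total_var_def lam_def by simp
qed

lemma T_zero: "T (%z. 0) = 0"
 using T_scale[OF Ccinf_zero[OF U], of 0] by simp

lemma Ccinf_U: "opn n W==>W <= U==>g : Ccinf n W n==>g : Ccinf n U n"
 using Ccinf_mono[of n W U n] U by blast

lemma lam_upper: "g : Ccinf n W n==>(!!z. norm (g z) <= 1)==>ennreal (T g) <= lam W"
 unfolding lam_def by (rule SUP_upper) simp

lemma lam_least: "(!!g. g : Ccinf n W n==>(!!z. norm (g z) <= 1)==>ennreal (T g) <= c)==>lam W <= c"
 unfolding lam_def by (rule SUP_least) blast

lemma lam_mono: "opn n W==>opn n Y==>W <= Y==>lam W <= lam Y" by (rule lam_least, rule lam_upper) (use Ccinf_mono in blast)+

lemma tv_open: "opn n W==>W <= U==>tv W = lam W"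
 unfolding tv_def by (rule antisym) (auto intro!: INF_lower2[of W] INF_greatest lam_mono)

lemma tv_mono: "A <= B==>tv A <= tv B"
 unfolding tv_def by (rule INF_superset_mono) auto

lemma tv_close: assumes "tv A < c" obtains W where "opn n W" "W <= U" "A <= W" "lam W < c"
 using assms unfolding tv_def INF_less_iff by blast

lemma lam_empty: "lam {} = 0"
proof -
 have "lam {} <= 0"
 proof (rule lam_least)
  fix g assume "g : Ccinf n {} n"
  hence "g = (%z. 0)" by (rule CcinfE) auto
  thus "enn (T g) <= 0" by (simp add: T_zero)
 qed
 thus ?thesis by simp
qed

text \<open>A cutoff living in W that is one near the part of the support outside Y splits a
  competing field into a piece in W and a piece in Y, neither of them longer than the field.\<close>

lemma lam_Un:
 assumes W: "opn n W" "opn n Y" "W <= U" "Y <= U"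
 shows "lam (W Un Y) <= lam W+lam Y"
proof (rule lam_least)
 fix g assume g: "g : Ccinf n (W Un Y) n" and n1: "!!z. norm (g z) <= 1"
 obtain C where C: "compact C" "C <= W Un Y" "!!z. z ~: C==>g z = 0" "smooth n (W Un Y) g" "!!z. g z : Rn n"
  using CcinfE[OF g] by blast
 have CRn: "C <= Rn n" using C W opn_subset by blast
 obtain H where H: "open H" "Y = Rn n Int H" using W(2) by (auto simp: openin_open)
 have "C - Y = C - H" using CRn H by auto
 hence C1: "compact (C - Y)" "C - Y <= W" using C H compact_diff by auto
 obtain xi J where xi: "xi : Csc n W" "!!x. 0 <= xi x" "!!x. xi x <= 1" "open J" "C - Y <= J"
  "!!x. x : J Int Rn n ==> xi x = 1" using cutoff[OF W(1) C1] by blast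
 have sg: "smooth n W g" "smooth n Y g" using C(4) smooth_subset by blast+
 have xiU: "smooth n U xi" using Csc_mono[OF W(1) U W(3)] xi(1) CscE by blast
 have g1: "(%z. xi z *\<^sub>R g z) : Ccinf n W n" by (rule Ccinf_Csc[OF W(1) xi(1) sg(1)]) (use C in auto)
 have g2: "(%z. (1 - xi z) *\<^sub>R g z) : Ccinf n Y n"
 proof (rule CcinfI[of "C - J"])
  show "compact (C - J)" using C xi compact_diff by blast
  show "C - J <= Y" using xi(5) by blast
  show "(1 - xi z) *\<^sub>R g z = 0" if "z ~: C - J" for z
   using that xi(6)[of z] C(3)[of z] CRn by auto
  show "smooth n Y (%z. (1 - xi z) *\<^sub>R g z)" by (intro smooth_scaleR smooth_diff smooth_const W sg smooth_subset[OF xiU])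
 qed (use C in auto)
 have "T g = T (%z. xi z *\<^sub>R g z+(1 - xi z) *\<^sub>R g z)" by (simp add: scaleR_left_diff_distrib)
 also have "... = T (%z. xi z *\<^sub>R g z)+T (%z. (1 - xi z) *\<^sub>R g z)" by (intro T_add Ccinf_U[OF _ _ g1] Ccinf_U[OF _ _ g2] W)
 finally have "enn (T g) <= enn (T (%z. xi z *\<^sub>R g z))+enn (T (%z. (1 - xi z) *\<^sub>R g z))" by (simp add: ennreal_add_le)
 also have "... <= lam W+lam Y"
 proof (intro add_mono lam_upper g1 g2)
  fix z
  show "norm (xi z *\<^sub>R g z) <= 1" "norm ((1 - xi z) *\<^sub>R g z) <= 1"
   using xi(2,3)[of z] n1[of z] by (auto intro!: mult_le_one)
 qed
 finally show "enn (T g) <= lam W+lam Y" .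
qed

lemma lam_UN_fin: "(!!i::nat. i < N==>opn n (W i) & W i <= U)==>lam (\<Union>i<N. W i) <= (\<Sum>i<N. lam (W i))"
proof (induction N)
 case (Suc N)
 have "lam (\<Union>i<Suc N. W i) = lam ((\<Union>i<N. W i) Un W N)" by (simp add: lessThan_Suc Un_commute)
 also have "... <= lam (\<Union>i<N. W i)+lam (W N)" by (rule lam_Un) (use Suc.prems in "auto intro!: opn_Union simp: UN_subset_iff")
 also have "... <= (\<Sum>i<N. lam (W i))+lam (W N)" by (intro add_mono Suc.IH) (use Suc.prems in auto)
 finally show ?case by simp
qed (simp add: lam_empty)

text \<open>The support of a competing field is compact, hence covered by finitely many of the
  sets.\<close>

lemma lam_UN:
 assumes W: "!!i::nat. opn n (W i)" "!!i. W i <= U"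
 shows "lam (\<Union>i. W i) <= (suminf (%i. lam (W i)))"
proof (rule lam_least)
 fix g assume g: "g : Ccinf n (\<Union>i. W i) n" and n1: "!!z. norm (g z) <= 1"
 obtain C where C: "compact C" "C <= (\<Union>i. W i)" "!!z. z ~: C==>g z = 0" "smooth n (\<Union>i. W i) g" "!!z. g z : Rn n"
  using CcinfE[OF g] by blast
 have "ALL i. EX H. open H & W i = Rn n Int H" using W(1) by (auto simp: openin_open)
 then obtain H where H: "!!i. open (H i)" "!!i. W i = Rn n Int H i" by metis
 obtain F where F: "finite F" "C <= (\<Union>i\<in>F. H i)"
 proof (rule compactE_image[OF C(1), of UNIV H])
  show "C <= (\<Union>i. H i)" using C(2) H(2) by blast
 qed (use H in auto)
 obtain N where N: "F <= {..<N}" using F(1) finite_nat_iff_bounded by blast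
 have "C <= (\<Union>i<N. W i)"
 proof
  fix x assume x: "x : C"
  then obtain i where "i : F" "x : H i" using F by blast
  moreover have "x : Rn n" using x C(2) H(2) by blast
  ultimately show "x : (\<Union>i<N. W i)" using N H(2) by blast
 qed
 hence "g : Ccinf n (\<Union>i<N. W i) n"
  using C by (intro CcinfI[of C] smooth_subset[OF C(4)]) auto
 hence "enn (T g) <= lam (\<Union>i<N. W i)" using n1 by (rule lam_upper)
 also have "... <= (\<Sum>i<N. lam (W i))" by (rule lam_UN_fin) (use W in auto)
 also have "... <= (suminf (%i. lam (W i)))" by (rule sum_le_suminf) auto
 finally show "enn (T g) <= (suminf (%i. lam (W i)))" .
qed

text \<open>Each \<open>A i\<close> of finite variation lies in an open set whose value exceeds that
  of \<open>A i\<close> by at most e / 2^(i+1).\<close>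

lemma tv_countable:
 fixes A :: "nat => vec set"
 shows "tv (\<Union>i. A i) <= (suminf (%i. tv (A i)))"
proof (cases "EX i. tv (A i) = \<infinity>")
 case True
 then obtain i where "tv (A i) = \<infinity>" by blast
 hence "(suminf (%i. tv (A i))) = \<infinity>" using sum_le_suminf[of "%i. tv (A i)" "{i}"] by (simp add: top_unique)
 thus ?thesis by simp
next
 case False
 show ?thesis
 proof (rule ennreal_le_epsilon)
  fix e :: real assume e: "0 < e"
  have "EX W. opn n W & W <= U & A i <= W & lam W <= tv (A i)+enn (e*(1/2) ^ Suc i)" for i
  proof -
   have "tv (A i) < tv (A i)+enn (e*(1/2) ^ Suc i)"
    using False e by (cases "tv (A i)") (auto simp flip: ennreal_plus simp: ennreal_less_iff)
   thus ?thesis using tv_close less_imp_le by metis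
  qed
  then obtain W where W: "!!i. opn n (W i)" "!!i. W i <= U" "!!i. A i <= W i"
   "!!i. lam (W i) <= tv (A i)+enn (e*(1/2) ^ Suc i)" by metis
  have "tv (\<Union>i. A i) <= tv (\<Union>i. W i)" using W(3) by (intro tv_mono) blast
  also have "... = lam (\<Union>i. W i)" using W by (intro tv_open opn_Union) auto
  also have "... <= (suminf (%i. lam (W i)))" by (rule lam_UN) (use W in auto)
  also have "... <= (suminf (%i. tv (A i)+enn (e*(1/2) ^ Suc i)))" by (intro suminf_le W) auto
  also have "... = (suminf (%i. tv (A i)))+(suminf (%i. enn (e*(1/2) ^ Suc i)))" by (rule suminf_add[symmetric]) auto
  also have "(suminf (%i. enn (e*(1/2) ^ Suc i))) = enn e"
   using e sums_mult[OF power_half_series, of e] by (intro suminf_ennreal_eq) auto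
  finally show "tv (\<Union>i. A i) <= (suminf (%i. tv (A i)))+enn e" .
 qed
qed

lemma tv_oms: "outer_measure_space (Pow U) tv"
 unfolding outer_measure_space_def positive_def increasing_def countably_subadditive_def
 using tv_open[of "{}"] lam_empty tv_mono tv_countable by simp

lemma tv_Un: "tv (A Un B) <= tv A+tv B"
proof -
 have "tv (\<Union>i. binaryset A B i) <= (suminf (%i. tv (binaryset A B i)))" by (rule tv_countable)
 thus ?thesis using tv_open[of "{}"] lam_empty by (simp add: UN_binaryset_eq suminf_binaryset_eq)
qed

text \<open>Caratheodory measurability of open sets. Let Y be open around x. A field with support C
  inside W and Y and a field supported in Y - C have disjoint supports, so their sum still has
  length at most one and competes in \<open>lam Y\<close>. Since Y - C contains the part of x
  outside W, taking suprema over both fields gives the inequality.\<close>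

lemma opn_lambda: assumes W: "opn n W" "W <= U" shows "W : lambda_system U (Pow U) tv"
 unfolding lambda_system_def
proof (intro CollectI conjI ballI antisym)
 fix x assume x: "x : Pow U"
 have "tv x <= tv ((W Int x) Un ((U - W) Int x))" using x by (intro tv_mono) auto
 also have "... <= tv (W Int x)+tv ((U - W) Int x)" by (rule tv_Un)
 finally show "tv x <= tv (W Int x)+tv ((U - W) Int x)" .
 show "tv (W Int x)+tv ((U - W) Int x) <= tv x"
  unfolding tv_def[of x]
 proof (rule INF_greatest)
  fix Y assume "Y : {W. opn n W & W <= U & x <= W}"
  hence Y: "opn n Y" "Y <= U" "x <= Y" by auto
  have WY: "opn n (W Int Y)" using W Y by blast
  have key: "enn (T g)+tv ((U - W) Int x) <= lam Y"
   if g: "g : Ccinf n (W Int Y) n" "!!z. norm (g z) <= 1" "0 <= T g" for g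
  proof -
   obtain C where C: "compact C" "C <= W Int Y" "!!z. z ~: C==>g z = 0" "smooth n (W Int Y) g" "!!z. g z : Rn n" using CcinfE[OF g(1)] by blast
   have o: "opn n (Y - C)" using Y C by (intro opn_Diff_closed compact_imp_closed)
   have gY: "g : Ccinf n Y n" using Ccinf_mono[OF WY Y(1)] g(1) by blast
   have "tv ((U - W) Int x) <= tv (Y - C)" using C Y by (intro tv_mono) auto
   also have "... = lam (Y - C)" using o Y by (intro tv_open) auto
   also have "enn (T g) + ... <= lam Y" unfolding lam_def[of "Y - C"]
   proof (subst ennreal_SUP_add_right)
    show "{g : Ccinf n (Y - C) n. ALL z. norm (g z) <= 1} ~= {}" using Ccinf_zero[OF o, of n] by force
    show "(SUP h\<in>{g : Ccinf n (Y - C) n. ALL z. norm (g z) <= 1}. enn (T g)+enn (T h)) <= lam Y"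
    proof (rule SUP_least)
     fix h assume "h : {g : Ccinf n (Y - C) n. ALL z. norm (g z) <= 1}"
     hence h: "h : Ccinf n (Y - C) n" "!!z. norm (h z) <= 1" by auto
     have hY: "h : Ccinf n Y n" using Ccinf_mono[OF o Y(1)] h(1) by blast
     obtain D where "compact D" and D: "D <= Y - C" "!!z. z ~: D==>h z = 0" "smooth n (Y - C) h" "!!z. h z : Rn n"
      using CcinfE[OF h(1)] by blast
     show "enn (T g)+enn (T h) <= lam Y"
     proof (cases "0 <= T h")
      case True
      have "norm (g z+h z) <= 1" for z
      proof (cases "z : C")
       case True
       hence "h z = 0" using D by blast
       thus ?thesis using g(2)[of z] by simp
      qed (use C(3)[of z] h(2)[of z] in simp)
      hence "enn (T (%z. g z+h z)) <= lam Y" by (intro lam_upper Ccinf_add Y gY hY) auto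
      thus ?thesis using True g(3) T_add[OF Ccinf_U[OF Y(1,2) gY] Ccinf_U[OF Y(1,2) hY]] by simp
     next
      case False
      hence "enn (T h) = 0" by (simp add: ennreal_neg)
      thus ?thesis using lam_upper[OF gY g(2)] by simp
     qed
    qed
   qed
   finally show ?thesis by (simp add: add_left_mono)
  qed
  have "tv (W Int x) <= tv (W Int Y)" using Y by (intro tv_mono) auto
  also have "... = lam (W Int Y)" using WY W by (intro tv_open) auto
  finally have "tv (W Int x)+tv ((U - W) Int x) <= lam (W Int Y)+tv ((U - W) Int x)" by (rule add_right_mono)
  also have "... <= lam Y" unfolding lam_def[of "W Int Y"]
  proof (subst ennreal_SUP_add_left[symmetric])
   show "{g : Ccinf n (W Int Y) n. ALL z. norm (g z) <= 1} ~= {}" using Ccinf_zero[OF WY, of n] by force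
   show "(SUP g\<in>{g : Ccinf n (W Int Y) n. ALL z. norm (g z) <= 1}. enn (T g)+tv ((U - W) Int x)) <= lam Y"
   proof (rule SUP_least)
    fix g assume "g : {g : Ccinf n (W Int Y) n. ALL z. norm (g z) <= 1}"
    hence g: "g : Ccinf n (W Int Y) n" "!!z. norm (g z) <= 1" by auto
    show "enn (T g)+tv ((U - W) Int x) <= lam Y"
    \<comment> \<open>A negative value is truncated to 0 by \<open>ennreal\<close>, and then the
      zero field gives the bound.\<close>
    proof (cases "0 <= T g")
     case False
     thus ?thesis using key[OF Ccinf_zero[OF WY]] by (simp add: ennreal_neg T_zero)
    qed (use key g in auto)
   qed
  qed
  finally show "tv (W Int x)+tv ((U - W) Int x) <= lam Y" .
 qed
qed (use W in auto)

lemma space_R: "space (restrict_space borel U) = U" by (simp add: space_restrict_space)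

lemma sets_M: "sets M = sets (restrict_space borel U)"
 unfolding total_var_measure_def
 using sets.sigma_sets_eq[of "restrict_space borel U"] sets.space_closed[of "restrict_space borel U"] by (simp add: space_R sets_measure_of)

lemma space_M [simp]: "space M = U"
 using sets_eq_imp_space_eq[OF sets_M] by (simp add: space_R)

lemma in_sets_M: "A : sets M \<longleftrightarrow> A : sets borel & A <= U"
 using opn_borel[OF U] by (simp add: sets_M sets_restrict_space_iff conj_commute)

text \<open>\<open>measure_of\<close> takes the prescribed values only if these form a measure. By
  Caratheodory they do on the measurable sets of the outer measure, which contain the relatively
  open and hence all Borel subsets of U.\<close>

lemma emeasure_M: assumes "A : sets M" shows "emeas M A = tv A"
proof -
 have sa: "sigma_algebra U (lambda_system U (Pow U) tv)" and ms: "measure_space U (lambda_system U (Pow U) tv) tv"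
  using sigma_algebra.caratheodory_lemma[OF sigma_algebra_Pow tv_oms] by (auto simp: measure_space_def)
 have "sets (restrict_space borel U) = sigma_sets U ((\<inter>) U ` {S. open S})"
  using opn_borel[OF U] by (simp add: sets_restrict_space borel_def sigma_sets_Int sets_measure_of)
 also have "... <= lambda_system U (Pow U) tv"
 proof (rule sigma_algebra.sigma_sets_subset[OF sa], safe)
  fix S :: "vec set" assume "open S"
  thus "U Int S : lambda_system U (Pow U) tv" by (intro opn_lambda opn_Int_open U) auto
 qed
 finally have "measure_space U (sets (restrict_space borel U)) tv"
  using measure_down[OF ms] sets.sigma_algebra_axioms[of "restrict_space borel U"] by (simp add: space_R)
 thus ?thesis using assms unfolding total_var_measure_def by (intro emeasure_measure_of_sigma) (simp_all add: measure_space_def sets_M flip: total_var_measure_def)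
qed

lemma M_compact: "compact C==>C <= U==>emeas M C < \<infinity>"
 using radon by (subst emeasure_M) (auto simp: in_sets_M radon_var_def compact_imp_closed)

lemma lam_M: "opn n W==>W <= U==>lam W = emeas M W"
 using opn_borel by (subst emeasure_M) (auto simp: in_sets_M tv_open)

lemma T_sum: "finite I==>(!!i. i : I==>g i : Ccinf n U n)==>T (%z. \<Sum>i\<in>I. g i z) = (\<Sum>i\<in>I. T (g i))" by (induction I rule: finite_induct) (auto simp: T_zero T_add Ccinf_sum[OF U])

lemma T_lam:
 assumes "opn n W" "W <= U" "g : Ccinf n W n" "0 < c" "!!z. norm (g z) <= c"
 shows "enn (T g) <= enn c*emeas M W"
proof -
 have gU: "g : Ccinf n U n" using assms Ccinf_U by blast
 have "enn (T (%z. (1/c) *\<^sub>R g z)) <= lam W"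
  using assms by (intro lam_upper Ccinf_scale) (auto simp: divide_le_eq)
 hence "enn c*enn ((1/c)*T g) <= enn c*lam W" by (simp add: T_scale[OF gU] mult_left_mono)
 thus ?thesis using assms by (simp add: lam_M ennreal_mult'[symmetric])
qed

text \<open>Decomposing a field by dyadic-free levels of its squared length bounds the functional by the
  integral of the length, up to a constant factor; the factor is irrelevant for all later uses.\<close>

lemma T_bound0:
 assumes g: "g : Ccinf n U n"
 shows "enn (T g) <= 9*(\<integral>\<^sup>+z. enn (norm (g z)) \<partial>M)"
proof (rule ennreal_le_epsilon)
 fix e0 :: real assume e0: "0 < e0"
 obtain C where C: "compact C" "C <= U" "!!z. z ~: C==>g z = 0" "smooth n U g" "!!z. g z : Rn n"
  using CcinfE[OF g] by blast
 have "tv C < \<infinity>" using radon C by (auto simp: radon_var_def)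
 then obtain W where W: "opn n W" "W <= U" "C <= W" "lam W < \<infinity>" using tv_close by metis
 obtain c where c: "emeas M W = enn c" "0 <= c" using W lam_M by (cases "emeas M W") auto
 \<comment> \<open>The remainder \<open>r\<close> below has length at most 2e and lives on W, whose
   measure is c; so it contributes at most e0.\<close>
 define e where "e = e0/(2*(c+1))"
 have e: "e > 0" "2*e*c <= e0" using e0 c by (auto simp: e_def field_simps)
 define q where "q z = (norm (g z))^2/e^2" for z
 define s where "s k z = stp (q z - real k)" for k z
 have cq: "continuous_on U q" unfolding q_def using smooth_continuous[OF C(4)] by (intro continuous_intros) (use e in auto)
 have ss: "smooth n U (s k)" for k
 proof -
  have "rsm UNIV (%t. stp ((1/e^2)*t + - real k))" by (rule rsm_affine[OF stp_props(1)])
  from smooth_compose[OF U _ smooth_inner_self[OF U C(4,5)] _ this]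
  show ?thesis by (simp add: s_def[abs_def] q_def)
 qed
 have q0: "q z >= 0" for z by (simp add: q_def)
 have nq: "norm (g z) = e * sqrt (q z)" for z using e by (simp add: q_def real_sqrt_divide)
 have "bounded (g ` C)"
  using C smooth_continuous[OF C(4)] by (intro compact_imp_bounded compact_continuous_image) (auto intro: continuous_on_subset)
 then obtain B where B: "ALL x:g ` C. norm x <= B" using bounded_iff by blast
 have B': "norm (g z) <= \<bar>B\<bar>" for z using B C(3)[of z] by (cases "z : C") force+
 obtain K where K: "B^2/e^2 <= real K" using real_arch_simple by blast
 have qK: "q z <= real K" for z
 proof -
  have "(norm (g z))^2 <= B^2" using power_mono[OF B'[of z], of 2] by simp
  hence "q z <= B^2/e^2" unfolding q_def by (intro divide_right_mono) auto
  thus ?thesis using K by simp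
 qed
 \<comment> \<open>The layer \<open>t k\<close> is the part of g where q lies between k+1 and k+3.
   The layers telescope, and \<open>r\<close> is what is left where q is below 2.\<close>
 define t where "t k z = (s (Suc k) z - s (Suc (Suc k)) z) *\<^sub>R g z" for k z
 define r where "r z = (1 - s 1 z) *\<^sub>R g z" for z
 \<comment> \<open>Each point lies in at most three of these open layers, and on the k-th of them
   sqrt(k+3) <= 3 sqrt(q); the two factors 3 account for the 9.\<close>
 define O1 where "O1 k = {z : U. q z : {real k+1/2 <..< real k+7/2}}" for k
 have oO: "opn n (O1 k)" for k unfolding O1_def by (rule opn_ne[OF U cq]) simp
 have tz: "t k z = 0" if "q z <= real k+1 \<or> real k+3 <= q z" for k z
  using that by (auto simp: t_def s_def stp_props)
 have tU: "t k : Ccinf n U n" for k unfolding t_def by (intro Ccinf_mult smooth_diff ss U g)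
 have rW: "r : Ccinf n W n"
 proof (rule CcinfI[OF C(1) W(3)])
  have "smooth n U r" unfolding r_def by (intro smooth_scaleR smooth_diff smooth_const ss C(4) U)
  thus "smooth n W r" using smooth_subset W(2) by blast
 qed (use C in "auto simp: r_def")
 have tO: "t k : Ccinf n (O1 k) n" for k
 proof (rule CcinfI)
  let ?D = "C Int {z : U. q z : {real k+1..real k+3}}"
  have "closedin (top_of_set U) (U Int q -` {real k+1..real k+3})" by (rule continuous_closedin_preimage[OF cq]) simp
  then obtain Z where Z: "closed Z" "U Int q -` {real k+1..real k+3} = U Int Z" by (auto simp: closedin_closed)
  have "compact (C Int Z)" using C(1) Z(1) by (rule compact_Int_closed)
  moreover have "C Int (U Int q -` {real k+1..real k+3}) = C Int Z" using Z(2) C(2) by auto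
  ultimately have "compact (C Int (U Int q -` {real k+1..real k+3}))" by simp
  moreover have "C Int (U Int q -` {real k+1..real k+3}) = ?D" by auto
  ultimately show "compact ?D" by simp
  show "?D <= O1 k" by (auto simp: O1_def)
  show "t k z = 0" if "z ~: ?D" for z
   using that C(2,3) tz[of z k] by (cases "z : C") (auto simp: t_def)
  show "smooth n (O1 k) (t k)" using CcinfE[OF tU] smooth_subset by (metis (no_types, lifting) O1_def mem_Collect_eq subsetI)
  show "t k z : Rn n" for z using C by (auto simp: t_def)
 qed
 have s01: "0 <= s k z" "s k z <= 1" for k z by (simp_all add: s_def stp_range)
 have sm: "s (Suc k) z <= s k z" for k z unfolding s_def by (rule monoD[OF stp_props(4)]) simp
 have decomp: "g z = r z+(\<Sum>k<K. t k z)" for z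
 proof -
  have "(\<Sum>k<K. s (Suc k) z - s (Suc (Suc k)) z) = s 1 z - s (Suc K) z"
   using sum_lessThan_telescope'[of "%k. s (Suc k) z" K] by simp
  moreover have "s (Suc K) z = 0" unfolding s_def using qK[of z] by (intro stp_props) simp
  ultimately have "(\<Sum>k<K. t k z) = s 1 z *\<^sub>R g z" unfolding t_def by (simp flip: scaleR_sum_left)
  thus ?thesis by (simp add: r_def scaleR_left_diff_distrib)
 qed
 have "g = (%z. r z+(\<Sum>k<K. t k z))" using decomp by (rule ext)
 hence "T g = T (%z. r z+(\<Sum>k<K. t k z))" by (rule arg_cong)
 also have "... = T r+T (%z. \<Sum>k<K. t k z)" by (intro T_add Ccinf_sum tU U Ccinf_U[OF W(1,2) rW])
 also have "... = T r+(\<Sum>k<K. T (t k))" by (subst T_sum) (auto intro: tU)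
 finally have "enn (T g) <= enn (T r)+(\<Sum>k<K. enn (T (t k)))"
 proof -
  assume *: "T g = T r+(\<Sum>k<K. T (t k))"
  have "(\<Sum>k<K. T (t k)) <= (\<Sum>k<K. max 0 (T (t k)))" by (intro sum_mono) auto
  hence "enn (T g) <= enn (max 0 (T r)+(\<Sum>k<K. max 0 (T (t k))))" unfolding*by (intro ennreal_leI add_mono) auto
  also have "... = enn (max 0 (T r))+(\<Sum>k<K. enn (max 0 (T (t k))))" by (subst ennreal_plus) (auto intro: sum_nonneg)
  finally show ?thesis by (simp add: ennreal_max_0)
 qed
 also have "enn (T r) <= enn (2*e)*emeas M W"
 proof (rule T_lam[OF W(1,2) rW])
  show "norm (r z) <= 2*e" for z
  proof (cases "q z >= 2")
   case True thus ?thesis using e by (simp add: r_def s_def stp_props)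
  next
   case False
   hence "sqrt (q z) <= sqrt 4" by (intro real_sqrt_le_mono) simp
   hence "norm (g z) <= 2*e" using e nq[of z] by simp
   moreover have "norm (r z) <= 1*norm (g z)" unfolding r_def norm_scaleR using s01[of 1 z] by (intro mult_right_mono) auto
   ultimately show ?thesis by simp
  qed
 qed (use e in auto)
 also have "enn (2*e)*emeas M W <= enn e0" using c e by (simp add: ennreal_mult'[symmetric] ennreal_leI)
 also have "(\<Sum>k<K. enn (T (t k))) <= (\<Sum>k<K. 3*(\<integral>\<^sup>+z. enn (norm (g z))*ind (O1 k) z \<partial>M))"
 proof (rule sum_mono)
  fix k
  have OU: "O1 k <= U" by (auto simp: O1_def)
  have Om: "O1 k : sets M" using opn_borel[OF oO] OU by (simp add: in_sets_M)
  have "enn (T (t k)) <= enn (e * sqrt (real k+3))*emeas M (O1 k)"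
  proof (rule T_lam[OF oO OU tO])
   show "norm (t k z) <= e * sqrt (real k+3)" for z
   proof (cases "q z <= real k+3")
    case True
    have "norm (t k z) <= 1*norm (g z)" unfolding t_def norm_scaleR
     using s01[of "Suc k" z] s01[of "Suc (Suc k)" z] sm[of "Suc k" z] by (intro mult_right_mono) auto
    also have "... <= e * sqrt (real k+3)" using True e by (simp add: nq)
    finally show ?thesis .
   next
    case False thus ?thesis using tz[of z k] e by simp
   qed
  qed (use e in simp)
  also have "... = (\<integral>\<^sup>+z. enn (e * sqrt (real k+3))*ind (O1 k) z \<partial>M)"
   using Om by (simp add: nn_integral_cmult_indicator)
  also have "... <= (\<integral>\<^sup>+z. 3*(enn (norm (g z))*ind (O1 k) z) \<partial>M)"
  proof (rule nn_integral_mono)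
   fix z
   show "enn (e * sqrt (real k+3))*ind (O1 k) z <= 3*(enn (norm (g z))*ind (O1 k) z)"
   proof (cases "z : O1 k")
    case True
    hence "sqrt (real k+3) <= sqrt (9*q z)" by (intro real_sqrt_le_mono) (auto simp: O1_def)
    also have "... = 3 * sqrt (q z)" by (simp add: real_sqrt_mult)
    finally have "e * sqrt (real k+3) <= 3*norm (g z)" using e by (simp add: nq)
    hence "enn (e * sqrt (real k+3)) <= enn (3*norm (g z))" by (rule ennreal_leI)
    thus ?thesis using True by (simp add: ennreal_mult')
   qed simp
  qed
  also have "... = 3*(\<integral>\<^sup>+z. enn (norm (g z))*ind (O1 k) z \<partial>M)"
  proof (rule nn_integral_cmult)
   have "continuous_on U g" by (rule smooth_continuous[OF C(4)])
   hence "(%z. norm (g z)) : bmeas (restrict_space borel U)" by (intro borel_measurable_continuous_on_restrict continuous_intros)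
   hence "(%z. norm (g z)) : bmeas M" by (simp add: measurable_cong_sets[OF sets_M refl])
   thus "(%z. enn (norm (g z))*ind (O1 k) z) : bmeas M" using Om by measurable
  qed
  finally show "enn (T (t k)) <= 3*(\<integral>\<^sup>+z. enn (norm (g z))*ind (O1 k) z \<partial>M)" .
 qed
 also have "(\<Sum>k<K. 3*(\<integral>\<^sup>+z. enn (norm (g z))*ind (O1 k) z \<partial>M)) <= 9*(\<integral>\<^sup>+z. enn (norm (g z)) \<partial>M)"
 proof -
  have mg: "(%z. norm (g z)) : bmeas M"
  proof -
   have "continuous_on U g" by (rule smooth_continuous[OF C(4)])
   hence "(%z. norm (g z)) : bmeas (restrict_space borel U)" by (intro borel_measurable_continuous_on_restrict continuous_intros)
   thus ?thesis by (simp add: measurable_cong_sets[OF sets_M refl])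
  qed
  have Om: "O1 k : sets M" for k using opn_borel[OF oO] by (auto simp: in_sets_M O1_def)
  have "(\<Sum>k<K. 3*(\<integral>\<^sup>+z. enn (norm (g z))*ind (O1 k) z \<partial>M))
   = 3*(\<integral>\<^sup>+z. (\<Sum>k<K. enn (norm (g z))*ind (O1 k) z) \<partial>M)"
   using mg Om by (subst nn_integral_sum) (auto simp: sum_distrib_left)
  also have "(\<integral>\<^sup>+z. (\<Sum>k<K. enn (norm (g z))*ind (O1 k) z) \<partial>M) <= (\<integral>\<^sup>+z. 3*enn (norm (g z)) \<partial>M)"
  proof (rule nn_integral_mono)
   fix z
   let ?S = "{k\<in>{..<K}. z : O1 k}"
   have "card ?S <= 3"
   proof (cases "?S = {}")
    case True thus ?thesis by (metis card.empty zero_le)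
   next
    case False
    let ?m = "Min ?S"
    have m: "?m : ?S" using False by (intro Min_in) auto
    have "?S <= {?m, ?m+1, ?m+2}"
    proof
     fix k assume k: "k : ?S"
     hence "?m <= k" by (intro Min_le) auto
     moreover have "real k < real ?m+3" using k m by (auto simp: O1_def)
     hence "k < ?m+3" by linarith
     ultimately show "k : {?m, ?m+1, ?m+2}" by auto
    qed
    hence "card ?S <= card {?m, ?m+1, ?m+2}" by (intro card_mono) auto
    also have "... <= 3" by (simp add: card_insert_if)
    finally show ?thesis .
   qed
   have "(\<Sum>k<K. enn (norm (g z))*ind (O1 k) z) = (\<Sum>k\<in>?S. enn (norm (g z)))" by (rule sum.mono_neutral_cong_right) (auto simp: indicator_def)
   also have "... = of_nat (card ?S)*enn (norm (g z))" by simp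
   also have "... <= 3*enn (norm (g z))"
   proof (rule mult_right_mono)
    show "of_nat (card ?S) <= (3::ennreal)" using \<open>card ?S <= 3\<close> by (metis of_nat_le_iff of_nat_numeral)
   qed simp
   finally show "(\<Sum>k<K. enn (norm (g z))*ind (O1 k) z) <= 3*enn (norm (g z))" .
  qed
  also have "(\<integral>\<^sup>+z. 3*enn (norm (g z)) \<partial>M) = 3*(\<integral>\<^sup>+z. enn (norm (g z)) \<partial>M)"
   using mg by (intro nn_integral_cmult) auto
  finally show ?thesis by (simp add: mult.assoc[symmetric] mult_left_mono)
 qed
 finally show "enn (T g) <= 9*(\<integral>\<^sup>+z. enn (norm (g z)) \<partial>M)+enn e0" by (simp add: add.commute add_mono)
qed

lemma T_bound:
 assumes g: "g : Ccinf n U n"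
 shows "enn \<bar>T g\<bar> <= 9*(\<integral>\<^sup>+z. enn (norm (g z)) \<partial>M)"
 using T_bound0[OF g] T_bound0[OF Ccinf_scale[OF U g, of "-1"]] T_scale[OF g, of "-1"] by (cases "0 <= T g") auto

end

subsection \<open>Extension of a vector distribution to integrable fields\<close>

context vdist
begin

abbreviation "cM \<equiv> completion M"

lemma space_cM [simp]: "space cM = U" by simp

lemma measurable_M_cont: "continuous_on U f==>f : bmeas M" for f :: "vec => real"
 using borel_measurable_continuous_on_restrict[of U f] by (simp add: measurable_cong_sets[OF sets_M refl])

lemma measurable_cM_cont: "continuous_on U f==>f : bmeas cM" for f :: "vec => real" by (rule measurable_completion[OF measurable_M_cont])

text \<open>Outer approximation by an open W comes from the definition of the total variation as an
  infimum, inner approximation of W by a compact \<open>C k\<close> from an exhaustion. A cutoff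
  between \<open>C k\<close> and W differs from the indicator only on W - \<open>C k\<close> and on
  the excess of W over the set.\<close>

lemma Csc_approx_indicator:
 assumes A: "A : sets cM" "emeas cM A < \<infinity>" and e: "e > 0"
 obtains xi where "xi : Csc n U" "(\<integral>\<^sup>+z. enn \<bar>xi z - ind A z\<bar> \<partial>M) < enn e"
proof -
 \<comment> \<open>A Borel set that agrees with the set A of the completed measure up to a null
   set.\<close>
 define A' where "A' = main_part M A"
 have A': "A' : sets M" "A' <= U" using A(1) sets.sets_into_space[of "main_part M A" M] by (auto simp: A'_def)
 have eA: "emeas M A' < \<infinity>" using A by (simp add: A'_def emeasure_completion)
 have AE1: "AE z in M. (ind A z :: real) = ind A' z"
  using AE_in_main_part[OF A(1)] by eventually_elim (auto simp: A'_def indicator_def)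
 have "tv A' < tv A'+enn (e/2)" 
  using eA e emeasure_M[OF A'(1)] by (cases "tv A'") (auto simp flip: ennreal_plus simp: ennreal_less_iff)
 then obtain W where W: "opn n W" "W <= U" "A' <= W" "lam W < tv A'+enn (e/2)" using tv_close by metis
 have Wm: "W : sets M" using W opn_borel by (simp add: in_sets_M)
 have eW: "emeas M W < emeas M A'+enn (e/2)" using W lam_M emeasure_M[OF A'(1)] by simp
 have fW: "emeas M W < \<infinity>" using eW eA by (metis ennreal_add_eq_top ennreal_neq_top infinity_ennreal_def less_top order_less_trans)
 have d1: "emeas M (W - A') < enn (e/2)"
  using e eW eA fW W(3) A' Wm emeasure_Diff[of M A' W]  by (cases "emeas M W"; cases "emeas M A'") (auto simp: ennreal_minus ennreal_less_iff simp flip: ennreal_plus intro!: ennreal_lessI)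
 obtain C where C: "!!k. compact (C k)" "incseq C" "(\<Union>k. C k) = W" using opn_exhaust[OF W(1)] by metis
 have Cm: "C k : sets M" for k using C W compact_imp_closed[OF C(1)[of k]] by (auto simp: in_sets_M)
 have "(%k. emeas M (C k)) \<longlonglongrightarrow> emeas M (\<Union>k. C k)" by (rule Lim_emeasure_incseq) (use Cm C in auto)
 hence lim: "(%k. emeas M (C k)) \<longlonglongrightarrow> emeas M W" using C by simp
 have "EX k. emeas M (W - C k) < enn (e/2)"
 \<comment> \<open>Subtraction of extended reals is truncated at 0, hence the separate case of small
   measure.\<close>
 proof (cases "emeas M W < enn (e/2)")
  case True
  have "emeas M (W - C 0) <= emeas M W" using Wm by (intro emeasure_mono) auto
  thus ?thesis using True order_le_less_trans by blast
 next
  case False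
  have "emeas M W - enn (e/2) < emeas M W"
   using False e fW by (cases "emeas M W") (auto simp: ennreal_minus ennreal_less_iff)
  hence "eventually (%k. emeas M W - enn (e/2) < emeas M (C k)) sequentially"
   using lim order_tendstoD(1) by blast
  then obtain k where k: "emeas M W - enn (e/2) < emeas M (C k)" by (auto simp: eventually_sequentially)
  have CW: "C k <= W" using C(3) by blast
  have "emeas M (W - C k) = emeas M W - emeas M (C k)"
   using fW CW Cm Wm emeasure_mono[OF CW Wm] by (intro emeasure_Diff) auto
  also have "... < enn (e/2)"
   using k fW emeasure_mono[OF CW Wm] False e by (cases "emeas M W"; cases "emeas M (C k)") (auto simp: ennreal_minus ennreal_less_iff)
  finally show ?thesis by blast
 qed
 then obtain k where k: "emeas M (W - C k) < enn (e/2)" by blast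
 have CW: "C k <= W" using C(3) by blast
 obtain xi H where xi: "xi : Csc n W" "!!x. 0 <= xi x" "!!x. xi x <= 1" "open H" "C k <= H"
  "!!x. x : H Int Rn n ==> xi x = 1" using cutoff[OF W(1) C(1) CW] by blast
 have xiW: "xi x = 0" if "x ~: W" for x
  using xi(1) that unfolding Csc_def by auto
 have "(\<integral>\<^sup>+z. enn \<bar>xi z - ind A z\<bar> \<partial>M) = (\<integral>\<^sup>+z. enn \<bar>xi z - ind A' z\<bar> \<partial>M)" by (rule nn_integral_cong_AE) (use AE1 in eventually_elim, simp)
 also have "... <= (\<integral>\<^sup>+z. ind (W - C k) z+ind (W - A') z \<partial>M)"
 proof (rule nn_integral_mono)
  fix z assume "z : space M"
  hence z: "z : Rn n" using U opn_mem by simp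
  have "z : C k ==> xi z = 1" using xi(5,6) z by blast
  hence "\<bar>xi z - ind A' z\<bar> <= ind (W - C k) z+ind (W - A') z"
   using xi(2,3)[of z] xiW[of z] W(3) CW by (cases "z : W"; cases "z : C k"; cases "z : A'") (auto simp: indicator_def)
  hence "enn \<bar>xi z - ind A' z\<bar> <= enn (ind (W - C k) z+ind (W - A') z)" by (rule ennreal_leI)
  thus "enn \<bar>xi z - ind A' z\<bar> <= ind (W - C k) z+ind (W - A') z" by (simp add: ennreal_plus ennreal_indicator)
 qed
 also have "... = emeas M (W - C k)+emeas M (W - A')"
  using Wm Cm A' by (subst nn_integral_add) auto
 also have "... < enn (e/2)+enn (e/2)" using k d1 by (rule add_strict_mono)
 also have "... = enn e" using e by (simp flip: ennreal_plus)
 finally have "(\<integral>\<^sup>+z. enn \<bar>xi z - ind A z\<bar> \<partial>M) < enn e" .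
 moreover have "xi : Csc n U" using xi(1) Csc_mono[OF W(1) U W(2)] by blast
 ultimately show ?thesis using that by blast
qed

lemma Csc_cont: "xi : Csc n U==>continuous_on U xi"
 unfolding Csc_def using smooth_continuous by blast

lemma Csc_meas: "xi : Csc n U ==> xi : bmeas cM" by (rule measurable_cM_cont[OF Csc_cont])

lemma Csc_add: "f : Csc n U==>g : Csc n U==>(%z. f z+g z) : Csc n U"
proof -
 assume "f : Csc n U" "g : Csc n U"
 then obtain C D where "compact C" "C <= U" "ALL z. z ~: C --> f z = 0" "smooth n U f"
   "compact D" "D <= U" "ALL z. z ~: D --> g z = 0" "smooth n U g" unfolding Csc_def by auto
 thus ?thesis using U by (intro CscI[of "C Un D"]) (auto intro: smooth_add)
qed

lemma Csc_cmult: "f : Csc n U==>(%z. c*f z) : Csc n U"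
proof -
 assume "f : Csc n U"
 then obtain C where "compact C" "C <= U" "ALL z. z ~: C --> f z = 0" "smooth n U f" unfolding Csc_def by auto
 thus ?thesis using U by (intro CscI[of C]) (auto intro: smooth_mult smooth_const)
qed

text \<open>Induction over integrable functions: multiples of indicators, sums, dominated
  limits.\<close>

lemma Csc_dense:
 fixes f :: "vec => real"
 assumes f: "integrable cM f" and e: "e > 0"
 shows "EX xi:Csc n U. (\<integral>\<^sup>+z. enn \<bar>xi z - f z\<bar> \<partial>cM) < enn e"
 using assms
proof (induction arbitrary: e rule: integrable_induct)
 case (base A c)
 obtain xi where xi: "xi : Csc n U" "(\<integral>\<^sup>+z. enn \<bar>xi z - ind A z\<bar> \<partial>M) < enn (e/(\<bar>c\<bar>+1))"
  using Csc_approx_indicator[of A "e/(\<bar>c\<bar>+1)"] base by (auto simp: less_top)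
 have "(\<integral>\<^sup>+z. enn \<bar>c*xi z - ind A z *\<^sub>R c\<bar> \<partial>cM) = (\<integral>\<^sup>+z. enn \<bar>c\<bar>*enn \<bar>xi z - ind A z\<bar> \<partial>cM)" by (intro nn_integral_cong) (simp flip: ennreal_mult abs_mult add: algebra_simps)
 also have "... = enn \<bar>c\<bar>*(\<integral>\<^sup>+z. enn \<bar>xi z - ind A z\<bar> \<partial>cM)"
 proof (rule nn_integral_cmult)
  have "(ind A :: vec => real) : bmeas cM" using base(1) by (rule borel_measurable_indicator)
  thus "(%z. enn \<bar>xi z - ind A z\<bar>) : bmeas cM" using Csc_meas[OF xi(1)] by measurable
 qed
 also have "... <= enn \<bar>c\<bar>*enn (e/(\<bar>c\<bar>+1))"
  using xi(2) by (intro mult_left_mono) (auto simp: nn_integral_completion)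
 also have "... < enn e" using base(3) by (auto simp flip: ennreal_mult simp: ennreal_less_iff field_simps)
 finally show ?case using Csc_cmult[OF xi(1), of c] by (intro bexI[of _ "%z. c*xi z"])
next
 case (add f g)
 from add.IH(1)[of "e/2"] obtain xi where xi: "xi : Csc n U" "(\<integral>\<^sup>+z. enn \<bar>xi z - f z\<bar> \<partial>cM) < enn (e/2)" using add.prems by auto
 from add.IH(2)[of "e/2"] obtain zeta where zeta: "zeta : Csc n U" "(\<integral>\<^sup>+z. enn \<bar>zeta z - g z\<bar> \<partial>cM) < enn (e/2)" using add.prems by auto
 have m: "f : bmeas cM" "g : bmeas cM" "xi : bmeas cM" "zeta : bmeas cM"
  using add.hyps Csc_meas xi(1) zeta(1) by auto
 have "(\<integral>\<^sup>+z. enn \<bar>(xi z+zeta z) - (f z+g z)\<bar> \<partial>cM) <= (\<integral>\<^sup>+z. enn \<bar>xi z - f z\<bar>+enn \<bar>zeta z - g z\<bar> \<partial>cM)" by (intro nn_integral_mono) (simp flip: ennreal_plus add: ennreal_leI)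
 also have "... = (\<integral>\<^sup>+z. enn \<bar>xi z - f z\<bar> \<partial>cM)+(\<integral>\<^sup>+z. enn \<bar>zeta z - g z\<bar> \<partial>cM)"
 proof (rule nn_integral_add)
  show "(%z. enn \<bar>xi z - f z\<bar>) : bmeas cM" using m(1,3) by measurable
  show "(%z. enn \<bar>zeta z - g z\<bar>) : bmeas cM" using m(2,4) by measurable
 qed
 also have "... < enn (e/2)+enn (e/2)" using xi(2) zeta(2) by (rule add_strict_mono)
 also have "... = enn e" using add.prems by (simp flip: ennreal_plus)
 finally show ?case using Csc_add[OF xi(1) zeta(1)] by (intro bexI[of _ "%z. xi z+zeta z"])
next
 case (lim f s)
 have "(%i. \<integral>\<^sup>+z. enn (norm (f z - s i z)) \<partial>cM) \<longlonglongrightarrow> 0"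
 proof (rule nn_integral_dominated_convergence_norm[where w = "%z. 2*norm (f z)"])
  show "(\<integral>\<^sup>+z. enn (2*norm (f z)) \<partial>cM) < \<infinity>"
  proof -
   have "integrable cM (%z. 2*norm (f z))" using lim.hyps(4) by simp
   thus ?thesis unfolding integrable_iff_bounded by simp
  qed
 qed (use lim.hyps in auto)
 hence "eventually (%i. (\<integral>\<^sup>+z. enn (norm (f z - s i z)) \<partial>cM) < enn (e/2)) sequentially"
  using order_tendstoD(2)[of _ "0::ennreal" sequentially "enn (e/2)"] lim.prems by simp
 then obtain i where i: "(\<integral>\<^sup>+z. enn (norm (f z - s i z)) \<partial>cM) < enn (e/2)" by (auto simp: eventually_sequentially)
 from lim.IH[of "e/2" i] obtain xi where xi: "xi : Csc n U" "(\<integral>\<^sup>+z. enn \<bar>xi z - s i z\<bar> \<partial>cM) < enn (e/2)" using lim.prems by auto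
 have m: "f : bmeas cM" "s i : bmeas cM" "xi : bmeas cM"
  using lim.hyps Csc_meas xi(1) by auto
 have "(\<integral>\<^sup>+z. enn \<bar>xi z - f z\<bar> \<partial>cM) <= (\<integral>\<^sup>+z. enn \<bar>xi z - s i z\<bar>+enn (norm (f z - s i z)) \<partial>cM)" by (intro nn_integral_mono) (simp flip: ennreal_plus add: ennreal_leI)
 also have "... = (\<integral>\<^sup>+z. enn \<bar>xi z - s i z\<bar> \<partial>cM)+(\<integral>\<^sup>+z. enn (norm (f z - s i z)) \<partial>cM)"
 proof (rule nn_integral_add)
  show "(%z. enn \<bar>xi z - s i z\<bar>) : bmeas cM" using m(2,3) by measurable
  show "(%z. enn (norm (f z - s i z))) : bmeas cM" using m(1,2) by measurable
 qed
 also have "... < enn (e/2)+enn (e/2)" using xi(2) i by (rule add_strict_mono)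
 also have "... = enn e" using lim.prems by (simp flip: ennreal_plus)
 finally show ?case using xi(1) by blast
qed

definition L1v :: "(vec => vec) => bool" where
 "L1v g \<longleftrightarrow> (ALL z:U. g z : Rn n) & (ALL i<n. integrable cM (%z. lk (g z) i))"

lemma L1v_add: "L1v g==>L1v h==>L1v (%z. g z+h z)" by (auto simp: L1v_def)
lemma L1v_diff: "L1v g==>L1v h==>L1v (%z. g z - h z)" by (auto simp: L1v_def)
lemma L1v_scale: "L1v g==>L1v (%z. c *\<^sub>R g z)" by (auto simp: L1v_def)

lemma L1v_norm: "L1v g==>(%z. norm (g z)) : bmeas cM"
proof -
 assume g: "L1v g"
 have "(%z. (\<Sum>i<n. (lk (g z) i)^2)) : bmeas cM"
 proof (intro borel_measurable_sum borel_measurable_power)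
  fix i assume "i : {..<n}"
  hence "integrable cM (%z. lk (g z) i)" using g by (simp add: L1v_def)
  thus "(%z. lk (g z) i) : bmeas cM" by (rule borel_measurable_integrable)
 qed
 hence "(%z. sqrt (\<Sum>i<n. (lk (g z) i)^2)) : bmeas cM" by measurable
 thus ?thesis by (rule subst[OF measurable_cong, rotated]) (use g in "auto simp: L1v_def norm_Rn")
qed

lemma L1v_fin: "L1v g==>(\<integral>\<^sup>+z. enn (norm (g z)) \<partial>cM) < \<infinity>"
proof -
 assume g: "L1v g"
 have "(\<integral>\<^sup>+z. enn (norm (g z)) \<partial>cM) <= (\<integral>\<^sup>+z. (\<Sum>i<n. enn \<bar>lk (g z) i\<bar>) \<partial>cM)"
  using g by (intro nn_integral_mono) (auto simp: L1v_def sum_ennreal intro!: ennreal_leI norm_Rn_le)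
 also have "... = (\<Sum>i<n. \<integral>\<^sup>+z. enn \<bar>lk (g z) i\<bar> \<partial>cM)"
 proof (rule nn_integral_sum)
  fix i assume "i : {..<n}"
  hence "integrable cM (%z. lk (g z) i)" using g by (simp add: L1v_def)
  hence "(%z. lk (g z) i) : bmeas cM" by (rule borel_measurable_integrable)
  thus "(%z. enn \<bar>lk (g z) i\<bar>) : bmeas cM" by measurable
 qed
 also have "... < \<infinity>"
  using g unfolding infinity_ennreal_def ennreal_sum_less_top[OF finite_lessThan] by (auto simp: L1v_def integrable_iff_bounded)
 finally show ?thesis .
qed

lemma Ccinf_bounded: assumes "g : Ccinf n U l" obtains B where "0 <= B" "!!z. norm (g z) <= B"
proof -
 obtain C where C: "compact C" "C <= U" "!!z. z ~: C==>g z = 0" "smooth n U g" "!!z. g z : Rn l"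
  using CcinfE[OF assms] by blast
 have "bounded (g ` C)"
  using C smooth_continuous[OF C(4)] by (intro compact_imp_bounded compact_continuous_image) (auto intro: continuous_on_subset)
 then obtain B where B: "ALL x:g ` C. norm x <= B" using bounded_iff by blast
 have "norm (g z) <= \<bar>B\<bar>" for z using B C(3)[of z] by (cases "z : C") force+
 thus ?thesis using that[of "\<bar>B\<bar>"] by simp
qed

lemma L1v_boundedI:
 assumes "compact C" "C <= U" "!!z. z : U==>z ~: C==>g z = 0" "!!z. z : U==>norm (g z) <= B"
  "!!z. z : U==>g z : Rn n" "!!i. i < n==>(%z. lk (g z) i) : bmeas cM"
 shows "L1v g"
 unfolding L1v_def
proof (intro conjI ballI allI impI)
 fix i assume i: "i < n"
 have Cm: "C : sets M" using assms(2) borel_closed[OF compact_imp_closed[OF assms(1)]] by (simp add: in_sets_M)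
 have "integrable cM (%z. ind C z*\<bar>B\<bar> :: real)"
  using Cm M_compact[OF assms(1,2)] by (intro integrable_mult_left integrable_real_indicator) auto
 thus "integrable cM (%z. lk (g z) i)"
 proof (rule Bochner_Integration.integrable_bound)
  show "AE z in cM. norm (lk (g z) i) <= norm (ind C z*\<bar>B\<bar> :: real)"
  proof (rule AE_I2)
   fix z assume "z : space cM"
   hence z: "z : U" by simp
   have "\<bar>lk (g z) i\<bar> <= norm (g z)" by (rule abs_lk_le_norm)
   thus "norm (lk (g z) i) <= norm (ind C z*\<bar>B\<bar> :: real)"
    using assms(3,4)[OF z] by (cases "z : C") auto
  qed
 qed (use assms i in auto)
qed (use assms in auto)

lemma L1v_Ccinf: assumes "g : Ccinf n U n" shows "L1v g"
proof -
 obtain C where C: "compact C" "C <= U" "!!z. z ~: C==>g z = 0" "smooth n U g" "!!z. g z : Rn n"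
  using CcinfE[OF assms] by blast
 obtain B where "0 <= B" "!!z. norm (g z) <= B" using Ccinf_bounded[OF assms] by blast
 thus ?thesis using C smooth_continuous[OF C(4)] by (intro L1v_boundedI[of C g B] measurable_cM_cont continuous_lk) auto
qed

lemma L1v_dense:
 assumes g: "L1v g" and e: "e > 0"
 shows "EX h:Ccinf n U n. (\<integral>\<^sup>+z. enn (norm (h z - g z)) \<partial>cM) < enn e"
\<comment> \<open>For n = 0 the error cannot be distributed over the coordinates, but all fields
  vanish.\<close>
proof (cases "n = 0")
 case True
 have R0: "Rn 0 = {0}" by (auto simp: Rn_iff intro!: vec_eqI)
 have "(\<integral>\<^sup>+z. enn (norm (0 - g z)) \<partial>cM) = (\<integral>\<^sup>+z. 0 \<partial>cM)"
 proof (rule nn_integral_cong)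
  fix z assume "z : space cM"
  hence "z : U" by simp
  hence "g z : Rn n" using g by (simp add: L1v_def)
  hence "g z = 0" using R0 True by auto
  thus "enn (norm (0 - g z)) = 0" by simp
 qed
 thus ?thesis using e Ccinf_zero[OF U, of n] by (intro bexI[of _ "%z. 0"]) auto
next
 case False
 have "EX xi:Csc n U. (\<integral>\<^sup>+z. enn \<bar>xi z - lk (g z) i\<bar> \<partial>cM) < enn (e/(2*n))" if "i < n" for i
  using g that e by (intro Csc_dense) (auto simp: L1v_def)
 hence "ALL i. EX xi. i < n --> xi : Csc n U & (\<integral>\<^sup>+z. enn \<bar>xi z - lk (g z) i\<bar> \<partial>cM) < enn (e/(2*n))" by blast
 from choice[OF this] obtain x where x: "!!i. i < n==>x i : Csc n U" 
  "!!i. i < n==>(\<integral>\<^sup>+z. enn \<bar>x i z - lk (g z) i\<bar> \<partial>cM) < enn (e/(2*n))" by blast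
 define h where "h z = (\<Sum>i<n. x i z *\<^sub>R uv i)" for z
 have h: "h : Ccinf n U n" unfolding h_def
 proof (rule Ccinf_sum[OF U])
  fix i assume "i : {..<n}"
  thus "(%z. x i z *\<^sub>R uv i) : Ccinf n U n" by (intro Ccinf_Csc U x smooth_const) auto
 qed
 have lh: "lk (h z) i = x i z" if "i < n" for i z
 proof -
  have "lk (h z) i = (\<Sum>j<n. if j = i then x i z else 0)" unfolding h_def lk_sum by (intro sum.cong) auto
  thus ?thesis using that by simp
 qed
 have "(\<integral>\<^sup>+z. enn (norm (h z - g z)) \<partial>cM) <= (\<integral>\<^sup>+z. (\<Sum>i<n. enn \<bar>x i z - lk (g z) i\<bar>) \<partial>cM)"
 proof (rule nn_integral_mono)
  fix z assume "z : space cM"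
  hence "z : U" by simp
  hence "g z : Rn n" using g by (simp add: L1v_def)
  moreover have "h z : Rn n" unfolding h_def by (intro Rn_sum Rn_scaleR) auto
  ultimately have "h z - g z : Rn n" by (intro Rn_diff)
  from norm_Rn_le[OF this] show "enn (norm (h z - g z)) <= (\<Sum>i<n. enn \<bar>x i z - lk (g z) i\<bar>)" by (auto simp: sum_ennreal lh intro!: ennreal_leI)
 qed
 also have "... = (\<Sum>i<n. \<integral>\<^sup>+z. enn \<bar>x i z - lk (g z) i\<bar> \<partial>cM)"
 proof (rule nn_integral_sum)
  fix i assume "i : {..<n}"
  hence "x i : bmeas cM" "(%z. lk (g z) i) : bmeas cM"
   using g x(1) Csc_meas by (auto simp: L1v_def)
  thus "(%z. enn \<bar>x i z - lk (g z) i\<bar>) : bmeas cM" by measurable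
 qed
 also have "... <= (\<Sum>i<n. enn (e/(2*n)))" using x(2) by (intro sum_mono) (simp add: less_imp_le)
 also have "... = enn (e/2)" using e False by (subst sum_ennreal) auto
 also have "... < enn e" using e by (intro ennreal_lessI) auto
 finally show ?thesis using h by blast
qed

definition approx :: "(nat => vec => vec) => (vec => vec) => bool" where
 "approx gs g \<longleftrightarrow> (ALL k. gs k : Ccinf n U n) & (%k. \<integral>\<^sup>+z. enn (norm (gs k z - g z)) \<partial>cM) \<longlonglongrightarrow> 0"

lemma T_diff_bound:
 assumes "h : Ccinf n U n" "h' : Ccinf n U n" "L1v g"
 shows "enn \<bar>T h - T h'\<bar> <= 9*((\<integral>\<^sup>+z. enn (norm (h z - g z)) \<partial>cM)+(\<integral>\<^sup>+z. enn (norm (h' z - g z)) \<partial>cM))"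
proof -
 have "T (%z. h z - h' z) = T h - T h'"
  using T_add[OF assms(1) Ccinf_scale[OF U assms(2), of "-1"]] T_scale[OF assms(2), of "-1"] by simp
 hence "enn \<bar>T h - T h'\<bar> <= 9*(\<integral>\<^sup>+z. enn (norm (h z - h' z)) \<partial>cM)"
  using T_bound[OF Ccinf_diff[OF U assms(1,2)]] by (simp add: nn_integral_completion)
 also have "... <= 9*(\<integral>\<^sup>+z. enn (norm (h z - g z))+enn (norm (h' z - g z)) \<partial>cM)"
 proof (intro mult_left_mono nn_integral_mono)
  fix z
  have "norm (h z - h' z) <= norm (h z - g z)+norm (h' z - g z)"
   using norm_triangle_ineq4[of "h z - g z" "h' z - g z"] by simp
  thus "enn (norm (h z - h' z)) <= enn (norm (h z - g z))+enn (norm (h' z - g z))" by (simp flip: ennreal_plus add: ennreal_leI)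
 qed simp
 also have "(\<integral>\<^sup>+z. enn (norm (h z - g z))+enn (norm (h' z - g z)) \<partial>cM) =
  (\<integral>\<^sup>+z. enn (norm (h z - g z)) \<partial>cM)+(\<integral>\<^sup>+z. enn (norm (h' z - g z)) \<partial>cM)"
  using assms L1v_Ccinf L1v_diff L1v_norm by (intro nn_integral_add) (auto intro!: measurable_compose[OF L1v_norm])
 finally show ?thesis .
qed

lemma approx_same:
 assumes "L1v g" "approx gs g" "approx hs g" "(%k. T (gs k)) \<longlonglongrightarrow> c" shows "(%k. T (hs k)) \<longlonglongrightarrow> c"
proof -
 have "(%k. enn \<bar>T (gs k) - T (hs k)\<bar>) \<longlonglongrightarrow> 0"
 proof (rule tendsto_sandwich[OF always_eventually always_eventually tendsto_const])
  show "ALL k. enn \<bar>T (gs k) - T (hs k)\<bar> <= 9*((\<integral>\<^sup>+z. enn (norm (gs k z - g z)) \<partial>cM)+(\<integral>\<^sup>+z. enn (norm (hs k z - g z)) \<partial>cM))"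
   using assms by (intro allI T_diff_bound) (auto simp: approx_def)
  have "(%k. 9*((\<integral>\<^sup>+z. enn (norm (gs k z - g z)) \<partial>cM)+(\<integral>\<^sup>+z. enn (norm (hs k z - g z)) \<partial>cM))) \<longlonglongrightarrow> 9*(0+0)"
   using assms by (intro ennreal_tendsto_cmult tendsto_add) (auto simp: approx_def)
  thus "(%k. 9*((\<integral>\<^sup>+z. enn (norm (gs k z - g z)) \<partial>cM)+(\<integral>\<^sup>+z. enn (norm (hs k z - g z)) \<partial>cM))) \<longlonglongrightarrow> 0" by simp
 qed auto
 hence "(%k. \<bar>T (gs k) - T (hs k)\<bar>) \<longlonglongrightarrow> 0" using tendsto_ennreal_iff[of "%k. \<bar>T (gs k) - T (hs k)\<bar>" sequentially 0] by simp
 hence "(%k. T (gs k) - T (hs k)) \<longlonglongrightarrow> 0" by (simp add: tendsto_rabs_zero_iff)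
 from tendsto_diff[OF assms(4) this] show ?thesis by simp
qed

lemma approx_conv:
 assumes "L1v g" "approx gs g" shows "convergent (%k. T (gs k))"
proof (intro real_Cauchy_convergent metric_CauchyI)
 fix e :: real assume e: "0 < e"
 \<comment> \<open>The fraction 1/18 compensates the constant 9 and the two terms of
   \<open>T_diff_bound\<close>.\<close>
 have "eventually (%k. (\<integral>\<^sup>+z. enn (norm (gs k z - g z)) \<partial>cM) < enn (e/18)) sequentially"
  using assms(2) e unfolding approx_def by (intro order_tendstoD(2)[of _ 0]) auto
 then obtain N where N: "!!k. k >= N==>(\<integral>\<^sup>+z. enn (norm (gs k z - g z)) \<partial>cM) < enn (e/18)" by (auto simp: eventually_sequentially)
 have "dist (T (gs k)) (T (gs l)) < e" if "k >= N" "l >= N" for k l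
 proof -
  have "enn \<bar>T (gs k) - T (gs l)\<bar> <= 9*((\<integral>\<^sup>+z. enn (norm (gs k z - g z)) \<partial>cM)+(\<integral>\<^sup>+z. enn (norm (gs l z - g z)) \<partial>cM))"
   using assms by (intro T_diff_bound) (auto simp: approx_def)
  also have "... < 9*(enn (e/18)+enn (e/18))"
   using add_strict_mono[OF N[OF that(1)] N[OF that(2)]] by (intro ennreal_mult_strict_left_mono) auto
  also have "... = enn e" using e by (simp flip: ennreal_plus ennreal_mult' ennreal_numeral)
  finally show ?thesis using e by (simp add: ennreal_less_iff dist_real_def)
 qed
 thus "EX M. ALL m>=M. ALL n>=M. dist (T (gs m)) (T (gs n)) < e" by blast
qed

lemma approx_ex: assumes "L1v g" shows "EX gs. approx gs g"
proof -
 have "EX h:Ccinf n U n. (\<integral>\<^sup>+z. enn (norm (h z - g z)) \<partial>cM) < enn (1/real (Suc k))" for k by (rule L1v_dense[OF assms]) simp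
 then obtain gs where gs: "!!k. gs k : Ccinf n U n" "!!k. (\<integral>\<^sup>+z. enn (norm (gs k z - g z)) \<partial>cM) < enn (1/real (Suc k))" by metis
 have "(%k. enn (1/real (Suc k))) \<longlonglongrightarrow> enn 0" by (intro tendsto_ennrealI LIMSEQ_Suc lim_1_over_n)
 hence "(%k. \<integral>\<^sup>+z. enn (norm (gs k z - g z)) \<partial>cM) \<longlonglongrightarrow> 0"
  using tendsto_sandwich[of "%k. 0" "%k. \<integral>\<^sup>+z. enn (norm (gs k z - g z)) \<partial>cM" sequentially "%k. enn (1/real (Suc k))" 0]
   gs(2)[THEN less_imp_le] by simp
 thus ?thesis using gs(1) unfolding approx_def by blast
qed

text \<open>Makes the definite description in \<open>ext\<close> meaningful: two approximating
  sequences of the same field lead to the same limit, because \<open>T_bound\<close> estimates the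
  difference of their values. Existence of a sequence and of its limit are \<open>approx_ex\<close>
  and \<open>approx_conv\<close>.\<close>

lemma ext_eqI: assumes "L1v g" "approx gs g" "(%k. T (gs k)) \<longlonglongrightarrow> c" shows "Defs.ext n U T g = c"
 unfolding Defs.ext_def
proof (rule the_equality)
 show "EX gs. (ALL k. gs k : Ccinf n U n) & (%k. \<integral>\<^sup>+z. enn (norm (gs k z - g z)) \<partial>cM) \<longlonglongrightarrow> 0 & (%k. T (gs k)) \<longlonglongrightarrow> c"
  using assms unfolding approx_def by blast
 fix d assume "EX gs. (ALL k. gs k : Ccinf n U n) & (%k. \<integral>\<^sup>+z. enn (norm (gs k z - g z)) \<partial>cM) \<longlonglongrightarrow> 0 & (%k. T (gs k)) \<longlonglongrightarrow> d"
 then obtain hs where "approx hs g" "(%k. T (hs k)) \<longlonglongrightarrow> d" unfolding approx_def by blast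
 thus "d = c" using approx_same[OF assms(1) _ assms(2)] assms(3) LIMSEQ_unique by blast
qed

lemma ext_lim: assumes "L1v g" "approx gs g" shows "(%k. T (gs k)) \<longlonglongrightarrow> Defs.ext n U T g"
 using approx_conv[OF assms] ext_eqI[OF assms] by (auto simp: convergent_def)

lemma ext_Ccinf: "g : Ccinf n U n==>Defs.ext n U T g = T g" by (rule ext_eqI[of _ "%k. g"]) (auto simp: L1v_Ccinf approx_def)

text \<open>Used to change a field outside the support of the distribution, so that a field that is
  not a test field on U can be replaced by one.\<close>

lemma ext_cong: assumes "AE z in M. g z = h z" shows "Defs.ext n U T g = Defs.ext n U T h"
proof -
 have "(\<integral>\<^sup>+z. enn (norm (f z - g z)) \<partial>cM) = (\<integral>\<^sup>+z. enn (norm (f z - h z)) \<partial>cM)" for f by (rule nn_integral_cong_AE) (use AE_completion[OF assms] in eventually_elim, simp)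
 thus ?thesis unfolding Defs.ext_def by simp
qed

lemma nn_L1v_add: "L1v g==>L1v h==>(\<integral>\<^sup>+z. enn (norm (g z+h z)) \<partial>cM) <= (\<integral>\<^sup>+z. enn (norm (g z)) \<partial>cM)+(\<integral>\<^sup>+z. enn (norm (h z)) \<partial>cM)"
proof -
 assume *: "L1v g" "L1v h"
 have "(\<integral>\<^sup>+z. enn (norm (g z+h z)) \<partial>cM) <= (\<integral>\<^sup>+z. enn (norm (g z))+enn (norm (h z)) \<partial>cM)" by (intro nn_integral_mono) (simp flip: ennreal_plus add: ennreal_leI norm_triangle_ineq)
 also have "... = (\<integral>\<^sup>+z. enn (norm (g z)) \<partial>cM)+(\<integral>\<^sup>+z. enn (norm (h z)) \<partial>cM)"
  using*by (intro nn_integral_add) (auto intro!: measurable_compose[OF L1v_norm])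
 finally show ?thesis .
qed

lemma ext_add: assumes "L1v g" "L1v h" shows "Defs.ext n U T (%z. g z+h z) = Defs.ext n U T g+Defs.ext n U T h"
proof -
 obtain gs hs where gs: "approx gs g" and hs: "approx hs h" using approx_ex assms by metis
 have "approx (%k z. gs k z+hs k z) (%z. g z+h z)"
  unfolding approx_def
 proof (intro conjI allI)
  show "(%z. gs k z+hs k z) : Ccinf n U n" for k using gs hs by (intro Ccinf_add U) (auto simp: approx_def)
  show "(%k. \<integral>\<^sup>+z. enn (norm (gs k z+hs k z - (g z+h z))) \<partial>cM) \<longlonglongrightarrow> 0"
  proof (rule tendsto_sandwich[OF always_eventually always_eventually tendsto_const])
   show "ALL k. (\<integral>\<^sup>+z. enn (norm (gs k z+hs k z - (g z+h z))) \<partial>cM) <= (\<integral>\<^sup>+z. enn (norm (gs k z - g z)) \<partial>cM)+(\<integral>\<^sup>+z. enn (norm (hs k z - h z)) \<partial>cM)"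
   proof
    fix k
    have "L1v (%z. gs k z - g z)" "L1v (%z. hs k z - h z)" using gs hs assms L1v_diff[OF L1v_Ccinf] by (auto simp: approx_def)
    from nn_L1v_add[OF this] show "(\<integral>\<^sup>+z. enn (norm (gs k z+hs k z - (g z+h z))) \<partial>cM) <= (\<integral>\<^sup>+z. enn (norm (gs k z - g z)) \<partial>cM)+(\<integral>\<^sup>+z. enn (norm (hs k z - h z)) \<partial>cM)" by (simp add: algebra_simps)
   qed
   show "(%k. (\<integral>\<^sup>+z. enn (norm (gs k z - g z)) \<partial>cM)+(\<integral>\<^sup>+z. enn (norm (hs k z - h z)) \<partial>cM)) \<longlonglongrightarrow> 0"
    using tendsto_add[of _ "0::ennreal" sequentially _ 0] gs hs by (auto simp: approx_def)
  qed auto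
 qed
 moreover have "(%k. T (%z. gs k z+hs k z)) \<longlonglongrightarrow> Defs.ext n U T g+Defs.ext n U T h"
 proof -
  have "T (%z. gs k z+hs k z) = T (gs k)+T (hs k)" for k using gs hs by (intro T_add) (auto simp: approx_def)
  thus ?thesis using tendsto_add[OF ext_lim[OF assms(1) gs] ext_lim[OF assms(2) hs]] by simp
 qed
 ultimately show ?thesis by (intro ext_eqI L1v_add assms)
qed

lemma ext_scale: assumes "L1v g" shows "Defs.ext n U T (%z. c *\<^sub>R g z) = c*Defs.ext n U T g"
proof -
 obtain gs where gs: "approx gs g" using approx_ex assms by metis
 have "approx (%k z. c *\<^sub>R gs k z) (%z. c *\<^sub>R g z)"
  unfolding approx_def
 proof (intro conjI allI)
  show "(%z. c *\<^sub>R gs k z) : Ccinf n U n" for k using gs by (intro Ccinf_scale U) (auto simp: approx_def)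
  have "(\<integral>\<^sup>+z. enn (norm (c *\<^sub>R gs k z - c *\<^sub>R g z)) \<partial>cM) = enn \<bar>c\<bar>*(\<integral>\<^sup>+z. enn (norm (gs k z - g z)) \<partial>cM)" for k
  proof -
   have m: "(%z. norm (gs k z - g z)) : bmeas cM"
    using gs assms L1v_norm[OF L1v_diff[OF L1v_Ccinf]] by (auto simp: approx_def)
   have "(\<integral>\<^sup>+z. enn (norm (c *\<^sub>R gs k z - c *\<^sub>R g z)) \<partial>cM) = (\<integral>\<^sup>+z. enn \<bar>c\<bar>*enn (norm (gs k z - g z)) \<partial>cM)" by (intro nn_integral_cong) (simp flip: scaleR_diff_right ennreal_mult)
   thus ?thesis using m by (simp add: nn_integral_cmult)
  qed
  moreover have "(%k. enn \<bar>c\<bar>*(\<integral>\<^sup>+z. enn (norm (gs k z - g z)) \<partial>cM)) \<longlonglongrightarrow> enn \<bar>c\<bar>*0"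
   using gs by (intro ennreal_tendsto_cmult) (auto simp: approx_def)
  ultimately show "(%k. \<integral>\<^sup>+z. enn (norm (c *\<^sub>R gs k z - c *\<^sub>R g z)) \<partial>cM) \<longlonglongrightarrow> 0" by simp
 qed
 moreover have "(%k. T (%z. c *\<^sub>R gs k z)) \<longlonglongrightarrow> c*Defs.ext n U T g"
 proof -
  have "T (%z. c *\<^sub>R gs k z) = c*T (gs k)" for k using gs by (intro T_scale) (auto simp: approx_def)
  thus ?thesis using tendsto_mult[OF tendsto_const ext_lim[OF assms gs]] by simp
 qed
 ultimately show ?thesis by (intro ext_eqI L1v_scale assms)
qed

lemma ext_diff: assumes "L1v g" "L1v h" shows "Defs.ext n U T (%z. g z - h z) = Defs.ext n U T g - Defs.ext n U T h"
 using ext_add[OF assms(1) L1v_scale[OF assms(2), of "-1"]] ext_scale[OF assms(2), of "-1"] by simp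

lemma ext_bound: assumes "L1v g" shows "enn \<bar>Defs.ext n U T g\<bar> <= 9*(\<integral>\<^sup>+z. enn (norm (g z)) \<partial>cM)"
proof -
 obtain gs where gs: "approx gs g" using approx_ex assms by metis
 have 1: "(%k. enn \<bar>T (gs k)\<bar>) \<longlonglongrightarrow> enn \<bar>Defs.ext n U T g\<bar>" by (intro tendsto_ennrealI tendsto_rabs ext_lim assms gs)
 have "(%k. 9*((\<integral>\<^sup>+z. enn (norm (gs k z - g z)) \<partial>cM)+(\<integral>\<^sup>+z. enn (norm (g z)) \<partial>cM))) \<longlonglongrightarrow> 9*(0+(\<integral>\<^sup>+z. enn (norm (g z)) \<partial>cM))"
  using gs by (intro ennreal_tendsto_cmult tendsto_add tendsto_const) (auto simp: approx_def)
 hence 2: "(%k. 9*((\<integral>\<^sup>+z. enn (norm (gs k z - g z)) \<partial>cM)+(\<integral>\<^sup>+z. enn (norm (g z)) \<partial>cM))) \<longlonglongrightarrow> 9*(\<integral>\<^sup>+z. enn (norm (g z)) \<partial>cM)" by simp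
 show ?thesis
 proof (rule tendsto_le[OF _ 2 1])
  have "enn \<bar>T (gs k)\<bar> <= 9*((\<integral>\<^sup>+z. enn (norm (gs k z - g z)) \<partial>cM)+(\<integral>\<^sup>+z. enn (norm (g z)) \<partial>cM))" for k
  proof -
   have g: "gs k : Ccinf n U n" using gs by (auto simp: approx_def)
   have "enn \<bar>T (gs k)\<bar> <= 9*(\<integral>\<^sup>+z. enn (norm ((gs k z - g z)+g z)) \<partial>cM)"
    using T_bound[OF g] by (simp add: nn_integral_completion)
   also have "... <= 9*((\<integral>\<^sup>+z. enn (norm (gs k z - g z)) \<partial>cM)+(\<integral>\<^sup>+z. enn (norm (g z)) \<partial>cM))" by (intro mult_left_mono nn_L1v_add L1v_diff L1v_Ccinf g assms) simp
   finally show ?thesis .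
  qed
  thus "eventually (%k. enn \<bar>T (gs k)\<bar> <= 9*((\<integral>\<^sup>+z. enn (norm (gs k z - g z)) \<partial>cM)+(\<integral>\<^sup>+z. enn (norm (g z)) \<partial>cM))) sequentially" by simp
 qed simp
qed

text \<open>Dominated convergence, by applying \<open>ext_bound\<close> to the differences. In the
  applications the fields are products of one test field with uniformly bounded functions, and the
  length of that test field yields the majorant.\<close>

lemma ext_dominated:
 assumes "!!k. L1v (gs k)" "L1v g" "integrable cM w" "!!k z. z : U==>norm (gs k z - g z) <= w z"
  "!!z. z : U==>(%k. gs k z) \<longlonglongrightarrow> g z"
 shows "(%k. Defs.ext n U T (gs k)) \<longlonglongrightarrow> Defs.ext n U T g"
proof -
 have m: "(%z. norm (gs k z - g z)) : bmeas cM" for k using L1v_norm[OF L1v_diff[OF assms(1,2)]] .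
 have "(%k. \<integral>\<^sup>+z. enn (norm (gs k z - g z)) \<partial>cM) \<longlonglongrightarrow> (\<integral>\<^sup>+z. 0 \<partial>cM)"
 proof (rule nn_integral_dominated_convergence[where w = "%z. enn (w z)"])
  show "(\<integral>\<^sup>+z. enn (w z) \<partial>cM) < \<infinity>"
  proof -
   have "(\<integral>\<^sup>+z. enn (w z) \<partial>cM) <= (\<integral>\<^sup>+z. enn (norm (w z)) \<partial>cM)" by (intro nn_integral_mono ennreal_leI) auto
   thus ?thesis using assms(3) unfolding integrable_iff_bounded using order_le_less_trans by blast
  qed
  show "AE z in cM. (%k. enn (norm (gs k z - g z))) \<longlonglongrightarrow> 0"
  proof (rule AE_I2)
   fix z assume "z : space cM"
   hence "(%k. norm (gs k z - g z)) \<longlonglongrightarrow> 0" using assms(5)[of z] by (simp add: tendsto_norm_zero_iff LIM_zero_iff)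
   thus "(%k. enn (norm (gs k z - g z))) \<longlonglongrightarrow> 0" using tendsto_ennrealI by fastforce
  qed
 qed (use m assms in "auto intro!: AE_I2 ennreal_leI")
 hence l: "(%k. 9*(\<integral>\<^sup>+z. enn (norm (gs k z - g z)) \<partial>cM)) \<longlonglongrightarrow> 9*0" by (intro ennreal_tendsto_cmult) auto
 have "(%k. enn \<bar>Defs.ext n U T (gs k) - Defs.ext n U T g\<bar>) \<longlonglongrightarrow> 0"
 proof (rule tendsto_sandwich[OF always_eventually always_eventually tendsto_const])
  show "ALL k. enn \<bar>Defs.ext n U T (gs k) - Defs.ext n U T g\<bar> <= 9*(\<integral>\<^sup>+z. enn (norm (gs k z - g z)) \<partial>cM)"
   using ext_bound[OF L1v_diff[OF assms(1,2)]] ext_diff[OF assms(1,2)] by simp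
 qed (use l in auto)
 hence "(%k. \<bar>Defs.ext n U T (gs k) - Defs.ext n U T g\<bar>) \<longlonglongrightarrow> 0"
  using tendsto_ennreal_iff[of "%k. \<bar>Defs.ext n U T (gs k) - Defs.ext n U T g\<bar>" sequentially 0] by simp
 thus ?thesis by (simp add: tendsto_rabs_zero_iff LIM_zero_iff)
qed

lemma M_null: assumes "opn n W" "W <= U" "!!g. g : Ccinf n W n==>T g = 0" shows "emeas M W = 0"
proof -
 have "lam W <= 0" by (rule lam_least) (simp add: assms(3))
 thus ?thesis using lam_M[OF assms(1,2)] by simp
qed

end

subsection \<open>Varifolds and their weight\<close>

abbreviation Rb :: "vec set => vec measure" where "Rb U \<equiv> restrict_space borel U"

text \<open>Entries of the projection matrix, that is, the functions that define the topology of the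
  Grassmannian; this makes them measurable for V.\<close>

definition pj :: "nat => nat => vec set => real" where
 "pj j i S = lk (orth_proj S (uv i)) j"

lemma abs_pj_le: assumes "S : Grass n m" shows "\<bar>pj j i S\<bar> <= 1"
proof -
 have "\<bar>pj j i S\<bar> <= norm (orth_proj S (uv i))" unfolding pj_def by (rule abs_lk_le_norm)
 also have "... <= norm (uv i)" by (rule orth_proj_props(5)[OF assms])
 finally show ?thesis by simp
qed

lemma hs_inner_pj:
 assumes "S : Grass n m"
 shows "hs_inner n L (orth_proj S) = (\<Sum>i<n. \<Sum>j<n. lk (L (uv i)) j*pj j i S)"
 unfolding hs_inner_def pj_def by (intro sum.cong refl inner_Rn2 orth_proj_props(2)[OF assms])

lemma hs_inner_commute: "hs_inner n a b = hs_inner n b a" by (simp add: hs_inner_def inner_commute)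

locale vfold =
 fixes n m :: nat and U :: "vec set" and V :: "(vec \<times> vec set) measure"
 assumes U: "opn n U" and vf: "varifold n m U V"
begin

abbreviation "X \<equiv> prod_topology (top_of_set U) (Grass_top n m)"
abbreviation "mu \<equiv> weight U V"
abbreviation "cV \<equiv> completion V"
abbreviation "cmu \<equiv> completion (weight U V)"

lemma space_V: "space V = U \<times> Grass n m" and sets_V: "sets V = sigma_sets (U \<times> Grass n m) {W. openin X W}"
 and fin_V: "compactin X C==>emeas V C < \<infinity>"
 using vf unfolding varifold_def Let_def by auto

lemma open_V: "openin X W==>W : sets V"
 unfolding sets_V by (rule sigma_sets.Basic) simp

lemma space_Rb: "space (Rb U) = U" by (simp add: space_restrict_space)

lemma in_sets_Rb: "A : sets (Rb U) \<longleftrightarrow> A : sets borel & A <= U"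
 using opn_borel[OF U] by (simp add: sets_restrict_space_iff conj_commute)

lemma fst_meas: "fst : measurable V (Rb U)"
proof (rule measurable_restrict_space2)
 show "fst : space V \<rightarrow> U" by (auto simp: space_V)
 show "fst : bmeas V"
 proof (rule borel_measurableI)
  fix S :: "vec set" assume "open S"
  hence "openin (top_of_set U) (U Int S)" by (simp add: openin_open_Int)
  moreover have "openin (Grass_top n m) (Grass n m)" by (metis openin_topspace topspace_Grass_top)
  ultimately have "openin X ((U Int S) \<times> Grass n m)" by (simp add: openin_prod_Times_iff)
  moreover have "fst -` S Int space V = (U Int S) \<times> Grass n m" by (auto simp: space_V)
  ultimately show "fst -` S Int space V : sets V" using open_V by simp
 qed
qed

lemma pj_meas: "(%p. pj j i (snd p)) : bmeas V"
proof (rule borel_measurableI)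
 fix S :: "real set" assume S: "open S"
 let ?f = "%S i j. lk (orth_proj S (uv j)) i"
 have "continuous_on UNIV (%M::nat => nat => real. M j i)" by (rule continuous_on_compose2[OF continuous_on_product_coordinates continuous_on_product_coordinates]) simp
 hence "open ((%M::nat => nat => real. M j i) -` S)" using S by (rule open_vimage[rotated])
 hence "openin (Grass_top n m) (?f -` ((%M::nat => nat => real. M j i) -` S) Int Grass n m)"
  unfolding Grass_top_def openin_pullback_topology by auto
 hence "openin X (U \<times> (?f -` ((%M::nat => nat => real. M j i) -` S) Int Grass n m))" by (simp add: openin_prod_Times_iff)
 moreover have "(%p. pj j i (snd p)) -` S Int space V = U \<times> (?f -` ((%M::nat => nat => real. M j i) -` S) Int Grass n m)" by (auto simp: space_V pj_def)
 ultimately show "(%p. pj j i (snd p)) -` S Int space V : sets V" using open_V by simp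
qed

lemma sets_mu: "sets mu = sets (Rb U)" by (simp add: weight_def)
lemma space_mu [simp]: "space mu = U" by (simp add: weight_def space_Rb)
lemma in_sets_mu: "A : sets mu \<longleftrightarrow> A : sets borel & A <= U" by (simp add: sets_mu in_sets_Rb)
lemma meas_mu_eq: "bmeas mu = bmeas (Rb U)" by (rule measurable_cong_sets[OF sets_mu refl])

text \<open>The Grassmannian is compact, so the cylinder over C is compact and V is finite on
  it.\<close>

lemma mu_compact: assumes C: "compact C" "C <= U" shows "emeas mu C < \<infinity>"
proof -
 have m: "C : sets (Rb U)" using C borel_closed[OF compact_imp_closed[OF C(1)]] by (simp add: in_sets_Rb)
 have "emeas mu C = emeas V (fst -` C Int space V)" unfolding weight_def by (rule emeasure_distr[OF fst_meas m])
 also have "fst -` C Int space V = C \<times> Grass n m" using C by (auto simp: space_V)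
 also have "emeas V ... < \<infinity>"
 proof (rule fin_V)
  have "compactin (top_of_set U) C" using C by (simp add: compactin_subtopology)
  moreover have "compactin (Grass_top n m) (Grass n m)" using compact_Grass by (metis compact_space_def topspace_Grass_top)
  ultimately show "compactin X (C \<times> Grass n m)" by (simp add: compactin_Times)
 qed
 finally show ?thesis .
qed

sublocale mu: sigma_finite_measure mu
proof
 obtain C where C: "!!k::nat. compact (C k)" "incseq C" "(\<Union>k. C k) = U" using opn_exhaust[OF U] by metis
 have "C k : sets mu" for k using C borel_closed[OF compact_imp_closed[OF C(1)]] by (auto simp: in_sets_mu)
 moreover have "emeas mu (C k) ~= \<infinity>" for k 
 proof -
  have "C k <= U" using C(3) by blast
  from mu_compact[OF C(1) this] show ?thesis by simp
 qed
 ultimately show "EX A. countable A & A <= sets mu & \<Union> A = space mu & (ALL a:A. emeas mu a ~= \<infinity>)"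
  using C(3) by (intro exI[of _ "range C"]) auto
qed

lemma cont_meas: "continuous_on U f==>f : bmeas mu" for f :: "vec => real"
 unfolding meas_mu_eq by (rule borel_measurable_continuous_on_restrict)

lemma cont_cmeas: "continuous_on U f==>f : bmeas cmu" for f :: "vec => real" by (rule measurable_completion[OF cont_meas])

lemma AE_V: "AE z in mu. P z==>AE p in V. P (fst p)"
 unfolding weight_def by (rule AE_distrD[OF fst_meas])

text \<open>The image of the completed V under the projection is the weight, so preimages of null
  sets are null and measurability for the completed weight lifts.\<close>

lemma fst_cmeas: "fst : measurable cV cmu"
proof -
 show ?thesis
 proof (rule completion.measurable_completion2)
  show "fst : measurable cV mu" using measurable_completion[OF fst_meas] by (simp add: measurable_cong_sets[OF refl sets_mu])
  show "null_sets mu <= null_sets (distr cV mu fst)"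
  proof -
   have "distr cV mu fst = distr cV (Rb U) fst" by (rule distr_cong) (simp_all add: sets_mu)
   also have "... = mu" unfolding weight_def by (rule distr_completion[OF fst_meas])
   finally show ?thesis by simp
  qed
 qed
qed

lemma cmeas_V: "u : bmeas cmu==>(%p. u (fst p)) : bmeas cV"
 using measurable_compose[OF fst_cmeas] by blast

text \<open>Change of variables for a Borel representative of u, transferred to u along the almost
  everywhere equality.\<close>

lemma integral_V: assumes u: "(u :: vec => real) : bmeas cmu"
 shows "(\<integral>p. u (fst p) \<partial>cV) = (\<integral>z. u z \<partial>cmu)" "integrable cV (%p. u (fst p)) \<longleftrightarrow> integrable cmu u"
proof -
 obtain u' where u': "u' : bmeas mu" "AE z in mu. u z = u' z" using completion_ex_borel_measurable_real[OF u] by blast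
 have m: "(%p. u' (fst p)) : bmeas V" using measurable_compose[OF fst_meas] u'(1) unfolding meas_mu_eq by blast
 have a1: "AE p in cV. u (fst p) = u' (fst p)" using AE_completion[OF AE_V[OF u'(2)]] .
 have a2: "AE z in cmu. u z = u' z" using AE_completion[OF u'(2)] .
 have "(\<integral>p. u (fst p) \<partial>cV) = (\<integral>p. u' (fst p) \<partial>cV)" by (rule integral_cong_AE[OF cmeas_V[OF u] measurable_completion[OF m] a1])
 also have "... = (\<integral>p. u' (fst p) \<partial>V)" by (rule integral_completion[OF m])
 also have "... = (\<integral>z. u' z \<partial>mu)" unfolding weight_def
  using u'(1) unfolding meas_mu_eq by (subst integral_distr[OF fst_meas]) auto
 also have "... = (\<integral>z. u' z \<partial>cmu)" by (rule integral_completion[OF u'(1), symmetric])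
 also have "... = (\<integral>z. u z \<partial>cmu)" by (rule integral_cong_AE[OF measurable_completion[OF u'(1)] u]) (use a2 in eventually_elim, simp)
 finally show "(\<integral>p. u (fst p) \<partial>cV) = (\<integral>z. u z \<partial>cmu)" .
 have "integrable cV (%p. u (fst p)) \<longleftrightarrow> integrable cV (%p. u' (fst p))" by (rule integrable_cong_AE[OF cmeas_V[OF u] measurable_completion[OF m] a1])
 also have "... \<longleftrightarrow> integrable V (%p. u' (fst p))" by (rule integrable_completion[OF m])
 also have "... \<longleftrightarrow> integrable mu u'" unfolding weight_def
  using u'(1) unfolding meas_mu_eq by (subst integrable_distr_eq[OF fst_meas]) auto
 also have "... \<longleftrightarrow> integrable cmu u'" by (rule integrable_completion[OF u'(1), symmetric])
 also have "... \<longleftrightarrow> integrable cmu u" by (rule integrable_cong_AE[OF measurable_completion[OF u'(1)] u]) (use a2 in eventually_elim, simp)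
 finally show "integrable cV (%p. u (fst p)) \<longleftrightarrow> integrable cmu u" .
qed

lemma integrable_pj: assumes "integrable cmu u" shows "integrable cV (%p. u (fst p)*pj j i (snd p))"
proof -
 have "integrable cV (%p. u (fst p))" using assms integral_V(2)[of u] by auto
 thus ?thesis
 proof (rule Bochner_Integration.integrable_bound)
  show "(%p. u (fst p)*pj j i (snd p)) : bmeas cV"
   using measurable_completion[OF pj_meas, of j i] cmeas_V[of u] assms by (intro borel_measurable_times) auto
  show "AE p in cV. norm (u (fst p)*pj j i (snd p)) <= norm (u (fst p))" by (rule AE_I2) (auto simp: space_V abs_mult intro!: mult_left_le abs_pj_le)
 qed
qed

text \<open>The barycentre of the tangent planes over a point; it replaces the approximate tangent plane,
  so that rectifiability is not needed.\<close>

lemma barycentre_exists: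
 "EX P. P : bmeas mu & (ALL z. \<bar>P z\<bar> <= (1::real)) &
  (ALL u. integrable cmu u --> (\<integral>p. u (fst p)*pj j i (snd p) \<partial>cV) = (\<integral>z. u z*P z \<partial>cmu))"
proof -
 \<comment> \<open>Adding 1 makes the matrix entry nonnegative and at most 2, so that a
   Radon-Nikodym density g of a positive measure exists; the barycentre is g - 1. The maximum with 0
   only acts outside the space of V.\<close>
 define w where "w p = max 0 (1+pj j i (snd p))" for p :: "vec \<times> vec set"
 have wm: "w : bmeas V" unfolding w_def using pj_meas[of j i] by measurable
 have w: "w p = 1+pj j i (snd p)" "0 <= w p" "w p <= 2" if "p : space V" for p
  using abs_pj_le[of "snd p" n m j i] that by (auto simp: w_def space_V)
 define nu where "nu = distr (density V (%p. enn (w p))) (Rb U) fst"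
 have fm: "fst : measurable (density V (%p. enn (w p))) (Rb U)" using fst_meas by simp
 have nu_int: "(\<integral>\<^sup>+z. u z \<partial>nu) = (\<integral>\<^sup>+p. enn (w p)*u (fst p) \<partial>V)" if "u : bmeas (Rb U)" for u
  unfolding nu_def using that wm measurable_compose[OF fst_meas that] by (subst nn_integral_distr[OF fm]) (auto simp: nn_integral_density)
 have mu_int: "(\<integral>\<^sup>+z. u z \<partial>mu) = (\<integral>\<^sup>+p. u (fst p) \<partial>V)" if "u : bmeas (Rb U)" for u
  unfolding weight_def by (subst nn_integral_distr[OF fst_meas]) (use that in auto)
 have le: "emeas nu A <= 2*emeas mu A" if A: "A : sets (Rb U)" for A
 proof -
  have iA: "ind A : bmeas (Rb U)" using A by simp
  have m: "(%p. ind A (fst p) :: ennreal) : bmeas V" using measurable_compose[OF fst_meas iA] .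
  have "emeas nu A = (\<integral>\<^sup>+z. ind A z \<partial>nu)" using A by (simp add: nu_def)
  also have "... = (\<integral>\<^sup>+p. enn (w p)*ind A (fst p) \<partial>V)" using iA by (rule nu_int)
  also have "... <= (\<integral>\<^sup>+p. 2*ind A (fst p) \<partial>V)"
  proof (intro nn_integral_mono mult_right_mono)
   fix p assume "p : space V"
   thus "enn (w p) <= 2" using w(3)[of p] ennreal_leI by fastforce
  qed simp
  also have "... = 2*(\<integral>\<^sup>+p. ind A (fst p) \<partial>V)" using m by (rule nn_integral_cmult)
  also have "... = 2*(\<integral>\<^sup>+z. ind A z \<partial>mu)" using mu_int[OF iA] by simp
  also have "... = 2*emeas mu A" using A by (simp add: sets_mu)
  finally show ?thesis .
 qed
 have snu: "sets nu = sets mu" by (simp add: nu_def sets_mu)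
 have ac: "absolutely_continuous mu nu" unfolding absolutely_continuous_def
 proof
  fix A assume "A : null_sets mu"
  thus "A : null_sets nu" using le[of A] snu by (auto simp: null_sets_def sets_mu)
 qed
 obtain f where f: "f : bmeas mu" "density mu f = nu" using mu.Radon_Nikodym[OF ac snu] by blast
 \<comment> \<open>The measure \<open>nu\<close> is at most twice \<open>mu\<close>, so the density
   exceeds 2 + 1/(k+1) only on a null set; finiteness on the compact sets \<open>C l\<close> permits
   cancelling the measure.\<close>
 have f2: "AE z in mu. f z <= 2"
 proof -
  define A where "A k = {z : U. f z >= 2+enn (1/real (Suc k))}" for k
  obtain C where C: "!!k::nat. compact (C k)" "incseq C" "(\<Union>k. C k) = U" using opn_exhaust[OF U] by metis
  have Cm: "C l : sets mu" for l using C borel_closed[OF compact_imp_closed[OF C(1)]] by (auto simp: in_sets_mu)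
  have Am: "A k : sets mu" for k
  proof -
   have "{z : space mu. f z >= 2+enn (1/real (Suc k))} : sets mu" using f(1) by measurable
   thus ?thesis by (simp add: A_def)
  qed
  have null: "A k Int C l : null_sets mu" for k l
  proof -
   have m: "A k Int C l : sets mu" using Am Cm by auto
   have "emeas mu (A k Int C l) <= emeas mu (C l)" using Cm by (intro emeasure_mono) auto
   also have "... < \<infinity>" using C by (intro mu_compact) auto
   finally have fin: "emeas mu (A k Int C l) < \<infinity>" .
   have "(2+enn (1/real (Suc k)))*emeas mu (A k Int C l) = (\<integral>\<^sup>+z. (2+enn (1/real (Suc k)))*ind (A k Int C l) z \<partial>mu)"
    using m by (simp add: nn_integral_cmult_indicator)
   also have "... <= (\<integral>\<^sup>+z. f z*ind (A k Int C l) z \<partial>mu)" by (intro nn_integral_mono) (auto simp: A_def indicator_def)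
   also have "... = emeas nu (A k Int C l)" using f m by (simp add: emeasure_density flip: f(2))
   also have "... <= 2*emeas mu (A k Int C l)" using m by (intro le) (simp add: sets_mu)
   finally have "emeas mu (A k Int C l) = 0"
    using fin by (cases "emeas mu (A k Int C l)")
     (auto simp flip: ennreal_plus ennreal_mult ennreal_numeral simp del: of_nat_Suc simp: algebra_simps mult_le_0_iff divide_le_0_iff)
   thus ?thesis using m by blast
  qed
  have "(\<Union>k. \<Union>l. A k Int C l) : null_sets mu" using null by (intro null_sets_UN) auto
  moreover have "{z : space mu. \<not> f z <= 2} <= (\<Union>k. \<Union>l. A k Int C l)"
  proof
   fix z assume z: "z : {z : space mu. \<not> f z <= 2}"
   have "EX k. 2+enn (1/real (Suc k)) <= f z"
   proof (cases "f z")
    case (real r)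
    hence "r > 2" using z by (auto simp: not_le ennreal_less_iff simp flip: ennreal_numeral)
    then obtain k where "inverse (real (Suc k)) < r - 2" using reals_Archimedean[of "r - 2"] by auto
    hence "2+1/real (Suc k) <= r" by (simp add: inverse_eq_divide)
    hence "enn (2+1/real (Suc k)) <= enn r" by (rule ennreal_leI)
    hence "enn (2+1/real (Suc k)) <= f z" using real by metis
    moreover have "enn (2+1/real (Suc k)) = 2+enn (1/real (Suc k))" by (subst ennreal_plus) auto
    ultimately show ?thesis by (intro exI[of _ k]) simp
   qed auto
   then obtain k where "z : A k" using z by (auto simp: A_def)
   moreover obtain l where "z : C l" using z C(3) by auto
   ultimately show "z : (\<Union>k. \<Union>l. A k Int C l)" by blast
  qed
  ultimately show ?thesis by (rule AE_I')
 qed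
 define g where "g z = enn2real (min 2 (f z))" for z
 have gm: "g : bmeas mu" unfolding g_def using f(1) by measurable
 have g01: "0 <= g z" "g z <= 2" for z
 proof -
  show "0 <= g z" by (simp add: g_def)
  have "min 2 (f z) <= enn 2" by simp
  thus "g z <= 2" unfolding g_def using enn2real_leI by fastforce
 qed
 have gf: "AE z in mu. f z = enn (g z)"
  using f2
 proof eventually_elim
  case (elim z)
  have "f z < top" using elim by (rule order_le_less_trans) simp
  thus ?case using elim by (simp add: g_def min_absorb2)
 qed
 have dg: "density mu (%z. enn (g z)) = nu"
 proof -
  have "density mu (%z. enn (g z)) = density mu f"
  proof (rule density_cong)
   show "(%z. enn (g z)) : bmeas mu" using gm by measurable
   show "AE z in mu. enn (g z) = f z" using gf by eventually_elim simp
  qed (rule f(1))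
  thus ?thesis using f(2) by simp
 qed
 have main: "(\<integral>p. u (fst p)*pj j i (snd p) \<partial>V) = (\<integral>z. u z*(g z - 1) \<partial>mu)"
  if u: "u : bmeas mu" and ui: "integrable mu u" for u :: "vec => real"
 proof -
  have um: "u : bmeas (Rb U)" using u by (simp add: meas_mu_eq)
  have m: "(%p. u (fst p)) : bmeas V" using measurable_compose[OF fst_meas um] .
  have iV: "integrable V (%p. u (fst p))" using ui unfolding weight_def by (simp add: integrable_distr_eq[OF fst_meas um])
  have "(\<integral>z. u z \<partial>nu) = (\<integral>p. u (fst p) \<partial>density V (%p. enn (w p)))"
   unfolding nu_def by (rule integral_distr[OF fm um])
  also have "... = (\<integral>p. w p *\<^sub>R u (fst p) \<partial>V)" by (rule integral_density[OF m wm]) (auto simp: w_def)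
  also have "... = (\<integral>p. u (fst p)+u (fst p)*pj j i (snd p) \<partial>V)" by (intro Bochner_Integration.integral_cong refl) (simp add: w(1) algebra_simps)
  also have "... = (\<integral>p. u (fst p) \<partial>V)+(\<integral>p. u (fst p)*pj j i (snd p) \<partial>V)"
  proof (rule Bochner_Integration.integral_add[OF iV])
   have "integrable cmu u" using ui u by (simp add: integrable_completion)
   hence "integrable cV (%p. u (fst p)*pj j i (snd p))" by (rule integrable_pj)
   thus "integrable V (%p. u (fst p)*pj j i (snd p))"
    using m pj_meas[of j i] by (subst (asm) integrable_completion) auto
  qed
  also have "(\<integral>p. u (fst p) \<partial>V) = (\<integral>z. u z \<partial>mu)" unfolding weight_def by (rule integral_distr[OF fst_meas um, symmetric])
  finally have 1: "(\<integral>z. u z \<partial>nu) = (\<integral>z. u z \<partial>mu)+(\<integral>p. u (fst p)*pj j i (snd p) \<partial>V)" .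
  have gui: "integrable mu (%z. g z*u z)"
  proof (rule Bochner_Integration.integrable_bound[of mu "%z. 2*u z"])
   show "AE z in mu. norm (g z*u z) <= norm (2*u z)" by (rule AE_I2) (auto simp: abs_mult g01 intro!: mult_right_mono)
  qed (use ui u gm in auto)
  have "(\<integral>z. u z \<partial>nu) = (\<integral>z. g z *\<^sub>R u z \<partial>mu)" unfolding dg[symmetric] by (rule integral_density[OF u gm]) (simp add: g01)
  hence "(\<integral>p. u (fst p)*pj j i (snd p) \<partial>V) = (\<integral>z. g z*u z \<partial>mu) - (\<integral>z. u z \<partial>mu)" using 1 by simp
  also have "... = (\<integral>z. g z*u z - u z \<partial>mu)" using gui ui by (rule Bochner_Integration.integral_diff[symmetric])
  finally show ?thesis by (simp add: algebra_simps)
 qed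
 show ?thesis
 proof (intro exI[of _ "%z. g z - 1"] conjI allI impI)
  show "(%z. g z - 1) : bmeas mu" using gm by measurable
  show "\<bar>g z - 1\<bar> <= 1" for z using g01[of z] by auto
  fix u :: "vec => real" assume u: "integrable cmu u"
  hence uc: "u : bmeas cmu" by auto
  obtain u' where u': "u' : bmeas mu" "AE z in mu. u z = u' z" using completion_ex_borel_measurable_real[OF uc] by blast
  have m: "(%p. u' (fst p)) : bmeas V" using measurable_compose[OF fst_meas] u'(1) unfolding meas_mu_eq by blast
  have a1: "AE p in cV. u (fst p) = u' (fst p)" using AE_completion[OF AE_V[OF u'(2)]] .
  have a2: "AE z in cmu. u z = u' z" using AE_completion[OF u'(2)] .
  have m2: "(%p. u' (fst p)*pj j i (snd p)) : bmeas V" using m pj_meas[of j i] by measurable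
  have gm1: "(%z. u' z*(g z - 1)) : bmeas mu" using gm u'(1) by measurable
  have "integrable cmu u'" using u a2 measurable_completion[OF u'(1)] uc by (subst integrable_cong_AE[of u' cmu u]) (auto elim: eventually_mono)
  hence ui': "integrable mu u'" using u'(1) by (simp add: integrable_completion)
  have "(\<integral>p. u (fst p)*pj j i (snd p) \<partial>cV) = (\<integral>p. u' (fst p)*pj j i (snd p) \<partial>cV)" by (rule integral_cong_AE[OF borel_measurable_integrable[OF integrable_pj[OF u]] measurable_completion[OF m2]])
    (use a1 in eventually_elim, simp)
  also have "... = (\<integral>p. u' (fst p)*pj j i (snd p) \<partial>V)" by (rule integral_completion[OF m2])
  also have "... = (\<integral>z. u' z*(g z - 1) \<partial>mu)" by (rule main[OF u'(1) ui'])
  also have "... = (\<integral>z. u' z*(g z - 1) \<partial>cmu)" by (rule integral_completion[OF gm1, symmetric])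
  also have "... = (\<integral>z. u z*(g z - 1) \<partial>cmu)"
  proof (rule integral_cong_AE[OF measurable_completion[OF gm1]])
   have "(%z. g z - 1) : bmeas cmu" using gm by (intro measurable_completion borel_measurable_diff) auto
   thus "(%z. u z*(g z - 1)) : bmeas cmu" using uc by (rule borel_measurable_times[rotated])
  qed (use a2 in eventually_elim, simp)
  finally show "(\<integral>p. u (fst p)*pj j i (snd p) \<partial>cV) = (\<integral>z. u z*(g z - 1) \<partial>cmu)" .
 qed
qed

definition P :: "nat => nat => vec => real" where
 "P j i = (SOME P. P : bmeas mu & (ALL z. \<bar>P z\<bar> <= (1::real)) &
  (ALL u. integrable cmu u --> (\<integral>p. u (fst p)*pj j i (snd p) \<partial>cV) = (\<integral>z. u z*P z \<partial>cmu)))"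

lemma P_meas: "P j i : bmeas cmu" and P_le: "\<bar>P j i z\<bar> <= 1"
 and P_int: "integrable cmu u==>(\<integral>p. u (fst p)*pj j i (snd p) \<partial>cV) = (\<integral>z. u z*P j i z \<partial>cmu)"
 using someI_ex[OF barycentre_exists[of j i]] measurable_completion unfolding P_def[symmetric] by blast+

lemma integrable_boundedI:
 fixes u :: "vec => real"
 assumes "compact C" "C <= U" "!!z. z : U==>z ~: C==>u z = 0" "!!z. z : U ==> \<bar>u z\<bar> <= B"
  "u : bmeas cmu"
 shows "integrable cmu u"
proof -
 have Cm: "C : sets mu" using assms(2) borel_closed[OF compact_imp_closed[OF assms(1)]] by (simp add: in_sets_mu)
 have "integrable cmu (%z. ind C z*\<bar>B\<bar> :: real)"
  using Cm mu_compact[OF assms(1,2)] by (intro integrable_mult_left integrable_real_indicator) auto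
 thus ?thesis
 proof (rule Bochner_Integration.integrable_bound)
  show "AE z in cmu. norm (u z) <= norm (ind C z*\<bar>B\<bar> :: real)"
  proof (rule AE_I2)
   fix z assume "z : space cmu"
   hence z: "z : U" by simp
   show "norm (u z) <= norm (ind C z*\<bar>B\<bar> :: real)"
    using assms(3,4)[OF z] by (cases "z : C") auto
  qed
 qed (use assms in auto)
qed

lemma smooth_cs_bounded:
 fixes f :: "vec => real"
 assumes "compact C" "C <= U" "!!z. z : U==>z ~: C==>f z = 0" "continuous_on U f"
 shows "EX B. ALL z:U. \<bar>f z\<bar> <= B"
proof -
 have "bounded (f ` C)"
  using assms by (intro compact_imp_bounded compact_continuous_image) (auto intro: continuous_on_subset)
 then obtain B where B: "ALL x:f ` C. norm x <= B" using bounded_iff by blast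
 have "\<bar>f z\<bar> <= \<bar>B\<bar>" if "z : U" for z using B assms(3)[OF that] by (cases "z : C") force+
 thus ?thesis by blast
qed

lemma Deriv_zero_off:
 assumes "compact C" "C <= U" "!!z. z : U==>z ~: C==>g z = 0" "z : U" "z ~: C" "v : Rn n"
 shows "Deriv n g z v = 0"
proof -
 have o: "opn n (U - C)" by (intro opn_Diff_closed U compact_imp_closed assms)
 have "Deriv n g z v = Deriv n (%x. 0) z v" by (rule Deriv_smooth_cong[OF o _ _ smooth_const[OF o]]) (use assms in auto)
 thus ?thesis using assms(4,6) opn_mem[OF U] by (simp add: Deriv_const)
qed

definition HS :: "(vec => vec) => vec \<times> vec set => real" where
 "HS g p = hs_inner n (Deriv n g (fst p)) (orth_proj (snd p))"

lemma HS_eq: "p : space V==>HS g p = (\<Sum>i<n. \<Sum>j<n. lk (Deriv n g (fst p) (uv i)) j*pj j i (snd p))"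
 unfolding HS_def by (rule hs_inner_pj[of _ n m]) (auto simp: space_V)

lemma Dg_props:
 assumes "g : Ccinf n U n" "i < n"
 shows "continuous_on U (%z. lk (Deriv n g z (uv i)) j)"
  "EX C B. compact C & C <= U & (ALL z:U. z ~: C --> lk (Deriv n g z (uv i)) j = 0) & (ALL z:U. \<bar>lk (Deriv n g z (uv i)) j\<bar> <= B)"
proof -
 obtain C where C: "compact C" "C <= U" "!!z. z ~: C==>g z = 0" "smooth n U g" "!!z. g z : Rn n" by (rule CcinfE[OF assms(1)]) (rule that; assumption)
 show c: "continuous_on U (%z. lk (Deriv n g z (uv i)) j)" by (rule continuous_lk[OF smooth_continuous[OF smooth_Deriv[OF C(4) assms(2)]]])
 have z: "lk (Deriv n g z (uv i)) j = 0" if "z : U" "z ~: C" for z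
  using Deriv_zero_off[OF C(1,2) _ that, of g "uv i"] C(3) assms(2) by simp
 have "EX B. ALL z:U. \<bar>lk (Deriv n g z (uv i)) j\<bar> <= B" by (rule smooth_cs_bounded[OF C(1,2) z c])
 then obtain B where "ALL z:U. \<bar>lk (Deriv n g z (uv i)) j\<bar> <= B" ..
 thus "EX C B. compact C & C <= U & (ALL z:U. z ~: C --> lk (Deriv n g z (uv i)) j = 0) & (ALL z:U. \<bar>lk (Deriv n g z (uv i)) j\<bar> <= B)"
  using C(1,2) z by (intro exI[of _ C] exI[of _ B]) auto
qed

lemma Dg_integrable:
 assumes "g : Ccinf n U n" "i < n" "u : bmeas cmu" "!!z. z : U ==> \<bar>u z\<bar> <= B"
 shows "integrable cmu (%z. u z*lk (Deriv n g z (uv i)) j)"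
proof -
 obtain C B' where C: "compact C" "C <= U" "ALL z:U. z ~: C --> lk (Deriv n g z (uv i)) j = 0"
   "ALL z:U. \<bar>lk (Deriv n g z (uv i)) j\<bar> <= B'" using Dg_props(2)[OF assms(1,2), of j] by (elim exE conjE)
 show ?thesis
 proof (rule integrable_boundedI[OF C(1,2)])
  show "\<bar>u z*lk (Deriv n g z (uv i)) j\<bar> <= \<bar>B\<bar>*\<bar>B'\<bar>" if "z : U" for z
   unfolding abs_mult using assms(4)[OF that] C(4) that by (intro mult_mono) (auto intro: order_trans)
  show "(%z. u z*lk (Deriv n g z (uv i)) j) : bmeas cmu" by (intro borel_measurable_times assms cont_cmeas Dg_props(1))
 qed (use C in auto)
qed

text \<open>The plane enters the integrand of the first variation linearly, through the entries
  \<open>pj\<close>. Integrating against a function of the base point therefore replaces these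
  entries by their barycentre \<open>P\<close> and leaves integrals over the weight.\<close>

lemma HS_expand:
 assumes "g : Ccinf n U n" "u : bmeas cmu" "!!z. z : U ==> \<bar>u z\<bar> <= B"
 shows "integrable cV (%p. u (fst p)*HS g p)"
  "(\<integral>p. u (fst p)*HS g p \<partial>cV) = (\<Sum>i<n. \<Sum>j<n. \<integral>z. u z*lk (Deriv n g z (uv i)) j*P j i z \<partial>cmu)"
proof -
 let ?s = "%p. \<Sum>i<n. \<Sum>j<n. (u (fst p)*lk (Deriv n g (fst p) (uv i)) j)*pj j i (snd p)"
 have e: "u (fst p)*HS g p = ?s p" if "p : space cV" for p
  using HS_eq[of p g] that by (simp add: sum_distrib_left mult.assoc)
 have i1: "integrable cV (%p. (u (fst p)*lk (Deriv n g (fst p) (uv i)) j)*pj j i (snd p))" if "i < n" for i j by (rule integrable_pj[OF Dg_integrable[OF assms(1) that assms(2,3)]])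
 have "integrable cV ?s" using i1 by (intro Bochner_Integration.integrable_sum) auto
 thus "integrable cV (%p. u (fst p)*HS g p)" by (subst Bochner_Integration.integrable_cong[OF refl e]) auto
 have "(\<integral>p. u (fst p)*HS g p \<partial>cV) = (\<integral>p. ?s p \<partial>cV)" by (rule Bochner_Integration.integral_cong[OF refl e])
 also have "... = (\<Sum>i<n. \<integral>p. (\<Sum>j<n. (u (fst p)*lk (Deriv n g (fst p) (uv i)) j)*pj j i (snd p)) \<partial>cV)"
  using i1 by (intro Bochner_Integration.integral_sum Bochner_Integration.integrable_sum) auto
 also have "... = (\<Sum>i<n. \<Sum>j<n. \<integral>p. (u (fst p)*lk (Deriv n g (fst p) (uv i)) j)*pj j i (snd p) \<partial>cV)"
  using i1 by (intro sum.cong refl Bochner_Integration.integral_sum) auto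
 also have "... = (\<Sum>i<n. \<Sum>j<n. \<integral>z. u z*lk (Deriv n g z (uv i)) j*P j i z \<partial>cmu)" by (intro sum.cong refl P_int Dg_integrable[OF assms(1) _ assms(2,3)]) auto
 finally show "(\<integral>p. u (fst p)*HS g p \<partial>cV) = (\<Sum>i<n. \<Sum>j<n. \<integral>z. u z*lk (Deriv n g z (uv i)) j*P j i z \<partial>cmu)" .
qed

lemma HS_meas: assumes g: "g : Ccinf n U n" shows "HS g : bmeas V"
proof -
 have "(%p. lk (Deriv n g (fst p) (uv i)) j) : bmeas V" if "i < n" for i j
  using measurable_compose[OF fst_meas] cont_meas[OF Dg_props(1)[OF g that]] unfolding meas_mu_eq by blast
 hence "(%p. \<Sum>i<n. \<Sum>j<n. lk (Deriv n g (fst p) (uv i)) j*pj j i (snd p)) : bmeas V"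
  using pj_meas by (intro borel_measurable_sum borel_measurable_times) auto
 thus ?thesis by (subst measurable_cong[OF HS_eq]) auto
qed

lemma first_var_eq: assumes g: "g : Ccinf n U n" shows "first_var n V g = (\<integral>p. HS g p \<partial>cV)"
proof -
 have "first_var n V g = (\<integral>p. HS g p \<partial>V)" unfolding first_var_def HS_def case_prod_unfold by simp
 thus ?thesis using integral_completion[OF HS_meas[OF g]] by simp
qed

lemma HS_integrable: assumes g: "g : Ccinf n U n" shows "integrable cV (HS g)"
 using HS_expand(1)[OF g, of "%z. 1" 1] by simp

lemma first_var_add: assumes "g : Ccinf n U n" "h : Ccinf n U n"
 shows "first_var n V (%z. g z+h z) = first_var n V g+first_var n V h"
proof -
 have s: "smooth n U g" "smooth n U h" using assms CcinfE by metis+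
 have "first_var n V (%z. g z+h z) = (\<integral>p. HS (%z. g z+h z) p \<partial>cV)" by (rule first_var_eq[OF Ccinf_add[OF U assms]])
 also have "... = (\<integral>p. HS g p+HS h p \<partial>cV)" by (intro Bochner_Integration.integral_cong refl)
   (auto simp: HS_eq Deriv_add[OF U _ s] space_V algebra_simps simp flip: sum.distrib)
 also have "... = first_var n V g+first_var n V h"
  using HS_integrable assms by (simp add: first_var_eq)
 finally show ?thesis .
qed

lemma first_var_scale: assumes "g : Ccinf n U n"
 shows "first_var n V (%z. c *\<^sub>R g z) = c*first_var n V g"
proof -
 have s: "smooth n U g" using assms CcinfE by metis
 have "first_var n V (%z. c *\<^sub>R g z) = (\<integral>p. HS (%z. c *\<^sub>R g z) p \<partial>cV)" by (rule first_var_eq[OF Ccinf_scale[OF U assms]])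
 also have "... = (\<integral>p. c*HS g p \<partial>cV)" by (intro Bochner_Integration.integral_cong refl)
   (auto simp: HS_eq Deriv_scaleR[OF U _ smooth_const[OF U] s] Deriv_const[OF opn_mem[OF U]] space_V sum_distrib_left mult.assoc)
 also have "... = c*first_var n V g"
  using assms by (simp add: first_var_eq)
 finally show ?thesis .
qed

text \<open>Leibniz rule under the integral. The last term pairs g with the differential of f
  composed with the barycentre \<open>P\<close>; it becomes the contribution of the spatial cutoff
  to the weak derivative of a product.\<close>

lemma HS_product:
 assumes g: "g : Ccinf n U n" and f: "smooth n U f" and u: "u : bmeas cmu" "!!z. z : U ==> \<bar>u z\<bar> <= B"
  and uf: "!!z. z : U ==> \<bar>u z*f z\<bar> <= B'"
 shows "(\<integral>p. u (fst p)*HS (%z. f z *\<^sub>R g z) p \<partial>cV) = (\<integral>p. (u (fst p)*f (fst p))*HS g p \<partial>cV)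
  + (\<integral>z. u z*(\<Sum>i<n. \<Sum>j<n. Deriv n f z (uv i)*lk (g z) j*P j i z) \<partial>cmu)"
proof -
 obtain C where C: "compact C" "C <= U" "!!z. z ~: C==>g z = 0" "smooth n U g" "!!z. g z : Rn n"
  using CcinfE[OF g] by blast
 have fg: "(%z. f z *\<^sub>R g z) : Ccinf n U n" by (rule Ccinf_mult[OF U f g])
 have ufm: "(%z. u z*f z) : bmeas cmu" by (intro borel_measurable_times u cont_cmeas smooth_continuous[OF f])
 let ?a = "%i j z. u z*f z*lk (Deriv n g z (uv i)) j*P j i z"
 let ?b = "%i j z. u z*(Deriv n f z (uv i)*lk (g z) j*P j i z)"
 have ia: "integrable cmu (?a i j)" if "i < n" for i j
 proof (rule Bochner_Integration.integrable_bound[OF Dg_integrable[OF g that ufm uf, of j]])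
  show "?a i j : bmeas cmu"  by (intro borel_measurable_times[OF borel_measurable_integrable[OF Dg_integrable[OF g that ufm uf]]] P_meas)
  show "AE z in cmu. norm (?a i j z) <= norm (u z*f z*lk (Deriv n g z (uv i)) j)" by (rule AE_I2) (simp add: abs_mult P_le mult_left_le)
 qed
 have ib: "integrable cmu (?b i j)" if i: "i < n" for i j
 proof -
  have c: "continuous_on U (%z. Deriv n f z (uv i)*lk (g z) j)" by (intro continuous_on_mult continuous_lk smooth_continuous[OF smooth_Deriv[OF f i]] smooth_continuous[OF C(4)])
  have "EX B. ALL z:U. \<bar>Deriv n f z (uv i)*lk (g z) j\<bar> <= B" by (rule smooth_cs_bounded[OF C(1,2) _ c]) (simp add: C(3))
  then obtain B2 where B2: "ALL z:U. \<bar>Deriv n f z (uv i)*lk (g z) j\<bar> <= B2" ..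
  show ?thesis
  proof (rule integrable_boundedI[OF C(1,2)])
   show "\<bar>?b i j z\<bar> <= \<bar>B\<bar>*(\<bar>B2\<bar>*1)" if "z : U" for z
   proof -
    have "\<bar>?b i j z\<bar> = \<bar>u z\<bar>*(\<bar>Deriv n f z (uv i)*lk (g z) j\<bar>*\<bar>P j i z\<bar>)" by (simp add: abs_mult)
    also have "... <= \<bar>B\<bar>*(\<bar>B2\<bar>*1)"
    proof (intro mult_mono)
     show "\<bar>u z\<bar> <= \<bar>B\<bar>" using u(2)[OF that] by simp
     show "\<bar>Deriv n f z (uv i)*lk (g z) j\<bar> <= \<bar>B2\<bar>" using B2 that by fastforce
    qed (auto simp: P_le)
    finally show ?thesis .
   qed
   show "?b i j : bmeas cmu" by (intro borel_measurable_times[OF u(1)] borel_measurable_times[OF cont_cmeas[OF c]] P_meas)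
  qed (use C(3) in auto)
 qed
 have D: "lk (Deriv n (%z. f z *\<^sub>R g z) z (uv i)) j = f z*lk (Deriv n g z (uv i)) j+Deriv n f z (uv i)*lk (g z) j"
  if "z : U" "i < n" for z i j using Deriv_scaleR[OF U that(1) f C(4), of "uv i"] that(2) by simp
 have "(\<integral>p. u (fst p)*HS (%z. f z *\<^sub>R g z) p \<partial>cV) = (\<Sum>i<n. \<Sum>j<n. \<integral>z. u z*lk (Deriv n (%z. f z *\<^sub>R g z) z (uv i)) j*P j i z \<partial>cmu)" by (rule HS_expand(2)[OF fg u])
 also have "... = (\<Sum>i<n. \<Sum>j<n. \<integral>z. ?a i j z + ?b i j z \<partial>cmu)" by (intro sum.cong refl Bochner_Integration.integral_cong) (auto simp: D algebra_simps)
 also have "... = (\<Sum>i<n. \<Sum>j<n. (\<integral>z. ?a i j z \<partial>cmu)+(\<integral>z. ?b i j z \<partial>cmu))" by (intro sum.cong refl Bochner_Integration.integral_add ia ib) auto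
 also have "... = (\<Sum>i<n. \<Sum>j<n. \<integral>z. ?a i j z \<partial>cmu)+(\<Sum>i<n. \<Sum>j<n. \<integral>z. ?b i j z \<partial>cmu)" by (simp add: sum.distrib)
 also have "(\<Sum>i<n. \<Sum>j<n. \<integral>z. ?a i j z \<partial>cmu) = (\<integral>p. (u (fst p)*f (fst p))*HS g p \<partial>cV)"
  using HS_expand(2)[OF g ufm uf] by simp
 also have "(\<Sum>i<n. \<Sum>j<n. \<integral>z. ?b i j z \<partial>cmu) = (\<integral>z. (\<Sum>i<n. \<Sum>j<n. ?b i j z) \<partial>cmu)"
  using ib by (subst Bochner_Integration.integral_sum, force intro: Bochner_Integration.integrable_sum)
    (intro sum.cong refl Bochner_Integration.integral_sum[symmetric], auto)
 finally show ?thesis by (simp add: sum_distrib_left)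
qed

end

subsection \<open>Weak derivatives of products\<close>

lemma sets_add_measure: "sets (add_measure M N) = sets M" and space_add_measure: "space (add_measure M N) = space M"
 unfolding add_measure_def by (simp_all add: sets.sets_measure_of_eq sets.space_measure_of_eq)

lemma emeasure_add_measure:
 assumes "sets N = sets M" "A : sets M"
 shows "emeas (add_measure M N) A = emeas M A+emeas N A"
 unfolding add_measure_def
proof (rule emeasure_measure_of_sigma)
 show "sigma_algebra (space M) (sets M)" ..
 show "positive (sets M) (%A. emeas M A+emeas N A)" by (simp add: positive_def)
 show "countably_additive (sets M) (%A. emeas M A+emeas N A)"
 proof (rule countably_additiveI)
  fix A :: "nat => 'a set" assume *: "range A <= sets M" "disjoint_family A"
  hence r: "range A <= sets N" using assms by simp
  have "(%i. emeas M (A i)+emeas N (A i)) sums (emeas M (\<Union>i. A i)+emeas N (\<Union>i. A i))"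
   using sums_emeasure[OF *(2)]*r by (intro sums_add sums_emeasure) auto
  thus "suminf (%i. emeas M (A i)+emeas N (A i)) = emeas M (\<Union>i. A i)+emeas N (\<Union>i. A i)" by (rule sums_unique[symmetric])
 qed
qed (use assms in auto)

lemma completion_sub:
 assumes "sets A = sets M" "null_sets A <= null_sets M"
 shows "sets (completion A) <= sets (completion M)"
proof
 fix S assume "S : sets (completion A)"
 then obtain S' N N' where "S = S' Un N" "N' : null_sets A" "N <= N'" "S' : sets A" by (rule sets_completionE)
 thus "S : sets (completion M)" using assms by (intro sets_completionI[of S S' N N' M]) auto
qed

lemma hs_norm_L2: "hs_norm n L = L2_set (%i. norm (L (uv i))) {..<n}" by (simp add: hs_norm_def hs_inner_def L2_set_def power2_norm_eq_inner)

lemma norm_Rn_L2: "v : Rn n==>norm v = L2_set (lk v) {..<n}" by (simp add: norm_Rn L2_set_def)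

locale vfr = vfold +
 assumes radon: "radon_var n U (first_var n V)"
begin

sublocale vd: vdist n U "first_var n V" by unfold_locales (auto intro: U first_var_add first_var_scale radon)

abbreviation "nu \<equiv> vd.M"
abbreviation "cnu \<equiv> completion (var_measure n U V)"
abbreviation "ex \<equiv> Defs.ext n U (first_var n V)"

text \<open>Null sets of the sum are null for both summands. Members of \<open>TV\<close> are
  measurable for the completed sum, and this passes measurability on to each of the two
  completions.\<close>

lemma add_sets: "sets (completion (add_measure mu nu)) <= sets cmu" "sets (completion (add_measure mu nu)) <= sets cnu"
proof -
 have e: "sets nu = sets mu" by (simp add: vd.sets_M sets_mu)
 have n1: "null_sets (add_measure mu nu) <= null_sets mu" "null_sets (add_measure mu nu) <= null_sets nu" by (auto simp: null_sets_def sets_add_measure emeasure_add_measure[OF e] e)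
 show "sets (completion (add_measure mu nu)) <= sets cmu" by (rule completion_sub[OF sets_add_measure n1(1)])
 show "sets (completion (add_measure mu nu)) <= sets cnu" by (rule completion_sub[OF _ n1(2)]) (simp add: sets_add_measure e)
qed

lemma add_meas:
 assumes "f : measurable (completion (add_measure mu nu)) N"
 shows "f : measurable cmu N" "f : measurable cnu N"
proof -
 have sp: "space (add_measure mu nu) = U" by (simp add: space_add_measure)
 show "f : measurable cmu N" using assms add_sets(1) sp by (auto simp: measurable_def)
 show "f : measurable cnu N" using assms add_sets(2) sp by (auto simp: measurable_def)
qed

lemma Rn_comp_meas:
 fixes h :: "vec => real"
 assumes "f : bmeas N" "!!z. z : space N==>f z : Rn l" "continuous_on (Rn l) h"
 shows "(%z. h (f z)) : bmeas N"
proof -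
 have 1: "f : measurable N (restrict_space borel (Rn l))" using assms by (intro measurable_restrict_space2) auto
 have 2: "h : bmeas (restrict_space borel (Rn l))" by (rule borel_measurable_continuous_on_restrict[OF assms(3)])
 show ?thesis using measurable_compose[OF 1 2] .
qed

end

text \<open>Setting for a cut off composite of f: \<open>xi\<close> is a spatial cutoff and
  \<open>eta\<close> a function of the values. The numbers \<open>Bu\<close> and \<open>Bd\<close>
  bound \<open>eta\<close> and its derivative on the values of f, and this derivative vanishes where
  the norm of f exceeds \<open>s\<close>. The last point matters because F is integrable only over
  sets on which f is bounded.\<close>

locale wprod = vfr +
 fixes l :: nat and f :: "vec => vec" and F :: "vec => vec => vec" and eta xi :: "vec => real" and Bu Bd s :: real
 assumes f_meas: "f : measurable (completion (add_measure (weight U V) (var_measure n U V))) borel"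
  and f_Rn: "f ` U <= Rn l"
  and F: "is_weak_deriv n l U V f F"
  and eta: "smooth l (Rn l) eta"
  and etaC: "EX C. compact C & C <= Rn l & (ALL y:Rn l - C. ALL v:Rn l. Deriv l eta y v = 0)"
  and Bu: "!!z. z : U ==> \<bar>eta (f z)\<bar> <= Bu"
  and Bd: "!!z v. z : U==>v : Rn l ==> \<bar>Deriv l eta (f z) v\<bar> <= Bd*norm v"
  and s: "!!z v. z : U==>s < norm (f z)==>v : Rn l==>Deriv l eta (f z) v = 0"
  and xi: "xi : Csc n U"
begin

definition u :: "vec => real" where "u z = eta (f z)"
definition w :: "vec => real" where "w z = xi z*u z"
text \<open>Derivative of \<open>xi\<close> along V: the differential of \<open>xi\<close> composed
  with the barycentre of the tangent projections.\<close>

definition DX :: "vec => vec => real" where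
 "DX z v = (\<Sum>i<n. \<Sum>j<n. Deriv n xi z (uv i)*lk v j*P j i z)"
text \<open>The weak derivative of \<open>w\<close> that the Leibniz and chain rules suggest;
  \<open>q\<close> below is its Hilbert-Schmidt norm.\<close>

definition GG :: "vec => vec => real" where
 "GG z v = xi z*Deriv l eta (f z) (F z v)+u z*DX z v"
definition q :: "vec => real" where "q z = L2_set (%i. GG z (uv i)) {..<n}"

lemma oR: "opn l (Rn l)" by simp

lemma fR: "z : U==>f z : Rn l" using f_Rn by blast

lemmas F_unf = F[unfolded is_weak_deriv_def]

lemma F_Hom: "z : U==>F z : Hom n l" using F_unf[THEN conjunct1] by blast
lemma F_lin: "z : U==>linear (F z)" using F_Hom by (auto simp: Hom_def)
lemma F_R: "z : U==>v : Rn n==>F z v : Rn l" using F_Hom by (fastforce simp: Hom_def)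
lemma F0: "z : U==>n <= i==>F z (uv i) = 0" using F_Hom by (auto simp: Hom_def)

lemma F_meas: "i < n==>(%z. F z (uv i)) : bmeas cmu" using F_unf[THEN conjunct2, THEN conjunct1] by simp

lemma F_int: "compact C==>C <= U==>0 <= t ==>
  (\<integral>\<^sup>+z\<in>C Int {z. norm (f z) <= t}. enn (hs_norm n (F z)) \<partial>cmu) < \<infinity>"
 using F_unf[THEN conjunct2, THEN conjunct2, THEN conjunct1, rule_format, of C t] by simp

lemma F_eq: assumes "th : Ccinf n U n" "smooth l (Rn l) h"
  "EX C. compact C & C <= Rn l & (ALL y:Rn l - C. ALL v:Rn l. Deriv l h y v = 0)"
 shows "ex (%z. h (f z) *\<^sub>R th z) = (\<integral>p. h (f (fst p))*HS th p \<partial>cV)+(\<integral>z. Deriv l h (f z) (F z (th z)) \<partial>cmu)"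
proof -
 have "ex (%z. h (f z) *\<^sub>R th z) = (\<integral>(z, S). h (f z)*hs_inner n (orth_proj S) (Deriv n th z) \<partial>cV)+(\<integral>z. Deriv l h (f z) (F z (th z)) \<partial>cmu)" by (rule F_unf[THEN conjunct2, THEN conjunct2, THEN conjunct2, rule_format]) (use assms in simp_all)
 thus ?thesis unfolding HS_def case_prod_unfold by (simp add: hs_inner_commute)
qed

lemma f_cmu: "f : bmeas cmu" and f_cnu: "f : bmeas cnu"
 using add_meas[OF f_meas] by auto

lemma u_meas: "u : bmeas cmu" "u : bmeas cnu"
 unfolding u_def using fR smooth_continuous[OF eta] by (auto intro!: Rn_comp_meas[OF f_cmu, of l eta] Rn_comp_meas[OF f_cnu, of l eta])

lemma Deta_meas: "i < l==>(%z. Deriv l eta (f z) (uv i)) : bmeas cmu"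
 using fR smooth_continuous[OF smooth_Deriv[OF eta]] by (intro Rn_comp_meas[OF f_cmu, of l "%y. Deriv l eta y (uv i)"]) auto

lemma xi_smooth: "smooth n U xi" using xi by (auto simp: Csc_def)
lemma xi_meas: "xi : bmeas cmu" "xi : bmeas cnu"
 using cont_cmeas vd.measurable_cM_cont smooth_continuous[OF xi_smooth] by auto

lemma lin_Deta: "z : U==>linear (Deriv l eta (f z))" by (rule Deriv_linear[OF eta fR])

lemma lin_GG: assumes z: "z : U" shows "linear (GG z)"
proof (rule linearI)
 have 1: "DX z (x+y) = DX z x+DX z y" "DX z (c *\<^sub>R x) = c*DX z x" for x y c
  unfolding DX_def by (simp_all add: algebra_simps sum.distrib sum_distrib_left)
 note l1 = linear_add[OF F_lin[OF z]] linear_add[OF lin_Deta[OF z]] linear_scale[OF F_lin[OF z]] linear_scale[OF lin_Deta[OF z]]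
 show "GG z (x+y) = GG z x+GG z y" for x y unfolding GG_def by (simp add: l1 1 algebra_simps)
 show "GG z (c *\<^sub>R x) = c *\<^sub>R GG z x" for c x unfolding GG_def by (simp add: l1 1 algebra_simps)
qed

lemma GG_expand: assumes z: "z : U" "v : Rn n" shows "GG z v = (\<Sum>i<n. lk v i*GG z (uv i))"
proof -
 have "GG z v = GG z (\<Sum>i<n. lk v i *\<^sub>R uv i)" using Rn_expand[OF z(2)] by simp
 thus ?thesis by (simp add: linear_sum[OF lin_GG[OF z(1)]] linear_scale[OF lin_GG[OF z(1)]])
qed

lemma GG_q: assumes "z : U" "v : Rn n" shows "\<bar>GG z v\<bar> <= q z*norm v"
proof -
 have "\<bar>GG z v\<bar> <= (\<Sum>i<n. \<bar>lk v i\<bar>*\<bar>GG z (uv i)\<bar>)"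
  unfolding GG_expand[OF assms] by (rule order_trans[OF sum_abs]) (simp add: abs_mult)
 also have "... <= L2_set (lk v) {..<n}*L2_set (%i. GG z (uv i)) {..<n}" by (rule L2_set_mult_ineq)
 finally show ?thesis using norm_Rn_L2[OF assms(2)] by (simp add: q_def mult.commute)
qed

lemma DetaF_meas: assumes "i < n" shows "(%z. Deriv l eta (f z) (F z (uv i))) : bmeas cmu"
proof -
 have "(%z. \<Sum>k<l. lk (F z (uv i)) k*Deriv l eta (f z) (uv k)) : bmeas cmu"
  using measurable_compose[OF F_meas[OF assms] lk_measurable] by (intro borel_measurable_sum borel_measurable_times Deta_meas) auto
 moreover have "Deriv l eta (f z) (F z (uv i)) = (\<Sum>k<l. lk (F z (uv i)) k*Deriv l eta (f z) (uv k))" if "z : space cmu" for z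
  using Deriv_expand[OF eta fR F_R] that assms by simp
 ultimately show ?thesis by (subst measurable_cong) auto
qed

lemma DX_meas: "(%z. DX z (uv i)) : bmeas cmu"
 unfolding DX_def by (intro borel_measurable_sum borel_measurable_times P_meas borel_measurable_const cont_cmeas smooth_continuous[OF smooth_Deriv[OF xi_smooth]]) auto

lemma GG_meas: assumes "i < n" shows "(%z. GG z (uv i)) : bmeas cmu"
 unfolding GG_def by (intro borel_measurable_add borel_measurable_times DetaF_meas[OF assms] xi_meas u_meas DX_meas)

lemma q_nonneg: "0 <= q z" by (simp add: q_def)

lemma q_meas: "q : bmeas cmu"
proof -
 have "(%z. \<Sum>i<n. (GG z (uv i))^2) : bmeas cmu" by (intro borel_measurable_sum borel_measurable_power GG_meas) auto
 thus ?thesis unfolding q_def L2_set_def by measurable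
qed

lemma hsF_meas: "(%z. hs_norm n (F z)) : bmeas cmu"
proof -
 have "(%z. \<Sum>i<n. (norm (F z (uv i)))^2) : bmeas cmu" by (intro borel_measurable_sum borel_measurable_power measurable_compose[OF F_meas borel_measurable_norm]) auto
 thus ?thesis unfolding hs_norm_L2 L2_set_def by measurable
qed

definition dx :: "vec => real" where "dx z = (\<Sum>i<n. \<bar>Deriv n xi z (uv i)\<bar>)"

lemma DX_le: "j < n ==> \<bar>DX z (uv j)\<bar> <= dx z"
proof -
 assume j: "j < n"
 have "DX z (uv j) = (\<Sum>i<n. Deriv n xi z (uv i)*P j i z)"
  unfolding DX_def
 proof (rule sum.cong[OF refl])
  fix i
  have "(\<Sum>k<n. Deriv n xi z (uv i)*lk (uv j) k*P k i z) = (\<Sum>k<n. if k = j then Deriv n xi z (uv i)*P j i z else 0)" by (rule sum.cong) auto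
  thus "(\<Sum>k<n. Deriv n xi z (uv i)*lk (uv j) k*P k i z) = Deriv n xi z (uv i)*P j i z" using j by simp
 qed
 hence "\<bar>DX z (uv j)\<bar> <= (\<Sum>i<n. \<bar>Deriv n xi z (uv i)*P j i z\<bar>)" by (simp add: sum_abs)
 also have "... <= dx z" unfolding dx_def by (intro sum_mono) (simp add: abs_mult P_le mult_left_le)
 finally show ?thesis .
qed

text \<open>The first summand vanishes where \<open>\<bar>f\<bar> > s\<close>; this is what makes it integrable.\<close>

lemma q_le:
 assumes z: "z : U"
 shows "q z <= \<bar>xi z\<bar>*(L2_set (%i. Deriv l eta (f z) (F z (uv i))) {..<n})+\<bar>u z\<bar>*(real n*dx z)"
proof -
 have "q z <= L2_set (%i. xi z*Deriv l eta (f z) (F z (uv i))) {..<n} + L2_set (%i. u z*DX z (uv i)) {..<n}"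
  unfolding q_def GG_def by (rule L2_set_triangle_ineq)
 also have "L2_set (%i. xi z*Deriv l eta (f z) (F z (uv i))) {..<n} = \<bar>xi z\<bar>*L2_set (%i. Deriv l eta (f z) (F z (uv i))) {..<n}" by (simp add: L2_set_def power_mult_distrib real_sqrt_mult flip: sum_distrib_left)
 also have "L2_set (%i. u z*DX z (uv i)) {..<n} = \<bar>u z\<bar>*L2_set (%i. DX z (uv i)) {..<n}" by (simp add: L2_set_def power_mult_distrib real_sqrt_mult flip: sum_distrib_left)
 also have "L2_set (%i. DX z (uv i)) {..<n} <= (\<Sum>i<n. \<bar>DX z (uv i)\<bar>)" by (rule L2_set_le_sum_abs)
 also have "... <= (\<Sum>i<n. dx z)" by (intro sum_mono DX_le) auto
 finally show ?thesis by (simp add: mult_left_mono)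
qed

lemma L2_DetaF:
 assumes z: "z : U"
 shows "L2_set (%i. Deriv l eta (f z) (F z (uv i))) {..<n} <= \<bar>Bd\<bar>*hs_norm n (F z)"
  "s < norm (f z)==>L2_set (%i. Deriv l eta (f z) (F z (uv i))) {..<n} = 0"
proof -
 have "L2_set (%i. Deriv l eta (f z) (F z (uv i))) {..<n} = L2_set (%i. \<bar>Deriv l eta (f z) (F z (uv i))\<bar>) {..<n}" by (simp add: L2_set_def)
 also have "... <= L2_set (%i. \<bar>Bd\<bar>*norm (F z (uv i))) {..<n}"
 proof (rule L2_set_mono)
  fix i assume "i : {..<n}"
  hence "\<bar>Deriv l eta (f z) (F z (uv i))\<bar> <= Bd*norm (F z (uv i))" using Bd[OF z F_R[OF z]] by simp
  also have "... <= \<bar>Bd\<bar>*norm (F z (uv i))" by (intro mult_right_mono) auto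
  finally show "\<bar>Deriv l eta (f z) (F z (uv i))\<bar> <= \<bar>Bd\<bar>*norm (F z (uv i))" .
 qed auto
 also have "... = \<bar>Bd\<bar>*hs_norm n (F z)" unfolding hs_norm_L2 by (simp add: L2_set_right_distrib)
 finally show "L2_set (%i. Deriv l eta (f z) (F z (uv i))) {..<n} <= \<bar>Bd\<bar>*hs_norm n (F z)" .
 show "L2_set (%i. Deriv l eta (f z) (F z (uv i))) {..<n} = 0" if "s < norm (f z)"
  using s[OF z that F_R[OF z]] by (simp add: L2_set_def)
qed

lemma hsF_integrable:
 assumes C: "compact C" "C <= U"
 shows "integrable cmu (%z. ind (C Int {z\<in>U. norm (f z) <= \<bar>s\<bar>}) z*hs_norm n (F z))"
proof (rule integrableI_bounded)
 have fm: "{z\<in>U. norm (f z) <= \<bar>s\<bar>} : sets cmu"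
 proof -
  have "(%z. norm (f z)) : bmeas cmu" using measurable_compose[OF f_cmu borel_measurable_norm] .
  hence "{z\<in>space cmu. norm (f z) <= \<bar>s\<bar>} : sets cmu" by measurable
  thus ?thesis by simp
 qed
 have "C : sets mu" using C borel_closed[OF compact_imp_closed[OF C(1)]] by (simp add: in_sets_mu)
 hence Cm: "C Int {z\<in>U. norm (f z) <= \<bar>s\<bar>} : sets cmu" using fm by auto
 show "(%z. ind (C Int {z\<in>U. norm (f z) <= \<bar>s\<bar>}) z*hs_norm n (F z)) : bmeas cmu"
  using Cm by (intro borel_measurable_times hsF_meas borel_measurable_indicator)
 have "(\<integral>\<^sup>+z. enn (norm (ind (C Int {z\<in>U. norm (f z) <= \<bar>s\<bar>}) z*hs_norm n (F z))) \<partial>cmu)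
   = (\<integral>\<^sup>+z\<in>C Int {z. norm (f z) <= \<bar>s\<bar>}. enn (hs_norm n (F z)) \<partial>cmu)" by (rule nn_integral_cong) (use C in "auto simp: indicator_def hs_norm_L2")
 also have "... < \<infinity>" by (rule F_int[OF C]) simp
 finally show "(\<integral>\<^sup>+z. enn (norm (ind (C Int {z\<in>U. norm (f z) <= \<bar>s\<bar>}) z*hs_norm n (F z))) \<partial>cmu) < \<infinity>" .
qed

lemma xi_bounds: "EX C B. compact C & C <= U & 0 <= B & (ALL z. z ~: C --> xi z = 0) & (ALL z:U. \<bar>xi z\<bar> <= B) & (ALL z:U. \<bar>dx z\<bar> <= B)
  & (ALL z:U. z ~: C --> dx z = 0)"
proof -
 obtain C where C: "compact C" "C <= U" "!!z. z ~: C ==> xi z = 0" "smooth n U xi" by (rule CscE[OF xi]) (rule that; assumption)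
 have d0: "dx z = 0" if "z : U" "z ~: C" for z
  unfolding dx_def using Deriv_zero_off[OF C(1,2) _ that, of xi] C(3) by simp
 have dc: "continuous_on U dx" unfolding dx_def by (intro continuous_intros smooth_continuous[OF smooth_Deriv[OF C(4)]]) auto
 have "EX B. ALL z:U. \<bar>dx z\<bar> <= B" by (rule smooth_cs_bounded[OF C(1,2) d0 dc])
 then obtain B1 where B1: "ALL z:U. \<bar>dx z\<bar> <= B1" ..
 have "EX B. ALL z:U. \<bar>xi z\<bar> <= B" by (rule smooth_cs_bounded[OF C(1,2) C(3) smooth_continuous[OF C(4)]])
 then obtain B2 where B2: "ALL z:U. \<bar>xi z\<bar> <= B2" ..
 show ?thesis using C d0 B1 B2 by (intro exI[of _ C] exI[of _ "\<bar>B1\<bar>+\<bar>B2\<bar>"]) fastforce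
qed

lemma dx_nonneg: "0 <= dx z" by (simp add: dx_def sum_nonneg)

text \<open>On the compact support of \<open>xi\<close>, the part with F is controlled by the
  integrability of F over the set where f has norm at most |s|, and the part with the differential
  of \<open>xi\<close> is bounded.\<close>

lemma q_integrable: "integrable cmu q"
proof -
 obtain C B where C: "compact C" "C <= U" "0 <= B" "ALL z. z ~: C --> xi z = 0" "ALL z:U. \<bar>xi z\<bar> <= B" "ALL z:U. \<bar>dx z\<bar> <= B"
  "ALL z:U. z ~: C --> dx z = 0" using xi_bounds by (elim exE conjE)
 have Cm: "C : sets mu" using C borel_closed[OF compact_imp_closed[OF C(1)]] by (simp add: in_sets_mu)
 let ?D = "C Int {z\<in>U. norm (f z) <= \<bar>s\<bar>}"
 have "integrable cmu (%z. B*\<bar>Bd\<bar>*(ind ?D z*hs_norm n (F z))+\<bar>Bu\<bar>*(real n*B)*ind C z)"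
  using Cm mu_compact[OF C(1,2)] by (intro Bochner_Integration.integrable_add integrable_mult_right hsF_integrable C integrable_real_indicator) auto
 thus ?thesis
 proof (rule Bochner_Integration.integrable_bound[OF _ q_meas])
  show "AE z in cmu. norm (q z) <= norm (B*\<bar>Bd\<bar>*(ind ?D z*hs_norm n (F z))+\<bar>Bu\<bar>*(real n*B)*ind C z)"
  proof (rule AE_I2)
   fix z assume "z : space cmu"
   hence z: "z : U" by simp
   let ?L = "L2_set (%i. Deriv l eta (f z) (F z (uv i))) {..<n}"
   have hs0: "0 <= hs_norm n (F z)" by (simp add: hs_norm_L2)
   have 1: "\<bar>xi z\<bar>*?L <= B*\<bar>Bd\<bar>*(ind ?D z*hs_norm n (F z))"
   proof (cases "z : ?D")
    case True
    have "\<bar>xi z\<bar>*?L <= B*(\<bar>Bd\<bar>*hs_norm n (F z))" using C z L2_DetaF(1)[OF z] by (intro mult_mono) auto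
    thus ?thesis using True by simp
   next
    case False
    hence "xi z = 0 \<or> s < norm (f z)" using z C(4) by auto
    thus ?thesis using L2_DetaF(2)[OF z] C(3) hs0 by auto
   qed
   have 2: "\<bar>u z\<bar>*(real n*dx z) <= \<bar>Bu\<bar>*(real n*B)*ind C z"
   proof (cases "z : C")
    case True
    have "\<bar>u z\<bar>*(real n*dx z) <= \<bar>Bu\<bar>*(real n*B)"
    proof (intro mult_mono)
     show "\<bar>u z\<bar> <= \<bar>Bu\<bar>" using Bu[OF z] by (simp add: u_def)
     show "dx z <= B" using C(6) z by force
    qed (auto simp: dx_nonneg)
    thus ?thesis using True by simp
   qed (use C z in simp)
   have "0 <= B*\<bar>Bd\<bar>*(ind ?D z*hs_norm n (F z))+\<bar>Bu\<bar>*(real n*B)*ind C z" using C(3) hs0 by simp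
   thus "norm (q z) <= norm (B*\<bar>Bd\<bar>*(ind ?D z*hs_norm n (F z))+\<bar>Bu\<bar>*(real n*B)*ind C z)"
    using q_le[OF z] 1 2 q_nonneg[of z] by simp
  qed
 qed
qed

lemma th_facts:
 assumes th: "th : Ccinf n U n"
 shows "EX B. 0 <= B & (ALL z. norm (th z) <= B)" "th z : Rn n" "(%z. lk (th z) i) : bmeas cmu" "(%z. lk (th z) i) : bmeas cnu"
proof -
 obtain C where C: "compact C" "C <= U" "!!z. z ~: C ==> th z = 0" "smooth n U th" "!!z. th z : Rn n" by (rule CcinfE[OF th]) (rule that; assumption)
 show "th z : Rn n" by (rule C)
 show "(%z. lk (th z) i) : bmeas cmu" "(%z. lk (th z) i) : bmeas cnu" by (intro cont_cmeas vd.measurable_cM_cont continuous_lk smooth_continuous[OF C(4)])+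
 show "EX B. 0 <= B & (ALL z. norm (th z) <= B)" using vd.Ccinf_bounded[OF th] by metis
qed

lemma GGth_integrable:
 assumes th: "th : Ccinf n U n" and r: "r : bmeas cmu" "!!z. z : U ==> \<bar>r z\<bar> <= R"
 shows "integrable cmu (%z. r z*GG z (th z))"
proof -
 obtain B where B: "0 <= B" "ALL z. norm (th z) <= B" using th_facts(1)[OF th] by (elim exE conjE)
 have "integrable cmu (%z. \<bar>R\<bar>*B*q z)" by (intro integrable_mult_right q_integrable)
 thus ?thesis
 proof (rule Bochner_Integration.integrable_bound)
  have "(%z. r z*(\<Sum>i<n. lk (th z) i*GG z (uv i))) : bmeas cmu" by (intro borel_measurable_times borel_measurable_sum r th_facts[OF th] GG_meas) auto
  thus "(%z. r z*GG z (th z)) : bmeas cmu" by (rule subst[OF measurable_cong, rotated]) (use GG_expand th_facts(2)[OF th] in simp)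
  show "AE z in cmu. norm (r z*GG z (th z)) <= norm (\<bar>R\<bar>*B*q z)"
  proof (rule AE_I2)
   fix z assume "z : space cmu"
   hence z: "z : U" by simp
   have "\<bar>GG z (th z)\<bar> <= q z*norm (th z)" by (rule GG_q[OF z th_facts(2)[OF th]])
   also have "... <= B*q z" using B q_nonneg by (simp add: mult.commute mult_right_mono)
   finally have "\<bar>r z\<bar>*\<bar>GG z (th z)\<bar> <= \<bar>R\<bar>*(B*q z)" using r(2)[OF z] by (intro mult_mono) auto
   thus "norm (r z*GG z (th z)) <= norm (\<bar>R\<bar>*B*q z)" using B q_nonneg by (simp add: abs_mult mult.assoc)
  qed
 qed
qed

lemma L1v_mult:
 assumes th: "th : Ccinf n U n" and r: "r : bmeas cnu" "!!z. z : U ==> \<bar>r z\<bar> <= R"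
 shows "vd.L1v (%z. r z *\<^sub>R th z)"
proof -
 obtain C where C: "compact C" "C <= U" "!!z. z ~: C ==> th z = 0" "smooth n U th" "!!z. th z : Rn n" by (rule CcinfE[OF th]) (rule that; assumption)
 obtain B where B: "0 <= B" "ALL z. norm (th z) <= B" using th_facts(1)[OF th] by (elim exE conjE)
 show ?thesis
 proof (rule vd.L1v_boundedI[OF C(1,2), of _ "\<bar>R\<bar>*B"])
  show "norm (r z *\<^sub>R th z) <= \<bar>R\<bar>*B" if "z : U" for z
   unfolding norm_scaleR using r(2)[OF that] B by (intro mult_mono) auto
  show "(%z. lk (r z *\<^sub>R th z) i) : bmeas cnu" for i
   unfolding lk_scaleR by (intro borel_measurable_times r th_facts[OF th])
 qed (use C in auto)
qed

lemma w_meas: "w : bmeas cmu" "w : bmeas cnu"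
 unfolding w_def by (intro borel_measurable_times xi_meas u_meas)+

lemma w_bound: "EX R>0. ALL z:U. \<bar>w z\<bar> <= R"
proof -
 obtain C B where C: "compact C" "C <= U" "0 <= B" "ALL z. z ~: C --> xi z = 0" "ALL z:U. \<bar>xi z\<bar> <= B" "ALL z:U. \<bar>dx z\<bar> <= B"
  "ALL z:U. z ~: C --> dx z = 0" using xi_bounds by (elim exE conjE)
 have "\<bar>w z\<bar> <= B*\<bar>Bu\<bar>+1" if z: "z : U" for z
 proof -
  have "\<bar>w z\<bar> <= B*\<bar>Bu\<bar>" unfolding w_def abs_mult u_def using C z Bu[OF z] by (intro mult_mono) auto
  thus ?thesis by simp
 qed
 moreover have "B*\<bar>Bu\<bar>+1 > 0" using C by (simp add: add_nonneg_pos)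
 ultimately show ?thesis by blast
qed

lemma Deta_power: "y : Rn l==>v : Rn l==>Deriv l (%y. eta y ^ k) y v = real k*eta y ^ (k - 1)*Deriv l eta y v" by (rule Deriv_power[OF oR _ eta])

text \<open>The defining identity for f is tested with the k-th power of \<open>eta\<close> and the
  field \<open>xi^k theta\<close>. Since \<open>w^k\<close> is the product of the two powers,
  \<open>HS_product\<close> moves \<open>xi^k\<close> out of the field, and the derivatives of both
  powers combine to \<open>k * w^(k-1)\<close> times \<open>GG\<close>. No product rule for weak
  derivatives has to be assumed.\<close>

lemma E_power:
 assumes th: "th : Ccinf n U n"
 shows "ex (%z. w z ^ k *\<^sub>R th z) = (\<integral>p. w (fst p) ^ k*HS th p \<partial>cV)+(\<integral>z. (real k * w z ^ (k - 1))*GG z (th z) \<partial>cmu)"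
proof -
 have xik: "smooth n U (%z. xi z ^ k)" by (intro smooth_power U xi_smooth)
 have th': "(%z. xi z ^ k *\<^sub>R th z) : Ccinf n U n" by (rule Ccinf_mult[OF U xik th])
 have etak: "smooth l (Rn l) (%y. eta y ^ k)" by (intro smooth_power oR eta)
 \<comment> \<open>The derivative of a power of \<open>eta\<close> contains the derivative of
   \<open>eta\<close> as a factor, so the same compact set serves.\<close>
 have Ck': "EX C. compact C & C <= Rn l & (ALL y:Rn l - C. ALL v:Rn l. Deriv l (%y. eta y ^ k) y v = 0)"
 proof -
  obtain C where C: "compact C" "C <= Rn l" "ALL y:Rn l - C. ALL v:Rn l. Deriv l eta y v = 0" using etaC by blast
  have "Deriv l (%y. eta y ^ k) y v = 0" if "y : Rn l - C" "v : Rn l" for y v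
   using Deta_power[of y v k] C(3) that by simp
  thus ?thesis using C(1,2) by (intro exI[of _ C]) simp
 qed
 obtain R where R: "R > 0" "ALL z:U. \<bar>w z\<bar> <= R" using w_bound by blast
 have ub: "\<bar>u z ^ k\<bar> <= \<bar>Bu\<bar> ^ k" if "z : U" for z
  unfolding power_abs using Bu[OF that] by (intro power_mono) (auto simp: u_def)
 have wb: "\<bar>u z ^ k*xi z ^ k\<bar> <= R ^ k" if "z : U" for z
 proof -
  have "u z ^ k*xi z ^ k = w z ^ k" by (simp add: w_def power_mult_distrib)
  thus ?thesis using R that by (simp add: power_abs power_mono)
 qed
 have um: "(%z. u z ^ k) : bmeas cmu" by (intro borel_measurable_power u_meas)
 have "ex (%z. w z ^ k *\<^sub>R th z) = ex (%z. eta (f z) ^ k *\<^sub>R (xi z ^ k *\<^sub>R th z))" by (simp add: w_def u_def power_mult_distrib mult.commute)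
 also have "... = (\<integral>p. u (fst p) ^ k*HS (%z. xi z ^ k *\<^sub>R th z) p \<partial>cV)+(\<integral>z. Deriv l (%y. eta y ^ k) (f z) (F z (xi z ^ k *\<^sub>R th z)) \<partial>cmu)"
  using F_eq[OF th' etak Ck'] by (simp add: u_def)
 also have "(\<integral>p. u (fst p) ^ k*HS (%z. xi z ^ k *\<^sub>R th z) p \<partial>cV) = (\<integral>p. (u (fst p) ^ k*xi (fst p) ^ k)*HS th p \<partial>cV)
  + (\<integral>z. u z ^ k*(\<Sum>i<n. \<Sum>j<n. Deriv n (%z. xi z ^ k) z (uv i)*lk (th z) j*P j i z) \<partial>cmu)" by (rule HS_product[OF th xik um ub wb])
 also have "(\<integral>p. (u (fst p) ^ k*xi (fst p) ^ k)*HS th p \<partial>cV) = (\<integral>p. w (fst p) ^ k*HS th p \<partial>cV)" by (simp add: w_def power_mult_distrib mult.commute)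
 finally have main: "ex (%z. w z ^ k *\<^sub>R th z) = (\<integral>p. w (fst p) ^ k*HS th p \<partial>cV)
   + ((\<integral>z. u z ^ k*(\<Sum>i<n. \<Sum>j<n. Deriv n (%z. xi z ^ k) z (uv i)*lk (th z) j*P j i z) \<partial>cmu)
   + (\<integral>z. Deriv l (%y. eta y ^ k) (f z) (F z (xi z ^ k *\<^sub>R th z)) \<partial>cmu))" by simp
 let ?c = "%z. real k * w z ^ (k - 1)"
 have e1: "u z ^ k*(\<Sum>i<n. \<Sum>j<n. Deriv n (%z. xi z ^ k) z (uv i)*lk (th z) j*P j i z) = ?c z*(u z*DX z (th z))" if z: "z : U" for z
 proof (cases k)
  case 0
  have "Deriv n (%z. xi z ^ k) z (uv i) = 0" if "i < n" for i using Deriv_power[OF U z xi_smooth, of "uv i" k] that 0 by simp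
  thus ?thesis using 0 by simp
 next
  case (Suc k')
  have "Deriv n (%z. xi z ^ k) z (uv i) = real k*xi z ^ k'*Deriv n xi z (uv i)" if "i < n" for i
   using Deriv_power[OF U z xi_smooth, of "uv i" k] that Suc by simp
  hence "(\<Sum>i<n. \<Sum>j<n. Deriv n (%z. xi z ^ k) z (uv i)*lk (th z) j*P j i z) = real k*xi z ^ k'*DX z (th z)"
   unfolding DX_def sum_distrib_left by (intro sum.cong refl) (simp add: mult.assoc)
  thus ?thesis using Suc by (simp add: w_def power_mult_distrib algebra_simps)
 qed
 have e2: "Deriv l (%y. eta y ^ k) (f z) (F z (xi z ^ k *\<^sub>R th z)) = ?c z*(xi z*Deriv l eta (f z) (F z (th z)))" if z: "z : U" for z
 proof -
  have R: "F z (th z) : Rn l" by (rule F_R[OF z th_facts(2)[OF th]])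
  have "F z (xi z ^ k *\<^sub>R th z) = xi z ^ k *\<^sub>R F z (th z)" by (rule linear_scale[OF F_lin[OF z]])
  hence "Deriv l (%y. eta y ^ k) (f z) (F z (xi z ^ k *\<^sub>R th z)) = real k*u z ^ (k - 1)*(xi z ^ k*Deriv l eta (f z) (F z (th z)))"
   using Deta_power[OF fR[OF z], of "xi z ^ k *\<^sub>R F z (th z)"] R by (simp add: u_def linear_scale[OF lin_Deta[OF z]] Rn_scaleR)
  thus ?thesis by (cases k) (simp_all add: w_def power_mult_distrib algebra_simps)
 qed
 have cm: "?c : bmeas cmu" by (intro borel_measurable_times borel_measurable_const borel_measurable_power w_meas)
 have cb: "\<bar>?c z\<bar> <= real k*R ^ (k - 1)" if "z : U" for z
  unfolding abs_mult power_abs using R that by (intro mult_mono power_mono) auto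
 have iG: "integrable cmu (%z. ?c z*GG z (th z))" by (rule GGth_integrable[OF th cm cb])
 have iX: "integrable cmu (%z. ?c z*(u z*DX z (th z)))"
 proof -
  obtain C B where C: "compact C" "C <= U" "0 <= B" "ALL z. z ~: C --> xi z = 0" "ALL z:U. \<bar>xi z\<bar> <= B" "ALL z:U. \<bar>dx z\<bar> <= B"
   "ALL z:U. z ~: C --> dx z = 0" using xi_bounds by (elim exE conjE)
  obtain B' where B': "0 <= B'" "ALL z. norm (th z) <= B'" using th_facts(1)[OF th] by (elim exE conjE)
  have DXe: "DX z (th z) = (\<Sum>i<n. lk (th z) i*DX z (uv i))" for z
  proof -
   have lin: "linear (DX z)" unfolding DX_def by (rule linearI) (simp_all add: algebra_simps sum.distrib sum_distrib_left)
   have "DX z (th z) = DX z (\<Sum>i<n. lk (th z) i *\<^sub>R uv i)" using Rn_expand[OF th_facts(2)[OF th, of z]] by simp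
   thus ?thesis by (simp add: linear_sum[OF lin] linear_scale[OF lin])
  qed
  have DXb: "\<bar>DX z (th z)\<bar> <= (\<Sum>i<n. B'*dx z)" for z
   unfolding DXe
  proof (rule order_trans[OF sum_abs], rule sum_mono)
   fix i assume "i : {..<n}"
   moreover have "\<bar>lk (th z) i\<bar> <= B'" using abs_lk_le_norm[of "th z" i] B'(2) by (meson order_trans)
   ultimately show "\<bar>lk (th z) i*DX z (uv i)\<bar> <= B'*dx z" unfolding abs_mult using DX_le B'(1) by (intro mult_mono) auto
  qed
  show ?thesis
  proof (rule integrable_boundedI[OF C(1,2)])
   show "?c z*(u z*DX z (th z)) = 0" if "z : U" "z ~: C" for z using DXb[of z] C(7) that by simp
   show "\<bar>?c z*(u z*DX z (th z))\<bar> <= (real k*R ^ (k - 1))*(\<bar>Bu\<bar>*(real n*(B'*B)))" if z: "z : U" for z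
   proof -
    have "dx z <= B" using C(6) z by force
    hence "\<bar>DX z (th z)\<bar> <= real n*(B'*B)" using DXb[of z] B'(1) mult_left_mono[OF mult_left_mono[of "dx z" B B'], of "real n"] by simp
    moreover have "\<bar>u z\<bar> <= \<bar>Bu\<bar>" using Bu[OF z] by (simp add: u_def)
    ultimately show ?thesis unfolding abs_mult[of "?c z"] abs_mult[of "u z"] using cb[OF z] R by (intro mult_mono) auto
   qed
   have "(%z. \<Sum>i<n. lk (th z) i*DX z (uv i)) : bmeas cmu" by (intro borel_measurable_sum borel_measurable_times th_facts[OF th] DX_meas)
   hence "(%z. DX z (th z)) : bmeas cmu" by (simp add: DXe)
   thus "(%z. ?c z*(u z*DX z (th z))) : bmeas cmu" by (intro borel_measurable_times cm u_meas)
  qed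
 qed
 have iD: "integrable cmu (%z. ?c z*(xi z*Deriv l eta (f z) (F z (th z))))"
  using Bochner_Integration.integrable_diff[OF iG iX] by (simp add: GG_def algebra_simps)
 have "(\<integral>z. u z ^ k*(\<Sum>i<n. \<Sum>j<n. Deriv n (%z. xi z ^ k) z (uv i)*lk (th z) j*P j i z) \<partial>cmu)
   + (\<integral>z. Deriv l (%y. eta y ^ k) (f z) (F z (xi z ^ k *\<^sub>R th z)) \<partial>cmu)
   = (\<integral>z. ?c z*(u z*DX z (th z)) \<partial>cmu)+(\<integral>z. ?c z*(xi z*Deriv l eta (f z) (F z (th z))) \<partial>cmu)" by (intro arg_cong2[where f = "(+)"] Bochner_Integration.integral_cong refl) (simp_all add: e1 e2)
 also have "... = (\<integral>z. ?c z*(u z*DX z (th z)) + ?c z*(xi z*Deriv l eta (f z) (F z (th z))) \<partial>cmu)" by (rule Bochner_Integration.integral_add[OF iX iD, symmetric])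
 also have "... = (\<integral>z. ?c z*GG z (th z) \<partial>cmu)" by (simp add: GG_def algebra_simps)
 finally show ?thesis using main by simp
qed

lemma ex_sum: "finite I==>(!!i. i : I==>vd.L1v (g i))==>vd.L1v (%z. \<Sum>i\<in>I. g i z) & ex (%z. \<Sum>i\<in>I. g i z) = (\<Sum>i\<in>I. ex (g i))"
proof (induction I rule: finite_induct)
 case empty
 have "vd.L1v (%z. 0)" by (simp add: vd.L1v_def)
 moreover have "ex (%z. 0) = 0" using vd.ext_Ccinf[OF Ccinf_zero[OF U]] vd.T_zero by simp
 ultimately show ?case by simp
next
 case (insert i I) thus ?case by (simp add: vd.ext_add vd.L1v_add)
qed

lemma E_poly:
 assumes th: "th : Ccinf n U n"
 shows "ex (%z. (\<Sum>k\<le>N. a k * w z ^ k) *\<^sub>R th z) = (\<integral>p. (\<Sum>k\<le>N. a k * w (fst p) ^ k)*HS th p \<partial>cV)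
  + (\<integral>z. (\<Sum>k\<le>N. a k*(real k * w z ^ (k - 1)))*GG z (th z) \<partial>cmu)"
proof -
 obtain R where R: "R > 0" "ALL z:U. \<bar>w z\<bar> <= R" using w_bound by blast
 have wb: "\<bar>w z ^ k\<bar> <= R ^ k" if "z : U" for z k using R that by (simp add: power_abs power_mono)
 have wm: "(%z. w z ^ k) : bmeas cmu" "(%z. w z ^ k) : bmeas cnu" for k by (intro borel_measurable_power w_meas)+
 have L: "vd.L1v (%z. w z ^ k *\<^sub>R th z)" for k by (rule L1v_mult[OF th wm(2) wb])
 have i1: "integrable cV (%p. w (fst p) ^ k*HS th p)" for k by (rule HS_expand(1)[OF th wm(1) wb])
 have i2: "integrable cmu (%z. (real k * w z ^ (k - 1))*GG z (th z))" for k
 proof (rule GGth_integrable[OF th, of _ "real k*R ^ (k - 1)"])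
  show "(%z. real k * w z ^ (k - 1)) : bmeas cmu" by (intro borel_measurable_times borel_measurable_const wm)
  show "\<bar>real k * w z ^ (k - 1)\<bar> <= real k*R ^ (k - 1)" if "z : U" for z
   unfolding abs_mult abs_of_nat by (intro mult_left_mono wb that) simp
 qed
 have "ex (%z. (\<Sum>k\<le>N. a k * w z ^ k) *\<^sub>R th z) = ex (%z. \<Sum>k\<le>N. a k *\<^sub>R (w z ^ k *\<^sub>R th z))" by (simp add: scaleR_sum_left)
 also have "... = (\<Sum>k\<le>N. a k*ex (%z. w z ^ k *\<^sub>R th z))"
  using ex_sum[of "{..N}" "%k z. a k *\<^sub>R (w z ^ k *\<^sub>R th z)"] vd.L1v_scale[OF L] vd.ext_scale[OF L] by simp
 also have "... = (\<Sum>k\<le>N. (\<integral>p. a k*(w (fst p) ^ k*HS th p) \<partial>cV)+(\<integral>z. a k*((real k * w z ^ (k - 1))*GG z (th z)) \<partial>cmu))" by (intro sum.cong refl) (simp add: E_power[OF th] distrib_left)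
 also have "... = (\<integral>p. (\<Sum>k\<le>N. a k*(w (fst p) ^ k*HS th p)) \<partial>cV)+(\<integral>z. (\<Sum>k\<le>N. a k*((real k * w z ^ (k - 1))*GG z (th z))) \<partial>cmu)"
  unfolding sum.distrib by (subst (1 2) Bochner_Integration.integral_sum) (use i1 i2 in auto)
 finally show ?thesis by (simp add: sum_distrib_right mult.assoc)
qed

end

section \<open>Polynomial approximation in C^1 and difference quotients of measures\<close>

text \<open>Weierstrass approximation of the derivative, followed by integration from 0. The error
  of the primitive is at most R times that of the derivative, whence the choice of
  \<open>e'\<close>.\<close>

lemma C1_approx:
 fixes ps ps' :: "real => real"
 assumes d: "!!x. (ps hrd ps' x) (at x)" and c: "continuous_on UNIV ps'" and R: "R > 0" and e: "e > 0"
 shows "EX N a. ALL x. \<bar>x\<bar> <= R --> \<bar>ps x - (\<Sum>k\<le>N. a k*x ^ k)\<bar> <= e &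
  \<bar>ps' x - (\<Sum>k\<le>N. a k*(real k*x ^ (k - 1)))\<bar> <= e"
proof -
 define e' where "e' = min e (e/R)"
 have e': "e' > 0" "e' <= e" "e'*R <= e" using e R by (auto simp: e'_def min_def field_simps)
 obtain p where p: "real_polynomial_function p" "!!x. x : cball 0 R ==> \<bar>ps' x - p x\<bar> < e'"
  using Stone_Weierstrass_real_polynomial_function[of "cball 0 R" ps' e'] c e' continuous_on_subset by (metis compact_cball top_greatest)
 obtain b n where b: "p = (%x. \<Sum>i\<le>n. b i*x ^ i)" using p(1) real_polynomial_function_iff_sum by blast
 define a where "a k = (case k of 0 => ps 0 | Suc i => b i/real (Suc i))" for k
 define Q where "Q x = (\<Sum>k\<le>Suc n. a k*x ^ k)" for x
 have Q': "(\<Sum>k\<le>Suc n. a k*(real k*x ^ (k - 1))) = p x" for x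
  unfolding b by (subst sum.atMost_Suc_shift) (simp add: a_def del: of_nat_Suc)
 have dQ: "(Q hrd p x) (at x)" for x
 proof -
  have "(Q hrd (\<Sum>k\<le>Suc n. a k*(real k*x ^ (k - 1)))) (at x)"
   unfolding Q_def by (intro DERIV_sum DERIV_cmult) (auto intro!: derivative_eq_intros)
  thus ?thesis by (simp only: Q')
 qed
 have Q0: "Q 0 = ps 0" unfolding Q_def by (subst sum.atMost_Suc_shift) (simp add: a_def)
 have "\<bar>ps x - Q x\<bar> <= e" if x: "\<bar>x\<bar> <= R" for x
 proof -
  have "norm ((%x. ps x - Q x) x - (%x. ps x - Q x) 0) <= e'*norm (x - 0)"
  proof (rule field_differentiable_bound[of "cball 0 R" _ "%x. ps' x - p x"])
   show "((%x. ps x - Q x) has_field_derivative ps' y - p y) (at y within cball 0 R)" if "y : cball 0 R" for y by (rule has_field_derivative_at_within[OF DERIV_diff[OF d dQ]])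
   show "norm (ps' y - p y) <= e'" if "y : cball 0 R" for y using p(2)[OF that] by simp
  qed (use x R in auto)
  also have "... <= e'*R" using x e'(1) by (intro mult_left_mono) auto
  also have "... <= e" by (rule e'(3))
  finally show ?thesis by (simp add: Q0)
 qed
 moreover have "\<bar>ps' x - p x\<bar> <= e" if "\<bar>x\<bar> <= R" for x using p(2)[of x] that e'(2) by simp
 ultimately have "ALL x. \<bar>x\<bar> <= R --> \<bar>ps x - Q x\<bar> <= e & \<bar>ps' x - p x\<bar> <= e" by blast
 thus ?thesis unfolding Q_def Q'[symmetric] by blast
qed

text \<open>Fatou's lemma replaces the almost everywhere differentiability of monotone functions.\<close>

lemma liminf_quotient_finite:
 assumes "finite_measure kp" and sb: "sets kp = sets borel"
 shows "AE t in lborel. liminf (%k. enn (real (Suc k))*emeas kp {t<..t+1/real (Suc k)}) < \<infinity>"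
proof -
 interpret kp: finite_measure kp by fact
 interpret pr: pair_sigma_finite kp "lborel :: real measure" ..
 define \<Phi> where "\<Phi> k t = (\<integral>\<^sup>+x. enn (real (Suc k))*ind {p. snd p < fst p & fst p <= snd p+1/real (Suc k)} (x, t) \<partial>kp)" for k and t :: real
 have ms: "sets (kp \<Otimes>\<^sub>M (lborel :: real measure)) = sets (borel \<Otimes>\<^sub>M borel)" by (rule sets_pair_measure_cong) (auto simp: sb)
 have st: "{p :: real \<times> real. snd p < fst p & fst p <= snd p+1/real (Suc k)} : sets (borel \<Otimes>\<^sub>M borel)" for k
 proof -
  have "{p : space (borel \<Otimes>\<^sub>M borel). snd p < (fst p :: real) & fst p <= snd p+1/real (Suc k)} : sets (borel \<Otimes>\<^sub>M borel)" by measurable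
  thus ?thesis by (simp add: space_pair_measure)
 qed
 have m: "(%p. enn (real (Suc k))*ind {p. snd p < fst p & fst p <= snd p+1/real (Suc k)} p) : bmeas (kp \<Otimes>\<^sub>M (lborel :: real measure))" for k
  using st[of k] by (intro borel_measurable_times_ennreal borel_measurable_const borel_measurable_indicator) (simp only: ms)
 have \<Phi>e: "\<Phi> k t = enn (real (Suc k))*emeas kp {t<..t+1/real (Suc k)}" for k t
 proof -
  have "\<Phi> k t = (\<integral>\<^sup>+x. enn (real (Suc k))*ind {t<..t+1/real (Suc k)} x \<partial>kp)"
   unfolding \<Phi>_def by (intro nn_integral_cong) (simp add: indicator_def)
  thus ?thesis by (simp add: nn_integral_cmult_indicator sb)
 qed
 have \<Phi>m: "\<Phi> k : bmeas lborel" for k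
 proof -
  let ?S = "{p :: real \<times> real. fst p < snd p & snd p <= fst p+1/real (Suc k)}"
  have "{p : space (borel \<Otimes>\<^sub>M borel). fst p < (snd p :: real) & snd p <= fst p+1/real (Suc k)} : sets (borel \<Otimes>\<^sub>M borel)" by measurable
  hence "?S : sets (borel \<Otimes>\<^sub>M borel)" by (simp add: space_pair_measure)
  moreover have "sets ((lborel :: real measure) \<Otimes>\<^sub>M kp) = sets (borel \<Otimes>\<^sub>M borel)" by (rule sets_pair_measure_cong) (auto simp: sb)
  ultimately have "(%p. enn (real (Suc k))*ind ?S p) : bmeas ((lborel :: real measure) \<Otimes>\<^sub>M kp)" by (intro borel_measurable_times_ennreal borel_measurable_const borel_measurable_indicator) (simp only:)
  from kp.borel_measurable_nn_integral_fst[OF this]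
  show ?thesis unfolding \<Phi>_def by (simp add: indicator_def)
 qed
 \<comment> \<open>By Fubini the difference quotients integrate to the total mass whatever k is,
   because each x is counted for the levels t in an interval of length 1/(k+1).\<close>
 have int: "(\<integral>\<^sup>+t. \<Phi> k t \<partial>lborel) <= emeas kp (space kp)" for k
 proof -
  have "(\<integral>\<^sup>+t. \<Phi> k t \<partial>lborel) = (\<integral>\<^sup>+x. \<integral>\<^sup>+t. enn (real (Suc k))*ind {p. snd p < fst p & fst p <= snd p+1/real (Suc k)} (x, t) \<partial>lborel \<partial>kp)"
   unfolding \<Phi>_def by (rule pr.Fubini[OF m])
  also have "... = (\<integral>\<^sup>+x. 1 \<partial>kp)"
  proof (rule nn_integral_cong)
   fix x
   have "(\<integral>\<^sup>+t. enn (real (Suc k))*ind {p. snd p < fst p & fst p <= snd p+1/real (Suc k)} (x, t) \<partial>lborel)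
    = (\<integral>\<^sup>+t. enn (real (Suc k))*ind {x - 1/real (Suc k)..<x} t \<partial>lborel)" by (intro nn_integral_cong) (auto simp: indicator_def)
   also have "... = enn (real (Suc k))*enn (1/real (Suc k))" by (simp add: nn_integral_cmult_indicator)
   also have "... = enn (real (Suc k)*(1/real (Suc k)))" by (rule ennreal_mult[symmetric]) auto
   also have "... = 1" by simp
   finally show "(\<integral>\<^sup>+t. enn (real (Suc k))*ind {p. snd p < fst p & fst p <= snd p+1/real (Suc k)} (x, t) \<partial>lborel) = 1" .
  qed
  finally show ?thesis by simp
 qed
 have "(\<integral>\<^sup>+t. liminf (%k. \<Phi> k t) \<partial>lborel) <= liminf (%k. \<integral>\<^sup>+t. \<Phi> k t \<partial>lborel)" by (rule nn_integral_liminf[OF \<Phi>m])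
 also have "... <= liminf (%k::nat. emeas kp (space kp))" using int by (intro Liminf_mono always_eventually) auto
 also have "... = emeas kp (space kp)" by (simp add: Liminf_const)
 also have "... < \<infinity>" using kp.emeasure_finite[of "space kp"] by (simp only: less_top infinity_ennreal_def)
 finally have "(\<integral>\<^sup>+t. liminf (%k. \<Phi> k t) \<partial>lborel) ~= \<infinity>" by simp
 moreover have "(%t. liminf (%k. \<Phi> k t)) : bmeas lborel" using \<Phi>m by measurable
 ultimately have "AE t in lborel. liminf (%k. \<Phi> k t) ~= \<infinity>" by (intro nn_integral_noteq_infinite)
 thus ?thesis by eventually_elim (simp add: \<Phi>e less_top)
qed

section \<open>Fundamental lemma of the calculus of variations for the weight\<close>

context vfold
begin

text \<open>Cutoffs concentrating on a compact set turn the hypothesis into vanishing of the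
  integrals of h over all compact sets. The measures with the positive and the negative part of h as
  densities then agree and are finite on compact sets. These generate the Borel sets and are stable
  under intersection, so the measures and hence their densities coincide.\<close>

lemma fundamental_lemma:
 fixes h :: "vec => real"
 assumes hm: "h : bmeas cmu" and hi: "!!C. compact C==>C <= U==>integrable cmu (%z. ind C z*h z)"
  and z: "!!phi. phi : Csc n U==>(\<integral>z. phi z*h z \<partial>cmu) = 0"
 shows "AE z in cmu. h z = 0"
proof -
 have int0: "(\<integral>z. ind C z*h z \<partial>cmu) = 0" if C: "compact C" "C <= U" for C
 proof -
  \<comment> \<open>The fixed cutoff \<open>phi0\<close> confines all approximations to one compact
    set K, on which h is integrable; this supplies the majorant for dominated convergence.\<close>
  obtain phi0 H0 where phi0: "phi0 : Csc n U" "!!x. 0 <= phi0 x" "!!x. phi0 x <= 1" "open H0" "C <= H0"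
   "!!x. x : H0 Int Rn n ==> phi0 x = 1" using cutoff[OF U C] by blast
  obtain K where K: "compact K" "K <= U" "ALL z. z ~: K --> phi0 z = 0" using phi0(1) unfolding Csc_def by auto
  define W where "W k = {x : U. EX c:C. dist x c < 1/real (Suc k)}" for k
  have oW: "opn n (W k)" for k
  proof -
   have "W k = U Int (\<Union>c\<in>C. ball c (1/real (Suc k)))" by (auto simp: W_def dist_commute)
   thus ?thesis using opn_Int_open[OF U, of "\<Union>c\<in>C. ball c (1/real (Suc k))"] by auto
  qed
  have CW: "C <= W k" for k
  proof
   fix x assume "x : C"
   moreover have "dist x x < 1/real (Suc k)" by simp
   ultimately show "x : W k" using C(2) unfolding W_def by blast
  qed
  have "EX phi. phi : Csc n (W k) & (ALL x. 0 <= phi x & phi x <= 1) & (ALL x:C. phi x = 1)" for k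
  proof -
   obtain phi H where phi: "phi : Csc n (W k)" "!!x. 0 <= phi x" "!!x. phi x <= 1" "open H" "C <= H"
    "!!x. x : H Int Rn n ==> phi x = 1" using cutoff[OF oW C(1) CW] by blast
   moreover have "C <= Rn n" using C(2) opn_subset[OF U] by blast
   ultimately show ?thesis by blast
  qed
  then obtain phi where phi: "!!k. phi k : Csc n (W k)" "!!k x. 0 <= phi k x" "!!k x. phi k x <= 1" "!!k x. x : C ==> phi k x = 1" by metis
  have phiU: "phi k : Csc n U" for k using Csc_mono[OF oW[of k] U] phi(1)[of k] by (auto simp: W_def)
  have pr: "(%z. phi k z*phi0 z) : Csc n U" for k
   using K smooth_mult[OF U, of "phi k" phi0] phiU[of k] phi0(1) by (intro CscI[of K]) (auto simp: Csc_def)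
  have lim: "(%k. phi k z*phi0 z*h z) \<longlonglongrightarrow> ind C z*h z" if zU: "z : U" for z
  proof (cases "z : C")
   case True
   hence "phi0 z = 1" using phi0(5,6) zU opn_mem[OF U] by blast
   thus ?thesis using True phi(4) by simp
  next
   case False
   have "open (- C)" using compact_imp_closed[OF C(1)] by auto
   then obtain d where d: "d > 0" "ball z d <= - C" using False open_contains_ball[of "- C"] by auto
   obtain N where N: "inverse (real (Suc N)) < d" using reals_Archimedean[OF d(1)] by auto
   have "phi k z = 0" if k: "k >= N" for k
   proof -
    have "1/real (Suc k) <= inverse (real (Suc N))" using k by (simp add: inverse_eq_divide frac_le)
    hence "z ~: W k" using d N by (auto simp: W_def subset_iff simp del: of_nat_Suc)
    thus ?thesis using phi(1)[of k] by (auto simp: Csc_def)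
   qed
   hence "eventually (%k. phi k z*phi0 z*h z = 0) sequentially" by (auto simp: eventually_sequentially)
   thus ?thesis using False by (simp add: tendsto_eventually)
  qed
  have hK: "integrable cmu (%z. \<bar>ind K z*h z\<bar>)" using hi[OF K(1,2)] by simp
  have "(%k. \<integral>z. phi k z*phi0 z*h z \<partial>cmu) \<longlonglongrightarrow> (\<integral>z. ind C z*h z \<partial>cmu)"
  proof (rule integral_dominated_convergence[OF _ _ hK])
   show "AE z in cmu. (%k. phi k z*phi0 z*h z) \<longlonglongrightarrow> ind C z*h z" by (rule AE_I2) (use lim in simp)
   show "(%z. ind C z*h z) : bmeas cmu" using hi[OF C] by auto
   show "(%z. phi k z*phi0 z*h z) : bmeas cmu" for k
    using pr[of k] smooth_continuous[of n U] by (intro borel_measurable_times[OF cont_cmeas hm]) (auto simp: Csc_def)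
   show "AE z in cmu. norm (phi k z*phi0 z*h z) <= \<bar>ind K z*h z\<bar>" for k
   proof (rule AE_I2)
    fix z
    have "\<bar>phi k z*phi0 z\<bar> <= ind K z" using phi(2,3)[of k z] phi0(2,3)[of z] K(3) by (cases "z : K") (auto intro: mult_le_one)
    thus "norm (phi k z*phi0 z*h z) <= \<bar>ind K z*h z\<bar>" unfolding real_norm_def abs_mult[of _ "h z"] by (intro mult_right_mono) auto
   qed
  qed
  moreover have "(\<integral>z. phi k z*phi0 z*h z \<partial>cmu) = 0" for k using z[OF pr[of k]] by simp
  ultimately have "(%k::nat. 0::real) \<longlonglongrightarrow> (\<integral>z. ind C z*h z \<partial>cmu)" by simp
  thus ?thesis by (simp only: LIMSEQ_const_iff)
 qed
 obtain h' where h': "h' : bmeas mu" "AE z in mu. h z = h' z" using completion_ex_borel_measurable_real[OF hm] by blast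
 have ae: "AE z in cmu. h z = h' z" by (rule AE_completion[OF h'(2)])
 have Cm: "C : sets mu" if "compact C" "C <= U" for C using that borel_closed[OF compact_imp_closed[OF that(1)]] by (simp add: in_sets_mu)
 have im: "(%z. ind C z*h' z) : bmeas mu" if "compact C" "C <= U" for C
  using Cm[OF that] h'(1) by (intro borel_measurable_times borel_measurable_indicator)
 have i': "integrable mu (%z. ind C z*h' z)" if C: "compact C" "C <= U" for C
 proof -
  have "integrable cmu (%z. ind C z*h' z)"
   using hi[OF C] by (rule integrable_cong_AE_imp[OF _ measurable_completion[OF im[OF C]]]) (use ae in eventually_elim, simp)
  thus ?thesis using im[OF C] by (simp add: integrable_completion)
 qed
 have int0': "(\<integral>z. ind C z*h' z \<partial>mu) = 0" if C: "compact C" "C <= U" for C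
 proof -
  have "(\<integral>z. ind C z*h' z \<partial>mu) = (\<integral>z. ind C z*h' z \<partial>cmu)" by (rule integral_completion[OF im[OF C], symmetric])
  also have "... = (\<integral>z. ind C z*h z \<partial>cmu)" by (rule integral_cong_AE[OF measurable_completion[OF im[OF C]]]) (use hi[OF C] ae in "auto elim: eventually_mono")
  finally show ?thesis using int0[OF C] by simp
 qed
 define p where "p z = enn (max 0 (h' z))" for z
 define m where "m z = enn (max 0 (- h' z))" for z
 have pm: "p : bmeas mu" "m : bmeas mu" unfolding p_def m_def using h'(1) by measurable
 have eq: "emeas (density mu p) C = emeas (density mu m) C & emeas (density mu p) C ~= \<infinity>" if C: "compact C" "C <= U" for C
 proof -
  have i1: "integrable mu (%z. ind C z*max 0 (h' z))" "integrable mu (%z. ind C z*max 0 (- h' z))"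
  proof -
   have "(%z. ind C z*max 0 (h' z)) : bmeas mu" "(%z. ind C z*max 0 (- h' z)) : bmeas mu"
    using Cm[OF C] h'(1) by (auto intro!: borel_measurable_times borel_measurable_indicator borel_measurable_max)
   thus "integrable mu (%z. ind C z*max 0 (h' z))" "integrable mu (%z. ind C z*max 0 (- h' z))"
    using Bochner_Integration.integrable_bound[OF i'[OF C]] by (auto simp: abs_mult intro!: AE_I2 Bochner_Integration.integrable_bound[OF i'[OF C]] mult_left_mono)
  qed
  have "(\<integral>z. ind C z*max 0 (h' z) \<partial>mu) - (\<integral>z. ind C z*max 0 (- h' z) \<partial>mu) = (\<integral>z. ind C z*h' z \<partial>mu)" by (subst Bochner_Integration.integral_diff[OF i1, symmetric]) (auto intro!: Bochner_Integration.integral_cong simp: max_def)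
  hence eqi: "(\<integral>z. ind C z*max 0 (h' z) \<partial>mu) = (\<integral>z. ind C z*max 0 (- h' z) \<partial>mu)" using int0'[OF C] by simp
  have "emeas (density mu p) C = (\<integral>\<^sup>+z. enn (ind C z*max 0 (h' z)) \<partial>mu)"
   using emeasure_density[OF pm(1) Cm[OF C]] by (simp add: p_def ennreal_mult'' ennreal_indicator mult.commute)
  also have "... = enn (\<integral>z. ind C z*max 0 (h' z) \<partial>mu)" using i1(1) by (intro nn_integral_eq_integral) auto
  finally have 1: "emeas (density mu p) C = enn (\<integral>z. ind C z*max 0 (h' z) \<partial>mu)" .
  have "emeas (density mu m) C = (\<integral>\<^sup>+z. enn (ind C z*max 0 (- h' z)) \<partial>mu)"
   using emeasure_density[OF pm(2) Cm[OF C]] by (simp add: m_def ennreal_mult'' ennreal_indicator mult.commute)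
  also have "... = enn (\<integral>z. ind C z*max 0 (- h' z) \<partial>mu)" using i1(2) by (intro nn_integral_eq_integral) auto
  finally show ?thesis using 1 eqi by simp
 qed
 let ?E = "{C. compact C & C <= U}"
 have gen: "sets (Rb U) = sigma_sets U ?E"
 proof
  have "sets (Rb U) = sigma_sets U ((\<inter>) U ` {S. open S})"
   using opn_borel[OF U] by (simp add: sets_restrict_space borel_def sigma_sets_Int sets_measure_of)
  also have "... <= sigma_sets U ?E"
  proof (rule sigma_algebra.sigma_sets_subset[OF sigma_algebra_sigma_sets], safe)
   fix S :: "vec set" assume "open S"
   hence "opn n (U Int S)" by (rule opn_Int_open[OF U])
   from opn_exhaust[OF this] obtain C where C: "!!k::nat. compact (C k)" "(\<Union>k. C k) = U Int S" by metis
   have "(\<Union>k. C k) : sigma_sets U ?E" using C by (intro sigma_sets.Union sigma_sets.Basic) blast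
   thus "U Int S : sigma_sets U ?E" using C by simp
  qed auto
  finally show "sets (Rb U) <= sigma_sets U ?E" .
  have "?E <= sets (Rb U)" using Cm by (auto simp: sets_mu)
  thus "sigma_sets U ?E <= sets (Rb U)" using sets.sigma_sets_subset[of ?E "Rb U"] by (simp add: space_Rb)
 qed
 obtain C where C: "!!k::nat. compact (C k)" "incseq C" "(\<Union>k. C k) = U" using opn_exhaust[OF U] by metis
 have "density mu p = density mu m"
 proof (rule measure_eqI_generator_eq[of ?E U _ _ C])
  show "Int_stable ?E" by (auto simp: Int_stable_def)
  show "range C <= ?E" using C by auto
  show "emeas (density mu p) (C i) ~= \<infinity>" for i using eq[OF C(1)[of i]] C(3) by blast
 qed (use eq C gen in "auto simp: sets_mu")
 hence "AE z in mu. p z = m z" using mu.density_unique_iff[OF pm] by simp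
 hence "AE z in mu. h' z = 0" by eventually_elim (auto simp: p_def m_def max_def split: if_splits)
 hence "AE z in cmu. h' z = 0" by (rule AE_completion)
 thus ?thesis using ae by eventually_elim simp
qed

end

section \<open>The product as a weakly differentiable function, and uniqueness of its
  derivative\<close>

context wprod
begin

text \<open>The values of w lie in an interval [-R, R], on which a C^1 function and its derivative
  are uniform limits of polynomials and their derivatives. All three terms of \<open>E_poly\<close>
  pass to the limit by dominated convergence.\<close>

lemma E_psi:
 fixes ps ps' :: "real => real"
 assumes d: "!!x. (ps hrd ps' x) (at x)" and c: "continuous_on UNIV ps'"
  and th: "th : Ccinf n U n"
 shows "ex (%z. ps (w z) *\<^sub>R th z) = (\<integral>p. ps (w (fst p))*HS th p \<partial>cV)+(\<integral>z. ps' (w z)*GG z (th z) \<partial>cmu)"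
  "vd.L1v (%z. ps (w z) *\<^sub>R th z)" "integrable cV (%p. ps (w (fst p))*HS th p)"
  "integrable cmu (%z. ps' (w z)*GG z (th z))"
proof -
 obtain R where R: "R > 0" "ALL z:U. \<bar>w z\<bar> <= R" using w_bound by blast
 have cp: "continuous_on UNIV ps" using d DERIV_isCont continuous_at_imp_continuous_on by blast
 have bd: "EX B. ALL x:{-R..R}. \<bar>g x\<bar> <= B" if "continuous_on UNIV g" for g :: "real => real"
 proof -
  have "compact (g ` {-R..R})" using that continuous_on_subset by (intro compact_continuous_image) auto
  thus ?thesis using compact_imp_bounded bounded_iff by (metis imageI real_norm_def)
 qed
 obtain B where B: "ALL x:{-R..R}. \<bar>ps x\<bar> <= B" using bd[OF cp] by blast
 obtain B' where B': "ALL x:{-R..R}. \<bar>ps' x\<bar> <= B'" using bd[OF c] by blast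
 have wR: "w z : {-R..R}" if "z : U" for z using R that by fastforce
 have "ALL k. EX Na. ALL x. \<bar>x\<bar> <= R --> \<bar>ps x - (\<Sum>k\<le>fst Na. snd Na k*x ^ k)\<bar> <= 1/real (Suc k) &
  \<bar>ps' x - (\<Sum>k\<le>fst Na. snd Na k*(real k*x ^ (k - 1)))\<bar> <= 1/real (Suc k)"
 proof
  fix k
  obtain N a where "ALL x. \<bar>x\<bar> <= R --> \<bar>ps x - (\<Sum>k\<le>N. a k*x ^ k)\<bar> <= 1/real (Suc k) &
   \<bar>ps' x - (\<Sum>k\<le>N. a k*(real k*x ^ (k - 1)))\<bar> <= 1/real (Suc k)"
   using C1_approx[OF d c R(1), of "1/real (Suc k)"] by auto
  thus "EX Na. ALL x. \<bar>x\<bar> <= R --> \<bar>ps x - (\<Sum>k\<le>fst Na. snd Na k*x ^ k)\<bar> <= 1/real (Suc k) &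
   \<bar>ps' x - (\<Sum>k\<le>fst Na. snd Na k*(real k*x ^ (k - 1)))\<bar> <= 1/real (Suc k)" by (intro exI[of _ "(N, a)"]) simp
 qed
 from choice[OF this] obtain Na where Na: "!!k x. \<bar>x\<bar> <= R ==> \<bar>ps x - (\<Sum>j\<le>fst (Na k). snd (Na k) j*x ^ j)\<bar> <= 1/real (Suc k)"
  "!!k x. \<bar>x\<bar> <= R ==> \<bar>ps' x - (\<Sum>j\<le>fst (Na k). snd (Na k) j*(real j*x ^ (j - 1)))\<bar> <= 1/real (Suc k)" by blast
 define p where "p k x = (\<Sum>j\<le>fst (Na k). snd (Na k) j*x ^ j)" for k x
 define p' where "p' k x = (\<Sum>j\<le>fst (Na k). snd (Na k) j*(real j*x ^ (j - 1)))" for k x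
 have le1: "1/real (Suc k) <= 1" for k by simp
 have pb: "\<bar>p k x\<bar> <= B+1" "\<bar>p' k x\<bar> <= B'+1" "\<bar>p k x - ps x\<bar> <= 1" if "x : {-R..R}" for k x
 proof -
  have x: "\<bar>x\<bar> <= R" using that by auto
  have "\<bar>ps x - p k x\<bar> <= 1" "\<bar>ps' x - p' k x\<bar> <= 1" using Na[OF x, of k] le1[of k] unfolding p_def p'_def by linarith+
  moreover have "\<bar>ps x\<bar> <= B" "\<bar>ps' x\<bar> <= B'" using B B' that by auto
  ultimately show "\<bar>p k x\<bar> <= B+1" "\<bar>p' k x\<bar> <= B'+1" "\<bar>p k x - ps x\<bar> <= 1" by linarith+
 qed
 have conv: "(%k. p k x) \<longlonglongrightarrow> ps x" "(%k. p' k x) \<longlonglongrightarrow> ps' x" if "x : {-R..R}" for x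
 proof -
  have x: "\<bar>x\<bar> <= R" using that by auto
  have l: "(%k. 1/real (Suc k)) \<longlonglongrightarrow> 0" by (intro LIMSEQ_Suc lim_1_over_n)
  show "(%k. p k x) \<longlonglongrightarrow> ps x"  by (rule metric_tendsto_imp_tendsto[OF l]) (use Na(1)[OF x] in "simp add: p_def dist_real_def abs_minus_commute")
  show "(%k. p' k x) \<longlonglongrightarrow> ps' x"  by (rule metric_tendsto_imp_tendsto[OF l]) (use Na(2)[OF x] in "simp add: p'_def dist_real_def abs_minus_commute")
 qed
 have cpk: "continuous_on UNIV (p k)" "continuous_on UNIV (p' k)" for k unfolding p_def p'_def by (intro continuous_intros)+
 have mp: "(%z. g (w z)) : bmeas cmu" "(%z. g (w z)) : bmeas cnu" if "continuous_on UNIV g" for g :: "real => real"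
  using measurable_compose[OF w_meas(1)] measurable_compose[OF w_meas(2)] borel_measurable_continuous_onI[OF that] by auto
 show L: "vd.L1v (%z. ps (w z) *\<^sub>R th z)" by (rule L1v_mult[OF th mp(2)[OF cp], of B]) (use B wR in auto)
 show I1: "integrable cV (%p. ps (w (fst p))*HS th p)" by (rule HS_expand(1)[OF th mp(1)[OF cp], of B]) (use B wR in auto)
 show I2: "integrable cmu (%z. ps' (w z)*GG z (th z))" by (rule GGth_integrable[OF th mp(1)[OF c], of B']) (use B' wR in auto)
 have Lk: "vd.L1v (%z. p k (w z) *\<^sub>R th z)" for k by (rule L1v_mult[OF th mp(2)[OF cpk(1)], where R = "B+1"]) (use pb wR in auto)
 have I1k: "integrable cV (%q. p k (w (fst q))*HS th q)" for k by (rule HS_expand(1)[OF th mp(1)[OF cpk(1)], where B = "B+1"]) (use pb wR in auto)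
 have I2k: "integrable cmu (%z. p' k (w z)*GG z (th z))" for k by (rule GGth_integrable[OF th mp(1)[OF cpk(2)], where R = "B'+1"]) (use pb wR in auto)
 have nth: "integrable cnu (%z. norm (th z))"
  using vd.L1v_fin[OF vd.L1v_Ccinf[OF th]] vd.L1v_norm[OF vd.L1v_Ccinf[OF th]] by (intro integrableI_bounded) auto
 have l1: "(%k. ex (%z. p k (w z) *\<^sub>R th z)) \<longlonglongrightarrow> ex (%z. ps (w z) *\<^sub>R th z)"
 proof (rule vd.ext_dominated[OF Lk L nth])
  fix k z assume z: "z : U"
  show "norm (p k (w z) *\<^sub>R th z - ps (w z) *\<^sub>R th z) <= norm (th z)"
   using mult_right_mono[OF pb(3)[OF wR[OF z], of k] norm_ge_zero[of "th z"]] by (simp flip: scaleR_left_diff_distrib)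
  show "(%k. p k (w z) *\<^sub>R th z) \<longlonglongrightarrow> ps (w z) *\<^sub>R th z" by (intro tendsto_scaleR tendsto_const conv wR z)
 qed
 have l2: "(%k. \<integral>q. p k (w (fst q))*HS th q \<partial>cV) \<longlonglongrightarrow> (\<integral>q. ps (w (fst q))*HS th q \<partial>cV)"
 proof (rule integral_dominated_convergence[where w = "%q. (B+1)*\<bar>HS th q\<bar>"])
  show "integrable cV (%q. (B+1)*\<bar>HS th q\<bar>)" using HS_integrable[OF th] by (intro integrable_mult_right integrable_abs)
  show "AE q in cV. (%k. p k (w (fst q))*HS th q) \<longlonglongrightarrow> ps (w (fst q))*HS th q" by (rule AE_I2) (auto simp: space_V intro!: tendsto_mult tendsto_const conv wR)
  show "AE q in cV. norm (p k (w (fst q))*HS th q) <= (B+1)*\<bar>HS th q\<bar>" for k by (rule AE_I2) (auto simp: space_V abs_mult intro!: mult_right_mono pb wR)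
 qed (use I1 I1k in auto)
 have l3: "(%k. \<integral>z. p' k (w z)*GG z (th z) \<partial>cmu) \<longlonglongrightarrow> (\<integral>z. ps' (w z)*GG z (th z) \<partial>cmu)"
 proof (rule integral_dominated_convergence[where w = "%z. (B'+1)*\<bar>1*GG z (th z)\<bar>"])
  have "integrable cmu (%z. 1*GG z (th z))" by (rule GGth_integrable[OF th, of _ 1]) auto
  thus "integrable cmu (%z. (B'+1)*\<bar>1*GG z (th z)\<bar>)" by simp
  show "AE z in cmu. (%k. p' k (w z)*GG z (th z)) \<longlonglongrightarrow> ps' (w z)*GG z (th z)" by (rule AE_I2) (auto intro!: tendsto_mult tendsto_const conv wR)
  show "AE z in cmu. norm (p' k (w z)*GG z (th z)) <= (B'+1)*\<bar>1*GG z (th z)\<bar>" for k by (rule AE_I2) (auto simp: abs_mult intro!: mult_right_mono pb wR)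
 qed (use I2 I2k in auto)
 have "ex (%z. p k (w z) *\<^sub>R th z) = (\<integral>q. p k (w (fst q))*HS th q \<partial>cV)+(\<integral>z. p' k (w z)*GG z (th z) \<partial>cmu)" for k
  unfolding p_def p'_def by (rule E_poly[OF th])
 hence "(%k. ex (%z. p k (w z) *\<^sub>R th z)) \<longlonglongrightarrow> (\<integral>q. ps (w (fst q))*HS th q \<partial>cV)+(\<integral>z. ps' (w z)*GG z (th z) \<partial>cmu)"
  using tendsto_add[OF l2 l3] by simp
 thus "ex (%z. ps (w z) *\<^sub>R th z) = (\<integral>p. ps (w (fst p))*HS th p \<partial>cV)+(\<integral>z. ps' (w z)*GG z (th z) \<partial>cmu)"
  using l1 LIMSEQ_unique by blast
qed

text \<open>Members of \<open>TV\<close> have values in some \<open>Rn l\<close>, so the scalar w is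
  placed on the first coordinate axis.\<close>

definition g :: "vec => vec" where "g z = w z *\<^sub>R uv 0"

definition G :: "vec => vec => vec" where "G z v = GG z v *\<^sub>R uv 0"

lemma e0_R: "r *\<^sub>R uv 0 : Rn 1" by (intro Rn_scaleR unit_vec_Rn) simp

lemma e0_meas: "h : bmeas N==>(%z. h z *\<^sub>R uv 0 :: vec) : bmeas N" for h :: "'z => real"
proof -
 assume h: "h : bmeas N"
 have "(%r::real. r *\<^sub>R uv 0 :: vec) : bmeas borel" by (intro borel_measurable_continuous_onI continuous_intros)
 from measurable_compose[OF h this] show ?thesis .
qed

lemma zeta_facts:
 assumes zeta: "smooth 1 (Rn 1) zeta"
 defines "ps \<equiv> (%t. zeta (t *\<^sub>R uv 0))" and "ps' \<equiv> (%t. Deriv 1 zeta (t *\<^sub>R uv 0) (uv 0))"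
 shows "(ps hrd ps' x) (at x)" "continuous_on UNIV ps'" "Deriv 1 zeta (t *\<^sub>R uv 0) (r *\<^sub>R uv 0) = ps' t*r"
proof -
 have lin: "linear (Deriv 1 zeta (t *\<^sub>R uv 0))" for t by (rule Deriv_linear[OF zeta e0_R])
 show l: "Deriv 1 zeta (t *\<^sub>R uv 0) (r *\<^sub>R uv 0) = ps' t*r" for t r by (simp add: linear_scale[OF lin] ps'_def del: One_nat_def)
 have h: "((%t::real. t *\<^sub>R uv 0 :: vec) has_derivative (%t. t *\<^sub>R uv 0)) (at x)" by (auto intro!: derivative_eq_intros)
 have "(zeta has_derivative Deriv 1 zeta (x *\<^sub>R uv 0)) (at (x *\<^sub>R uv 0) within range (%t::real. t *\<^sub>R uv 0))" by (rule has_derivative_subset[OF smooth_has_derivative[OF zeta e0_R]]) (use e0_R in blast)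
 from has_derivative_in_compose[OF h this]
 have "(ps has_derivative (%t. Deriv 1 zeta (x *\<^sub>R uv 0) (t *\<^sub>R uv 0))) (at x)" by (simp add: ps_def)
 thus "(ps hrd ps' x) (at x)" unfolding has_field_derivative_def l by simp
 have "continuous_on (Rn 1) (%z. Deriv 1 zeta z (uv 0))" by (rule smooth_continuous[OF smooth_Deriv[OF zeta]]) simp
 thus "continuous_on UNIV ps'" unfolding ps'_def by (rule continuous_on_compose2) (use e0_R in "auto intro!: continuous_intros")
qed

lemma hs_G: "hs_norm n (G z) = q z" by (simp add: hs_norm_L2 G_def q_def L2_set_def)

text \<open>A smooth function on \<open>Rn 1\<close>, read along the axis, is a C^1 function of one
  variable, to which \<open>E_psi\<close> applies. The local integrability condition is the
  integrability of \<open>q\<close>.\<close>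

lemma weak_deriv_g: "is_weak_deriv n 1 U V g G"
 unfolding is_weak_deriv_def
proof (intro conjI allI ballI impI)
 show "G ` U <= Hom n 1"
 proof (rule image_subsetI)
  fix z assume z: "z : U"
  have "linear (G z)" unfolding G_def
   using linear_add[OF lin_GG[OF z]] linear_scale[OF lin_GG[OF z]] by (intro linearI) (auto simp: scaleR_add_left)
  moreover have "G z ` Rn n <= Rn 1" using e0_R by (auto simp: G_def)
  moreover have "G z (uv i) = 0" if i: "n <= i" for i
  proof -
   have "DX z (uv i) = 0" unfolding DX_def using i by (auto intro!: sum.neutral)
   moreover have "Deriv l eta (f z) 0 = 0" by (rule linear_0[OF lin_Deta[OF z]])
   ultimately show ?thesis by (simp add: G_def GG_def F0[OF z i])
  qed
  ultimately show "G z : Hom n 1" by (auto simp: Hom_def)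
 qed
 show "(%z. G z (uv i)) : bmeas cmu" if "i < n" for i
  unfolding G_def by (rule e0_meas[OF GG_meas[OF that]])
 fix C and t :: real assume "compact C & C <= U & 0 <= t"
 have "(\<integral>\<^sup>+z\<in>C Int {z. norm (g z) <= t}. enn (hs_norm n (G z)) \<partial>cmu) <= (\<integral>\<^sup>+z. enn (norm (q z)) \<partial>cmu)" by (intro nn_integral_mono) (auto simp: hs_G q_nonneg indicator_def)
 also have "... < \<infinity>" using q_integrable by (simp add: integrable_iff_bounded)
 finally show "(\<integral>\<^sup>+z\<in>C Int {z. norm (g z) <= t}. enn (hs_norm n (G z)) \<partial>cmu) < \<infinity>" .
next
 fix th zeta
 assume th: "th : Ccinf n U n"
  and zeta: "smooth 1 (Rn 1) (zeta :: vec => real) & (EX C. compact C & C <= Rn 1 & (ALL y:Rn 1 - C. ALL v:Rn 1. Deriv 1 zeta y v = 0))"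
 note zf = zeta_facts[OF conjunct1[OF zeta]]
 have "ex (%z. zeta (g z) *\<^sub>R th z) = (\<integral>p. zeta (g (fst p))*HS th p \<partial>cV)+(\<integral>z. Deriv 1 zeta (w z *\<^sub>R uv 0) (uv 0)*GG z (th z) \<partial>cmu)"
  unfolding g_def by (rule E_psi(1)[OF zf(1,2) th])
 thus "ex (%z. zeta (g z) *\<^sub>R th z) = (\<integral>(z, S). zeta (g z)*hs_inner n (orth_proj S) (Deriv n th z) \<partial>cV)+(\<integral>z. Deriv 1 zeta (g z) (G z (th z)) \<partial>cmu)"
  unfolding case_prod_unfold G_def g_def zf(3) HS_def by (simp add: hs_inner_commute del: One_nat_def)
qed

lemma g_meas: "g : bmeas (completion (add_measure mu nu))"
proof -
 have sp: "space (add_measure mu nu) = U" by (simp add: space_add_measure)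
 have "u : bmeas (completion (add_measure mu nu))"
  unfolding u_def using fR smooth_continuous[OF eta] by (auto intro!: Rn_comp_meas[OF f_meas, of l eta] simp: sp)
 moreover have "xi : bmeas (completion (add_measure mu nu))"
  using cont_meas[OF smooth_continuous[OF xi_smooth]] by (intro measurable_completion) (simp add: measurable_cong_sets[OF sets_add_measure refl])
 ultimately have "w : bmeas (completion (add_measure mu nu))" unfolding w_def by (rule borel_measurable_times[rotated])
 thus ?thesis unfolding g_def by (rule e0_meas)
qed

lemma g_TV: "g : TV n 1 U V"
 unfolding TV_def using g_meas weak_deriv_g e0_R by (auto simp: g_def)

lemma norm_g: "norm (g z) = \<bar>w z\<bar>" by (simp add: g_def)

text \<open>Test functions with slope one on the range of \<open>g\<close> identify the weak derivative.\<close>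

lemma weak_deriv_unique:
 assumes G': "is_weak_deriv n 1 U V g G'"
 shows "AE z in cmu. hs_norm n (G' z) = q z"
proof -
 obtain R where R: "R > 0" "ALL z:U. \<bar>w z\<bar> <= R" using w_bound by blast
 \<comment> \<open>The plateau is centred at R + 2 so that b vanishes on the negative axis, as
   \<open>rsm_antideriv\<close> requires. Shifted back, its primitive has slope one on [-R, R],
   where the values of w lie.\<close>
 define b where "b x = 1 - stp ((x - (R+2))^2 - R\<^sup>2)" for x
 have rb: "rsm UNIV b"
 proof -
  have "rsm UNIV (%x. 1 - stp (((1*x + - (R+2))*(1*x + - (R+2))) - R\<^sup>2))" by (intro rsm_diff rsm_const rsm_compose[OF _ _ stp_props(1)] rsm_mult rsm_add rsm_cmult rsm_ident) auto
  moreover have "(%x. 1 - stp (((1*x + - (R+2))*(1*x + - (R+2))) - R\<^sup>2)) = b" by (rule ext) (simp only: b_def power2_eq_square mult_1 diff_conv_add_uminus[symmetric])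
  ultimately show ?thesis by simp
 qed
 have b0: "b x = 0" if "x <= 0" for x
 proof -
  have "(R+2)^2 <= (x - (R+2))^2" using that R by (intro abs_le_square_iff[THEN iffD1]) auto
  moreover have "(R+2)^2 - R\<^sup>2 >= 1" using R by (simp add: power2_eq_square algebra_simps)
  ultimately show ?thesis by (simp add: b_def stp_props)
 qed
 obtain I where I: "rsm UNIV I" "!!x. (I hrd b x) (at x)" "!!x. x <= 0==>I x = 0"
  using rsm_antideriv[OF rb b0] by blast
 define ps where "ps x = I (x+(R+2))" for x
 have rps: "rsm UNIV ps" unfolding ps_def using rsm_affine[OF I(1), of 1] by simp
 have dps: "(ps hrd b (x+(R+2))) (at x)" for x unfolding ps_def
 proof -
  have "((%x. x+(R+2)) hrd 1) (at x)" by (auto intro!: derivative_eq_intros)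
  from DERIV_chain2[OF I(2) this] show "((%x. I (x+(R+2))) hrd b (x+(R+2))) (at x)" by simp
 qed
 have b1: "b (x+(R+2)) = 1" if "\<bar>x\<bar> <= R" for x
  using that abs_le_square_iff[of x R] R by (simp add: b_def stp_props)
 have b2: "b (x+(R+2)) = 0" if "\<bar>x\<bar> >= R+2" for x
 proof -
  have "(R+2)^2 <= x^2" using that R by (intro abs_le_square_iff[THEN iffD1]) auto
  moreover have "(R+2)^2 - R\<^sup>2 >= 1" using R by (simp add: power2_eq_square algebra_simps)
  ultimately show ?thesis by (simp add: b_def stp_props)
 qed
 define zeta where "zeta y = ps (lk y 0)" for y
 have o1: "opn 1 (Rn 1)" by simp
 have lks: "smooth 1 (Rn 1) (%y. lk y 0)" by (rule smooth_linear[OF o1 bounded_linear_lk])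
 have zetas: "smooth 1 (Rn 1) zeta" unfolding zeta_def by (rule smooth_compose[OF o1 _ lks _ rps]) auto
 have Dzeta: "Deriv 1 zeta y v = b (lk y 0+(R+2))*lk v 0" if "y : Rn 1" "v : Rn 1" for y v
 proof -
  have "Deriv 1 (%y. lk y 0) y v = lk v 0" by (rule Deriv_eq[OF bounded_linear_imp_has_derivative[OF bounded_linear_lk]]) (use that in auto)
  thus ?thesis unfolding zeta_def using Deriv_compose[OF o1 that(1) lks dps that(2)] by simp
 qed
 have zetaC: "EX C. compact C & C <= Rn 1 & (ALL y:Rn 1 - C. ALL v:Rn 1. Deriv 1 zeta y v = 0)"
 proof (intro exI[of _ "cball 0 (R+2) Int Rn 1"] conjI ballI compact_cball_Rn)
  fix y v assume y: "y : Rn 1 - cball 0 (R+2) Int Rn 1" and v: "v : Rn 1"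
  hence "norm y = \<bar>lk y 0\<bar>" using norm_Rn[of y 1] by simp
  moreover have yR: "y : Rn 1" "\<not> norm y <= R+2" using y by (auto simp: dist_norm)
  ultimately have "b (lk y 0+(R+2)) = 0" by (intro b2) simp
  thus "Deriv 1 zeta y v = 0" using Dzeta[OF yR(1) v] by simp
 qed simp
 have G'H: "G' z : Hom n 1" if "z : U" for z using G' that unfolding is_weak_deriv_def by (meson image_subset_iff)
 note G'u = G'[unfolded is_weak_deriv_def]
 have key: "(\<integral>z. lk (G' z (th z)) 0 \<partial>cmu) = (\<integral>z. GG z (th z) \<partial>cmu)" if th: "th : Ccinf n U n" for th
 proof -
  have 1: "ex (%z. zeta (g z) *\<^sub>R th z) = (\<integral>(z, S). zeta (g z)*hs_inner n (orth_proj S) (Deriv n th z) \<partial>cV)+(\<integral>z. Deriv 1 zeta (g z) (G' z (th z)) \<partial>cmu)" by (rule G'u[THEN conjunct2, THEN conjunct2, THEN conjunct2, rule_format, OF th]) (use zetas zetaC in blast)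
  have 2: "ex (%z. zeta (g z) *\<^sub>R th z) = (\<integral>(z, S). zeta (g z)*hs_inner n (orth_proj S) (Deriv n th z) \<partial>cV)+(\<integral>z. Deriv 1 zeta (g z) (G z (th z)) \<partial>cmu)" by (rule weak_deriv_g[unfolded is_weak_deriv_def, THEN conjunct2, THEN conjunct2, THEN conjunct2, rule_format, OF th]) (use zetas zetaC in blast)
  have gz: "lk (g z) 0 = w z" "g z : Rn 1" for z using e0_R by (auto simp: g_def)
  have "(\<integral>z. lk (G' z (th z)) 0 \<partial>cmu) = (\<integral>z. Deriv 1 zeta (g z) (G' z (th z)) \<partial>cmu)"
  proof (rule Bochner_Integration.integral_cong[OF refl])
   fix z assume "z : space cmu"
   hence z: "z : U" by simp
   have "G' z (th z) : Rn 1" using G'H[OF z] th_facts(2)[OF th, of z] by (auto simp: Hom_def)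
   thus "lk (G' z (th z)) 0 = Deriv 1 zeta (g z) (G' z (th z))" using Dzeta gz b1 R z by simp
  qed
  also have "... = (\<integral>z. Deriv 1 zeta (g z) (G z (th z)) \<partial>cmu)" using 1 2 by simp
  also have "... = (\<integral>z. GG z (th z) \<partial>cmu)"
  proof (rule Bochner_Integration.integral_cong[OF refl])
   fix z assume "z : space cmu"
   hence z: "z : U" by simp
   show "Deriv 1 zeta (g z) (G z (th z)) = GG z (th z)" using Dzeta[OF gz(2) e0_R] gz b1 R z by (simp add: G_def)
  qed
  finally show ?thesis .
 qed
 have am: "(%z. lk (G' z (uv i)) 0) : bmeas cmu" if "i < n" for i
  using G'u[THEN conjunct2, THEN conjunct1] that measurable_compose[OF _ lk_measurable] by blast
 have aint: "integrable cmu (%z. ind C z*lk (G' z (uv i)) 0)" if i: "i < n" and C: "compact C" "C <= U" for i C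
 proof (rule integrableI_bounded)
  have Cm: "C : sets mu" using C borel_closed[OF compact_imp_closed[OF C(1)]] by (simp add: in_sets_mu)
  thus "(%z. ind C z*lk (G' z (uv i)) 0) : bmeas cmu" by (intro borel_measurable_times am i borel_measurable_indicator) auto
  have "(\<integral>\<^sup>+z. enn (norm (ind C z*lk (G' z (uv i)) 0)) \<partial>cmu) <= (\<integral>\<^sup>+z\<in>C Int {z. norm (g z) <= R}. enn (hs_norm n (G' z)) \<partial>cmu)"
  proof (rule nn_integral_mono)
   fix z assume "z : space cmu"
   hence z: "z : U" by simp
   have "\<bar>lk (G' z (uv i)) 0\<bar> <= norm (G' z (uv i))" by (rule abs_lk_le_norm)
   also have "... <= hs_norm n (G' z)" unfolding hs_norm_L2 by (rule member_le_L2_set) (use i in auto)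
   finally show "enn (norm (ind C z*lk (G' z (uv i)) 0)) <= enn (hs_norm n (G' z))*ind (C Int {z. norm (g z) <= R}) z"
    using R z by (cases "z : C") (auto simp: norm_g intro: ennreal_leI)
  qed
  also have "... < \<infinity>" by (rule G'u[THEN conjunct2, THEN conjunct2, THEN conjunct1, rule_format]) (use C R in simp)
  finally show "(\<integral>\<^sup>+z. enn (norm (ind C z*lk (G' z (uv i)) 0)) \<partial>cmu) < \<infinity>" .
 qed
 have gint: "integrable cmu (%z. GG z (uv i))" if i: "i < n" for i
 proof (rule Bochner_Integration.integrable_bound[OF q_integrable GG_meas[OF i]])
  show "AE z in cmu. norm (GG z (uv i)) <= norm (q z)" by (rule AE_I2) (use GG_q[OF _ unit_vec_Rn[OF i]] q_nonneg in simp)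
 qed
 \<comment> \<open>Test fields in direction i isolate the i-th component of both derivatives, and
   the fundamental lemma applies to the difference.\<close>
 have "AE z in cmu. lk (G' z (uv i)) 0 - GG z (uv i) = 0" if i: "i < n" for i
 proof (rule fundamental_lemma)
  show "(%z. lk (G' z (uv i)) 0 - GG z (uv i)) : bmeas cmu" by (intro borel_measurable_diff am GG_meas i)
  show "integrable cmu (%z. ind C z*(lk (G' z (uv i)) 0 - GG z (uv i)))" if C: "compact C" "C <= U" for C
  proof -
   have Cm: "C : sets mu" using C borel_closed[OF compact_imp_closed[OF C(1)]] by (simp add: in_sets_mu)
   have "integrable cmu (%z. ind C z*GG z (uv i))"
   proof (rule Bochner_Integration.integrable_bound[OF gint[OF i]])
    show "(%z. ind C z*GG z (uv i)) : bmeas cmu"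
     using Cm by (intro borel_measurable_times borel_measurable_indicator GG_meas i) auto
    show "AE z in cmu. norm (ind C z*GG z (uv i)) <= norm (GG z (uv i))" by (rule AE_I2) (simp add: indicator_def)
   qed
   from Bochner_Integration.integrable_diff[OF aint[OF i C] this] show ?thesis by (simp add: right_diff_distrib)
  qed
  fix phi assume phi: "phi : Csc n U"
  have th: "(%z. phi z *\<^sub>R uv i) : Ccinf n U n" by (rule Ccinf_Csc[OF U phi smooth_const[OF U]]) (use i in auto)
  obtain C where C: "compact C" "C <= U" "!!z. z ~: C ==> phi z = 0" "smooth n U phi" by (rule CscE[OF phi]) (rule that; assumption)
  obtain B where B: "ALL z:U. \<bar>phi z\<bar> <= B" using smooth_cs_bounded[OF C(1,2) C(3) smooth_continuous[OF C(4)]] by blast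
  have phim: "phi : bmeas cmu" by (rule cont_cmeas[OF smooth_continuous[OF C(4)]])
  have "(\<integral>z. phi z*lk (G' z (uv i)) 0 \<partial>cmu) = (\<integral>z. lk (G' z (phi z *\<^sub>R uv i)) 0 \<partial>cmu)"
  proof (rule Bochner_Integration.integral_cong[OF refl])
   fix z assume "z : space cmu"
   hence "linear (G' z)" using G'H by (auto simp: Hom_def)
   thus "phi z*lk (G' z (uv i)) 0 = lk (G' z (phi z *\<^sub>R uv i)) 0" by (simp add: linear_scale)
  qed
  also have "... = (\<integral>z. GG z (phi z *\<^sub>R uv i) \<partial>cmu)" by (rule key[OF th])
  also have "... = (\<integral>z. phi z*GG z (uv i) \<partial>cmu)" by (rule Bochner_Integration.integral_cong[OF refl]) (simp add: linear_scale[OF lin_GG])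
  finally have e: "(\<integral>z. phi z*lk (G' z (uv i)) 0 \<partial>cmu) = (\<integral>z. phi z*GG z (uv i) \<partial>cmu)" .
  have i1: "integrable cmu (%z. phi z*lk (G' z (uv i)) 0)" by (rule Bochner_Integration.integrable_bound[OF integrable_mult_right[OF aint[OF i C(1,2)], of "\<bar>B\<bar>"]])
    (use B C(3) in "fastforce intro!: borel_measurable_times phim am i AE_I2 mult_right_mono simp: abs_mult indicator_def")+
  have i2: "integrable cmu (%z. phi z*GG z (uv i))" by (rule Bochner_Integration.integrable_bound[OF integrable_mult_right[OF gint[OF i], of "\<bar>B\<bar>"]])
    (use B in "fastforce intro!: borel_measurable_times phim GG_meas i AE_I2 mult_right_mono simp: abs_mult")+
  show "(\<integral>z. phi z*(lk (G' z (uv i)) 0 - GG z (uv i)) \<partial>cmu) = 0"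
   using Bochner_Integration.integral_diff[OF i1 i2] e by (simp add: right_diff_distrib)
 qed
 hence "AE z in cmu. ALL i:{..<n}. lk (G' z (uv i)) 0 - GG z (uv i) = 0" by (intro AE_finite_allI) auto
 moreover have "AE z in cmu. z : U" by (rule AE_I2) simp
 ultimately show ?thesis
 proof eventually_elim
  case (elim z)
  have "norm (G' z (uv i)) = \<bar>GG z (uv i)\<bar>" if "i < n" for i
  proof -
   have "G' z (uv i) : Rn 1" using G'H[OF elim(2)] that by (auto simp: Hom_def)
   hence "norm (G' z (uv i)) = \<bar>lk (G' z (uv i)) 0\<bar>" using norm_Rn[of _ 1] by simp
   thus ?thesis using elim(1) that by simp
  qed
  thus ?case unfolding hs_norm_L2 q_def L2_set_def by simp
 qed
qed

end

subsection \<open>Vanishing boundary values of compactly supported products\<close>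

text \<open>0 is a minimum point of \<open>stp\<close>. This covers the left end of a ramp, which
  the half-open intervals of levels leave out.\<close>

lemma deriv_stp_0: "deriv stp 0 = 0"
 using DERIV_local_min[OF stp_deriv[of 0], of 1] stp_props(2)[of 0] stp_range(1) by auto

context vfold
begin

lemma HS_add: "g : Ccinf n U n==>h : Ccinf n U n==>p : space V==>HS (%z. g z+h z) p = HS g p+HS h p" by (auto simp: HS_eq Deriv_add[OF U] Ccinf_def space_V algebra_simps simp flip: sum.distrib)

lemma HS_scale: "g : Ccinf n U n==>p : space V==>HS (%z. c *\<^sub>R g z) p = c*HS g p" by (auto simp: HS_eq Deriv_scaleR[OF U _ smooth_const[OF U]] Ccinf_def Deriv_const[OF opn_mem[OF U]] space_V sum_distrib_left mult.assoc)

end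

context wprod
begin

text \<open>The ramps \<open>ps k\<close> rise from 0 to 1 between the levels t and t + 1/(k+1), and
  composed with w they converge to the indicator of E. Their identity from \<open>E_psi\<close>
  therefore exhibits the boundary distribution as the limit of integrals of \<open>ps' k\<close> of
  w against \<open>GG\<close>. Each of these is at most \<open>Lstp * B\<close> times the difference
  quotient of the q-mass between the two levels. As the integrals converge, a bound on the lower
  limit of the quotients suffices.\<close>

lemma superlevel_bdry_bound:
 assumes L: "liminf (%k. enn (real (Suc k))*(\<integral>\<^sup>+z. enn (q z)*ind {z. t < w z & w z <= t+1/real (Suc k)} z \<partial>cmu)) < enn c"
  and c: "0 < c" and E: "E = {z : U. t < w z}" and th: "th : Ccinf n U n" and B: "0 <= B" "!!z. norm (th z) <= B"
 shows "\<bar>bdry_var n U V E th\<bar> <= Lstp*B*c"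
proof -
 have Em: "E : sets cmu" "E : sets cnu"
 proof -
  have "{z : space cmu. t < w z} : sets cmu" "{z : space cnu. t < w z} : sets cnu" using w_meas by measurable
  thus "E : sets cmu" "E : sets cnu" by (simp_all add: E)
 qed
 have im: "(ind E :: vec => real) : bmeas cmu" "(ind E :: vec => real) : bmeas cnu"
  using Em by (auto intro: borel_measurable_indicator)
 define ps where "ps k x = stp ((x - t)*real (Suc k))" for k x
 define ps' where "ps' k x = deriv stp ((x - t)*real (Suc k))*real (Suc k)" for k x
 have d: "(ps k hrd ps' k x) (at x)" for k x
 proof -
  have "((%x. (x - t)*real (Suc k)) hrd real (Suc k)) (at x)" by (auto intro!: derivative_eq_intros)
  from DERIV_chain2[OF stp_deriv this] show ?thesis unfolding ps_def[abs_def] ps'_def by simp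
 qed
 have cd: "continuous_on UNIV (ps' k)" for k
 proof -
  have "continuous_on UNIV (deriv stp)" by (rule rsm_cont[OF rsm_deriv[OF stp_props(1)]])
  hence "continuous_on UNIV (%x. deriv stp ((x - t)*real (Suc k)))" by (rule continuous_on_compose2) (auto intro!: continuous_on_mult continuous_on_diff continuous_on_id continuous_on_const)
  thus ?thesis unfolding ps'_def by (rule continuous_on_mult[OF _ continuous_on_const])
 qed
 note Ek = E_psi[OF d cd th]
 define a where "a k = (\<integral>z. ps' k (w z)*GG z (th z) \<partial>cmu)" for k
 have ps01: "0 <= ps k x" "ps k x <= 1" for k x by (simp_all add: ps_def stp_range)
 have conv: "(%k. ps k (w z)) \<longlonglongrightarrow> ind E z" if z: "z : U" for z
 proof (cases "t < w z")
  case False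
  hence "ps k (w z) = 0" for k unfolding ps_def by (intro stp_props(2) mult_nonpos_nonneg) auto
  thus ?thesis using False by (simp add: E)
 next
  case True
  obtain N where N: "inverse (real (Suc N)) < w z - t" using reals_Archimedean[of "w z - t"] True by auto
  have "ps k (w z) = 1" if k: "k >= N" for k
  proof -
   have "1 <= (w z - t)*real (Suc N)" using N by (simp add: inverse_eq_divide divide_less_eq del: of_nat_Suc)
   also have "... <= (w z - t)*real (Suc k)" using k True by (intro mult_left_mono) auto
   finally show ?thesis unfolding ps_def by (rule stp_props(3))
  qed
  hence "eventually (%k. ps k (w z) = ind E z) sequentially" using True z by (auto simp: eventually_sequentially E)
  thus ?thesis by (rule tendsto_eventually)
 qed
 have LE: "vd.L1v (%z. ind E z *\<^sub>R th z)" by (rule L1v_mult[OF th im(2), where R = 1]) (simp add: indicator_def)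
 have nth: "integrable cnu (%z. norm (th z))"
  using vd.L1v_fin[OF vd.L1v_Ccinf[OF th]] vd.L1v_norm[OF vd.L1v_Ccinf[OF th]] by (intro integrableI_bounded) auto
 have l1: "(%k. ex (%z. ps k (w z) *\<^sub>R th z)) \<longlonglongrightarrow> ex (%z. ind E z *\<^sub>R th z)"
 proof (rule vd.ext_dominated[OF Ek(2) LE nth])
  fix k z assume z: "z : U"
  have "\<bar>ps k (w z) - ind E z\<bar> <= 1" using ps01[of k "w z"] by (auto simp: indicator_def)
  from mult_right_mono[OF this norm_ge_zero[of "th z"]]
  show "norm (ps k (w z) *\<^sub>R th z - ind E z *\<^sub>R th z) <= norm (th z)" by (simp flip: scaleR_left_diff_distrib)
  show "(%k. ps k (w z) *\<^sub>R th z) \<longlonglongrightarrow> ind E z *\<^sub>R th z" by (intro tendsto_scaleR tendsto_const conv z)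
 qed
 have IE: "integrable cV (%p. ind E (fst p)*HS th p)" by (rule HS_expand(1)[OF th im(1), where B = 1]) (simp add: indicator_def)
 have l2: "(%k. \<integral>p. ps k (w (fst p))*HS th p \<partial>cV) \<longlonglongrightarrow> (\<integral>p. ind E (fst p)*HS th p \<partial>cV)"
 proof (rule integral_dominated_convergence[where w = "%p. \<bar>HS th p\<bar>"])
  show "integrable cV (%p. \<bar>HS th p\<bar>)" using HS_integrable[OF th] by (intro integrable_abs)
  show "AE p in cV. (%k. ps k (w (fst p))*HS th p) \<longlonglongrightarrow> ind E (fst p)*HS th p" by (rule AE_I2) (auto simp: space_V intro!: tendsto_mult tendsto_const conv)
  show "AE p in cV. norm (ps k (w (fst p))*HS th p) <= \<bar>HS th p\<bar>" for k by (rule AE_I2) (simp add: abs_mult ps01 mult_left_le_one_le)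
 qed (use IE Ek(3) in auto)
 have be: "bdry_var n U V E th = ex (%z. ind E z *\<^sub>R th z) - (\<integral>p. ind E (fst p)*HS th p \<partial>cV)"
  unfolding bdry_var_def case_prod_unfold HS_def ..
 have "a k = ex (%z. ps k (w z) *\<^sub>R th z) - (\<integral>p. ps k (w (fst p))*HS th p \<partial>cV)" for k
  unfolding a_def using Ek(1)[of k] by simp
 hence la: "a \<longlonglongrightarrow> bdry_var n U V E th" unfolding be using tendsto_diff[OF l1 l2] by (simp add: a_def[abs_def])
 let ?\<Phi> = "%k. enn (real (Suc k))*(\<integral>\<^sup>+z. enn (q z)*ind {z. t < w z & w z <= t+1/real (Suc k)} z \<partial>cmu)"
 have ab: "enn \<bar>a k\<bar> <= enn (Lstp*B)*?\<Phi> k" for k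
 proof -
  have psb: "\<bar>ps' k x\<bar> <= real (Suc k)*Lstp*ind {x. t < x & x <= t+1/real (Suc k)} x" for x
  proof (cases "t < x & x <= t+1/real (Suc k)")
   case True
   have "\<bar>ps' k x\<bar> = \<bar>deriv stp ((x - t)*real (Suc k))\<bar>*real (Suc k)" by (simp add: ps'_def abs_mult)
   also have "... <= Lstp*real (Suc k)" by (intro mult_right_mono Lstp) simp
   finally show ?thesis using True by (simp add: mult.commute)
  next
   case False
   hence "x = t \<or> x < t \<or> t+1/real (Suc k) < x" by auto
   hence "deriv stp ((x - t)*real (Suc k)) = 0"
   proof (elim disjE)
    assume "x = t" thus ?thesis by (simp add: deriv_stp_0)
   next
    assume "x < t" thus ?thesis by (intro deriv_stp_zero disjI1 mult_neg_pos) auto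
   next
    assume "t+1/real (Suc k) < x"
    hence "1/real (Suc k) < x - t" by simp
    hence "1 < (x - t)*real (Suc k)" by (simp add: divide_less_eq del: of_nat_Suc)
    thus ?thesis by (intro deriv_stp_zero disjI2)
   qed
   thus ?thesis using False by (simp add: ps'_def)
  qed
  have "enn \<bar>a k\<bar> <= (\<integral>\<^sup>+z. enn \<bar>ps' k (w z)*GG z (th z)\<bar> \<partial>cmu)"
   using integral_norm_bound_ennreal[OF Ek(4)[of k]] by (simp add: a_def)
  also have "... <= (\<integral>\<^sup>+z. enn (real (Suc k)*Lstp*B)*(enn (q z)*ind {z. t < w z & w z <= t+1/real (Suc k)} z) \<partial>cmu)"
  proof (rule nn_integral_mono)
   fix z assume "z : space cmu"
   hence z: "z : U" by simp
   have "\<bar>GG z (th z)\<bar> <= q z*norm (th z)" by (rule GG_q[OF z th_facts(2)[OF th]])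
   also have "... <= q z*B" by (intro mult_left_mono B q_nonneg)
   finally have "\<bar>ps' k (w z)*GG z (th z)\<bar> <= (real (Suc k)*Lstp*ind {x. t < x & x <= t+1/real (Suc k)} (w z))*(q z*B)"
    unfolding abs_mult by (intro mult_mono psb) (auto simp: Lstp less_imp_le)
   also have "... = (real (Suc k)*Lstp*B)*(q z*ind {z. t < w z & w z <= t+1/real (Suc k)} z)" by (simp add: indicator_def)
   finally have "enn \<bar>ps' k (w z)*GG z (th z)\<bar> <= enn ((real (Suc k)*Lstp*B)*(q z*ind {z. t < w z & w z <= t+1/real (Suc k)} z))" by (rule ennreal_leI)
   also have "... = enn (real (Suc k)*Lstp*B)*(enn (q z)*ind {z. t < w z & w z <= t+1/real (Suc k)} z)"
   proof -
    have "0 <= real (Suc k)*Lstp*B" using B(1) Lstp(1) by simp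
    thus ?thesis using q_nonneg[of z] by (simp only: ennreal_mult ennreal_indicator[symmetric] mult_nonneg_nonneg indicator_pos_le)
   qed
   finally show "enn \<bar>ps' k (w z)*GG z (th z)\<bar> <= enn (real (Suc k)*Lstp*B)*(enn (q z)*ind {z. t < w z & w z <= t+1/real (Suc k)} z)" .
  qed
  also have "... = enn (real (Suc k)*Lstp*B)*(\<integral>\<^sup>+z. enn (q z)*ind {z. t < w z & w z <= t+1/real (Suc k)} z \<partial>cmu)"
  proof (rule nn_integral_cmult)
   have "(%z. ind {x. t < x & x <= t+1/real (Suc k)} (w z) :: ennreal) : bmeas cmu"
    using w_meas(1) by measurable
   hence "(%z. ind {z. t < w z & w z <= t+1/real (Suc k)} z :: ennreal) : bmeas cmu" by (simp add: indicator_def)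
   thus "(%z. enn (q z)*ind {z. t < w z & w z <= t+1/real (Suc k)} z) : bmeas cmu"
    using q_meas by (intro borel_measurable_times_ennreal) auto
  qed
  also have "enn (real (Suc k)*Lstp*B) = enn (Lstp*B)*enn (real (Suc k))"
   using B(1) Lstp(1) by (subst ennreal_mult[symmetric]) (auto simp: mult_ac)
  finally show ?thesis by (simp add: mult.assoc)
 qed
 show ?thesis
 \<comment> \<open>Otherwise the difference quotients would eventually be at least c, against the
   assumption on their lower limit.\<close>
 proof (rule ccontr)
  assume "\<not> \<bar>bdry_var n U V E th\<bar> <= Lstp*B*c"
  hence "Lstp*B*c < \<bar>bdry_var n U V E th\<bar>" by simp
  moreover have "(%k. \<bar>a k\<bar>) \<longlonglongrightarrow> \<bar>bdry_var n U V E th\<bar>" by (intro tendsto_rabs la)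
  ultimately have "eventually (%k. Lstp*B*c < \<bar>a k\<bar>) sequentially" by (rule order_tendstoD(1)[rotated])
  hence "eventually (%k. enn c <= ?\<Phi> k) sequentially"
  proof eventually_elim
   case (elim k)
   have "0 <= Lstp*B*c" using B c Lstp(1) by simp
   hence "enn (Lstp*B)*enn c < enn \<bar>a k\<bar>"
    using elim B c Lstp(1) \<open>0 <= Lstp*B*c\<close> by (subst ennreal_mult[symmetric]) (simp_all add: ennreal_less_iff)
   also have "... <= enn (Lstp*B)*?\<Phi> k" by (rule ab)
   finally have "\<not> ?\<Phi> k <= enn c" using mult_left_mono[of "?\<Phi> k" "enn c" "enn (Lstp*B)"] by auto
   thus ?case by simp
  qed
  hence "enn c <= liminf ?\<Phi>" by (rule Liminf_bounded)
  thus False using L by simp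
 qed
qed

text \<open>Distribution of the q-mass over the levels of w; its difference quotients are the ones
  occurring in \<open>superlevel_bdry_bound\<close>.\<close>

lemma finite_level_measure:
 defines "kp \<equiv> distr (density cmu (%z. enn (q z))) borel w"
 shows "finite_measure kp" "sets kp = sets borel"
  "emeas kp {t<..t+r} = (\<integral>\<^sup>+z. enn (q z)*ind {z. t < w z & w z <= t+r} z \<partial>cmu)"
proof -
 have wd: "w : measurable (density cmu (%z. enn (q z))) borel" using w_meas(1) by simp
 have qm: "(%z. enn (q z)) : bmeas cmu" using q_meas by measurable
 have e: "emeas kp A = (\<integral>\<^sup>+z. enn (q z)*ind (w -` A Int U) z \<partial>cmu)" if "A : sets borel" for A
 proof -
  have "emeas kp A = emeas (density cmu (%z. enn (q z))) (w -` A Int U)"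
   unfolding kp_def using emeasure_distr[OF wd that] by simp
  moreover have "w -` A Int U : sets cmu" using measurable_sets[OF w_meas(1) that] by simp
  ultimately show ?thesis using emeasure_density[OF qm] by simp
 qed
 show "sets kp = sets borel" by (simp add: kp_def)
 show "finite_measure kp"
 proof
  have "emeas kp (space kp) = emeas kp UNIV" by (simp add: kp_def)
  also have "... = (\<integral>\<^sup>+z. enn (q z)*ind (w -` UNIV Int U) z \<partial>cmu)" by (rule e) simp
  also have "... <= (\<integral>\<^sup>+z. enn (norm (q z)) \<partial>cmu)" by (intro nn_integral_mono) (simp add: indicator_def q_nonneg)
  also have "... < \<infinity>" using q_integrable by (simp add: integrable_iff_bounded)
  finally show "emeas kp (space kp) ~= \<infinity>" by simp
 qed
 have "emeas kp {t<..t+r} = (\<integral>\<^sup>+z. enn (q z)*ind (w -` {t<..t+r} Int U) z \<partial>cmu)" by (rule e) simp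
 also have "... = (\<integral>\<^sup>+z. enn (q z)*ind {z. t < w z & w z <= t+r} z \<partial>cmu)" by (rule nn_integral_cong) (simp add: indicator_def)
 finally show "emeas kp {t<..t+r} = (\<integral>\<^sup>+z. enn (q z)*ind {z. t < w z & w z <= t+r} z \<partial>cmu)" .
qed

text \<open>For w >= 0 the superlevel sets of the norm of g are those of w, and for t > 0 they lie
  in the compact support \<open>C0\<close> of \<open>xi\<close>, away from the boundary of U. Hence
  the measures involved are finite, and a test field that lives up to or beyond the boundary of U
  may be multiplied by a cutoff \<open>kp\<close> equal to one near \<open>C0\<close>. For almost
  every level the boundary distribution is controlled by
  \<open>superlevel_bdry_bound\<close>.\<close>

lemma g_TG:
 assumes wn: "!!z. z : U==>0 <= w z"
 shows "g : TG n 1 U V (Bdry n U)"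
proof -
 obtain C0 where C0: "compact C0" "C0 <= U" "!!z. z ~: C0 ==> xi z = 0" "smooth n U xi" by (rule CscE[OF xi]) (rule that; assumption)
 obtain kp H where kp: "kp : Csc n U" "!!x. 0 <= kp x" "!!x. kp x <= 1" "open H" "C0 <= H"
  "!!x. x : H Int Rn n ==> kp x = 1" using cutoff[OF U C0(1,2)] by blast
 have main: "(ALL C. compact C & C <= Rn n -->
    emeas cmu (E Int C)+emeas cnu (E Int C)+total_var n U (bdry_var n U V E) (U Int C) < \<infinity>) &
   (ALL th : Ccinf n (Rn n) n.
    (\<integral>(z, S). ind E z*hs_inner n (Deriv n th z) (orth_proj S) \<partial>cV) =
    ex (%z. ind E z *\<^sub>R th z) - Defs.ext n U (bdry_var n U V E) th)"
  if t: "0 < t" and E: "E = {z : U. t < w z}"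
   and L: "liminf (%k. enn (real (Suc k))*(\<integral>\<^sup>+z. enn (q z)*ind {z. t < w z & w z <= t+1/real (Suc k)} z \<partial>cmu)) < \<infinity>" for t E
 proof -
  obtain c where c: "0 < c" "liminf (%k. enn (real (Suc k))*(\<integral>\<^sup>+z. enn (q z)*ind {z. t < w z & w z <= t+1/real (Suc k)} z \<partial>cmu)) < enn c"
  proof -
   let ?l = "liminf (%k. enn (real (Suc k))*(\<integral>\<^sup>+z. enn (q z)*ind {z. t < w z & w z <= t+1/real (Suc k)} z \<partial>cmu))"
   obtain r where r: "?l = enn r" "0 <= r" using L by (cases ?l) auto
   have "enn r < enn (r+1)" using r by (intro ennreal_lessI) auto
   thus ?thesis using that[of "r+1"] r by simp
  qed
  let ?T = "bdry_var n U V E"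
  have bd: "\<bar>?T th\<bar> <= Lstp*B*c" if "th : Ccinf n U n" "0 <= B" "!!z. norm (th z) <= B" for th B by (rule superlevel_bdry_bound[OF c(2,1) E that])
  have Em: "E : sets cmu" "E : sets cnu"
  proof -
   have "{z : space cmu. t < w z} : sets cmu" "{z : space cnu. t < w z} : sets cnu" using w_meas by measurable
   thus "E : sets cmu" "E : sets cnu" by (simp_all add: E)
  qed
  have im: "(ind E :: vec => real) : bmeas cmu" "(ind E :: vec => real) : bmeas cnu"
   using Em by (auto intro: borel_measurable_indicator)
  have EC: "E <= C0" using C0(3) t by (force simp: E w_def)
  have be: "?T th = ex (%z. ind E z *\<^sub>R th z) - (\<integral>p. ind E (fst p)*HS th p \<partial>cV)" for th
   unfolding bdry_var_def case_prod_unfold HS_def ..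
  have LE: "vd.L1v (%z. ind E z *\<^sub>R th z)" if "th : Ccinf n U n" for th by (rule L1v_mult[OF that im(2), where R = 1]) (simp add: indicator_def)
  have IE: "integrable cV (%p. ind E (fst p)*HS th p)" if "th : Ccinf n U n" for th by (rule HS_expand(1)[OF that im(1), where B = 1]) (simp add: indicator_def)
  have tvb: "total_var n U ?T A <= enn (Lstp*1*c)" if "A <= U" for A
   unfolding total_var_def
  proof (rule INF_lower2[of U])
   show "(SUP g\<in>{g : Ccinf n U n. ALL z. norm (g z) <= 1}. enn (?T g)) <= enn (Lstp*1*c)" by (intro SUP_least ennreal_leI order_trans[OF abs_ge_self bd]) auto
  qed (use that in simp)
  \<comment> \<open>The boundary distribution is itself a vector distribution of finite total
    variation, so the general results on \<open>ext\<close> apply to it.\<close>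
  interpret bv: vdist n U ?T
  proof
   show "opn n U" by (rule U)
   show "?T (%z. g z+h z) = ?T g + ?T h" if g: "g : Ccinf n U n" and h: "h : Ccinf n U n" for g h
   proof -
    have "(\<integral>p. ind E (fst p)*HS (%z. g z+h z) p \<partial>cV) = (\<integral>p. ind E (fst p)*HS g p+ind E (fst p)*HS h p \<partial>cV)" by (intro Bochner_Integration.integral_cong refl) (simp add: HS_add[OF g h] distrib_left)
    thus ?thesis unfolding be using vd.ext_add[OF LE[OF g] LE[OF h]] IE[OF g] IE[OF h] by (simp add: scaleR_add_right)
   qed
   show "?T (%z. c *\<^sub>R g z) = c*?T g" if g: "g : Ccinf n U n" for g c
   proof -
    have "(\<integral>p. ind E (fst p)*HS (%z. c *\<^sub>R g z) p \<partial>cV) = (\<integral>p. c*(ind E (fst p)*HS g p) \<partial>cV)" by (intro Bochner_Integration.integral_cong refl) (simp add: HS_scale[OF g])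
    moreover have "ex (%z. ind E z *\<^sub>R (c *\<^sub>R g z)) = c*ex (%z. ind E z *\<^sub>R g z)"
     using vd.ext_scale[OF LE[OF g], of c] by (simp add: mult.commute)
    ultimately show ?thesis unfolding be by (simp add: right_diff_distrib)
   qed
   show "radon_var n U ?T" unfolding radon_var_def using tvb by (metis ennreal_less_top infinity_ennreal_def order_le_less_trans)
  qed
  show ?thesis
  proof (intro conjI allI impI ballI)
   fix C assume "compact C & C <= Rn n"
   have m1: "C0 : sets mu" "C0 : sets nu" using C0 borel_closed[OF compact_imp_closed[OF C0(1)]] by (auto simp: in_sets_mu vd.in_sets_M)
   have "emeas cmu (E Int C) <= emeas cmu C0" "emeas cnu (E Int C) <= emeas cnu C0"
    using EC m1 emeasure_mono[of "E Int C" C0 cmu] emeasure_mono[of "E Int C" C0 cnu] by auto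
   moreover have "emeas cmu C0 < \<infinity>" "emeas cnu C0 < \<infinity>" using mu_compact[OF C0(1,2)] vd.M_compact[OF C0(1,2)] m1 by auto
   ultimately have 1: "emeas cmu (E Int C) < \<infinity>" "emeas cnu (E Int C) < \<infinity>" using order_le_less_trans by blast+
   have "total_var n U ?T (U Int C) <= enn (Lstp*1*c)" by (rule tvb) auto
   hence "total_var n U ?T (U Int C) < \<infinity>" by (rule order_le_less_trans) simp
   thus "emeas cmu (E Int C)+emeas cnu (E Int C)+total_var n U ?T (U Int C) < \<infinity>" using 1 by simp
  next
   fix th assume th: "th : Ccinf n (Rn n) n"
   have ths: "smooth n U th" "!!z. th z : Rn n" using th smooth_subset[OF _ opn_subset[OF U]] by (auto simp: Ccinf_def)
   define th' where "th' z = kp z *\<^sub>R th z" for z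
   have th': "th' : Ccinf n U n" unfolding th'_def by (rule Ccinf_Csc[OF U kp(1) ths])
   have eqC: "th' z = th z" if "z : C0" for z
   proof -
    have "z : H Int Rn n" using that kp(5) C0(2) opn_subset[OF U] by blast
    thus ?thesis using kp(6) by (simp add: th'_def)
   qed
   \<comment> \<open>As E lies in \<open>C0\<close>, the boundary distribution has no mass off
     \<open>C0\<close>; thus \<open>th\<close> and \<open>th'\<close> agree almost everywhere for
     it.\<close>
   have null: "emeas bv.M (U - C0) = 0"
   proof (rule bv.M_null)
    show "opn n (U - C0)" using U C0 by (intro opn_Diff_closed compact_imp_closed)
    show "?T h = 0" if h: "h : Ccinf n (U - C0) n" for h
    proof -
     obtain D where D: "compact D" "D <= U - C0" "!!z. z ~: D==>h z = 0" "smooth n (U - C0) h" "!!z. h z : Rn n" by (rule CcinfE[OF h]) (rule that; assumption)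
     have "ind E z *\<^sub>R h z = 0" for z using EC D(2,3) by (auto simp: indicator_def)
     hence z0: "(%z. ind E z *\<^sub>R h z) = (%z. 0)" by (rule HOL.ext)
     have 1: "ex (%z. ind E z *\<^sub>R h z) = 0" unfolding z0 using vd.ext_Ccinf[OF Ccinf_zero[OF U]] vd.T_zero by simp
     have "ind E (fst p)*HS h p = 0" if p: "p : space cV" for p
     proof (cases "fst p : E")
      case True
      hence "fst p ~: D" using EC D(2) by blast
      moreover have "fst p : U" using True E by simp
      ultimately have "Deriv n h (fst p) (uv i) = 0" if "i < n" for i
       using Deriv_zero_off[of D h "fst p" "uv i"] D that by blast
      thus ?thesis using HS_eq[of p h] p by simp
     qed simp
     hence "(\<integral>p. ind E (fst p)*HS h p \<partial>cV) = (\<integral>p. 0 \<partial>cV)" by (intro Bochner_Integration.integral_cong refl)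
     thus ?thesis unfolding be 1 by simp
    qed
   qed simp
   have "U - C0 : null_sets bv.M"
    using null C0 opn_borel[OF U] borel_closed[OF compact_imp_closed[OF C0(1)]] by (intro null_setsI) (auto simp: bv.in_sets_M)
   hence "AE z in bv.M. z ~: U - C0" by (rule AE_not_in)
   moreover have "AE z in bv.M. z : U" by (rule AE_I2) simp
   ultimately have "AE z in bv.M. th z = th' z" by eventually_elim (auto simp: eqC)
   hence "Defs.ext n U ?T th = Defs.ext n U ?T th'" by (rule bv.ext_cong)
   also have "... = ?T th'" by (rule bv.ext_Ccinf[OF th'])
   finally have ext_eq: "Defs.ext n U ?T th = ?T th'" .
   have "(%z. ind E z *\<^sub>R th' z) = (%z. ind E z *\<^sub>R th z)" 
   proof
    fix z show "ind E z *\<^sub>R th' z = ind E z *\<^sub>R th z"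
     using EC eqC[of z] by (cases "z : E") auto
   qed
   moreover have "(\<integral>p. ind E (fst p)*HS th' p \<partial>cV) = (\<integral>p. ind E (fst p)*HS th p \<partial>cV)"
   proof (intro Bochner_Integration.integral_cong refl)
    fix p assume p: "p : space cV"
    show "ind E (fst p)*HS th' p = ind E (fst p)*HS th p"
    proof (cases "fst p : E")
     case True
     have o: "opn n (U Int H)" by (rule opn_Int_open[OF U kp(4)])
     have "fst p : U Int H" using True E EC kp(5) by blast
     hence "Deriv n th' (fst p) (uv i) = Deriv n th (fst p) (uv i)" if "i < n" for i by (rule Deriv_smooth_cong[OF o _ _ smooth_subset[OF ths(1)]])
       (use kp(6) opn_mem[OF U] that in "auto simp: th'_def")
     thus ?thesis using HS_eq[of p] p by simp
    qed simp
   qed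
   ultimately have "?T th' = ex (%z. ind E z *\<^sub>R th z) - (\<integral>p. ind E (fst p)*HS th p \<partial>cV)" unfolding be by simp
   thus "(\<integral>(z, S). ind E z*hs_inner n (Deriv n th z) (orth_proj S) \<partial>cV) =
    ex (%z. ind E z *\<^sub>R th z) - Defs.ext n U ?T th"
    unfolding ext_eq case_prod_unfold HS_def by simp
  qed
 qed
 have "AE t in lborel. 0 < t -->
  (let B = Bdry n U - Bdry n U; E = {z : U. t < norm (g z)} in
   (ALL C. compact C & C <= Rn n - B -->
    emeas cmu (E Int C)+emeas cnu (E Int C)+total_var n U (bdry_var n U V E) (U Int C) < \<infinity>) &
   (ALL th : Ccinf n (Rn n - B) n.
    (\<integral>(z, S). ind E z*hs_inner n (Deriv n th z) (orth_proj S) \<partial>cV) =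
    ex (%z. ind E z *\<^sub>R th z) - Defs.ext n U (bdry_var n U V E) th))"
  using liminf_quotient_finite[OF finite_level_measure(1,2)]
 proof eventually_elim
  case (elim t)
  show ?case
  proof
   assume t: "0 < t"
   have e: "{z : U. t < norm (g z)} = {z : U. t < w z}" using wn by (auto simp: norm_g)
   show "let B = Bdry n U - Bdry n U; E = {z : U. t < norm (g z)} in
   (ALL C. compact C & C <= Rn n - B -->
    emeas cmu (E Int C)+emeas cnu (E Int C)+total_var n U (bdry_var n U V E) (U Int C) < \<infinity>) &
   (ALL th : Ccinf n (Rn n - B) n.
    (\<integral>(z, S). ind E z*hs_inner n (Deriv n th z) (orth_proj S) \<partial>cV) =
    ex (%z. ind E z *\<^sub>R th z) - Defs.ext n U (bdry_var n U V E) th)"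
    unfolding Let_def Diff_cancel Diff_empty by (rule main[OF t e]) (use elim in "simp only: finite_level_measure(3)")
  qed
 qed
 thus ?thesis unfolding TG_def using g_TV by blast
qed

end

subsection \<open>Consequences of the Sobolev--Poincare property\<close>

lemma epow_mono: "x <= y==>0 <= a==>epow x a <= epow y a" by (cases x; cases y) (auto simp: epow_def top_unique intro!: ennreal_leI powr_mono2)

lemma epow_one: "epow x 1 = x" by (cases x) (auto simp: epow_def)

lemma Lnorm_mono:
 assumes f: "f : bmeas M" and le: "AE z in M. \<bar>f z\<bar> <= \<bar>g z\<bar>"
 shows "Lnorm M q f <= Lnorm M q g"
proof (cases "q = \<infinity>")
 case True
 have "(%z. enn \<bar>f z\<bar>) : bmeas M" using f by measurable
 moreover have "AE z in M. enn \<bar>f z\<bar> <= enn \<bar>g z\<bar>" using le by eventually_elim (rule ennreal_leI)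
 ultimately show ?thesis using True by (simp add: Lnorm_def esssup_AE_mono)
next
 case False
 have "(\<integral>\<^sup>+z. enn (\<bar>f z\<bar> powr enn2real q) \<partial>M) <= (\<integral>\<^sup>+z. enn (\<bar>g z\<bar> powr enn2real q) \<partial>M)" by (rule nn_integral_mono_AE) (use le in "eventually_elim, auto intro!: ennreal_leI powr_mono2")
 thus ?thesis using False by (simp add: Lnorm_def epow_mono)
qed

lemma Lnorm_1: "(!!z. 0 <= f z)==>Lnorm M 1 f = (\<integral>\<^sup>+z. enn (f z) \<partial>M)" by (simp add: Lnorm_def epow_one)

text \<open>The varifold hypotheses of the theorem together with a Sobolev-Poincare number for M =
  2n. The inequality is used with exponent p = m, so that \<open>psi\<close> is the variation
  measure for m = 1 and is given by the m-th power of the mean curvature for m > 1.\<close>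

locale vsp = vfr +
 fixes \<Gamma> :: real
 assumes m1: "1 <= m" and mn: "m <= n"
  and dens: "AE z in weight U V. has_mdens (weight U V) m z & 1 <= mdens (weight U V) m z"
  and mc: "1 < m==>mean_curv_hyp n U V (real m)"
  and SP: "SP (2*real n) \<Gamma>"
begin

abbreviation "psi \<equiv> psi_measure n U V (real m)"
abbreviation "Sp \<equiv> spt U mu"

lemma \<Gamma>_pos: "0 < \<Gamma>" using SP by (simp add: SP_def)

text \<open>Part (II) of the property, with zero boundary values prescribed on all of the boundary
  of U.\<close>

lemma SP_apply:
 assumes g: "g : TG n 1 U V (Bdry n U)" and fin: "emeas cmu {z : U. g z ~= 0} < \<infinity>"
 shows "SP_implications \<Gamma> 1 m n (real m) U V g cmu"
proof -
 note S = SP[unfolded SP_def Let_def, THEN conjunct2, rule_format, of 1 m n "real m" U V "Bdry n U" g, THEN conjunct2]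
 show ?thesis by (rule S[rule_format]) (use m1 mn U vf radon dens mc g fin in auto)
qed

lemma Sp_U: "Sp <= U" by (auto simp: spt_def)

definition Nsp :: "vec set" where "Nsp = \<Union>{W. openin (top_of_set U) W & emeas mu W = 0}"

lemma Sp_eq: "Sp = U - Nsp" by (simp add: spt_def Nsp_def)

lemma Nsp_open: "opn n Nsp" "Nsp <= U"
proof -
 show "opn n Nsp" unfolding Nsp_def by (rule openin_Union) (use opn_trans[OF U] in auto)
 show "Nsp <= U" unfolding Nsp_def using openin_imp_subset by blast
qed

text \<open>A union of arbitrarily many open null sets: every compact subset is covered by finitely
  many of them, and countably many compact sets exhaust the union.\<close>

lemma Nsp_null: "Nsp : null_sets mu"
proof -
 obtain C where C: "!!k::nat. compact (C k)" "(\<Union>k. C k) = Nsp" using opn_exhaust[OF Nsp_open(1)] by metis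
 have "C k : null_sets mu" for k
 proof -
  have sub: "C k <= Nsp" using C(2) by blast
  let ?\<W> = "{W. openin (top_of_set U) W & emeas mu W = 0}"
  have "EX H. open H & W = U Int H" if "W : ?\<W>" for W using that by (auto simp: openin_open)
  then obtain H where H: "!!W. W : ?\<W>==>open (H W) & W = U Int H W" by metis
  obtain F where F: "F <= ?\<W>" "finite F" "C k <= (\<Union>W\<in>F. H W)"
  proof (rule compactE_image[OF C(1)[of k], of ?\<W> H])
   show "C k <= (\<Union>W\<in>?\<W>. H W)" using sub H unfolding Nsp_def by blast
  qed (use H in auto)
  have W0: "W : null_sets mu" if "W : F" for W
  proof -
   have "openin (top_of_set U) W" "emeas mu W = 0" using that F(1) by auto
   moreover have "W : sets borel" "W <= U" using opn_borel[OF opn_trans[OF U calculation(1)]] openin_imp_subset[OF calculation(1)] by auto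
   ultimately show ?thesis by (intro null_setsI) (auto simp: in_sets_mu)
  qed
  have "(\<Union>W\<in>F. W) : null_sets mu" using F(2) W0 by (intro null_sets_UN') (auto intro: countable_finite)
  moreover have "C k <= (\<Union>W\<in>F. W)"
  proof
   fix x assume x: "x : C k"
   then obtain W where W: "W : F" "x : H W" using F(3) by blast
   have "x : U" using x sub Nsp_open(2) by blast
   thus "x : (\<Union>W\<in>F. W)" using W H F(1) by blast
  qed
  moreover have "C k : sets mu" using borel_closed[OF compact_imp_closed[OF C(1)]] sub Nsp_open(2) by (auto simp: in_sets_mu)
  ultimately show ?thesis by (metis null_sets_subset)
 qed
 hence "(\<Union>k. C k) : null_sets mu" by (intro null_sets_UN) auto
 thus ?thesis using C(2) by simp
qed

lemma AE_Sp: "AE z in cmu. z : Sp"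
proof -
 have "AE z in mu. z ~: Nsp" by (rule AE_not_in[OF Nsp_null])
 moreover have "AE z in mu. z : U" by (rule AE_I2) simp
 ultimately have "AE z in mu. z : Sp" by eventually_elim (simp add: Sp_eq)
 thus ?thesis by (rule AE_completion)
qed

text \<open>An inequality valid almost everywhere holds somewhere near each point of the support.\<close>

lemma AE_near_Sp:
 assumes Pr: "AE z in cmu. Pr z" and y: "y : Sp" and H: "open H" "y : H"
 shows "EX z:Sp Int H. Pr z"
proof (rule ccontr)
 assume c: "\<not> ?thesis"
 have o: "openin (top_of_set U) (U Int H)" using H by (simp add: openin_open_Int)
 have m: "U Int H : sets mu" using opn_borel[OF opn_trans[OF U o]] by (simp add: in_sets_mu)
 have "AE z in cmu. z ~: U Int H" using Pr AE_Sp by eventually_elim (use c in blast)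
 hence "AE z in mu. z ~: U Int H" by (simp add: AE_completion_iff)
 hence "U Int H : null_sets mu" using m by (subst AE_iff_null_sets) auto
 hence "U Int H <= Nsp" using o by (auto simp: Nsp_def null_sets_def)
 thus False using y H by (auto simp: Sp_eq)
qed

lemma Sp_closed: assumes C: "compact C" "C <= U" shows "compact (Sp Int C)"
proof -
 obtain H where H: "open H" "Nsp = Rn n Int H" using Nsp_open(1) by (auto simp: openin_open)
 have "Sp Int C = C - H" using C(2) Nsp_open H opn_mem[OF U] by (auto simp: Sp_eq)
 thus ?thesis using compact_diff[OF C(1) H(1)] by simp
qed

lemma Sp_borel: "Sp : sets mu"
 using opn_borel[OF Nsp_open(1)] opn_borel[OF U] by (auto simp: Sp_eq in_sets_mu)

text \<open>Allows the product results to be used with f = 0 and \<open>eta\<close> = 1, in which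
  case the product is the cutoff \<open>xi\<close> itself.\<close>

lemma zero_weak_deriv: "is_weak_deriv n 1 U V (%z. 0) (%z v. 0)"
 unfolding is_weak_deriv_def
proof (intro conjI allI ballI impI)
 show "(%z v. 0) ` U <= Hom n 1" by (auto simp: Hom_def intro!: linearI)
 show "(\<integral>\<^sup>+z\<in>C Int {z. norm (0::vec) <= s}. enn (hs_norm n (%v. 0)) \<partial>cmu) < \<infinity>" for C s by (simp add: hs_norm_def hs_inner_def)
 fix th and eta :: "vec => real" assume th: "th : Ccinf n U n"
  and eta: "smooth 1 (Rn 1) eta & (EX C. compact C & C <= Rn 1 & (ALL y:Rn 1 - C. ALL v:Rn 1. Deriv 1 eta y v = 0))"
 have "ex (%z. eta 0 *\<^sub>R th z) = eta 0*first_var n V th"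
  using vd.ext_Ccinf[OF Ccinf_scale[OF U th]] vd.T_scale[OF th] by simp
 also have "... = (\<integral>p. eta 0*HS th p \<partial>cV)" by (simp add: first_var_eq[OF th])
 moreover have "Deriv 1 eta 0 0 = 0" using linear_0[OF Deriv_linear[OF conjunct1[OF eta], of 0]] by simp
 ultimately show "ex (%z. eta 0 *\<^sub>R th z) = (\<integral>(z, S). eta 0*hs_inner n (orth_proj S) (Deriv n th z) \<partial>cV)+(\<integral>z. Deriv 1 eta 0 0 \<partial>cmu)"
  unfolding case_prod_unfold HS_def by (simp add: hs_inner_commute)
qed (auto simp: hs_norm_def hs_inner_def)

end

locale vspw = vsp+wprod
begin

text \<open>Implication (b) for m = 1 and implication (d) for m > 1. The weak derivative occurring
  there is an arbitrary choice; \<open>weak_deriv_unique\<close> identifies its norm with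
  \<open>q\<close> almost everywhere. The essential supremum on the left is read as an almost
  everywhere bound on w.\<close>

lemma SP_estimate:
 assumes wn: "!!z. z : U==>0 <= w z" and small: "emeas psi {z : U. w z ~= 0} <= enn (1/\<Gamma>)"
 shows "m = 1==>AE z in cmu. enn (w z) <= enn \<Gamma>*(\<integral>\<^sup>+z. enn (q z) \<partial>cmu)"
  "1 < m==>ennreal (real m) < r==>a = 1/real m - enn2real (1/r) ==>
   AE z in cmu. enn (w z) <= enn (\<Gamma> powr (1/a))*epow (emeas cmu {z : U. w z ~= 0}) a*Lnorm cmu r q"
proof -
 obtain C0 B where C0: "compact C0" "C0 <= U" "0 <= B" "ALL z. z ~: C0 --> xi z = 0" "ALL z:U. \<bar>xi z\<bar> <= B" "ALL z:U. \<bar>dx z\<bar> <= B"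
  "ALL z:U. z ~: C0 --> dx z = 0" using xi_bounds by (elim exE conjE)
 have gw: "{z : U. g z ~= 0} = {z : U. w z ~= 0}"
 proof -
  have "g z ~= 0 \<longleftrightarrow> w z ~= 0" for z using norm_g[of z] by (metis abs_eq_0 norm_eq_zero)
  thus ?thesis by simp
 qed
 have sub: "{z : U. w z ~= 0} <= C0" using C0(4) by (auto simp: w_def)
 have Cm: "C0 : sets mu" using C0 borel_closed[OF compact_imp_closed[OF C0(1)]] by (simp add: in_sets_mu)
 have "emeas cmu {z : U. w z ~= 0} <= emeas cmu C0" using Cm by (intro emeasure_mono sub) auto
 also have "... < \<infinity>" using mu_compact[OF C0(1,2)] Cm by simp
 finally have "emeas cmu {z : U. g z ~= 0} < \<infinity>" using gw by simp
 from SP_apply[OF g_TG[OF wn] this]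
 have sp: "SP_implications \<Gamma> 1 m n (real m) U V g cmu" by simp
 let ?D = "%z. hs_norm n (weak_deriv n 1 U V g z)"
 have "is_weak_deriv n 1 U V g (weak_deriv n 1 U V g)"
  unfolding weak_deriv_def by (rule someI[of _ G]) (rule weak_deriv_g)
 hence D: "AE z in cmu. ?D z = q z" and D': "?D : bmeas cmu"
 proof -
  assume W: "is_weak_deriv n 1 U V g (weak_deriv n 1 U V g)"
  show "AE z in cmu. ?D z = q z" by (rule weak_deriv_unique[OF W])
  have "(%z. \<Sum>i<n. (norm (weak_deriv n 1 U V g z (uv i)))^2) : bmeas cmu"
   using W[unfolded is_weak_deriv_def, THEN conjunct2, THEN conjunct1] by (intro borel_measurable_sum borel_measurable_power measurable_compose[OF _ borel_measurable_norm]) auto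
  thus "?D : bmeas cmu" unfolding hs_norm_L2 L2_set_def by measurable
 qed
 have Ln: "Lnorm cmu r ?D <= Lnorm cmu r q" for r by (rule Lnorm_mono[OF D']) (use D in eventually_elim, simp)
 have u: "AE z in cmu. enn (w z) <= Lnorm cmu \<infinity> (%z. norm (g z))"
 proof -
  have "AE z in cmu. enn \<bar>norm (g z)\<bar> <= Lnorm cmu \<infinity> (%z. norm (g z))"
   using esssup_AE[of "%z. enn \<bar>norm (g z)\<bar>" cmu] by (simp add: Lnorm_def)
  thus ?thesis
  proof eventually_elim
   case (elim z)
   have "enn (w z) <= enn \<bar>norm (g z)\<bar>" by (rule ennreal_leI) (simp add: norm_g)
   thus ?case using elim by (rule order_trans)
  qed
 qed
 note spu = sp[unfolded SP_implications_def Let_def gw]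
 show "AE z in cmu. enn (w z) <= enn \<Gamma>*(\<integral>\<^sup>+z. enn (q z) \<partial>cmu)" if "m = 1"
 proof -
  have "Lnorm cmu \<infinity> (%z. norm (g z)) <= enn \<Gamma>*Lnorm cmu 1 ?D" by (rule spu[THEN conjunct2, THEN conjunct1, rule_format]) (use that small in simp)
  also have "... <= enn \<Gamma>*Lnorm cmu 1 q" by (intro mult_left_mono Ln) simp
  also have "Lnorm cmu 1 q = (\<integral>\<^sup>+z. enn (q z) \<partial>cmu)" by (rule Lnorm_1[OF q_nonneg])
  finally show ?thesis using u by (auto elim!: eventually_mono intro: order_trans)
 qed
 show "AE z in cmu. enn (w z) <= enn (\<Gamma> powr (1/a))*epow (emeas cmu {z : U. w z ~= 0}) a*Lnorm cmu r q"
  if "1 < m" "enn (real m) < r" "a = 1/real m - enn2real (1/r)"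
 proof -
  have "Lnorm cmu \<infinity> (%z. norm (g z)) <= enn (\<Gamma> powr (1/a))*epow (emeas cmu {z : U. w z ~= 0}) a*Lnorm cmu r ?D"
   unfolding that(3) by (rule spu[THEN conjunct2, THEN conjunct2, THEN conjunct2, rule_format]) (use that small in auto)
  also have "... <= enn (\<Gamma> powr (1/a))*epow (emeas cmu {z : U. w z ~= 0}) a*Lnorm cmu r q" by (intro mult_left_mono Ln) simp
  finally show ?thesis using u by (auto elim!: eventually_mono intro: order_trans)
 qed
qed

end

context vsp
begin

lemma vspw_smooth:
 assumes "xi : Csc n U"
 shows "vspw n m U V \<Gamma> 1 (%z. 0) (%z v. 0) (%y. 1) xi 1 0 0"
proof (unfold_locales)
 show "smooth 1 (Rn 1) (%y. 1::real)" by (rule smooth_const) simp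
 show "EX C. compact C & C <= Rn 1 & (ALL y:Rn 1 - C. ALL v:Rn 1. Deriv 1 (%y. 1::real) y v = 0)" by (intro exI[of _ "{}"]) (auto simp: Deriv_const)
qed (auto simp: zero_weak_deriv[simplified] zero_weak_deriv assms Deriv_const)

text \<open>A test function with gradient bounded by \<open>D\<close> and living on a set of small measure is small.\<close>

lemma small_mass:
 assumes D: "0 < D"
 shows "EX c>0. ALL xi E. xi : Csc n U --> (ALL z. 0 <= xi z) --> E : sets mu --> emeas mu E <= enn c -->
  emeas psi {z : U. xi z ~= 0} <= enn (1/\<Gamma>) -->
  (AE z in cmu. z ~: E --> xi z = 0) -->
  (AE z in cmu. (\<Sum>i<n. \<bar>Deriv n xi z (uv i)\<bar>) <= D*ind E z) -->
  (AE z in cmu. xi z <= 1/2)"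
proof -
 have np: "0 < n" using m1 mn by simp
 have n0: "0 < real n*D" using D np by simp
 \<comment> \<open>Chosen so that the right-hand side of the estimate, with derivative at most n D,
   is 1/2: for m = 1 it is Gamma n D c, and for m > 1 with integrability exponent infinity it is
   Gamma^m c^(1/m) n D.\<close>
 define c where "c = (if m = 1 then 1/(2*\<Gamma>*(real n*D)) else (1/(2*\<Gamma> powr real m*(real n*D))) powr real m)"
 have c: "0 < c" using \<Gamma>_pos n0 unfolding c_def using m1 mn by auto
 have main: "AE z in cmu. xi z <= 1/2" if xi: "xi : Csc n U" "!!z. 0 <= xi z" and E: "E : sets mu" "emeas mu E <= enn c"
  and small: "emeas psi {z : U. xi z ~= 0} <= enn (1/\<Gamma>)"
  and z1: "AE z in cmu. z ~: E --> xi z = 0" and d: "AE z in cmu. (\<Sum>i<n. \<bar>Deriv n xi z (uv i)\<bar>) <= D*ind E z" for xi E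
 proof -
  interpret X: vspw n m U V \<Gamma> 1 "%z. 0" "%z v. 0" "%y. 1" xi 1 0 0 by (rule vspw_smooth[OF xi(1)])
  have w: "X.w z = xi z" for z by (simp add: X.w_def X.u_def)
  have wn: "0 <= X.w z" for z using xi(2) by (simp add: w)
  have sm: "emeas psi {z : U. X.w z ~= 0} <= enn (1/\<Gamma>)" using small by (simp add: w)
  have AU: "AE z in cmu. z : U" by (rule AE_I2) simp
  have ql: "AE z in cmu. X.q z <= real n*D*ind E z"
   using d AU
  proof eventually_elim
   case (elim z)
   have "X.q z <= real n*X.dx z"
   proof -
    have "Deriv 1 (%y. 1::real) 0 0 = 0" by (rule Deriv_const) auto
    thus ?thesis using X.q_le[OF elim(2)] by (simp add: X.u_def L2_set_def del: One_nat_def)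
   qed
   also have "... <= real n*(D*ind E z)" using elim(1) by (intro mult_left_mono) (auto simp: X.dx_def)
   finally show ?case by (simp add: mult.assoc)
  qed
  have Ec: "E : sets cmu" using E(1) by simp
  have key: "AE z in cmu. enn (xi z) <= enn (1/2)"
  proof (cases "m = 1")
   case True
   have "(\<integral>\<^sup>+z. enn (X.q z) \<partial>cmu) <= (\<integral>\<^sup>+z. enn (real n*D)*ind E z \<partial>cmu)" by (rule nn_integral_mono_AE) (use ql in "eventually_elim, auto simp: indicator_def ennreal_neg intro!: ennreal_leI split: if_splits")
   also have "... = enn (real n*D)*emeas mu E" using Ec E(1) by (simp add: nn_integral_cmult_indicator)
   also have "... <= enn (real n*D)*enn c" by (intro mult_left_mono E) simp
   finally have "enn \<Gamma>*(\<integral>\<^sup>+z. enn (X.q z) \<partial>cmu) <= enn \<Gamma>*(enn (real n*D)*enn c)" by (intro mult_left_mono) auto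
   also have "... = enn (\<Gamma>*(real n*D*c))" using \<Gamma>_pos n0 c by (simp add: ennreal_mult)
   also have "\<Gamma>*(real n*D*c) = 1/2" using \<Gamma>_pos D np True by (simp add: c_def)
   finally have "enn \<Gamma>*(\<integral>\<^sup>+z. enn (X.q z) \<partial>cmu) <= enn (1/2)" .
   thus ?thesis using X.SP_estimate(1)[OF wn sm True] by (auto elim!: eventually_mono intro: order_trans simp: w)
  next
   case False
   hence m2: "1 < m" using m1 by simp
   have a: "1/real m = 1/real m - enn2real (1/\<infinity>)" by simp
   have Lq: "Lnorm cmu \<infinity> X.q <= enn (real n*D)"
   proof -
    have "(%z. enn \<bar>X.q z\<bar>) : bmeas cmu" using X.q_meas by measurable
    moreover have "AE z in cmu. enn \<bar>X.q z\<bar> <= enn (real n*D)"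
     using ql
    proof eventually_elim
     case (elim z)
     have "real n*D*ind E z <= real n*D*1" using n0 by (intro mult_left_mono) (auto simp: indicator_def)
     thus ?case using elim X.q_nonneg[of z] by (intro ennreal_leI) simp
    qed
    ultimately show ?thesis by (simp add: Lnorm_def esssup_I)
   qed
   have "emeas cmu {z : U. X.w z ~= 0} <= emeas cmu E"
   proof (rule emeasure_mono_AE)
    show "AE z in cmu. z : {z : U. X.w z ~= 0} --> z : E" using z1 by eventually_elim (auto simp: w)
   qed (rule Ec)
   hence "emeas cmu {z : U. X.w z ~= 0} <= enn c" using E by simp
   hence "epow (emeas cmu {z : U. X.w z ~= 0}) (1/real m) <= epow (enn c) (1/real m)" by (rule epow_mono) simp
   also have "... = enn (1/(2*\<Gamma> powr real m*(real n*D)))"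
    using c m2 \<Gamma>_pos n0 by (simp add: epow_def c_def powr_powr)
   finally have ep: "epow (emeas cmu {z : U. X.w z ~= 0}) (1/real m) <= enn (1/(2*\<Gamma> powr real m*(real n*D)))" .
   have "enn (\<Gamma> powr (1/(1/real m)))*epow (emeas cmu {z : U. X.w z ~= 0}) (1/real m)*Lnorm cmu \<infinity> X.q
    <= enn (\<Gamma> powr real m)*enn (1/(2*\<Gamma> powr real m*(real n*D)))*enn (real n*D)" by (intro mult_mono ep Lq) auto
   also have "... = enn (\<Gamma> powr real m*(1/(2*\<Gamma> powr real m*(real n*D)))*(real n*D))"
    using \<Gamma>_pos n0 by (simp only: ennreal_mult'[symmetric] powr_ge_zero mult_nonneg_nonneg less_imp_le divide_nonneg_nonneg zero_le_one zero_le_numeral)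
   also have "\<Gamma> powr real m*(1/(2*\<Gamma> powr real m*(real n*D)))*(real n*D) = 1/2" using \<Gamma>_pos D np by simp
   finally have "enn (\<Gamma> powr (1/(1/real m)))*epow (emeas cmu {z : U. X.w z ~= 0}) (1/real m)*Lnorm cmu \<infinity> X.q <= enn (1/2)" .
   thus ?thesis using X.SP_estimate(2)[OF wn sm m2 _ a] by (auto elim!: eventually_mono intro: order_trans simp: w)
  qed
  thus ?thesis by eventually_elim (subst (asm) ennreal_le_iff, simp_all)
 qed
 show ?thesis using c main by (intro exI[of _ c]) blast
qed

end

section \<open>Relatively clopen pieces of the support and a local intermediate value
  property\<close>

context vsp
begin

text \<open>In such a ball the smallness condition on \<open>psi\<close> holds for every function
  that is supported in the ball and vanishes at a. The centre is taken out because for m = 1 the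
  variation measure may have an atom there, which no choice of radius makes small.\<close>

definition nice_ball :: "vec => real => bool" where
 "nice_ball a r \<longleftrightarrow> a : Sp & 0 < r & cball a r Int Rn n <= U & emeas psi (ball a r Int U - {a}) <= enn (1/\<Gamma>)"

lemma sets_psi: "A : sets borel==>A <= U==>A : sets psi" by (auto simp: psi_measure_def in_sets_mu vd.in_sets_M)

definition clop :: "vec => real => vec set => bool" where
 "clop a rho Q \<longleftrightarrow> openin (top_of_set (Sp Int ball a (2*rho))) Q & closedin (top_of_set (Sp Int ball a (2*rho))) Q & a ~: Q"

lemma clop_sets: assumes "clop a rho Q" shows "Q : sets mu" "Q <= Sp Int ball a (2*rho)"
proof -
 obtain H where H: "open H" "Q = Sp Int ball a (2*rho) Int H" using assms by (auto simp: clop_def openin_open)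
 show "Q <= Sp Int ball a (2*rho)" using H by blast
 have "Sp : sets borel" using Sp_borel by (simp add: in_sets_mu)
 hence "Q : sets borel" using H by auto
 thus "Q : sets mu" using H Sp_U by (auto simp: in_sets_mu)
qed

text \<open>A relatively clopen piece of the support missing \<open>a\<close> carries a cutoff function whose gradient
  does not see the boundary of the piece; hence it cannot have small mass.\<close>

lemma clop_mass:
 assumes nb: "nice_ball a (2*rho)"
 shows "EX c>0. ALL Q. clop a rho Q --> Q Int ball a rho ~= {} --> enn c < emeas mu Q"
proof -
 let ?s = "3*rho/2"
 have rho: "0 < rho" "rho < ?s" "0 <= rho" and aS: "a : Sp" and cb: "cball a (2*rho) Int Rn n <= U" using nb by (auto simp: nice_ball_def)
 define D where "D = real n*(2*Lstp*?s/(?s^2 - rho\<^sup>2))"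
 have p: "0 < ?s^2 - rho\<^sup>2" using rho by (simp add: power_strict_mono)
 have "0 < n" using m1 mn by simp
 hence D: "0 < D" unfolding D_def using p Lstp(1) rho by (intro mult_pos_pos divide_pos_pos) auto
 obtain c where c: "0 < c" and sm: "!!xi E. xi : Csc n U==>(!!z. 0 <= xi z)==>E : sets mu==>emeas mu E <= enn c ==>
  emeas psi {z : U. xi z ~= 0} <= enn (1/\<Gamma>)==>AE z in cmu. z ~: E --> xi z = 0 ==>
  AE z in cmu. (\<Sum>i<n. \<bar>Deriv n xi z (uv i)\<bar>) <= D*ind E z==>AE z in cmu. xi z <= 1/2"
 proof -
  from small_mass[OF D] obtain c where c: "0 < c" "ALL xi E. xi : Csc n U --> (ALL z. 0 <= xi z) --> E : sets mu --> emeas mu E <= enn c -->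
  emeas psi {z : U. xi z ~= 0} <= enn (1/\<Gamma>) -->
  (AE z in cmu. z ~: E --> xi z = 0) -->
  (AE z in cmu. (\<Sum>i<n. \<bar>Deriv n xi z (uv i)\<bar>) <= D*ind E z) -->
  (AE z in cmu. xi z <= 1/2)" by (elim exE conjE)
  show thesis
  proof (rule that[OF c(1)])
   fix xi E assume "xi : Csc n U" "!!z. 0 <= xi z" "E : sets mu" "emeas mu E <= enn c"
    "emeas psi {z : U. xi z ~= 0} <= enn (1/\<Gamma>)" "AE z in cmu. z ~: E --> xi z = 0"
    "AE z in cmu. (\<Sum>i<n. \<bar>Deriv n xi z (uv i)\<bar>) <= D*ind E z"
   thus "AE z in cmu. xi z <= 1/2" by (intro c(2)[rule_format]) simp_all
  qed
 qed
 have "enn c < emeas mu Q" if Q: "clop a rho Q" and y: "y : Q" "y : ball a rho" for Q y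
 proof (rule ccontr)
  assume "\<not> ?thesis"
  hence Qc: "emeas mu Q <= enn c" by simp
  define S where "S = Sp Int ball a (2*rho)"
  have QS: "Q <= S" using clop_sets[OF Q] by (simp add: S_def)
  \<comment> \<open>As Q is clopen, Q and its complement in the support both have compact traces on
    the ball of radius 3 rho / 2. A cutoff \<open>kp\<close> that is one near the first and
    supported off the second is locally constant along the support there, so only the radial cutoff
    contributes to the gradient on the support.\<close>
  define K1 where "K1 = Q Int cball a ?s"
  define K2 where "K2 = (S - Q) Int cball a ?s"
  have CU: "cball a ?s Int Rn n <= U" using cb rho by (auto simp: subset_eq)
  have cS: "compact (Sp Int (cball a ?s Int Rn n))" by (rule Sp_closed[OF compact_cball_Rn CU])
  have Sb: "Sp Int (cball a ?s Int Rn n) = S Int cball a ?s" using Sp_U opn_subset[OF U] rho by (auto simp: S_def)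
  obtain C1 H2 where CH: "closed C1" "Q = S Int C1" "open H2" "Q = S Int H2"
   using Q by (auto simp: clop_def S_def openin_open closedin_closed)
  have K1: "compact K1" using compact_Int_closed[OF cS CH(1)] Sb CH(2) by (simp add: K1_def Int_ac)
  have K2e: "K2 = (Sp Int (cball a ?s Int Rn n)) - H2" unfolding Sb K2_def using CH(4) by blast
  have K2: "compact K2" unfolding K2e by (rule compact_diff[OF cS CH(3)])
  have W: "opn n (U - K2)" by (rule opn_Diff_closed[OF U compact_imp_closed[OF K2]])
  have K1W: "K1 <= U - K2" using QS Sp_U by (auto simp: K1_def K2_def S_def)
  obtain kp H where kp: "kp : Csc n (U - K2)" "!!x. 0 <= kp x" "open H" "K1 <= H" "!!x. x : H Int Rn n ==> kp x = 1" by (rule cutoff[OF W K1 K1W]) (rule that; assumption)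
  obtain C where C: "compact C" "C <= U - K2" "!!z. z ~: C ==> kp z = 0"
   using kp(1) unfolding Csc_def by blast
  have kpU: "kp : Csc n U" using Csc_mono[OF W U] kp(1) by blast
  define xi where "xi x = kp x*bmp a rho ?s x" for x
  define C' where "C' = C Int cball a ?s"
  have C': "compact C'" "C' <= U" using C by (auto simp: C'_def intro: compact_Int_closed)
  have z0: "xi z = 0" if "z ~: C'" for z
  proof (cases "z : C")
   case True
   hence "?s <= norm (z - a)" using that by (auto simp: C'_def dist_norm norm_minus_commute)
   thus ?thesis using bmp_zero[OF rho(3,2)] by (simp add: xi_def)
  qed (simp add: xi_def C(3))
  have smxi: "smooth n U xi" unfolding xi_def using kpU by (intro smooth_mult U bmp_smooth) (simp add: Csc_def)
  have xi: "xi : Csc n U" using C' z0 smxi unfolding Csc_def by blast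
  have xi0: "0 <= xi z" for z using kp(2) bmp_range(1) by (simp add: xi_def)
  \<comment> \<open>Because a is not in Q it belongs to \<open>K2\<close>, off the support of
    \<open>kp\<close>; so \<open>xi\<close> lives in the punctured ball, where \<open>psi\<close> is
    small.\<close>
  have aK: "a : K2" using aS rho Q by (auto simp: K2_def S_def clop_def)
  have sub: "{z : U. xi z ~= 0} <= ball a (2*rho) Int U - {a}"
  proof
   fix z assume z: "z : {z : U. xi z ~= 0}"
   hence "z : C'" using z0 by blast
   thus "z : ball a (2*rho) Int U - {a}" using z C(2) aK rho by (auto simp: C'_def)
  qed
  have psm: "emeas psi {z : U. xi z ~= 0} <= enn (1/\<Gamma>)"
  proof -
   have "ball a (2*rho) Int U - {a} : sets psi" by (rule sets_psi) (use opn_borel[OF U] in auto)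
   from emeasure_mono[OF sub this] show ?thesis using nb by (auto simp: nice_ball_def)
  qed
  have inQ: "z : K1 & z : Q" if "z : Sp" "z : C'" for z
   using that C(2) rho Sp_U opn_subset[OF U] by (auto simp: C'_def K1_def K2_def S_def)
  have dz: "(\<Sum>i<n. \<bar>Deriv n xi z (uv i)\<bar>) <= D*ind Q z" if z: "z : Sp" for z
  proof (cases "z : C'")
   case True
   have zU: "z : U Int H" using inQ[OF z True] kp(4) z Sp_U by blast
   have zR: "z : Rn n" using zU opn_mem[OF U] by blast
   have o: "opn n (U Int H)" by (rule opn_Int_open[OF U kp(3)])
   have "\<bar>Deriv n xi z (uv i)\<bar> <= 2*Lstp*?s/(?s^2 - rho\<^sup>2)" if i: "i < n" for i
   proof -
    have "Deriv n xi z (uv i) = Deriv n (bmp a rho ?s) z (uv i)" by (rule Deriv_smooth_cong[OF o zU _ bmp_smooth[OF o]]) (use kp(5) opn_mem[OF U] i in "auto simp: xi_def")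
    thus ?thesis using bmp_deriv[OF rho(3,2) zR unit_vec_Rn[OF i], of a] by simp
   qed
   hence "(\<Sum>i<n. \<bar>Deriv n xi z (uv i)\<bar>) <= (\<Sum>i<n. 2*Lstp*?s/(?s^2 - rho\<^sup>2))" by (intro sum_mono) auto
   thus ?thesis using inQ[OF z True] by (simp add: D_def)
  next
   case False
   have "Deriv n xi z (uv i) = 0" if "i < n" for i by (rule Deriv_zero_off[OF C' _ _ False]) (use z0 z Sp_U that in auto)
   thus ?thesis using D by (simp add: indicator_def)
  qed
  have "AE z in cmu. xi z <= 1/2"
  proof (rule sm[OF xi xi0 clop_sets(1)[OF Q] Qc psm])
   show "AE z in cmu. z ~: Q --> xi z = 0" using AE_Sp by eventually_elim (use inQ z0 in blast)
   show "AE z in cmu. (\<Sum>i<n. \<bar>Deriv n xi z (uv i)\<bar>) <= D*ind Q z" using AE_Sp by eventually_elim (rule dz)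
  qed
  moreover have "y : Sp" using y QS by (auto simp: S_def)
  moreover have "open (H Int ball a rho)" "y : H Int ball a rho" using kp(3,4) y rho by (auto simp: K1_def subset_eq)
  \<comment> \<open>Near y the function \<open>xi\<close> equals one at points of the support,
    against the bound 1/2.\<close>
  ultimately obtain z where z: "z : Sp" "z : H" "z : ball a rho" "xi z <= 1/2" using AE_near_Sp by blast
  have "z : Rn n" using z Sp_U opn_subset[OF U] by blast
  hence "xi z = 1" using kp(5)[of z] bmp_one[OF rho(3,2), of z a] z by (simp add: xi_def dist_norm norm_minus_commute)
  thus False using z by simp
 qed
 thus ?thesis using c by (intro exI[of _ c]) blast
qed

text \<open>If pieces came arbitrarily close to a, they could be accumulated: a piece W stays at
  positive distance from a, a piece Q reaching closer gives the piece Q - W disjoint from W, and by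
  \<open>clop_mass\<close> each such addition increases the mass by at least c. The mass of the ball
  is finite.\<close>

lemma clop_avoid:
 assumes nb: "nice_ball a (2*rho)"
 shows "EX \<sigma>>0. ALL Q. clop a rho Q --> Q Int ball a \<sigma> = {}"
proof (rule ccontr)
 assume neg: "\<not> ?thesis"
 have rho: "0 < rho" and aS: "a : Sp" and cb: "cball a (2*rho) Int Rn n <= U" using nb by (auto simp: nice_ball_def)
 obtain c where c: "0 < c" "!!Q. clop a rho Q==>Q Int ball a rho ~= {} ==> ennreal c < emeas mu Q" using clop_mass[OF nb] by blast
 have "EX W. clop a rho W & enn (real N*c) <= emeas mu W" for N
 proof (induction N)
  case 0
  show ?case by (intro exI[of _ "{}"]) (auto simp: clop_def)
 next
  case (Suc N)
  then obtain W where W: "clop a rho W" "enn (real N*c) <= emeas mu W" by blast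
  obtain C1 where C1: "closed C1" "W = Sp Int ball a (2*rho) Int C1" using W by (auto simp: clop_def closedin_closed)
  have "a : - C1" using W(1) C1(2) aS rho by (auto simp: clop_def)
  moreover have "open (- C1)" using C1(1) by blast
  ultimately obtain \<tau> where \<tau>: "0 < \<tau>" "ball a \<tau> <= - C1" using open_contains_ball by metis
  have "0 < min \<tau> rho" using \<tau> rho by simp
  then obtain Q where Q: "clop a rho Q" "Q Int ball a (min \<tau> rho) ~= {}" using neg by blast
  have QW: "clop a rho (Q - W)" using Q(1) W(1) unfolding clop_def by (auto intro: openin_diff closedin_diff)
  have "ball a (min \<tau> rho) <= ball a rho" "ball a (min \<tau> rho) Int W = {}" using \<tau>(2) C1(2) by auto
  hence "(Q - W) Int ball a rho ~= {}" using Q(2) by blast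
  hence m: "enn c < emeas mu (Q - W)" using c(2) QW by blast
  have "clop a rho (W Un (Q - W))" using QW W(1) unfolding clop_def by (auto intro: openin_Un closedin_Un simp del: Un_Diff_cancel)
  moreover have "emeas mu (W Un (Q - W)) = emeas mu W+emeas mu (Q - W)" by (rule plus_emeasure[symmetric]) (use clop_sets(1) W(1) QW in auto)
  moreover have "enn (real (Suc N)*c) = enn (real N*c)+enn c" using c(1) by (simp add: ennreal_plus[symmetric] algebra_simps del: ennreal_plus)
  ultimately show ?case using add_mono[OF W(2) less_imp_le[OF m]] by (intro exI[of _ "W Un (Q - W)"]) (simp del: Un_Diff_cancel)
 qed
 moreover have "emeas mu W <= emeas mu (cball a (2*rho) Int Rn n)" if "clop a rho W" for W
 proof (rule emeasure_mono)
  show "W <= cball a (2*rho) Int Rn n" using clop_sets(2)[OF that] Sp_U opn_subset[OF U] by auto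
  show "cball a (2*rho) Int Rn n : sets mu" using cb by (simp add: in_sets_mu)
 qed
 ultimately have b: "enn (real N*c) <= emeas mu (cball a (2*rho) Int Rn n)" for N by (meson order_trans)
 have "emeas mu (cball a (2*rho) Int Rn n) < \<infinity>" by (rule mu_compact[OF compact_cball_Rn cb])
 then obtain r where r: "emeas mu (cball a (2*rho) Int Rn n) = enn r" "0 <= r" by (auto simp: less_top_ennreal)
 obtain N where "r < real N*c" using reals_Archimedean3[OF c(1)] by blast
 thus False using b[of N] r by (simp add: ennreal_le_iff)
qed

text \<open>If c is skipped near a and h(a) < c < h(z), then {h > c} is a relatively clopen piece
  that misses a and contains z, which \<open>clop_avoid\<close> excludes for z close to a; the other
  order of the values is reduced to this by passing to -h. The radius precedes the quantifier over
  h, and this is what makes the final modulus independent of f.\<close>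

lemma local_ivt:
 assumes nb: "nice_ball a (2*rho)"
 shows "EX \<sigma>>0. ALL (h::vec => real) z c. continuous_on Sp h --> z : Sp Int ball a \<sigma> --> min (h a) (h z) < c --> c < max (h a) (h z) -->
  (EX y:Sp Int ball a (2*rho). h y = c)"
proof -
 have rho: "0 < rho" and aS: "a : Sp" using nb by (auto simp: nice_ball_def)
 obtain \<sigma> where \<sigma>: "0 < \<sigma>" "!!Q. clop a rho Q==>Q Int ball a \<sigma> = {}" using clop_avoid[OF nb] by blast
 have main: "EX y:Sp Int ball a (2*rho). h y = c" if h: "continuous_on Sp h" and z: "z : Sp Int ball a (min \<sigma> rho)" and lt: "h a < c" "c < h z" for h :: "vec => real" and z c
 proof (rule ccontr)
  assume n: "\<not> ?thesis"
  let ?S = "Sp Int ball a (2*rho)"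
  have hS: "continuous_on ?S h" using h by (rule continuous_on_subset) blast
  \<comment> \<open>The value c is not attained, so the strict and the weak superlevel set coincide,
    and the set is both open and closed.\<close>
  have e: "?S Int h -` {c<..} = ?S Int h -` {c..}" using n by (auto simp: order_le_less)
  have "openin (top_of_set ?S) (?S Int h -` {c<..})" by (rule continuous_openin_preimage_gen[OF hS]) simp
  moreover have "closedin (top_of_set ?S) (?S Int h -` {c..})" by (rule continuous_closedin_preimage[OF hS]) simp
  ultimately have "clop a rho (?S Int h -` {c<..})" using lt e by (auto simp: clop_def)
  thus False using \<sigma>(2)[of "?S Int h -` {c<..}"] z lt rho by auto
 qed
 show ?thesis
 proof (intro exI[of _ "min \<sigma> rho"] conjI allI impI)
  fix h :: "vec => real" and z c
  assume h: "continuous_on Sp h" and z: "z : Sp Int ball a (min \<sigma> rho)" and c: "min (h a) (h z) < c" "c < max (h a) (h z)"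
  show "EX y:Sp Int ball a (2*rho). h y = c"
  proof (cases "h a < c")
   case True
   thus ?thesis using main[OF h z True] c by auto
  next
   case False
   have "continuous_on Sp (%y. - h y)" using h by (intro continuous_intros)
   from main[OF this z, of "- c"] show ?thesis using c False by auto
  qed
 qed (use \<sigma> rho in auto)
qed

end

section \<open>Profile functions for strips in the target space\<close>

text \<open>Primitive of a slope that is 1 on [1/8, 3/8], antisymmetric about 1/2, and zero near 0,
  1/2 and 1. The antisymmetry brings it back to zero at 1, and its middle value is at least the
  length 1/4 of the plateau; this 1/4 is the origin of the factor 4 in
  \<open>oscillation_1\<close>.\<close>

lemma profile_exists:
 "EX \<beta>. rsm UNIV \<beta> & (ALL x. 0 <= \<beta> x & \<beta> x <= 1 & \<bar>deriv \<beta> x\<bar> <= 1) &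
  (ALL x. x <= 0 \<or> 1 <= x --> \<beta> x = 0 & deriv \<beta> x = 0) & 1/4 <= \<beta> (1/2)"
proof -
 define c where "c t = stp (16*t + -1) * stp (-16*t+7)" for t
 define b where "b t = c t - c (-1*t+1)" for t
 have rc: "rsm UNIV c" unfolding c_def by (intro rsm_mult rsm_affine stp_props) simp
 have rb: "rsm UNIV b" unfolding b_def by (intro rsm_diff rsm_affine rc) simp
 have c01: "0 <= c t" "c t <= 1" for t using stp_range mult_le_one[of "stp (16*t + -1)" "stp (-16*t+7)"] by (auto simp: c_def)
 have c0: "c t = 0" if "t <= 1/16 \<or> 7/16 <= t" for t using that stp_props(2)[of "16*t + -1"] stp_props(2)[of "-16*t+7"] by (auto simp: c_def)
 have c1: "c t = 1" if "1/8 <= t" "t <= 3/8" for t using that by (simp add: c_def stp_props(3))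
 have b0: "b x = 0" if "x <= 0" for x using c0[of x] c0[of "-1*x+1"] that by (simp add: b_def)
 obtain \<beta> where \<beta>: "rsm UNIV \<beta>" "!!x. (\<beta> hrd b x) (at x)" "!!x. x <= 0 ==> \<beta> x = 0"
  using rsm_antideriv[OF rb b0] by blast
 have d: "deriv \<beta> x = b x" for x by (rule DERIV_imp_deriv[OF \<beta>(2)])
 have b1: "\<bar>b x\<bar> <= 1" for x using c01[of x] c01[of "-1*x+1"] by (auto simp: b_def)
 have bb: "0 <= b x & b x <= 1" if "x <= 1/2" for x using c01[of x] c0[of "-1*x+1"] that by (simp add: b_def)
 have sym: "\<beta> (1 - x) = \<beta> x" for x
 proof -
  have "((%x. \<beta> x - \<beta> (1 - x)) hrd 0) (at y)" for y
  proof -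
   have "((%x. \<beta> (1 - x)) hrd b (1 - y)*(0 - 1)) (at y)" by (rule DERIV_chain2[OF \<beta>(2)]) (auto intro!: derivative_eq_intros)
   from DERIV_diff[OF \<beta>(2) this] show ?thesis by (simp add: b_def)
  qed
  from DERIV_isconst_all[OF allI[OF this], of x "1/2"] have "\<beta> x - \<beta> (1 - x) = \<beta> (1/2) - \<beta> (1 - 1/2)" .
  thus ?thesis by simp
 qed
 have mono: "\<beta> x <= \<beta> y" if "x <= y" "y <= 1/2" for x y by (rule DERIV_nonneg_imp_nondecreasing[OF that(1)]) (use \<beta>(2) bb that in "meson order_trans")
 have up: "\<beta> x <= 1" if "x <= 1/2" for x
 proof (cases "x <= 0")
  case False
  have "(%x. x - \<beta> x) 0 <= (%x. x - \<beta> x) x"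
  proof (rule DERIV_nonneg_imp_nondecreasing[where f = "%x. x - \<beta> x"])
   fix y assume "0 <= y" "y <= x"
   thus "EX k. ((%x. x - \<beta> x) hrd k) (at y) & 0 <= k"
    using bb[of y] that by (intro exI[of _ "1 - b y"] conjI DERIV_diff DERIV_ident \<beta>(2)) auto
  qed (use False in simp)
  thus ?thesis using \<beta>(3)[of 0] that by simp
 qed (simp add: \<beta>(3))
 have range: "0 <= \<beta> x & \<beta> x <= 1" for x
 proof (cases "x <= 1/2")
  case True
  thus ?thesis using up[OF True] mono[of "min 0 x" x] \<beta>(3)[of "min 0 x"] by auto
 next
  case False
  hence "1 - x <= 1/2" by simp
  thus ?thesis using up[of "1 - x"] mono[of "min 0 (1 - x)" "1 - x"] \<beta>(3)[of "min 0 (1 - x)"] sym[of x] by auto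
 qed
 have "1/4 <= \<beta> (1/2)"
 proof -
  have "EX z. 1/8 < z & z < 3/8 & \<beta> (3/8) - \<beta> (1/8) = (3/8 - 1/8)*b z" by (rule MVT2) (use \<beta>(2) in auto)
  then obtain z where z: "1/8 < z" "z < 3/8" "\<beta> (3/8) - \<beta> (1/8) = (3/8 - 1/8)*b z" by blast
  have "b z = 1" using z(1,2) c1[of z] c0[of "-1*z+1"] by (simp add: b_def)
  hence "1/4 <= \<beta> (3/8)" using z(3) range[of "1/8"] by simp
  thus ?thesis using mono[of "3/8" "1/2"] by simp
 qed
 moreover have "\<beta> x = 0 & deriv \<beta> x = 0" if "x <= 0 \<or> 1 <= x" for x
  using that \<beta>(3)[of x] \<beta>(3)[of "1 - x"] sym[of x] b0[of x] c0[of x] c0[of "-1*x+1"] by (auto simp: d b_def)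
 ultimately show ?thesis using \<beta>(1) range b1 d by (intro exI[of _ \<beta>]) auto
qed

text \<open>Rescaling the profile to an interval of length L and multiplying it by L keeps the slope
  at most one. The cutoff at radius R in the target makes the derivative compactly supported, as the
  definition of weak differentiability demands; inside radius R it is not felt.\<close>

lemma strip_function:
 assumes i: "i < l" and L: "0 < L" and R: "0 < R"
 obtains eta :: "vec => real" and Bd where "smooth l (Rn l) eta" "!!y. 0 <= eta y & eta y <= L"
  "!!y v. y : Rn l==>R+1 < norm y==>v : Rn l==>Deriv l eta y v = 0"
  "!!y v. y : Rn l==>v : Rn l ==> \<bar>Deriv l eta y v\<bar> <= Bd*norm v"
  "!!y v. y : Rn l==>norm y < R==>v : Rn l ==> \<bar>Deriv l eta y v\<bar> <= norm v"
  "!!y. lk y i <= \<alpha> \<or> \<alpha>+L <= lk y i ==> eta y = 0"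
  "!!y v. y : Rn l==>norm y < R==>lk y i <= \<alpha> \<or> \<alpha>+L <= lk y i==>v : Rn l==>Deriv l eta y v = 0"
  "!!y. norm y < R==>lk y i = \<alpha>+L/2==>L/4 <= eta y"
proof -
 obtain \<beta> where \<beta>: "rsm UNIV \<beta>" "!!x. 0 <= \<beta> x" "!!x. \<beta> x <= 1" "!!x. \<bar>deriv \<beta> x\<bar> <= 1"
  "!!x. x <= 0 \<or> 1 <= x ==> \<beta> x = 0" "!!x. x <= 0 \<or> 1 <= x==>deriv \<beta> x = 0" "1/4 <= \<beta> (1/2)"
  using profile_exists by metis
 define b where "b y = L*\<beta> ((1/L)*lk y i + - \<alpha>/L)" for y
 define eta where "eta y = b y*bmp 0 R (R+1) y" for y
 have o: "opn l (Rn l)" by simp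
 have arg: "(1/L)*t + - \<alpha>/L = (t - \<alpha>)/L" for t by (simp add: diff_divide_distrib)
 have br: "0 <= b y" "b y <= L" for y using \<beta>(2,3) L by (auto simp: b_def intro: mult_left_le)
 have b0: "b y = 0 & deriv \<beta> ((1/L)*lk y i + - \<alpha>/L) = 0" if "lk y i <= \<alpha> \<or> \<alpha>+L <= lk y i" for y
  using that L \<beta>(5,6) unfolding b_def arg by (auto simp: field_simps)
 have slk: "smooth l W (%y. lk y i)" if "opn l W" for W by (rule smooth_linear[OF that bounded_linear_lk])
 have sb: "smooth l W b" if "opn l W" for W
 proof -
  have "rsm UNIV (%t. L*\<beta> ((1/L)*t + - \<alpha>/L))" by (intro rsm_cmult rsm_affine \<beta>) simp
  from smooth_compose[OF that _ slk[OF that] _ this] show ?thesis by (simp add: b_def[abs_def])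
 qed
 have seta: "smooth l W eta" if "opn l W" for W unfolding eta_def[abs_def] by (intro smooth_mult sb bmp_smooth that)
 have Dlk: "Deriv l (%y. lk y i) y v = lk v i" if "y : Rn l" "v : Rn l" for y v by (rule Deriv_eq[OF bounded_linear.has_derivative[OF bounded_linear_lk has_derivative_ident] that])
 have Db: "Deriv l b y v = deriv \<beta> ((1/L)*lk y i + - \<alpha>/L)*lk v i" if "y : Rn l" "v : Rn l" for y v
 proof -
  have "((%t. \<beta> ((1/L)*t + - \<alpha>/L)) hrd deriv \<beta> ((1/L)*lk y i + - \<alpha>/L)*(1/L)) (at (lk y i))" by (rule DERIV_chain2[OF rsm_DERIV[OF \<beta>(1)]]) (use L in "auto intro!: derivative_eq_intros")
  from DERIV_cmult[OF this, of L]
  have "((%t. L*\<beta> ((1/L)*t + - \<alpha>/L)) hrd deriv \<beta> ((1/L)*lk y i + - \<alpha>/L)) (at (lk y i))"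
   using L by (simp only: mult.left_commute[of L] mult_1_right nonzero_mult_div_cancel_left times_divide_eq_right less_imp_neq[symmetric] not_False_eq_True)
  from Deriv_compose[OF o that(1) slk[OF o] this that(2)] show ?thesis by (simp add: b_def[abs_def] Dlk[OF that])
 qed
 have Db1: "\<bar>Deriv l b y v\<bar> <= norm v" if "y : Rn l" "v : Rn l" for y v
 proof -
  have "\<bar>Deriv l b y v\<bar> <= 1*norm v" unfolding Db[OF that] abs_mult by (intro mult_mono \<beta> abs_lk_le_norm) auto
  thus ?thesis by simp
 qed
 have near: "Deriv l eta y v = Deriv l b y v" if "y : Rn l" "norm y < R" "v : Rn l" for y v
 proof -
  have o': "opn l (Rn l Int ball 0 R)" by (rule opn_Int_open[OF o]) simp
  show ?thesis by (rule Deriv_smooth_cong[OF o' _ _ sb[OF o'] that(3)]) (use that R in "auto simp: eta_def bmp_one")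
 qed
 have far: "Deriv l eta y v = 0" if "y : Rn l" "R+1 < norm y" "v : Rn l" for y v
 proof -
  have o': "opn l (Rn l - cball 0 (R+1))" by (rule opn_Diff_closed[OF o]) simp
  have "Deriv l eta y v = Deriv l (%y. 0) y v" by (rule Deriv_smooth_cong[OF o' _ _ smooth_const[OF o'] that(3)]) (use that R in "auto simp: eta_def bmp_zero")
  thus ?thesis using Deriv_const[OF that(1,3)] by simp
 qed
 define Bd where "Bd = L*(2*Lstp*(R+1)/((R+1)^2 - R\<^sup>2))+1"
 have bd: "\<bar>Deriv l eta y v\<bar> <= Bd*norm v" if "y : Rn l" "v : Rn l" for y v
 proof -
  let ?B = "2*Lstp*(R+1)/((R+1)^2 - R\<^sup>2)"
  have "Deriv l eta y v = b y*Deriv l (bmp 0 R (R+1)) y v+Deriv l b y v * bmp 0 R (R+1) y"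
   unfolding eta_def[abs_def] by (rule Deriv_mult[OF o that(1) sb[OF o] bmp_smooth[OF o] that(2)])
  also have "\<bar>...\<bar> <= \<bar>b y\<bar>*\<bar>Deriv l (bmp 0 R (R+1)) y v\<bar>+\<bar>Deriv l b y v\<bar>*\<bar>bmp 0 R (R+1) y\<bar>" by (metis abs_mult abs_triangle_ineq)
  also have "... <= L*(?B*norm v)+norm v * 1" by (intro add_mono mult_mono Db1 that bmp_deriv) (use br[of y] bmp_range[of 0 R "R+1" y] R L in auto)
  finally show ?thesis by (simp add: Bd_def algebra_simps)
 qed
 have f1: "0 <= eta y & eta y <= L" for y
  using br[of y] bmp_range[of 0 R "R+1" y] mult_mono[of "b y" L "bmp 0 R (R+1) y" 1] L by (auto simp: eta_def)
 have f2: "L/4 <= eta y" if "norm y < R" "lk y i = \<alpha>+L/2" for y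
 proof -
  have "(1/L)*lk y i + - \<alpha>/L = 1/2" using that(2) L by (simp add: field_simps)
  hence "b y = L*\<beta> (1/2)" by (simp only: b_def)
  hence "L*(1/4) <= b y" using \<beta>(7) L by (simp only: mult_left_mono less_imp_le)
  thus ?thesis using that(1) R by (simp add: eta_def bmp_one)
 qed
 have f3: "\<bar>Deriv l eta y v\<bar> <= norm v" if "y : Rn l" "norm y < R" "v : Rn l" for y v
  using near[OF that] Db1[OF that(1,3)] by simp
 have f4: "eta y = 0" if "lk y i <= \<alpha> \<or> \<alpha>+L <= lk y i" for y using b0[OF that] by (simp add: eta_def)
 have f5: "Deriv l eta y v = 0" if "y : Rn l" "norm y < R" "lk y i <= \<alpha> \<or> \<alpha>+L <= lk y i" "v : Rn l" for y v
  unfolding near[OF that(1,2,4)] Db[OF that(1,4)] using b0[OF that(3)] by (simp only: mult_zero_left)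
 show thesis by (rule that[of eta Bd, OF seta[OF o] f1 far bd f3 f4 f5 f2])
qed

section \<open>The Sobolev-Poincare estimate on one strip\<close>

context vsp
begin

text \<open>n times a bound for the sum of the absolute partial derivatives of the cutoff between
  the radii 2 rho and 3 rho; the outer factor n is the one in \<open>q_le\<close>.\<close>

definition Kc :: "real => real" where "Kc rho = real n*(real n*(2*Lstp*(3*rho)/((3*rho)^2 - (2*rho)^2)))"

text \<open>\<open>SP_estimate\<close> for the product w of the spatial cutoff and
  \<open>eta\<close> of f. By \<open>a0\<close> it vanishes at a, so its support lies in the
  punctured ball where \<open>psi\<close> is small. On the support of the weight its derivative is
  at most J: the profile has slope at most one and height at most L, and both its value and its
  derivative vanish off the strip set A. The left-hand side L/4 is a lower bound for w at y.\<close>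

lemma strip_estimate:
 assumes nb: "nice_ball a (4*rho)" and fc: "continuous_on Sp f" and fT: "f : TV n l U V"
  and i: "i < l" and L: "0 < L" and y: "y : Sp Int ball a (2*rho)" "lk (f y) i = \<alpha>+L/2"
  and a0: "lk (f a) i <= \<alpha> \<or> \<alpha>+L <= lk (f a) i"
  and A: "A = {z : U Int cball a (3*rho). \<alpha> < lk (f z) i & lk (f z) i < \<alpha>+L}"
  and J: "J = (%z. ind A z*(hs_norm n (weak_deriv n l U V f z)+L*Kc rho))"
 shows "A : sets cmu" "J : bmeas cmu" "m = 1==>ennreal (L/4) <= enn \<Gamma>*(\<integral>\<^sup>+z. enn (J z) \<partial>cmu)"
  "1 < m==>ennreal (real m) < r==>b = 1/real m - enn2real (1/r) ==>
   enn (L/4) <= enn (\<Gamma> powr (1/b))*epow (emeas cmu A) b*Lnorm cmu r J"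
proof -
 let ?F = "weak_deriv n l U V f"
 have rho: "0 < rho" and aS: "a : Sp" and cb: "cball a (4*rho) Int Rn n <= U" using nb by (auto simp: nice_ball_def)
 note fT' = fT[unfolded TV_def mem_Collect_eq]
 have fm: "f : bmeas (completion (add_measure (weight U V) (var_measure n U V)))" and fR: "f ` U <= Rn l"
  and eF: "EX F. is_weak_deriv n l U V f F" by (rule fT'[THEN conjunct1] fT'[THEN conjunct2, THEN conjunct1] fT'[THEN conjunct2, THEN conjunct2])+
 have F: "is_weak_deriv n l U V f ?F" unfolding weak_deriv_def by (rule someI_ex[OF eF])
 have C3: "cball a (3*rho) Int Rn n <= U" using cb rho by (auto simp: subset_eq)
 have "compact (Sp Int (cball a (3*rho) Int Rn n))" by (rule Sp_closed[OF compact_cball_Rn C3])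
 hence "compact (f ` (Sp Int (cball a (3*rho) Int Rn n)))" by (intro compact_continuous_image continuous_on_subset[OF fc]) auto
 then obtain R0 where R0: "!!z. z : Sp Int (cball a (3*rho) Int Rn n)==>norm (f z) <= R0" by (meson bounded_iff compact_imp_bounded imageI)
 \<comment> \<open>f is bounded on the support inside the ball of radius 3 rho, and the target
   cutoff is placed beyond that bound.\<close>
 define R where "R = \<bar>R0\<bar>+1"
 have R: "0 < R" by (simp add: R_def)
 have fRs: "norm (f z) < R" if "z : Sp" "z : cball a (3*rho)" for z
  using R0[of z] that Sp_U opn_subset[OF U] by (force simp: R_def)
 obtain eta Bd where eta: "smooth l (Rn l) eta" "!!y. 0 <= eta y & eta y <= L"
  "!!y v. y : Rn l==>R+1 < norm y==>v : Rn l==>Deriv l eta y v = 0"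
  "!!y v. y : Rn l==>v : Rn l ==> \<bar>Deriv l eta y v\<bar> <= Bd*norm v"
  "!!y v. y : Rn l==>norm y < R==>v : Rn l ==> \<bar>Deriv l eta y v\<bar> <= norm v"
  "!!y. lk y i <= \<alpha> \<or> \<alpha>+L <= lk y i ==> eta y = 0"
  "!!y v. y : Rn l==>norm y < R==>lk y i <= \<alpha> \<or> \<alpha>+L <= lk y i==>v : Rn l==>Deriv l eta y v = 0"
  "!!y. norm y < R==>lk y i = \<alpha>+L/2==>L/4 <= eta y" by (rule strip_function[OF i L R, of \<alpha>]) (rule that; assumption)
 define xi where "xi x = (if x : Rn n then bmp a (2*rho) (3*rho) x else 0)" for x
 have xi: "xi : Csc n U" unfolding xi_def[abs_def] by (rule bmp_Csc[OF U _ _ C3]) (use rho in auto)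
 interpret X: vspw n m U V \<Gamma> l f ?F eta xi L Bd "R+1"
 proof (unfold_locales; (rule fm fR F eta(1) xi)?)
  show "EX C. compact C & C <= Rn l & (ALL y:Rn l - C. ALL v:Rn l. Deriv l eta y v = 0)" by (intro exI[of _ "cball 0 (R+1) Int Rn l"] conjI compact_cball_Rn ballI eta(3)) auto
 qed (use eta(2,3,4) fR in auto)
 have ur: "0 <= X.u z & X.u z <= L" for z using eta(2) by (simp add: X.u_def)
 have xir: "0 <= xi z & xi z <= 1" for z using bmp_range by (simp add: xi_def)
 have xi0: "xi z = 0" if "z ~: cball a (3*rho) Int Rn n" for z
  using that bmp_zero[of "2*rho" "3*rho" z a] rho by (auto simp: xi_def dist_norm norm_minus_commute)
 have wn: "0 <= X.w z" for z using ur xir by (simp add: X.w_def)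
 have w0: "z : cball a (3*rho) Int U - {a}" if "z : U" "X.w z ~= 0" for z
  using that xi0[of z] eta(6)[OF a0] by (auto simp: X.w_def X.u_def)
 have small: "emeas psi {z : U. X.w z ~= 0} <= enn (1/\<Gamma>)"
 proof -
  have "{z : U. X.w z ~= 0} <= ball a (4*rho) Int U - {a}" using w0 rho by force
  moreover have "ball a (4*rho) Int U - {a} : sets psi" by (rule sets_psi) (use opn_borel[OF U] in auto)
  ultimately have "emeas psi {z : U. X.w z ~= 0} <= emeas psi (ball a (4*rho) Int U - {a})" by (rule emeasure_mono)
  thus ?thesis using nb by (auto simp: nice_ball_def)
 qed
 have fmeas: "(%z. lk (f z) i) : bmeas cmu" by (rule measurable_compose[OF X.f_cmu lk_measurable])
 have cU: "U Int cball a (3*rho) : sets cmu" using opn_borel[OF U] by (simp add: in_sets_mu)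
 show Am: "A : sets cmu"
 proof -
  have "A = ((%z. lk (f z) i) -` {\<alpha><..<\<alpha>+L} Int space cmu) Int (U Int cball a (3*rho))" by (auto simp: A)
  moreover have "(%z. lk (f z) i) -` {\<alpha><..<\<alpha>+L} Int space cmu : sets cmu" by (rule measurable_sets[OF fmeas]) simp
  ultimately show ?thesis using cU by (metis sets.Int)
 qed
 show Jm: "J : bmeas cmu" unfolding J by (intro borel_measurable_times borel_measurable_indicator Am borel_measurable_add X.hsF_meas borel_measurable_const)
 have Kc0: "0 <= Kc rho"
 proof -
  have "(3*rho)^2 - (2*rho)^2 >= 0" by (simp add: power2_eq_square)
  thus ?thesis unfolding Kc_def using Lstp(1) rho by (intro mult_nonneg_nonneg divide_nonneg_nonneg) auto
 qed
 have hs0: "0 <= hs_norm n (?F z)" for z by (simp add: hs_norm_L2)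
 have J0: "0 <= J z" for z using hs0[of z] Kc0 L by (simp add: J indicator_def)
 have qJ: "X.q z <= J z" if z: "z : Sp" for z
 proof -
  have zU: "z : U" using z Sp_U by blast
  have zR: "z : Rn n" using zU opn_mem[OF U] by blast
  let ?L2 = "L2_set (%j. Deriv l eta (f z) (?F z (uv j))) {..<n}"
  note q = X.q_le[OF zU]
  have dxz: "X.dx z = 0" if n: "z ~: cball a (3*rho)"
  proof -
   have "Deriv n xi z (uv j) = 0" if "j < n" for j by (rule Deriv_zero_off[OF compact_cball_Rn C3 _ zU]) (use xi0 n that in auto)
   thus ?thesis by (simp add: X.dx_def)
  qed
  show ?thesis
  proof (cases "z : cball a (3*rho)")
   case False
   hence "xi z = 0" using xi0 by blast
   thus ?thesis using q dxz[OF False] J0[of z] by simp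
  next
   case c: True
   note fz = fRs[OF z c]
   have fzR: "f z : Rn l" using fR zU by blast
   show ?thesis
   proof (cases "z : A")
    case False
    hence out: "lk (f z) i <= \<alpha> \<or> \<alpha>+L <= lk (f z) i" using c zU by (auto simp: A)
    have "Deriv l eta (f z) (?F z (uv j)) = 0" if "j < n" for j by (rule eta(7)[OF fzR fz out X.F_R[OF zU unit_vec_Rn[OF that]]])
    hence "?L2 = 0" by (simp add: L2_set_def)
    moreover have "X.u z = 0" using eta(6)[OF out] by (simp add: X.u_def)
    ultimately show ?thesis using q J0[of z] by simp
   next
    case True
    have L2: "?L2 <= hs_norm n (?F z)"
    proof -
     have "?L2 = L2_set (%j. \<bar>Deriv l eta (f z) (?F z (uv j))\<bar>) {..<n}" by (simp add: L2_set_def)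
     also have "... <= L2_set (%j. norm (?F z (uv j))) {..<n}" by (rule L2_set_mono) (use eta(5)[OF fzR fz] X.F_R[OF zU unit_vec_Rn] in auto)
     finally show ?thesis by (simp add: hs_norm_L2)
    qed
    have "X.dx z <= (\<Sum>j<n. 2*Lstp*(3*rho)/((3*rho)^2 - (2*rho)^2))"
     unfolding X.dx_def
    proof (rule sum_mono)
     fix j assume "j : {..<n}"
     hence j: "uv j : Rn n" by simp
     have "Deriv n xi z (uv j) = Deriv n (bmp a (2*rho) (3*rho)) z (uv j)" by (rule Deriv_smooth_cong[OF U zU _ bmp_smooth[OF U] j]) (use opn_mem[OF U] in "auto simp: xi_def")
     thus "\<bar>Deriv n xi z (uv j)\<bar> <= 2*Lstp*(3*rho)/((3*rho)^2 - (2*rho)^2)"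
      using bmp_deriv[OF _ _ zR j, of "2*rho" "3*rho" a] rho by simp
    qed
    hence "real n*X.dx z <= Kc rho" unfolding Kc_def by (intro mult_left_mono) auto
    hence "\<bar>X.u z\<bar>*(real n*X.dx z) <= L*Kc rho" using ur[of z] X.dx_nonneg[of z] L by (intro mult_mono) auto
    moreover have "\<bar>xi z\<bar>*?L2 <= 1*hs_norm n (?F z)" using xir[of z] L2 by (intro mult_mono) auto
    ultimately show ?thesis using q True by (simp add: J)
   qed
  qed
 qed
 have AEq: "AE z in cmu. X.q z <= J z" using AE_Sp by eventually_elim (rule qJ)
 \<comment> \<open>Carries the almost everywhere bound on w to the point y: by continuity, every
   number below L/4 is exceeded by \<open>eta\<close> of f on the support near y, where
   \<open>xi\<close> is one, and \<open>AE_near_Sp\<close> finds a point there obeying the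
   bound.\<close>
 have fin: "enn (L/4) <= c" if c: "AE z in cmu. enn (X.w z) <= c" for c
 proof (rule ccontr)
  assume "\<not> ?thesis"
  hence lt: "c < enn (L/4)" by simp
  then obtain c' where c': "c = enn c'" "0 <= c'" by (cases c) auto
  have c'L: "c' < L/4" using lt c' L by (simp add: ennreal_less_iff)
  have yS: "y : Sp" "y : cball a (3*rho)" using y(1) rho by auto
  have "c' < eta (f y)" using c'L eta(8)[OF fRs[OF yS] y(2)] by simp
  moreover have co: "continuous_on Sp (%z. eta (f z))" by (rule continuous_on_compose2[OF smooth_continuous[OF eta(1)] fc]) (use fR Sp_U in auto)
  have "openin (top_of_set Sp) (Sp Int (%z. eta (f z)) -` {c'<..})" by (rule continuous_openin_preimage_gen[OF co]) simp
  then obtain H where H: "open H" "Sp Int (%z. eta (f z)) -` {c'<..} = Sp Int H" by (auto simp: openin_open)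
  ultimately have "y : H Int ball a (2*rho)" using yS y(1) by blast
  moreover have "open (H Int ball a (2*rho))" using H(1) by blast
  ultimately obtain z where z: "z : Sp" "z : H" "z : ball a (2*rho)" "enn (X.w z) <= c"
   using AE_near_Sp[OF c yS(1)] by blast
  have "z : Rn n" using z(1) Sp_U opn_subset[OF U] by blast
  hence "xi z = 1" using z(3) rho bmp_one[of "2*rho" "3*rho" z a] by (simp add: xi_def dist_norm norm_minus_commute)
  hence "X.w z = eta (f z)" by (simp add: X.w_def X.u_def)
  moreover have "c' < eta (f z)" using z(1,2) H(2) by blast
  moreover have "X.w z <= c'" using z(4) c' by (simp add: ennreal_le_iff)
  ultimately show False by simp
 qed
 show "enn (L/4) <= enn \<Gamma>*(\<integral>\<^sup>+z. enn (J z) \<partial>cmu)" if m: "m = 1"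
 proof -
  have "(\<integral>\<^sup>+z. enn (X.q z) \<partial>cmu) <= (\<integral>\<^sup>+z. enn (J z) \<partial>cmu)" by (rule nn_integral_mono_AE) (use AEq in "eventually_elim, simp add: ennreal_leI")
  hence "enn \<Gamma>*(\<integral>\<^sup>+z. enn (X.q z) \<partial>cmu) <= enn \<Gamma>*(\<integral>\<^sup>+z. enn (J z) \<partial>cmu)" by (intro mult_left_mono) auto
  with fin[OF X.SP_estimate(1)[OF wn small m]] show ?thesis by (rule order_trans)
 qed
 show "enn (L/4) <= enn (\<Gamma> powr (1/b))*epow (emeas cmu A) b*Lnorm cmu r J"
  if m: "1 < m" and r: "enn (real m) < r" and b: "b = 1/real m - enn2real (1/r)"
 proof -
  have b0: "0 <= b"
  proof (cases "r = \<infinity>")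
   case False
   then obtain r' where r': "r = enn r'" "0 <= r'" by (cases r) auto
   hence "real m < r'" using r m by (simp add: ennreal_less_iff)
   moreover have "enn2real (1/r) = 1/r'" using r' calculation by (simp add: divide_ennreal[of 1 r', simplified])
   ultimately show ?thesis using b m by (simp add: frac_le)
  qed (use b in simp)
  have "AE z in cmu. z : {z : U. X.w z ~= 0} --> z : A" using AE_Sp
  proof eventually_elim
   case (elim z)
   show ?case using w0[of z] eta(6)[of "f z"] by (force simp: A X.w_def X.u_def not_le)
  qed
  hence "emeas cmu {z : U. X.w z ~= 0} <= emeas cmu A" by (rule emeasure_mono_AE[OF _ Am])
  hence 1: "epow (emeas cmu {z : U. X.w z ~= 0}) b <= epow (emeas cmu A) b" by (rule epow_mono[OF _ b0])
  have 2: "Lnorm cmu r X.q <= Lnorm cmu r J" by (rule Lnorm_mono[OF X.q_meas]) (use AEq in eventually_elim, use X.q_nonneg J0 in "auto intro: order_trans")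
  have "enn (\<Gamma> powr (1/b))*epow (emeas cmu {z : U. X.w z ~= 0}) b*Lnorm cmu r X.q
   <= enn (\<Gamma> powr (1/b))*epow (emeas cmu A) b*Lnorm cmu r J" by (intro mult_mono 1 2) auto
  with fin[OF X.SP_estimate(2)[OF wn small m r b]] show ?thesis by (rule order_trans)
 qed
qed

end

section \<open>Integral inequalities for possibly non-measurable integrands\<close>

text \<open>For a simple function s below the sum, s - h is measurable and lies below f, so only h
  has to be measurable. The lemma is applied with f built from the chosen representative of the mean
  curvature.\<close>

lemma nn_integral_add_le:
 assumes h: "h : bmeas M"
 shows "(\<integral>\<^sup>+x. h x+f x \<partial>M) <= (\<integral>\<^sup>+x. h x \<partial>M)+(\<integral>\<^sup>+x. f x \<partial>M)"
 unfolding nn_integral_def_finite[of M "%x. h x+f x"]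
proof (rule SUP_least)
 fix s assume "s : {g. simple_function M g & g <= (%x. h x+f x) & (ALL x. g x < top)}"
 hence s: "simple_function M s" "!!x. s x <= h x+f x" "!!x. s x < top" by (auto simp: le_fun_def)
 have sm: "s : bmeas M" by (rule borel_measurable_simple_function[OF s(1)])
 have "integral\<^sup>S M s = (\<integral>\<^sup>+x. s x \<partial>M)" using nn_integral_eq_simple_integral[OF s(1)] by simp
 also have "... <= (\<integral>\<^sup>+x. h x+(s x - h x) \<partial>M)"
 proof (rule nn_integral_mono)
  fix x
  show "s x <= h x+(s x - h x)"
  proof (cases "h x <= s x")
   case True
   have "s x = s x - h x+h x" by (rule diff_add_cancel_ennreal[OF True, symmetric])
   thus ?thesis by (subst add.commute) (rule eq_refl)
  next
   case False
   hence "s x <= h x" by simp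
   thus ?thesis by (rule order_trans) simp
  qed
 qed
 also have "... = (\<integral>\<^sup>+x. h x \<partial>M)+(\<integral>\<^sup>+x. s x - h x \<partial>M)" by (rule nn_integral_add) (use h sm in auto)
 also have "(\<integral>\<^sup>+x. s x - h x \<partial>M) <= (\<integral>\<^sup>+x. f x \<partial>M)" by (rule nn_integral_mono) (use s(2,3) in "simp add: ennreal_minus_le_iff less_top[symmetric]")
 finally show "integral\<^sup>S M s <= (\<integral>\<^sup>+x. h x \<partial>M)+(\<integral>\<^sup>+x. f x \<partial>M)" by (simp add: add_left_mono)
qed

text \<open>If the prescribed set function is not a measure, \<open>density\<close> assigns the
  value 0, so the inequality holds for every f.\<close>

lemma emeasure_density_le: "emeas (density M f) A <= (\<integral>\<^sup>+x. f x*ind A x \<partial>M)"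
 unfolding density_def emeasure_measure_of_conv by simp

text \<open>Continuity from above along concentric punctured balls, whose intersection is
  empty.\<close>

lemma punctured_small:
 fixes N :: "vec measure" and a :: vec
 assumes sets: "!!r. cball a r Int U - {a} : sets N" and fin: "emeas N (cball a R Int U - {a}) < \<infinity>" and R: "0 < R" and e: "0 < e"
 shows "EX r0>0. ALL r<=r0. emeas N (cball a r Int U - {a}) < e"
proof -
 define A where "A k = cball a (R/real (Suc k)) Int U - {a}" for k
 have mono: "emeas N (cball a r Int U - {a}) <= emeas N (cball a s Int U - {a})" if "r <= s" for r s by (rule emeasure_mono) (use that sets in auto)
 have "emeas N (A k) ~= \<infinity>" for k
 proof -
  have "emeas N (A k) <= emeas N (cball a R Int U - {a})" unfolding A_def by (rule mono) (use R in "simp add: field_simps")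
  thus ?thesis using fin by auto
 qed
 moreover have dA: "decseq A"
 proof (rule decseq_SucI)
  fix k
  have "R/real (Suc (Suc k)) <= R/real (Suc k)" using R by (intro divide_left_mono) auto
  thus "A (Suc k) <= A k" by (auto simp: A_def)
 qed
 moreover have "range A <= sets N" using sets by (auto simp: A_def)
 ultimately have "(%k. emeas N (A k)) \<longlonglongrightarrow> emeas N (\<Inter>k. A k)" by (intro Lim_emeasure_decseq)
 moreover have "(\<Inter>k. A k) = {}"
 proof -
  have "x = a" if x: "!!k. x : cball a (R/real (Suc k))" for x
  proof -
   have "(%k. R*(1/real (Suc k))) \<longlonglongrightarrow> R*0" by (intro tendsto_intros LIMSEQ_Suc[OF lim_1_over_n])
   hence "(%k. R/real (Suc k)) \<longlonglongrightarrow> 0" by simp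
   hence "dist a x <= 0" by (rule tendsto_lowerbound) (use x in auto)
   thus ?thesis by simp
  qed
  thus ?thesis by (auto simp: A_def)
 qed
 ultimately have "(%k. emeas N (A k)) \<longlonglongrightarrow> 0" by simp
 hence "eventually (%k. emeas N (A k) < e) sequentially" using e by (rule order_tendstoD)
 then obtain k where k: "emeas N (A k) < e" by (auto simp: eventually_sequentially)
 have "0 < R/real (Suc k)" using R by simp
 moreover have "emeas N (cball a r Int U - {a}) < e" if "r <= R/real (Suc k)" for r
  using mono[OF that] k by (simp add: A_def)
 ultimately show ?thesis by blast
qed

section \<open>First variation of radial fields\<close>

context vfold
begin

definition Xr :: "vec => (real => real) => vec => vec" where
 "Xr a w x = (if x : Rn n then w ((norm (x - a))^2) *\<^sub>R (x - a) else 0)"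

text \<open>For the field w(|x - a|^2)(x - a) the divergence along a plane S is m w + 2 w' |S(x -
  a)|^2, with S also denoting the projection. As w' <= 0 and projections do not increase length, it
  is at least m w + 2 t w' at t = |x - a|^2. Smoothness of w is asked on an open set containing the
  nonnegative reals, which admits powers of t + kp^2.\<close>

lemma first_var_radial:
 assumes A: "open A" "rsm A w" "{0..} <= A" and R: "0 < R" and w0: "!!t. R^2 <= t==>w t = 0" and cb: "cball a R Int Rn n <= U" and a: "a : Rn n"
  and dw: "!!t. 0 <= t==>deriv w t <= 0"
 defines "k t \<equiv> real m * w t+2*t*deriv w t"
 shows "Xr a w : Ccinf n U n" "integrable cmu (%x. k ((norm (x - a))^2))" "(\<integral>x. k ((norm (x - a))^2) \<partial>cmu) <= first_var n V (Xr a w)"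
  "integrable cmu (%x. w ((norm (x - a))^2))"
proof -
 let ?N = "%x. (norm (x - a))^2"
 have sN: "smooth n U ?N" by (rule smooth_normsq[OF U])
 have NA: "?N ` U <= A" using A(3) by auto
 have swN: "smooth n U (%x. w (?N x))" by (rule smooth_compose[OF U A(1) sN NA A(2)])
 have slin: "smooth n U (%x. x - a)" by (intro smooth_diff U smooth_linear smooth_const) (rule bounded_linear_ident)
 have big: "R^2 <= ?N x" if "x : Rn n" "x ~: cball a R Int Rn n" for x
  using that R by (auto simp: dist_norm norm_minus_commute intro!: power_mono)
 have sX: "smooth n U (Xr a w)" by (rule smooth_cong[OF U _ smooth_scaleR[OF U swN slin]]) (use opn_mem[OF U] in "auto simp: Xr_def")
 show X: "Xr a w : Ccinf n U n" by (rule CcinfI[OF compact_cball_Rn cb _ sX]) (use w0 big a in "auto simp: Xr_def intro: Rn_diff Rn_scaleR")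
 have dw0: "deriv w t = 0" if "R^2 < t" for t
 proof -
  have "(w hrd 0) (at t) \<longleftrightarrow> ((%t. 0) hrd 0) (at t)" by (rule DERIV_cong_ev[OF refl _ refl]) (use eventually_gt_at_top order_tendstoD(1)[OF tendsto_ident_at that] that w0 in \<open>auto simp: eventually_nhds intro!: exI[of _ "{R^2<..}"]\<close>)
  thus ?thesis by (simp add: DERIV_imp_deriv)
 qed
 have kz: "k (?N x) = 0" if "x : U" "x ~: cball a R Int Rn n" for x
 proof -
  have "R < norm (x - a)" using that opn_mem[OF U] by (auto simp: dist_norm norm_minus_commute)
  hence "R^2 < ?N x" using R by (simp add: power_strict_mono)
  thus ?thesis using w0 dw0 by (simp add: k_def)
 qed
 have cw: "continuous_on U (%x. w (?N x))" by (rule smooth_continuous[OF swN])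
 have cd: "continuous_on U (%x. deriv w (?N x))" by (rule smooth_continuous[OF smooth_compose[OF U A(1) sN NA rsm_deriv[OF A(2)]]])
 have ck: "continuous_on U (%x. k (?N x))" unfolding k_def by (intro continuous_intros cw cd)
 obtain B where B: "ALL z:U. \<bar>k (?N z)\<bar> <= B" using smooth_cs_bounded[OF compact_cball_Rn cb _ ck] kz by blast
 show ki: "integrable cmu (%x. k (?N x))" by (rule integrable_boundedI[OF compact_cball_Rn cb _ _ cont_cmeas[OF ck]]) (use kz B in blast)+
 have wz: "w (?N x) = 0" if "x : U" "x ~: cball a R Int Rn n" for x using big[OF opn_mem[OF U that(1)] that(2)] w0 by blast
 obtain B where B: "ALL z:U. \<bar>w (?N z)\<bar> <= B" using smooth_cs_bounded[OF compact_cball_Rn cb _ cw] wz by blast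
 show "integrable cmu (%x. w (?N x))" by (rule integrable_boundedI[OF compact_cball_Rn cb _ _ cont_cmeas[OF cw]]) (use wz B in blast)+
 have HS: "k (?N (fst p)) <= HS (Xr a w) p" if p: "p : space V" for p
 proof -
  obtain x S where xS: "p = (x, S)" "x : U" "S : Grass n m" using p by (auto simp: space_V)
  have xR: "x : Rn n" using xS opn_mem[OF U] by blast
  let ?P = "orth_proj S"
  note pr = orth_proj_props[OF xS(3)]
  have D: "Deriv n (Xr a w) x v = w (?N x) *\<^sub>R v+(2*deriv w (?N x)*inner (x - a) v) *\<^sub>R (x - a)" if v: "v : Rn n" for v
  proof -
   have "Deriv n (Xr a w) x v = Deriv n (%x. w (?N x) *\<^sub>R (x - a)) x v" by (rule Deriv_smooth_cong[OF U xS(2) _ smooth_scaleR[OF U swN slin] v]) (use opn_mem[OF U] in "auto simp: Xr_def")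
   also have "... = w (?N x) *\<^sub>R Deriv n (%x. x - a) x v+Deriv n (%x. w (?N x)) x v *\<^sub>R (x - a)" by (rule Deriv_scaleR[OF U xS(2) swN slin v])
   also have "Deriv n (%x. x - a) x v = v" by (rule Deriv_eq[OF _ xR v]) (auto intro!: derivative_eq_intros)
   also have "Deriv n (%x. w (?N x)) x v = deriv w (?N x)*Deriv n ?N x v" by (rule Deriv_compose[OF U xS(2) sN rsm_DERIV[OF A(2)] v]) (use NA xS in blast)
   also have "Deriv n ?N x v = 2*inner (x - a) v" by (rule Deriv_normsq[OF xR v])
   finally show ?thesis by (simp add: mult.assoc mult.left_commute)
  qed
  have xa: "x - a : Rn n" using xR a by (rule Rn_diff)
  have "HS (Xr a w) p = (\<Sum>i<n. inner (w (?N x) *\<^sub>R uv i+(2*deriv w (?N x)*inner (x - a) (uv i)) *\<^sub>R (x - a)) (?P (uv i)))"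
   unfolding HS_def hs_inner_def xS by (intro sum.cong refl) (simp add: D)
  also have "... = (\<Sum>i<n. w (?N x)*inner (uv i) (?P (uv i))+2*deriv w (?N x)*(lk (x - a) i*lk (?P (x - a)) i))"
  proof (rule sum.cong[OF refl])
   fix i assume "i : {..<n}"
   have "inner (x - a) (?P (uv i)) = lk (?P (x - a)) i" using pr(3)[of "x - a" "uv i"] by (simp add: inner_unit_vec)
   thus "inner (w (?N x) *\<^sub>R uv i+(2*deriv w (?N x)*inner (x - a) (uv i)) *\<^sub>R (x - a)) (?P (uv i)) =
    w (?N x)*inner (uv i) (?P (uv i))+2*deriv w (?N x)*(lk (x - a) i*lk (?P (x - a)) i)"
    unfolding inner_add_left inner_scaleR_left by (simp only: inner_unit_vec mult.assoc)
  qed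
  also have "... = w (?N x)*(\<Sum>i<n. inner (uv i) (?P (uv i)))+2*deriv w (?N x)*(\<Sum>i<n. lk (x - a) i*lk (?P (x - a)) i)"
   unfolding sum.distrib sum_distrib_left ..
  also have "(\<Sum>i<n. lk (x - a) i*lk (?P (x - a)) i) = (norm (?P (x - a)))^2"
   unfolding inner_Rn[OF xa, symmetric] by (rule pr(4))
  finally have e: "HS (Xr a w) p = real m * w (?N x)+2*deriv w (?N x)*(norm (?P (x - a)))^2" unfolding pr(6) by (simp add: mult.commute)
  have "(norm (?P (x - a)))^2 <= ?N x" using pr(5) by (intro power_mono) auto
  hence "2*deriv w (?N x)*?N x <= 2*deriv w (?N x)*(norm (?P (x - a)))^2" using dw[of "?N x"] by (intro mult_left_mono_neg) auto
  moreover have "k (?N (fst p)) = real m * w (?N x)+2*deriv w (?N x)*?N x" by (simp add: k_def xS(1))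
  ultimately show ?thesis using e by linarith
 qed
 have "(\<integral>x. k (?N x) \<partial>cmu) = (\<integral>p. k (?N (fst p)) \<partial>cV)" using integral_V(1)[OF cont_cmeas[OF ck]] by simp
 also have "... <= (\<integral>p. HS (Xr a w) p \<partial>cV)" by (rule integral_mono[OF _ HS_integrable[OF X] HS]) (use integral_V(2)[OF cont_cmeas[OF ck]] ki in auto)
 finally show "(\<integral>x. k (?N x) \<partial>cmu) <= first_var n V (Xr a w)" using first_var_eq[OF X] by simp
qed

end

context vsp
begin

lemma psi_compact: assumes C: "compact C" "C <= U" shows "emeas psi C < \<infinity>"
proof (cases "m = 1")
 case True
 have "C : sets vd.M" using C borel_closed[OF compact_imp_closed[OF C(1)]] by (simp add: vd.in_sets_M)
 thus ?thesis using True vd.M_compact[OF C] by (simp add: psi_measure_def)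
next
 case False
 hence m: "1 < m" using m1 by simp
 have "emeas psi C <= (\<integral>\<^sup>+z. enn (norm (mean_curv n U V z) powr real m)*ind C z \<partial>cmu)"
  using m by (simp add: psi_measure_def emeasure_density_le)
 also have "... < \<infinity>" by (rule mc[OF m, unfolded mean_curv_hyp_def, THEN conjunct1, rule_format, OF conjI[OF C]])
 finally show ?thesis .
qed

text \<open>\<open>psi\<close> is finite on compact sets, so it is small on small punctured
  balls.\<close>

lemma nice_ball_exists:
 assumes a: "a : Sp"
 shows "EX r0>0. ALL r. 0 < r & r <= r0 --> nice_ball a r"
proof -
 have "a : U" using a Sp_U by blast
 then obtain R where R: "0 < R" "cball a R Int Rn n <= U" using opn_cball[OF U] by blast
 have s: "cball a r Int U - {a} : sets psi" for r by (rule sets_psi) (use opn_borel[OF U] in auto)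
 have "emeas psi (cball a R Int U - {a}) <= emeas psi (cball a R Int Rn n)"
 proof (rule emeasure_mono)
  show "cball a R Int U - {a} <= cball a R Int Rn n" using opn_subset[OF U] by blast
  show "cball a R Int Rn n : sets psi" by (rule sets_psi[OF _ R(2)]) simp
 qed
 also have "... < \<infinity>" by (rule psi_compact[OF compact_cball_Rn R(2)])
 finally have fin: "emeas psi (cball a R Int U - {a}) < \<infinity>" .
 have "0 < enn (1/\<Gamma>)" using \<Gamma>_pos by simp
 from punctured_small[OF s fin R(1) this] obtain r0 where r0: "0 < r0" "!!r. r <= r0==>emeas psi (cball a r Int U - {a}) < enn (1/\<Gamma>)" by blast
 have "nice_ball a r" if r: "0 < r" "r <= min r0 R" for r
 proof -
  have "emeas psi (ball a r Int U - {a}) <= emeas psi (cball a r Int U - {a})" by (rule emeasure_mono[OF _ s]) auto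
  also have "... <= enn (1/\<Gamma>)" using r0(2)[of r] r by simp
  finally show ?thesis using a r R(2) by (auto simp: nice_ball_def)
 qed
 thus ?thesis using r0(1) R(1) by (intro exI[of _ "min r0 R"]) auto
qed

end

lemma nn_integral_cmult_le:
 assumes c: "0 < c"
 shows "(\<integral>\<^sup>+x. enn c*f x \<partial>M) <= enn c*(\<integral>\<^sup>+x. f x \<partial>M)"
 unfolding nn_integral_def_finite[of M "%x. enn c*f x"]
proof (rule SUP_least)
 fix s assume "s : {g. simple_function M g & g <= (%x. enn c*f x) & (ALL x. g x < top)}"
 hence s: "simple_function M s" "!!x. s x <= enn c*f x" by (auto simp: le_fun_def)
 have e: "enn c*enn (1/c) = 1" using c by (simp add: ennreal_mult'[symmetric])
 have sm: "s : bmeas M" by (rule borel_measurable_simple_function[OF s(1)])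
 have "integral\<^sup>S M s = (\<integral>\<^sup>+x. s x \<partial>M)" using nn_integral_eq_simple_integral[OF s(1)] by simp
 also have "... = (\<integral>\<^sup>+x. enn c*(enn (1/c) * s x) \<partial>M)" using e by (simp add: mult.assoc[symmetric])
 also have "... = enn c*(\<integral>\<^sup>+x. enn (1/c) * s x \<partial>M)" by (rule nn_integral_cmult) (use sm in measurable)
 also have "... <= enn c*(\<integral>\<^sup>+x. f x \<partial>M)"
 proof (intro mult_left_mono nn_integral_mono)
  fix x
  have "enn (1/c) * s x <= enn (1/c)*(enn c*f x)" by (intro mult_left_mono s) simp
  also have "... = f x" using e by (simp add: mult.assoc[symmetric] mult.commute)
  finally show "enn (1/c) * s x <= f x" .
 qed simp
 finally show "integral\<^sup>S M s <= enn c*(\<integral>\<^sup>+x. f x \<partial>M)" .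
qed

text \<open>Either x h <= delta, or the factor (x h / delta)^(m-1) is at least one and may be
  inserted. This takes the role of Young's inequality when the mean curvature term is
  absorbed.\<close>

lemma radial_young:
 fixes x h w :: real
 assumes "0 <= x" "0 <= h" "0 <= w" "0 < \<delta>" "1 <= m" "w*x powr m <= B"
 shows "w*x*h <= \<delta> * w+B*(1/\<delta>) powr (m - 1)*h powr m"
proof (cases "x*h <= \<delta>")
 case True
 have "0 <= B" using assms(3,6) by (meson mult_nonneg_nonneg order_trans powr_ge_zero)
 have "w*(x*h) <= w*\<delta>" using True assms by (intro mult_left_mono) auto
 moreover have "0 <= B*(1/\<delta>) powr (m - 1)*h powr m" using \<open>0 <= B\<close> by simp
 ultimately show ?thesis using mult.assoc[of w x h] mult.commute[of w \<delta>] by linarith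
next
 case False
 hence y: "\<delta> < x*h" by simp
 hence "0 < x*h" using assms(4) by linarith
 hence x: "0 < x" "0 < h" using assms by (auto simp: zero_less_mult_iff)
 have "1 <= (x*h*(1/\<delta>)) powr (m - 1)" using y assms(4,5) by (intro ge_one_powr_ge_zero) (auto simp: field_simps)
 hence "x*h <= x*h*(x*h*(1/\<delta>)) powr (m - 1)" using x by simp
 also have "... = x powr m*h powr m*(1/\<delta>) powr (m - 1)"
  using x assms(4) by (simp add: powr_mult powr_diff powr_divide)
 finally have "w*(x*h) <= w*(x powr m*h powr m*(1/\<delta>) powr (m - 1))" by (rule mult_left_mono[OF _ assms(3)])
 also have "... = (w*x powr m)*((1/\<delta>) powr (m - 1)*h powr m)" by simp
 also have "... <= B*((1/\<delta>) powr (m - 1)*h powr m)" by (rule mult_right_mono[OF assms(6)]) simp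
 finally show ?thesis using assms(3,4) by (simp add: mult.assoc add_increasing)
qed

section \<open>Growth of the mass of balls for m > 1\<close>

context vsp
begin

text \<open>The first variation is tested with the radial field of profile w(t) = (t + kp^2)^(-b/2)
  c(t), where c is a cutoff and b = m - delta. Here m w + 2 t w' is at least delta w - B1, whereas
  the mean curvature side is at most delta/2 times the integral W of w plus a constant, by
  \<open>radial_young\<close>. Thus W is bounded independently of kp, and on the ball of radius kp
  the profile is at least (2 kp^2)^(-b/2).\<close>

lemma growth:
 assumes m: "1 < m" and \<delta>: "0 < \<delta>" "\<delta> < real m" and a: "a : U"
 shows "EX C R. 0 < C & 0 < R & (ALL kp. 0 < kp & kp <= R --> emeas mu (cball a kp Int U) <= enn (C*kp powr (real m - \<delta>)))"
proof -
 obtain R where R: "0 < R" "cball a R Int Rn n <= U" using opn_cball[OF U a] by blast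
 have aR: "a : Rn n" using a opn_mem[OF U] by blast
 define b where "b = real m - \<delta>"
 have b: "0 < b" using \<delta> by (simp add: b_def)
 \<comment> \<open>With p R^2 = 4/3 the argument p t - 1/3 of the step runs from 0 at t = R^2/4 to 1
   at t = R^2.\<close>
 define p where "p = 4/(3*R^2)"
 have p: "0 < p" using R by (simp add: p_def)
 have pR: "p*R^2 = 4/3" using R by (simp add: p_def)
 define c where "c t = 1 - stp (p*t + - 1/3)" for t
 have rc: "rsm UNIV c" unfolding c_def by (intro rsm_diff rsm_const rsm_affine stp_props) simp_all
 have dc: "(c hrd - (p*deriv stp (p*t + - 1/3))) (at t)" for t
 proof -
  have "((%t. stp (p*t + - 1/3)) hrd deriv stp (p*t + - 1/3)*p) (at t)" by (rule DERIV_chain2[OF stp_deriv]) (auto intro!: derivative_eq_intros)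
  from DERIV_diff[OF DERIV_const this, of 1] show ?thesis unfolding c_def by (simp add: mult.commute)
 qed
 have c01: "0 <= c t" "c t <= 1" for t using stp_range by (auto simp: c_def)
 have c1: "c t = 1" if "t <= R^2/4" for t
 proof -
  have "p*t <= p*(R^2/4)" using that p by (intro mult_left_mono) auto
  thus ?thesis using pR by (simp add: c_def stp_props(2))
 qed
 have c0: "c t = 0" if "R^2 <= t" for t
 proof -
  have "p*R^2 <= p*t" using that p by (intro mult_left_mono) auto
  thus ?thesis using pR by (simp add: c_def stp_props(3))
 qed
 let ?C = "cball a R Int Rn n"
 have Cm: "?C : sets mu" using R by (simp add: in_sets_mu)
 have Cf: "emeas mu ?C < \<infinity>" by (rule mu_compact[OF compact_cball_Rn R(2)])
 define H where "H = mean_curv n U V"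
 have If: "(\<integral>\<^sup>+z\<in>?C. enn (norm (H z) powr real m) \<partial>cmu) < \<infinity>"
  unfolding H_def by (rule mc[OF m, unfolded mean_curv_hyp_def, THEN conjunct1, rule_format]) (use compact_cball_Rn R in blast)
 define I where "I = enn2real (\<integral>\<^sup>+z\<in>?C. enn (norm (H z) powr real m) \<partial>cmu)"
 have I: "(\<integral>\<^sup>+z\<in>?C. enn (norm (H z) powr real m) \<partial>cmu) = enn I" "0 <= I" using If by (auto simp: I_def less_top)
 \<comment> \<open>Bounds the term in which the cutoff is differentiated; that term lives on R^2/4
   <= t <= R^2.\<close>
 define B1 where "B1 = 2*R^2*(R^2/4) powr (- b/2)*(p*Lstp)"
 have B1: "0 <= B1" using p Lstp(1) by (simp add: B1_def)
 \<comment> \<open>The constant of \<open>radial_young\<close> for delta/2 in place of delta and B =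
   R^delta.\<close>
 define C2 where "C2 = R powr \<delta>*(1/(\<delta>/2)) powr (real m - 1)"
 have C2: "0 < C2" using R \<delta> by (simp add: C2_def)
 define C3 where "C3 = 2*(C2*I+B1*measure cmu ?C)/\<delta>"
 have C3: "0 <= C3" using C2 I B1 \<delta> by (simp add: C3_def)
 have est: "emeas mu (cball a kp Int U) <= enn ((C3*2 powr (b/2)+1)*kp powr b)" if kp: "0 < kp" "kp <= R/2" for kp
 proof -
  define w where "w t = 1*(t+kp^2) powr (- b/2)*c t" for t
  let ?A = "{-kp\<^sup>2<..}"
  let ?N = "%x. (norm (x - a))^2"
  have k2: "0 < kp^2" using kp by simp
  have A: "open ?A" "rsm ?A w" "{0..} <= ?A"
  proof -
   show "rsm ?A w" unfolding w_def by (intro rsm_mult rsm_powr rsm_subset[OF rc]) auto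
   show "{0..} <= ?A" using k2 by (auto intro: less_le_trans[of _ 0])
  qed simp
  have dw: "deriv w t = (- b/2)*(t+kp^2) powr (- b/2 - 1)*c t + - (p*deriv stp (p*t + - 1/3))*(t+kp^2) powr (- b/2)" if t: "0 <= t" for t
  proof -
   have "0 < t+kp^2" using t k2 by linarith
   hence "((%t. (t+kp^2) powr (- b/2)) hrd (- b/2)*(t+kp^2) powr (- b/2 - 1)) (at t)" by (auto intro!: derivative_eq_intros simp: powr_diff)
   from DERIV_mult[OF this dc[of t]] show ?thesis unfolding w_def by (intro DERIV_imp_deriv) simp
  qed
  have w0: "w t = 0" if "R^2 <= t" for t using c0[OF that] by (simp add: w_def)
  have wnn: "0 <= w t" for t using c01(1)[of t] by (simp add: w_def)
  have dwn: "deriv w t <= 0" if t: "0 <= t" for t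
  proof -
   have "0 <= b/2*(t+kp^2) powr (- b/2 - 1)*c t" using b c01(1)[of t] by simp
   moreover have "0 <= p*deriv stp (p*t + - 1/3)*(t+kp^2) powr (- b/2)" using p deriv_stp_nonneg[of "p*t + - 1/3"] by simp
   ultimately show ?thesis unfolding dw[OF t] by simp
  qed
  note rad = first_var_radial[OF A R(1) w0 R(2) aR dwn]
  let ?X = "Xr a w"
  define k where "k t = real m * w t+2*t*deriv w t" for t
  have kl: "\<delta> * w t - B1 <= k t" if t: "0 <= t" for t
  proof -
   have tk: "0 < t+kp^2" using t k2 by linarith
   have 1: "t*(t+kp^2) powr (- b/2 - 1) <= (t+kp^2) powr (- b/2)"
   proof -
    have "t*(t+kp^2) powr (- b/2 - 1) <= (t+kp^2)*(t+kp^2) powr (- b/2 - 1)" using k2 by (intro mult_right_mono) auto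
    thus ?thesis using tk by (simp add: powr_diff)
   qed
   have "b*c t*(t*(t+kp^2) powr (- b/2 - 1)) <= b*c t*(t+kp^2) powr (- b/2)" by (rule mult_left_mono[OF 1]) (use b c01(1)[of t] in simp)
   moreover have "2*t*(p*deriv stp (p*t + - 1/3))*(t+kp^2) powr (- b/2) <= B1"
   proof (cases "R^2/4 <= t & t <= R^2")
    case True
    have "(t+kp^2) powr (- b/2) <= (R^2/4) powr (- b/2)" by (rule powr_mono2') (use True R b in "auto intro: add_increasing2")
    hence "2*t*(p*deriv stp (p*t + - 1/3))*(t+kp^2) powr (- b/2) <= 2*R^2*(p*Lstp)*(R^2/4) powr (- b/2)"
     using True Lstp p deriv_stp_nonneg[of "p*t + - 1/3"] t by (intro mult_mono) auto
    thus ?thesis by (simp add: B1_def mult_ac)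
   next
    case False
    have "p*t + - 1/3 < 0 \<or> 1 < p*t + - 1/3"
    proof (cases "R^2/4 <= t")
     case True
     hence "p*R^2 < p*t" using False p by (intro mult_strict_left_mono) auto
     thus ?thesis using pR by simp
    next
     case False
     hence "p*t < p*(R^2/4)" using p by (intro mult_strict_left_mono) auto
     thus ?thesis using pR by simp
    qed
    thus ?thesis using deriv_stp_zero B1 by simp
   qed
   moreover have "k t = real m * w t - b*c t*(t*(t+kp^2) powr (- b/2 - 1)) - 2*t*(p*deriv stp (p*t + - 1/3))*(t+kp^2) powr (- b/2)"
    unfolding k_def dw[OF t] by (simp add: algebra_simps)
   moreover have "real m * w t = \<delta> * w t+b*c t*(t+kp^2) powr (- b/2)" unfolding w_def b_def by (simp add: algebra_simps)
   ultimately show ?thesis by linarith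
  qed
  define W where "W = (\<integral>x. w (?N x) \<partial>cmu)"
  have Wi: "integrable cmu (%x. w (?N x))" by (rule rad(4))
  have kint: "integrable cmu (%x. k (?N x))" using rad(2) by (simp only: k_def)
  have kle: "(\<integral>x. k (?N x) \<partial>cmu) <= first_var n V ?X" using rad(3) by (simp only: k_def)
  have "\<delta>*W - B1*measure cmu ?C = (\<integral>x. \<delta> * w (?N x) - B1*ind ?C x \<partial>cmu)"
   using Wi Cm Cf Int_absorb2[OF R(2)] by (simp add: W_def)
  also have "... <= (\<integral>x. k (?N x) \<partial>cmu)"
  proof (rule integral_mono[OF _ kint])
   show "integrable cmu (%x. \<delta> * w (?N x) - B1*ind ?C x)" using Wi Cm Cf by (intro Bochner_Integration.integrable_diff) auto
   fix x assume "x : space cmu"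
   hence xR: "x : Rn n" using opn_mem[OF U] by simp
   show "\<delta> * w (?N x) - B1*ind ?C x <= k (?N x)"
   proof (cases "x : ?C")
    case False
    hence "R < norm (x - a)" using xR by (auto simp: dist_norm norm_minus_commute)
    hence N: "R^2 < ?N x" using R by (simp add: power_strict_mono)
    have "p*R^2 < p*?N x" using N p by (intro mult_strict_left_mono)
    hence "deriv stp (p*?N x + - 1/3) = 0" using pR by (intro deriv_stp_zero) simp
    hence "k (?N x) = 0" using w0[of "?N x"] N dw[of "?N x"] c0[of "?N x"] by (simp add: k_def)
    thus ?thesis using False w0[of "?N x"] N by simp
   qed (use kl[of "?N x"] in simp)
  qed
  also have "... <= first_var n V ?X" by (rule kle)
  finally have low: "\<delta>*W - B1*measure cmu ?C <= first_var n V ?X" .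
  have fv: "first_var n V ?X = - (\<integral>z. inner (?X z) (H z) \<partial>cmu)"
   unfolding H_def by (rule mc[OF m, unfolded mean_curv_hyp_def, THEN conjunct2, rule_format, OF rad(1)])
  have "enn \<bar>first_var n V ?X\<bar> <= (\<integral>\<^sup>+z. enn (norm (inner (?X z) (H z))) \<partial>cmu)"
  \<comment> \<open>Without integrability the Bochner integral is 0 by convention, and the bound is
    trivial.\<close>
  proof (cases "integrable cmu (%z. inner (?X z) (H z))")
   case True
   from integral_norm_bound_ennreal[OF True] show ?thesis by (simp add: fv)
  next
   case False
   thus ?thesis by (simp add: fv not_integrable_integral_eq)
  qed
  also have "... <= (\<integral>\<^sup>+z. enn (\<delta>/2 * w (?N z))+enn C2*(enn (norm (H z) powr real m)*ind ?C z) \<partial>cmu)"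
  proof (rule nn_integral_mono)
   fix z assume "z : space cmu"
   hence zR: "z : Rn n" using opn_mem[OF U] by simp
   have "norm (inner (?X z) (H z)) <= norm (?X z)*norm (H z)" by (simp add: Cauchy_Schwarz_ineq2)
   also have "... = w (?N z)*norm (z - a)*norm (H z)" using zR wnn by (simp add: Xr_def)
   also have "... <= \<delta>/2 * w (?N z)+C2*(norm (H z) powr real m*ind ?C z)"
   proof (cases "z : ?C")
    case False
    hence "R <= norm (z - a)" using zR by (auto simp: dist_norm norm_minus_commute)
    hence "w (?N z) = 0" using R by (intro w0 power_mono) auto
    thus ?thesis using False by simp
   next
    case True
    \<comment> \<open>The profile is at most |z - a|^(-b), and m - b = delta.\<close>
    have "w (?N z)*norm (z - a) powr real m <= R powr \<delta>"
    proof (cases "norm (z - a) = 0")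
     case False
     hence nz: "0 < norm (z - a)" by simp
     have "w (?N z) <= (?N z+kp^2) powr (- b/2)*1" unfolding w_def using c01 by (simp add: mult_left_le)
     also have "(?N z+kp^2) powr (- b/2) <= (?N z) powr (- b/2)" by (rule powr_mono2') (use nz k2 b in auto)
     also have "(?N z) powr (- b/2) = norm (z - a) powr (- b)" using nz by (simp add: powr_powr flip: powr_numeral)
     finally have "w (?N z)*norm (z - a) powr real m <= norm (z - a) powr (- b)*norm (z - a) powr real m" by (intro mult_right_mono) auto
     also have "... = norm (z - a) powr \<delta>" by (simp add: b_def flip: powr_add)
     also have "... <= R powr \<delta>" by (rule powr_mono2) (use True \<delta> in "auto simp: dist_norm norm_minus_commute")
     finally show ?thesis .
    qed (use \<delta> in simp)
    from radial_young[OF norm_ge_zero norm_ge_zero wnn _ _ this, of "\<delta>/2" "H z"] \<delta> m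
    show ?thesis using True by (simp add: C2_def mult.assoc)
   qed
   finally have "norm (inner (?X z) (H z)) <= \<delta>/2 * w (?N z)+C2*(norm (H z) powr real m*ind ?C z)" .
   hence "enn (norm (inner (?X z) (H z))) <= enn (\<delta>/2 * w (?N z)+C2*(norm (H z) powr real m*ind ?C z))" by (rule ennreal_leI)
   also have "... = enn (\<delta>/2 * w (?N z))+enn C2*(enn (norm (H z) powr real m)*ind ?C z)"
    using C2 \<delta> wnn by (subst ennreal_plus) (auto simp: ennreal_mult indicator_def)
   finally show "enn (norm (inner (?X z) (H z))) <= enn (\<delta>/2 * w (?N z))+enn C2*(enn (norm (H z) powr real m)*ind ?C z)" .
  qed
  also have "... <= (\<integral>\<^sup>+z. enn (\<delta>/2 * w (?N z)) \<partial>cmu)+(\<integral>\<^sup>+z. enn C2*(enn (norm (H z) powr real m)*ind ?C z) \<partial>cmu)" by (rule nn_integral_add_le) (use Wi in auto)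
  also have "... <= enn (\<delta>/2*W)+enn C2*enn I"
  proof (rule add_mono)
   have "(\<integral>\<^sup>+z. enn (\<delta>/2 * w (?N z)) \<partial>cmu) = enn (\<integral>z. \<delta>/2 * w (?N z) \<partial>cmu)" by (rule nn_integral_eq_integral) (use Wi wnn \<delta> in auto)
   thus "(\<integral>\<^sup>+z. enn (\<delta>/2 * w (?N z)) \<partial>cmu) <= enn (\<delta>/2*W)" by (simp add: W_def)
   show "(\<integral>\<^sup>+z. enn C2*(enn (norm (H z) powr real m)*ind ?C z) \<partial>cmu) <= enn C2*enn I"
    unfolding I(1)[symmetric] by (rule nn_integral_cmult_le[OF C2])
  qed
  also have "... = enn (\<delta>/2*W+C2*I)"
  proof -
   have "0 <= W" unfolding W_def by (rule integral_nonneg_AE) (use wnn in simp)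
   thus ?thesis using C2 I \<delta> by (subst ennreal_plus) (auto simp: ennreal_mult)
  qed
  finally have "enn \<bar>first_var n V ?X\<bar> <= enn (\<delta>/2*W+C2*I)" .
  moreover have W0: "0 <= W" unfolding W_def by (rule integral_nonneg_AE) (use wnn in simp)
  ultimately have "\<bar>first_var n V ?X\<bar> <= \<delta>/2*W+C2*I" using C2 I \<delta> by (subst (asm) ennreal_le_iff) auto
  hence "\<delta>*W <= 2*(C2*I+B1*measure cmu ?C)" using low by (simp add: algebra_simps)
  hence WC3: "W <= C3" using \<delta> by (simp add: C3_def field_simps)
  have Bm: "cball a kp Int U : sets cmu" using opn_borel[OF U] by (simp add: in_sets_mu)
  have BC: "cball a kp Int U <= ?C" using kp R opn_subset[OF U] by auto
  have Bf: "emeas cmu (cball a kp Int U) < \<infinity>"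
  proof -
   have "emeas cmu (cball a kp Int U) <= emeas cmu ?C" by (rule emeasure_mono[OF BC]) (use Cm in simp)
   thus ?thesis using Cf Cm by simp
  qed
  have "(2*kp^2) powr (- b/2)*measure cmu (cball a kp Int U) = (\<integral>x. (2*kp^2) powr (- b/2)*ind (cball a kp Int U) x \<partial>cmu)"
   using Bm Bf by simp
  also have "... <= W" unfolding W_def
  proof (rule integral_mono[OF _ Wi])
   show "integrable cmu (%x. (2*kp^2) powr (- b/2)*ind (cball a kp Int U) x)" using Bm Bf by auto
   fix x
   show "(2*kp^2) powr (- b/2)*ind (cball a kp Int U) x <= w (?N x)"
   proof (cases "x : cball a kp Int U")
    case True
    hence N: "?N x <= kp^2" using kp by (auto simp: dist_norm norm_minus_commute intro!: power_mono)
    have "kp^2 <= (R/2)^2" using kp by (intro power_mono) auto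
    hence "c (?N x) = 1" using N by (intro c1) (simp add: power_divide)
    moreover have "(2*kp^2) powr (- b/2) <= (?N x+kp^2) powr (- b/2)" by (rule powr_mono2') (use N k2 b in "auto intro: add_nonneg_pos")
    ultimately show ?thesis using True by (simp add: w_def)
   qed (use wnn in simp)
  qed
  also have "W <= C3" by (rule WC3)
  finally have fin: "(2*kp^2) powr (- b/2)*measure cmu (cball a kp Int U) <= C3" .
  have e: "(2*kp^2) powr (- b/2) = 1/(2 powr (b/2)*kp powr b)"
  proof -
   have "(kp^2) powr (- b/2) = kp powr (- b)" using kp by (simp add: powr_powr flip: powr_numeral)
   thus ?thesis by (simp add: powr_mult powr_minus_divide)
  qed
  have "measure cmu (cball a kp Int U) <= C3*(2 powr (b/2)*kp powr b)"
   using fin kp unfolding e by (simp add: field_simps)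
  also have "... <= (C3*2 powr (b/2)+1)*kp powr b" by (simp add: algebra_simps)
  finally have "enn (measure cmu (cball a kp Int U)) <= enn ((C3*2 powr (b/2)+1)*kp powr b)" by (rule ennreal_leI)
  moreover have "emeas mu (cball a kp Int U) = enn (measure cmu (cball a kp Int U))"
   using Bf opn_borel[OF U] by (simp add: emeasure_eq_ennreal_measure less_top[symmetric] in_sets_mu)
  ultimately show ?thesis by simp
 qed
 have "0 < C3*2 powr (b/2)+1" using C3 by (simp add: add_nonneg_pos)
 thus ?thesis using est R(1) unfolding b_def by (intro exI[of _ "C3*2 powr ((real m - \<delta>)/2)+1"] exI[of _ "R/2"]) auto
qed


section \<open>Monotonicity of the mass quotient for m = 1\<close>

text \<open>Let s < s2 < r1 < r. The derivative of the profile w is -(1/2) t^(-3/2), switched on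
  smoothly between s^2 and s2^2 and off between r1^2 and r^2, so that w is close to 1/max(|x - a|,
  s) - 1/r on the ball of radius r. Then w + 2 t w' is at least 1/s2 - 1/r1 on the ball of radius s
  and at least -1/r1 on the rest of the ball of radius r. The field itself has length at most one,
  vanishes at a and outside the ball, so \<open>T_bound\<close> bounds its first variation by 9
  times the variation measure of the punctured ball. Finally r1 tends to r and s2 to s.\<close>

lemma monotonicity:
 assumes m: "m = 1" and a: "a : Rn n" and s: "0 < s" "s < r" and cb: "cball a r Int Rn n <= U"
 shows "measure mu (cball a s Int U)/s <= measure mu (cball a r Int U)/r+9*measure nu (cball a r Int U - {a})"
proof -
 have r: "0 < r" using s by simp
 let ?C = "cball a r Int Rn n"
 have Uc: "cball a r Int U = ?C" using cb opn_subset[OF U] by auto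
 have Cf: "emeas mu ?C < \<infinity>" by (rule mu_compact[OF compact_cball_Rn cb])
 have sub: "cball a t Int U <= ?C" if "t <= r" for t using that opn_subset[OF U] by auto
 have meas: "cball a t Int U : sets mu" for t using opn_borel[OF U] by (simp add: in_sets_mu)
 have fin: "emeas mu (cball a t Int U) < \<infinity>" if "t <= r" for t
 proof -
  have "emeas mu (cball a t Int U) <= emeas mu ?C" by (rule emeasure_mono[OF sub[OF that]]) (use cb in "simp add: in_sets_mu")
  thus ?thesis using Cf by simp
 qed
 let ?R = "9*measure nu (cball a r Int U - {a})"
 have main: "measure mu (cball a s Int U)/s2 <= measure mu (cball a r Int U)/r1 + ?R" if s2: "s < s2" "s2 < r1" "r1 < r" for s2 r1
 proof -
  have sq: "0 < s^2" "s^2 < s2^2" "s2^2 < r1^2" "r1^2 < r^2" using s s2 by (auto intro: power_strict_mono)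
  have s2p: "0 < s2" "0 < r1" using s s2 by auto
  define p1 where "p1 = 1/(s2^2 - s\<^sup>2)"
  define p2 where "p2 = 1/(r^2 - r1\<^sup>2)"
  have p: "0 < p1" "0 < p2" using sq by (simp_all add: p1_def p2_def)
  define c1 where "c1 t = stp (p1*t + - s\<^sup>2*p1)" for t
  define c2 where "c2 t = 1 - stp (p2*t + - r1\<^sup>2*p2)" for t
  have arg1: "p1*t + - s\<^sup>2*p1 = (t - s\<^sup>2)/(s2^2 - s\<^sup>2)" for t by (simp add: p1_def diff_divide_distrib)
  have arg2: "p2*t + - r1\<^sup>2*p2 = (t - r1\<^sup>2)/(r^2 - r1\<^sup>2)" for t by (simp add: p2_def diff_divide_distrib)
  have rc: "rsm UNIV (%t. c1 t*c2 t)" unfolding c1_def c2_def by (intro rsm_mult rsm_diff rsm_const rsm_affine stp_props) simp_all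
  have c1r: "0 <= c1 t" "c1 t <= 1" and c2r: "0 <= c2 t" "c2 t <= 1" for t using stp_range by (auto simp: c1_def c2_def)
  have c1z: "c1 t = 0" if "t <= s^2" for t unfolding c1_def arg1 using that sq by (intro stp_props(2)) (simp add: divide_le_0_iff)
  have c1o: "c1 t = 1" if "s2^2 <= t" for t unfolding c1_def arg1 using that sq by (intro stp_props(3)) (simp add: le_divide_eq)
  have c2o: "c2 t = 1" if "t <= r1^2" for t
  proof -
   have "stp (p2*t + - r1\<^sup>2*p2) = 0" unfolding arg2 using that sq by (intro stp_props(2)) (simp add: divide_le_0_iff)
   thus ?thesis by (simp add: c2_def)
  qed
  have c2z: "c2 t = 0" if "r^2 <= t" for t
  proof -
   have "stp (p2*t + - r1\<^sup>2*p2) = 1" unfolding arg2 using that sq by (intro stp_props(3)) (simp add: le_divide_eq)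
   thus ?thesis by (simp add: c2_def)
  qed
  define d1 where "d1 t = deriv stp (p1*t + - s\<^sup>2*p1)*p1" for t
  have dc1: "(c1 hrd d1 t) (at t)" for t
   unfolding c1_def d1_def by (rule DERIV_chain2[OF stp_deriv]) (auto intro!: derivative_eq_intros)
  have d1n: "0 <= d1 t" for t using p deriv_stp_nonneg by (simp add: d1_def)
  have dc2: "(c2 hrd 0) (at t)" if "t <= r1^2" for t
  proof -
   have "((%t. stp (p2*t + - r1\<^sup>2*p2)) hrd deriv stp (p2*t + - r1\<^sup>2*p2)*p2) (at t)" by (rule DERIV_chain2[OF stp_deriv]) (auto intro!: derivative_eq_intros)
   moreover have "deriv stp (p2*t + - r1\<^sup>2*p2) = 0"
   proof (cases "t = r1^2")
    case True
    thus ?thesis unfolding arg2 by (simp add: deriv_stp_0)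
   next
    case False
    thus ?thesis unfolding arg2 using that sq by (intro deriv_stp_zero) (simp add: divide_less_0_iff)
   qed
   ultimately have "((%t. 1 - stp (p2*t + - r1\<^sup>2*p2)) hrd 0 - 0) (at t)" by (intro DERIV_diff DERIV_const) simp
   thus ?thesis by (simp add: c2_def[abs_def])
  qed
  \<comment> \<open>The summand 0 matches the form of \<open>rsm_powr\<close>; smoothness at t = 0
    comes from the vanishing of \<open>c1\<close> below s^2.\<close>
  define b where "b t = (1/2)*(t+0) powr (- 3/2)*(c1 t*c2 t)" for t
  have bz: "b t = 0" if "t <= s^2 \<or> r^2 <= t" for t using that c1z c2z by (auto simp: b_def)
  have rb: "rsm UNIV b"
  proof -
   have 1: "rsm {0<..} b" unfolding b_def
   proof (rule rsm_mult)
    show "rsm {0<..} (%t. 1/2*(t+0) powr (- 3/2))" using rsm_powr[of 0 "1/2" "-3/2"] by simp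
    show "rsm {0<..} (%t. c1 t*c2 t)" by (rule rsm_subset[OF rc]) simp
   qed simp
   have 2: "rsm {..<s^2} b" by (rule rsm_cong[OF _ _ rsm_const[of _ 0]]) (use bz in auto)
   have "rsm ({0<..} Un {..<s^2}) b" by (rule rsm_Un[OF _ _ 1 2]) auto
   moreover have "{0<..} Un {..<s^2} = UNIV" using sq(1) by (auto simp: not_less intro: le_less_trans)
   ultimately show ?thesis by simp
  qed
  have bn: "0 <= b t" for t using c1r c2r by (simp add: b_def)
  obtain I where I: "rsm UNIV I" "!!x. (I hrd b x) (at x)" "!!x. x <= 0==>I x = 0"
   using rsm_antideriv[OF rb] bz sq(1) by (metis less_imp_le order_trans)
  define w where "w t = I (r^2) - I t" for t
  have rw: "rsm UNIV w" unfolding w_def by (intro rsm_diff rsm_const I) simp_all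
  have Dw: "(w hrd - b t) (at t)" for t
   using DERIV_diff[OF DERIV_const I(2), of "I (r^2)" t] by (simp add: w_def[abs_def])
  have dw: "deriv w t = - b t" for t by (rule DERIV_imp_deriv[OF Dw])
  have w0: "w t = 0" if "r^2 <= t" for t
  proof -
   have "EX y. (w hrd y) (at x) & 0 <= y" "EX y. (w hrd y) (at x) & y <= 0" if "r^2 <= x" for x
    using Dw[of x] bz[of x] that by (auto intro!: exI[of _ 0])
   hence "w (r^2) <= w t" "w t <= w (r^2)"
    using DERIV_nonneg_imp_nondecreasing[OF that, of w] DERIV_nonpos_imp_nonincreasing[OF that, of w] by blast+
   thus ?thesis by (simp add: w_def)
  qed
  have wmono: "w y <= w x" if "x <= y" for x y by (rule DERIV_nonpos_imp_nonincreasing[OF that]) (use Dw bn in "meson neg_le_0_iff_le")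
  have wn: "0 <= w t" for t
   using wmono[of t "r^2"] w0[of "r^2"] w0[of t] by (cases "t <= r^2") auto
  have Dp: "((%t. t powr (- 1/2)) hrd - (1/2)*t powr (- 3/2)) (at t)" if "0 < t" for t
   using that by (auto intro!: derivative_eq_intros)
  have wle: "w t <= t powr (- 1/2)" if t: "0 < t" for t
  proof (cases "t <= r^2")
   case True
   have "(%t. t powr (- 1/2) - w t) (r^2) <= (%t. t powr (- 1/2) - w t) t"
   proof (rule DERIV_nonpos_imp_nonincreasing[OF True, of "%t. t powr (- 1/2) - w t"])
    fix x assume x: "t <= x" "x <= r^2"
    have "b x <= (1/2)*x powr (- 3/2)*1" unfolding b_def using c1r c2r by (intro mult_mono) (auto simp: mult_le_one)
    moreover have "((%t. t powr (- 1/2) - w t) hrd - (1/2)*x powr (- 3/2) - - b x) (at x)" by (rule DERIV_diff[OF Dp Dw]) (use t x in simp)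
    ultimately show "EX y. ((%t. t powr (- 1/2) - w t) hrd y) (at x) & y <= 0" by fastforce
   qed
   hence "(r^2) powr (- 1/2) - w (r^2) <= t powr (- 1/2) - w t" .
   thus ?thesis using w0[OF order_refl] powr_ge_zero[of "r^2" "- 1/2"] by linarith
  next
   case False
   thus ?thesis using w0[of t] by simp
  qed
  define k where "k t = w t+2*t*deriv w t" for t
  have kt: "k t = w t - t powr (- 1/2)*(c1 t*c2 t)" if t: "0 < t" for t
  proof -
   have "t*t powr (- 3/2) = t powr 1*t powr (- 3/2)" using t by simp
   also have "... = t powr (- 1/2)" unfolding powr_add[symmetric] by simp
   finally show ?thesis unfolding k_def dw b_def by (simp add: mult.assoc[symmetric])
  qed
  have psq: "(x^2) powr (- 1/2) = 1/x" if "0 < x" for x :: real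
  proof -
   have "(x^2) powr (- 1/2) = x powr (- 1)" using that by (simp add: powr_powr flip: powr_numeral)
   thus ?thesis using that by (simp add: powr_minus_divide)
  qed
  \<comment> \<open>One derivative formula for two comparisons: e = 0 up to the radius r1, and e =
    1/s2 on the inner ramp.\<close>
  have Dk: "((%t. w t - t powr (- 1/2)*c1 t+e*c1 t) hrd (e - t powr (- 1/2))*d1 t) (at t)" if "0 < t" "t <= r1^2" for t e
  proof -
   have "((%t. w t - t powr (- 1/2)*c1 t+e*c1 t) hrd - b t - (- (1/2)*t powr (- 3/2)*c1 t+d1 t*t powr (- 1/2))+e*d1 t) (at t)" by (intro DERIV_add DERIV_diff DERIV_cmult DERIV_mult Dw Dp dc1 that)
   moreover have "b t = (1/2)*t powr (- 3/2)*c1 t" using c2o[OF that(2)] by (simp add: b_def)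
   ultimately show ?thesis by (simp add: algebra_simps)
  qed
  have kr1: "w (r1^2) - (r1^2) powr (- 1/2)*c1 (r1^2) >= - 1/r1" unfolding psq[OF s2p(2)] using wn[of "r1^2"] c1o[of "r1^2"] sq by simp
  have kmid: "w t - t powr (- 1/2)*c1 t >= - 1/r1" if t: "s^2 <= t" "t <= r1^2" for t
  proof -
   have "(%t. w t - t powr (- 1/2)*c1 t+0*c1 t) (r1^2) <= (%t. w t - t powr (- 1/2)*c1 t+0*c1 t) t"
   proof (rule DERIV_nonpos_imp_nonincreasing[OF t(2), of "%t. w t - t powr (- 1/2)*c1 t+0*c1 t"])
    fix x assume x: "t <= x" "x <= r1^2"
    have "0 < x" using x t sq by linarith
    thus "EX y. ((%t. w t - t powr (- 1/2)*c1 t+0*c1 t) hrd y) (at x) & y <= 0"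
     using Dk[of x 0] x d1n[of x] by (intro exI conjI) (assumption, simp)
   qed
   thus ?thesis using kr1 by simp
  qed
  have ks: "w (s^2) >= 1/s2 - 1/r1"
  proof -
   let ?K = "%t. w t - t powr (- 1/2)*c1 t+1/s2*c1 t"
   have "?K (s2^2) <= ?K (s^2)"
   proof (rule DERIV_nonpos_imp_nonincreasing[of _ _ ?K])
    fix x assume x: "s^2 <= x" "x <= s2^2"
    have x0: "0 < x" by (rule less_le_trans[OF sq(1) x(1)])
    have "(s2^2) powr (- 1/2) <= x powr (- 1/2)" by (rule powr_mono2'[OF _ x0 x(2)]) simp
    hence "(1/s2 - x powr (- 1/2))*d1 x <= 0" using d1n[of x] psq[OF s2p(1)] by (intro mult_nonpos_nonneg) auto
    moreover have "(?K hrd (1/s2 - x powr (- 1/2))*d1 x) (at x)" by (rule Dk[OF x0]) (use x sq in linarith)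
    ultimately show "EX y. (?K hrd y) (at x) & y <= 0" by blast
   qed (use sq in simp)
   moreover have "c1 (s^2) = 0" "c1 (s2^2) = 1" using c1z c1o by auto
   ultimately show ?thesis using kmid[of "s2^2"] sq by simp
  qed
  have klow: "k t >= 1/s2*(if t <= s^2 then 1 else 0) - 1/r1*(if t <= r^2 then 1 else 0)" if t: "0 <= t" for t
  proof (cases "t <= s^2")
   case True
   hence "k t = w t" using bz[of t] by (simp add: k_def dw)
   thus ?thesis using True ks wmono[OF True] sq by simp
  next
   case False
   hence t0: "0 < t" using sq by linarith
   show ?thesis
   proof (cases "t <= r1^2")
    case True
    thus ?thesis using kmid[of t] False kt[OF t0] c2o[of t] sq by simp
   next
    case r1: False
    show ?thesis
    proof (cases "t <= r^2")
     case True
     have "t powr (- 1/2) <= (r1^2) powr (- 1/2)" by (rule powr_mono2') (use r1 s2p in auto)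
     hence "t powr (- 1/2)*(c1 t*c2 t) <= 1/r1*1" using psq[OF s2p(2)] s2p c1r c2r by (intro mult_mono) (auto simp: mult_le_one)
     thus ?thesis using kt[OF t0] wn[of t] True False by simp
    next
     case False
     hence "w t = 0" "b t = 0" using w0[of t] bz[of t] by auto
     thus ?thesis using False \<open>\<not> t <= s^2\<close> by (simp add: k_def dw)
    qed
   qed
  qed
  let ?N = "%x. (norm (x - a))^2"
  have dwn: "deriv w t <= 0" for t using bn[of t] by (simp add: dw)
  note rad = first_var_radial[OF open_UNIV rw subset_UNIV r w0 cb a dwn]
  have kk: "real m * w t+2*t*deriv w t = k t" for t by (simp add: k_def m)
  let ?X = "Xr a w"
  have Ni: "x : cball a t \<longleftrightarrow> ?N x <= t^2" if "0 < t" for x t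
   using that by (auto simp: dist_norm norm_minus_commute abs_le_square_iff[symmetric])
  have "1/s2*measure mu (cball a s Int U) - 1/r1*measure mu (cball a r Int U) = (\<integral>x. 1/s2*ind (cball a s Int U) x - 1/r1*ind (cball a r Int U) x \<partial>cmu)"
   using meas fin[of s] fin[of r] s by (simp add: measure_completion)
  also have "... <= (\<integral>x. k (?N x) \<partial>cmu)"
  proof (rule integral_mono)
   show "integrable cmu (%x. 1/s2*ind (cball a s Int U) x - 1/r1*ind (cball a r Int U) x)"
    using meas fin[of s] fin[of r] s by (intro Bochner_Integration.integrable_diff integrable_mult_right integrable_real_indicator) auto
   show "integrable cmu (%x. k (?N x))" using rad(2) unfolding kk .
   fix x assume "x : space cmu"
   hence "x : U" by simp
   thus "1/s2*ind (cball a s Int U) x - 1/r1*ind (cball a r Int U) x <= k (?N x)"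
    using klow[of "?N x"] Ni[OF s(1), of x] Ni[OF r, of x] by (simp only: indicator_def of_bool_def Int_iff simp_thms zero_le_power2 split: if_splits)
  qed
  also have "... <= first_var n V ?X" using rad(3) unfolding kk .
  also have "first_var n V ?X <= ?R"
  proof -
   let ?B = "cball a r Int U - {a}"
   have Bm: "?B : sets nu" using opn_borel[OF U] unfolding vd.in_sets_M by auto
   have Bf: "emeas nu ?B < \<infinity>"
   proof -
    have "emeas nu ?B <= emeas nu ?C" by (rule emeasure_mono) (use cb Uc in "auto simp: vd.in_sets_M")
    thus ?thesis using vd.M_compact[OF compact_cball_Rn cb] by (rule order.strict_trans1)
   qed
   have "enn \<bar>first_var n V ?X\<bar> <= 9*(\<integral>\<^sup>+z. enn (norm (?X z)) \<partial>nu)" by (rule vd.T_bound[OF rad(1)])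
   also have "(\<integral>\<^sup>+z. enn (norm (?X z)) \<partial>nu) <= (\<integral>\<^sup>+z. ind ?B z \<partial>nu)"
   proof (rule nn_integral_mono)
    fix z assume z: "z : space nu"
    show "enn (norm (?X z)) <= ind ?B z"
    proof (cases "z : ?B")
     case True
     hence nz: "0 < norm (z - a)" by simp
     have "w (?N z)*norm (z - a) <= 1/norm (z - a)*norm (z - a)"
      using wle[of "?N z"] nz psq[OF nz] by (intro mult_right_mono) auto
     hence "norm (?X z) <= 1" using wn[of "?N z"] nz by (simp add: Xr_def)
     thus ?thesis using True by (simp add: ennreal_le_1)
    next
     case False
     hence "z = a \<or> r^2 <= ?N z" using z Ni[OF r, of z] by auto
     thus ?thesis using w0 False by (auto simp: Xr_def)
    qed
   qed
   also have "(\<integral>\<^sup>+z. ind ?B z \<partial>nu) = emeas nu ?B" using Bm by simp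
   also have "emeas nu ?B = enn (measure nu ?B)" using Bf by (simp add: emeasure_eq_ennreal_measure less_top[symmetric])
   finally have "enn \<bar>first_var n V ?X\<bar> <= 9*enn (measure nu ?B)" by (simp add: mult_left_mono)
   also have "... = ennreal ?R" by (simp add: ennreal_mult' flip: ennreal_numeral)
   finally show ?thesis by (simp add: ennreal_le_iff)
  qed
  finally show ?thesis by simp
 qed
 \<comment> \<open>The inner limit, r1 to r from below; afterwards s2 tends to s from above.\<close>
 have 1: "measure mu (cball a s Int U)/s2 <= measure mu (cball a r Int U)/r + ?R" if s2: "s < s2" "s2 < r" for s2
 proof (rule tendsto_lowerbound[where F = "at_left r"])
  show "((%r1. measure mu (cball a r Int U)/r1 + ?R) \<longlongrightarrow> measure mu (cball a r Int U)/r + ?R) (at_left r)"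
   using r by (intro tendsto_intros) auto
  show "eventually (%r1. measure mu (cball a s Int U)/s2 <= measure mu (cball a r Int U)/r1 + ?R) (at_left r)"
   using eventually_at_left_real[OF s2(2)] by eventually_elim (rule main, use s2 in auto)
 qed simp
 show ?thesis
 proof (rule tendsto_upperbound[where F = "at_right s"])
  show "((%s2. measure mu (cball a s Int U)/s2) \<longlongrightarrow> measure mu (cball a s Int U)/s) (at_right s)"
   using s by (intro tendsto_intros) auto
  show "eventually (%s2. measure mu (cball a s Int U)/s2 <= measure mu (cball a r Int U)/r + ?R) (at_right s)"
   using eventually_at_right_real[OF s(2)] by eventually_elim (rule 1, auto)
 qed simp
qed

end

section \<open>Lower density bound at every point of the support for m = 1\<close>

context vsp
begin

lemma Sp_pos: assumes a: "a : Sp" and r: "0 < r" shows "0 < emeas mu (ball a r Int U)"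
proof (rule ccontr)
 assume "\<not> ?thesis"
 hence "emeas mu (U Int ball a r) = 0" by (simp add: Int_commute)
 moreover have "openin (top_of_set U) (U Int ball a r)" by (rule openin_open_Int) simp
 ultimately have "U Int ball a r <= Nsp" by (auto simp: Nsp_def)
 thus False using a r by (auto simp: Sp_eq)
qed

text \<open>By monotonicity the quotient mu(B(a,r))/r has a limit Lambda as r tends to 0. Suppose
  Lambda < 1/2. If the support near a is just {a}, a fixed small ball has mass at most s/2 for every
  small s, hence no mass, although a is in the support. Otherwise there is b close to a with density
  at least one. With t = |a - b| the ball B(b, t/2) misses a, so its error term is bounded by a
  small error term at a, and monotonicity at b gives it mass at least 3t/4. As it lies in B(a,
  3t/2), the quotient at a for radius 3t/2 is at least 1/2, a contradiction. Division by alpha(1) =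
  2 yields 1/4.\<close>

lemma density_lower_bound:
 assumes m: "m = 1" and a: "a : Sp"
 shows "enn (1/4) <= mdens (weight U V) 1 a"
proof -
 have aU: "a : U" using a Sp_U by blast
 hence aR: "a : Rn n" using opn_mem[OF U] by blast
 obtain R where R: "0 < R" "cball a R Int Rn n <= U" using opn_cball[OF U aU] by blast
 have meas: "cball x r Int U : sets mu" for x r using opn_borel[OF U] by (simp add: in_sets_mu)
 have measn: "cball x r Int U - {x} : sets nu" for x r using opn_borel[OF U] unfolding vd.in_sets_M by auto
 define phi where "phi x r = measure mu (cball x r Int U)/r" for x r
 define N where "N x r = 9*measure nu (cball x r Int U - {x})" for x r
 have in_ball: "cball x r Int Rn n <= cball a R Int Rn n" if "dist a x+r <= R" for x r
  using that by (auto simp: subset_eq) (meson dist_triangle_le add_mono order_trans dist_triangle le_less)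
 have fin: "emeas mu (cball x r Int U) < \<infinity>" "emeas nu (cball x r Int U - {y}) < \<infinity>" if "dist a x+r <= R" for x y r
 proof -
  have s: "cball x r Int U <= cball a R Int Rn n" using in_ball[OF that] opn_subset[OF U] by blast
  have "emeas mu (cball x r Int U) <= emeas mu (cball a R Int Rn n)" by (rule emeasure_mono[OF s]) (use R in "simp add: in_sets_mu")
  thus "emeas mu (cball x r Int U) < \<infinity>" using mu_compact[OF compact_cball_Rn R(2)] by (rule order.strict_trans1)
  have "emeas nu (cball x r Int U - {y}) <= emeas nu (cball a R Int Rn n)" by (rule emeasure_mono) (use s R in "auto simp: vd.in_sets_M")
  thus "emeas nu (cball x r Int U - {y}) < \<infinity>" using vd.M_compact[OF compact_cball_Rn R(2)] by (rule order.strict_trans1)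
 qed
 have em: "emeas mu (cball x r Int U) = enn (measure mu (cball x r Int U))" if "dist a x+r <= R" for x r
  using fin(1)[OF that] by (simp add: emeasure_eq_ennreal_measure less_top[symmetric])
 have mon: "phi x s <= phi x r+N x r" if "x : U" "dist a x+r <= R" "0 < s" "s < r" for x s r
  unfolding phi_def N_def by (rule monotonicity[OF m opn_mem[OF U that(1)] that(3,4)]) (use in_ball[OF that(2)] R(2) in blast)
 have N0: "EX r0>0. ALL r<=r0. N a r < e" if e: "0 < e" for e
 proof -
  have "emeas nu (cball a R Int U - {a}) < \<infinity>" by (rule fin) simp
  moreover have "0 < enn (e/9)" using e by simp
  ultimately obtain r0 where r0: "0 < r0" "!!r. r <= r0==>emeas nu (cball a r Int U - {a}) < enn (e/9)"
   using punctured_small[OF measn _ R(1)] by blast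
  have "N a r < e" if "r <= r0" for r
  proof -
   have l: "emeas nu (cball a r Int U - {a}) < enn (e/9)" by (rule r0(2)[OF that])
   hence "emeas nu (cball a r Int U - {a}) = enn (measure nu (cball a r Int U - {a}))" by (intro emeasure_eq_ennreal_measure) auto
   hence "measure nu (cball a r Int U - {a}) < e/9" using l by (simp add: ennreal_less_iff)
   thus ?thesis by (simp add: N_def)
  qed
  thus ?thesis using r0(1) by blast
 qed
 have phi0: "0 <= phi x r" if "0 <= r" for x r using that by (simp add: phi_def)
 have Nn: "0 <= N x r" for x r by (simp add: N_def)
 \<comment> \<open>Since the error \<open>N a r\<close> tends to zero, the infimum of the sum is the
   limit of \<open>phi a\<close>.\<close>
 define \<Lambda> where "\<Lambda> = Inf ((%r. phi a r+N a r) ` {0<..R})"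
 have bdd: "bdd_below ((%r. phi a r+N a r) ` {0<..R})" using phi0 Nn by (intro bdd_belowI2[of _ 0]) auto
 have lim: "(phi a \<longlongrightarrow> \<Lambda>) (at_right 0)"
 proof (rule order_tendstoI)
  fix y assume y: "y < \<Lambda>"
  obtain r0 where r0: "0 < r0" "!!r. r <= r0==>N a r < \<Lambda> - y" using N0[of "\<Lambda> - y"] y by auto
  have "y < phi a s" if "0 < s" "s < min r0 R" for s
  proof -
   have "\<Lambda> <= phi a s+N a s" unfolding \<Lambda>_def by (rule cINF_lower[OF bdd]) (use that in auto)
   thus ?thesis using r0(2)[of s] that by simp
  qed
  thus "eventually (%s. y < phi a s) (at_right 0)" using r0(1) R(1) by (auto simp: eventually_at_right_field intro!: exI[of _ "min r0 R"])
 next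
  fix y assume y: "\<Lambda> < y"
  then obtain r where r: "0 < r" "r <= R" "phi a r+N a r < y"
   using cINF_less_iff[OF _ bdd, of y] R(1) unfolding \<Lambda>_def by auto
  have "phi a s < y" if "0 < s" "s < r" for s using mon[OF aU _ that] r by simp
  thus "eventually (%s. phi a s < y) (at_right 0)" using r(1) by (auto simp: eventually_at_right_field intro!: exI[of _ r])
 qed
 \<comment> \<open>The density at x is the limit of \<open>phi x s / 2\<close>, and monotonicity
   bounds \<open>phi x s\<close> by the value at radius r plus the error.\<close>
 have ub: "2 <= phi x r+N x r" if x: "x : U" "has_mdens mu 1 x" "1 <= mdens mu 1 x" and r: "0 < r" "dist a x+r <= R" for x r
 proof -
  have l: "(dens_ratio mu 1 x \<longlongrightarrow> mdens mu 1 x) (at_right 0)" using x(2) by (simp add: has_mdens_def)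
  have "mdens mu 1 x <= enn ((phi x r+N x r)/2)"
  proof (rule tendsto_upperbound[OF l])
   have "dens_ratio mu 1 x s <= enn ((phi x r+N x r)/2)" if s: "0 < s" "s < r" for s
   proof -
    have "dens_ratio mu 1 x s = enn (phi x s/2)"
     using em[of x s] r s by (simp add: dens_ratio_def phi_def unit_ball_vol_1 divide_ennreal)
    also have "... <= enn ((phi x r+N x r)/2)" using mon[OF x(1) r(2) s] by (intro ennreal_leI) simp
    finally show ?thesis .
   qed
   thus "eventually (%s. dens_ratio mu 1 x s <= enn ((phi x r+N x r)/2)) (at_right 0)"
    using r(1) by (auto simp: eventually_at_right_field intro!: exI[of _ r])
  qed simp
  with x(3) have "1 <= enn ((phi x r+N x r)/2)" by (rule order_trans)
  thus ?thesis by (simp add: ennreal_ge_1)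
 qed
 have half: "1/2 <= \<Lambda>"
 proof (rule ccontr)
  assume "\<not> ?thesis"
  hence "\<Lambda> < 1/2" by simp
  hence "eventually (%s. phi a s < 1/2) (at_right 0)" by (rule order_tendstoD(2)[OF lim])
  then obtain r1 where r1: "0 < r1" "!!s. 0 < s==>s < r1 ==> phi a s < 1/2" by (auto simp: eventually_at_right_field)
  obtain r0 where r0: "0 < r0" "!!r. r <= r0==>N a r < 1/2" using N0[of "1/2"] by auto
  \<comment> \<open>Radii up to 2 times this number must be admissible, since balls of radius 3t/2
    around a occur with t below it.\<close>
  define \<tau> where "\<tau> = min (min r1 r0) R/2"
  have \<tau>: "0 < \<tau>" "2*\<tau> <= r1" "2*\<tau> <= r0" "2*\<tau> <= R" using r1 r0 R by (auto simp: \<tau>_def)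
  show False
  proof (cases "Sp Int ball a \<tau> <= {a}")
   case True
   have b: "emeas mu (ball a \<tau> Int U) <= enn (s/2)" if s: "0 < s" "s < \<tau>" for s
   proof -
    have "AE z in mu. z : Sp" using AE_Sp by (simp add: AE_completion_iff)
    hence "AE z in mu. z : ball a \<tau> Int U --> z : cball a s Int U" by eventually_elim (use True s in auto)
    hence "emeas mu (ball a \<tau> Int U) <= emeas mu (cball a s Int U)" by (rule emeasure_mono_AE[OF _ meas])
    also have "... = enn (measure mu (cball a s Int U))" by (rule em) (use s \<tau> in simp)
    also have "... <= enn (s/2)"
    proof (rule ennreal_leI)
     have "phi a s < 1/2" by (rule r1(2)) (use s \<tau> in auto)
     thus "measure mu (cball a s Int U) <= s/2" using s by (simp add: phi_def field_simps)
    qed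
    finally show ?thesis .
   qed
   obtain c where c: "emeas mu (ball a \<tau> Int U) = enn c" "0 <= c" using b[of "\<tau>/2"] \<tau>(1) by (cases "emeas mu (ball a \<tau> Int U)") (auto simp: top_unique)
   have c0: "0 < c" using Sp_pos[OF a \<tau>(1)] c by simp
   define s where "s = min c (\<tau>/2)"
   have s: "0 < s" "s < \<tau>" "s <= c" using c0 \<tau>(1) by (auto simp: s_def)
   have "c <= s/2" using b[OF s(1,2)] s(1) unfolding c(1) by (subst (asm) ennreal_le_iff) auto
   thus False using s by linarith
  next
   case False
   then obtain y where y: "y : Sp" "y : ball a \<tau> - {a}" by blast
   have "AE z in cmu. has_mdens mu m z & 1 <= mdens mu m z" using dens by (rule AE_completion)
   moreover have "open (ball a \<tau> - {a})" by (intro open_Diff) auto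
   ultimately obtain b where b: "b : Sp" "b : ball a \<tau> - {a}" "has_mdens mu m b" "1 <= mdens mu m b"
    using AE_near_Sp[OF _ y(1), of "%z. has_mdens mu m z & 1 <= mdens mu m z" "ball a \<tau> - {a}"] y(2) by blast
   define t where "t = dist a b"
   have t: "0 < t" "t < \<tau>" using b(2) by (auto simp: t_def)
   have bU: "b : U" using b(1) Sp_U by blast
   have le: "dist a b+t/2 <= R" using t \<tau> by (simp add: t_def[symmetric])
   have "2 <= phi b (t/2)+N b (t/2)" using ub[OF bU _ _ _ le] b(3,4) m t by simp
   moreover have "N b (t/2) <= N a (2*\<tau>)"
   proof -
    have "cball b (t/2) Int U - {b} <= cball a (2*\<tau>) Int U - {a}"
    proof
     fix x assume x: "x : cball b (t/2) Int U - {b}"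
     have "dist a x <= dist a b+dist b x" by (rule dist_triangle)
     hence "dist a x <= 2*\<tau>" using x t by (simp add: t_def[symmetric])
     moreover have "x ~= a" using x t by (auto simp: t_def dist_commute)
     ultimately show "x : cball a (2*\<tau>) Int U - {a}" using x by simp
    qed
    hence "measure nu (cball b (t/2) Int U - {b}) <= measure nu (cball a (2*\<tau>) Int U - {a})" by (rule measure_mono_fmeasurable[OF _ measn]) (use fin(2)[of a "2*\<tau>" a] measn \<tau> in "auto simp: fmeasurable_def")
    thus ?thesis by (simp add: N_def)
   qed
   moreover have "N a (2*\<tau>) < 1/2" by (rule r0(2)) (use \<tau> in simp)
   ultimately have "3/2 <= phi b (t/2)" by linarith
   hence mb: "3*t/4 <= measure mu (cball b (t/2) Int U)" using t by (simp add: phi_def field_simps)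
   have "cball b (t/2) Int U <= cball a (3*t/2) Int U"
   proof
    fix x assume x: "x : cball b (t/2) Int U"
    have "dist a x <= dist a b+dist b x" by (rule dist_triangle)
    thus "x : cball a (3*t/2) Int U" using x by (simp add: t_def[symmetric])
   qed
   hence "measure mu (cball b (t/2) Int U) <= measure mu (cball a (3*t/2) Int U)" by (rule measure_mono_fmeasurable[OF _ meas]) (use fin(1)[of a "3*t/2"] meas \<tau> t in "auto simp: fmeasurable_def")
   hence "3*t/4 <= measure mu (cball a (3*t/2) Int U)" using mb by simp
   hence "1/2 <= phi a (3*t/2)" using t by (simp add: phi_def field_simps)
   moreover have "phi a (3*t/2) < 1/2" by (rule r1(2)) (use t \<tau> in auto)
   ultimately show False by simp
  qed
 qed
 have "(dens_ratio mu 1 a \<longlongrightarrow> enn (\<Lambda>/2)) (at_right 0)"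
 proof (rule Lim_transform_eventually)
  show "((%s. enn (phi a s/2)) \<longlongrightarrow> enn (\<Lambda>/2)) (at_right 0)" by (intro tendsto_ennrealI tendsto_divide lim tendsto_const) simp
  have "enn (phi a s/2) = dens_ratio mu 1 a s" if "0 < s" "s < R" for s
   using em[of a s] that by (simp add: dens_ratio_def phi_def unit_ball_vol_1 divide_ennreal)
  thus "eventually (%s. enn (phi a s/2) = dens_ratio mu 1 a s) (at_right 0)"
   using R(1) by (auto simp: eventually_at_right_field intro!: exI[of _ R])
 qed
 hence "mdens mu 1 a = enn (\<Lambda>/2)" unfolding mdens_def by (intro tendsto_Lim) auto
 thus ?thesis using half by (simp add: ennreal_leI)
qed

lemma weak_deriv_facts:
 assumes fT: "f : TV n l U V"
 shows "(%z. hs_norm n (weak_deriv n l U V f z)) : bmeas cmu" "0 <= hs_norm n (weak_deriv n l U V f z)"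
proof -
 have eF: "EX F. is_weak_deriv n l U V f F" using fT[unfolded TV_def mem_Collect_eq] by (elim conjE)
 have F: "is_weak_deriv n l U V f (weak_deriv n l U V f)" unfolding weak_deriv_def by (rule someI_ex[OF eF])
 have "(%z. \<Sum>i<n. (norm (weak_deriv n l U V f z (uv i)))^2) : bmeas cmu"
  using F[unfolded is_weak_deriv_def, THEN conjunct2, THEN conjunct1] by (intro borel_measurable_sum borel_measurable_power measurable_compose[OF _ borel_measurable_norm]) auto
 thus "(%z. hs_norm n (weak_deriv n l U V f z)) : bmeas cmu" unfolding hs_norm_L2 L2_set_def by measurable
 show "0 <= hs_norm n (weak_deriv n l U V f z)" by (simp add: hs_norm_L2)
qed

text \<open>Between two nearby points each level of a coordinate of \<open>f\<close> is attained; hence the interval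
  between the two values can be cut into \<open>N\<close> strips to each of which the strip estimate applies.\<close>

lemma strips:
 assumes nb: "nice_ball a (4*rho)"
 shows "EX \<sigma>>0. ALL l f i z. continuous_on Sp f --> z : Sp Int ball a \<sigma> --> lk (f z) i ~= lk (f a) i -->
  (ALL N::nat. 0 < N --> (ALL j<N. EX y:Sp Int ball a (2*rho). EX \<alpha> L. L = \<bar>lk (f z) i - lk (f a) i\<bar>/real N &
   \<alpha> = min (lk (f a) i) (lk (f z) i)+real j*L & lk (f y) i = \<alpha>+L/2 & (lk (f a) i <= \<alpha> \<or> \<alpha>+L <= lk (f a) i)))"
proof -
 have "nice_ball a (2*rho)"
 proof -
  have "emeas psi (ball a (2*rho) Int U - {a}) <= emeas psi (ball a (4*rho) Int U - {a})"
  proof (rule emeasure_mono)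
   show "ball a (4*rho) Int U - {a} : sets psi" by (rule sets_psi) (use opn_borel[OF U] in auto)
  qed (use nb in "auto simp: nice_ball_def")
  moreover have "cball a (2*rho) <= cball a (4*rho)" using nb by (auto simp: nice_ball_def)
  ultimately show ?thesis using nb unfolding nice_ball_def by (auto intro: order_trans)
 qed
 then obtain \<sigma> where \<sigma>: "0 < \<sigma>" "!!(h::vec => real) z c. continuous_on Sp h==>z : Sp Int ball a \<sigma>==>min (h a) (h z) < c==>c < max (h a) (h z) ==>
  EX y:Sp Int ball a (2*rho). h y = c" using local_ivt[of a rho] by blast
 have "EX y:Sp Int ball a (2*rho). EX \<alpha> L. L = \<bar>lk (f z) i - lk (f a) i\<bar>/real N &
   \<alpha> = min (lk (f a) i) (lk (f z) i)+real j*L & lk (f y) i = \<alpha>+L/2 & (lk (f a) i <= \<alpha> \<or> \<alpha>+L <= lk (f a) i)"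
  if f: "continuous_on Sp f" and z: "z : Sp Int ball a \<sigma>" and ne: "lk (f z) i ~= lk (f a) i" and N: "0 < N" "j < N" for f i z and N j :: nat
 proof -
  define d where "d = \<bar>lk (f z) i - lk (f a) i\<bar>"
  define L where "L = d/real N"
  define lo where "lo = min (lk (f a) i) (lk (f z) i)"
  define \<alpha> where "\<alpha> = lo+real j*L"
  have d: "0 < d" using ne by (simp add: d_def)
  hence L: "0 < L" using N by (simp add: L_def)
  have NL: "real N*L = d" using N by (simp add: L_def)
  have hi: "max (lk (f a) i) (lk (f z) i) = lo+d" by (auto simp: lo_def d_def)
  have "(real j+1)*L <= real N*L" using N L by (intro mult_right_mono) auto
  hence u: "\<alpha>+L <= lo+d" using NL by (simp add: \<alpha>_def algebra_simps)
  have l: "lo <= \<alpha>" using L by (simp add: \<alpha>_def)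
  have c: "continuous_on Sp (%y. lk (f y) i)" using f by (intro continuous_intros)
  obtain y where y: "y : Sp Int ball a (2*rho)" "lk (f y) i = \<alpha>+L/2"
   using \<sigma>(2)[OF c z, of "\<alpha>+L/2"] u l L hi lo_def by auto
  have "lk (f a) i = lo \<or> lk (f a) i = lo+d" by (auto simp: lo_def d_def)
  hence "lk (f a) i <= \<alpha> \<or> \<alpha>+L <= lk (f a) i" using u l by auto
  thus ?thesis using y by (intro bexI[of _ y] exI[of _ \<alpha>] exI[of _ L]) (auto simp: L_def d_def \<alpha>_def lo_def)
 qed
 thus ?thesis using \<sigma>(1) by blast
qed

end

lemma powr_add_le: fixes x y p :: real assumes "0 <= x" "0 <= y" "0 <= p" shows "(x+y) powr p <= 2 powr p*(x powr p+y powr p)"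
proof -
 have "(x+y) powr p <= (2*max x y) powr p" by (rule powr_mono2) (use assms in auto)
 also have "... = 2 powr p*max x y powr p" using assms by (simp add: powr_mult)
 also have "max x y powr p <= x powr p+y powr p" by (simp add: max_def)
 finally show ?thesis by simp
qed

lemma powr_add_ge: fixes x y p :: real assumes "0 <= x" "0 <= y" "1 <= p" shows "x powr p+y powr p <= (2*(x+y)) powr p"
proof -
 have "x powr p+y powr p <= 2*(x+y) powr p" using powr_mono2[of p x "x+y"] powr_mono2[of p y "x+y"] assms by simp
 also have "2 <= (2::real) powr p" using powr_mono[of 1 p "2::real"] assms by simp
 also have "2 powr p*(x+y) powr p = (2*(x+y)) powr p" by (rule powr_mult[symmetric])
 finally show ?thesis by (simp add: mult_right_mono)
qed

text \<open>A crude Minkowski inequality, uniform in the exponent; the factor 4 comes from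
  \<open>powr_add_le\<close> and \<open>powr_add_ge\<close>. For q infinite the exponent 1/q is 0,
  and then the positivity of x makes its power equal to 1.\<close>

lemma Lnorm_indicator_add:
 assumes h: "h : bmeas M" "!!z. 0 <= h z" and A: "A : sets M" "A <= B" "emeas M A = enn x" "0 < x" and B: "B Int space M : sets M"
  and c: "0 <= c" and q: "1 <= q" and g: "Lnorm (restr M B) q h <= enn g" "0 <= g"
 shows "Lnorm M q (%z. ind A z*(h z+c)) <= enn (4*(g+c*x powr enn2real (1/q)))"
proof -
 have iB: "(ind B :: _ => ennreal) : bmeas M" using B by (simp add: borel_measurable_indicator_iff)
 have Jm: "(%z. ind A z*(h z+c)) : bmeas M" using h(1) A(1) by measurable
 show ?thesis
 proof (cases "q = \<infinity>")
  case True
  have "AE z in restr M B. enn \<bar>h z\<bar> <= esssup (restr M B) (%z. enn \<bar>h z\<bar>)" by (rule esssup_AE)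
  hence "AE z in restr M B. enn \<bar>h z\<bar> <= enn g" using g(1) True by (auto simp: Lnorm_def elim!: eventually_mono intro: order_trans)
  hence "AE z in M. 0 < (ind B z :: ennreal) --> enn \<bar>h z\<bar> <= enn g" unfolding restr_def by (simp add: AE_density[OF iB])
  hence "AE z in M. enn \<bar>ind A z*(h z+c)\<bar> <= enn (4*(g+c*x powr enn2real (1/q)))"
  proof eventually_elim
   case (elim z)
   show ?case
   proof (rule ennreal_leI, cases "z : A")
    case zA: True
    hence "h z <= g" using elim A(2) h(2)[of z] g(2) by (auto simp: ennreal_le_iff indicator_def)
    thus "\<bar>ind A z*(h z+c)\<bar> <= 4*(g+c*x powr enn2real (1/q))" using zA True h(2)[of z] c g(2) A(4) by simp
   qed (use c g in simp)
  qed
  thus ?thesis using True Jm by (simp add: Lnorm_def esssup_I)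
 next
  case False
  then obtain p where p: "q = enn p" "0 <= p" by (cases q) auto
  have p1: "1 <= p" using q p by (simp add: ennreal_ge_1)
  have ep: "enn2real q = p" using p by simp
  have s: "enn2real (1/q) = 1/p" using p p1 by (simp add: divide_ennreal[of 1 p, simplified])
  define I where "I = (\<integral>\<^sup>+z. enn (h z powr p)*ind B z \<partial>M)"
  have "(\<integral>\<^sup>+z. enn (\<bar>h z\<bar> powr p) \<partial>restr M B) = I"
   unfolding restr_def I_def by (subst nn_integral_density[OF iB]) (use h in "auto simp: mult.commute")
  hence eI: "epow I (1/p) <= enn g" using g(1) False ep by (simp add: Lnorm_def)
  have "I ~= \<infinity>" using eI by (auto simp: epow_def top_unique)
  then obtain r where r: "I = enn r" "0 <= r" by (cases I) auto
  have "r powr (1/p) <= g" using eI r g(2) by (simp add: epow_def ennreal_le_iff)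
  hence "(r powr (1/p)) powr p <= g powr p" using p1 by (intro powr_mono2) auto
  hence rg: "r <= g powr p" using p1 r by (simp add: powr_powr)
  have "(\<integral>\<^sup>+z. enn (\<bar>ind A z*(h z+c)\<bar> powr p) \<partial>M) <= (\<integral>\<^sup>+z. enn (2 powr p)*(enn (h z powr p)*ind B z+enn (c powr p)*ind A z) \<partial>M)"
  proof (rule nn_integral_mono)
   fix z
   show "enn (\<bar>ind A z*(h z+c)\<bar> powr p) <= enn (2 powr p)*(enn (h z powr p)*ind B z+enn (c powr p)*ind A z)"
   proof (cases "z : A")
    case True
    have "(h z+c) powr p <= 2 powr p*(h z powr p+c powr p)" by (rule powr_add_le) (use h(2) c p in auto)
    hence "enn ((h z+c) powr p) <= enn (2 powr p)*(enn (h z powr p)+enn (c powr p))" by (simp add: ennreal_mult'[symmetric] ennreal_leI flip: ennreal_plus)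
    thus ?thesis using True A(2) h(2)[of z] c by (auto simp: subset_eq)
   qed simp
  qed
  also have "... = enn (2 powr p)*(\<integral>\<^sup>+z. enn (h z powr p)*ind B z+enn (c powr p)*ind A z \<partial>M)" by (rule nn_integral_cmult) (use h iB A in measurable)
  also have "(\<integral>\<^sup>+z. enn (h z powr p)*ind B z+enn (c powr p)*ind A z \<partial>M) = I+(\<integral>\<^sup>+z. enn (c powr p)*ind A z \<partial>M)"
   unfolding I_def by (rule nn_integral_add) (use h iB A in measurable)
  also have "(\<integral>\<^sup>+z. enn (c powr p)*ind A z \<partial>M) = enn (c powr p)*enn x" using A by (simp add: nn_integral_cmult_indicator)
  finally have "(\<integral>\<^sup>+z. enn (\<bar>ind A z*(h z+c)\<bar> powr p) \<partial>M) <= enn (2 powr p)*(I+enn (c powr p)*enn x)" .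
  also have "... = enn (2 powr p*(r+c powr p*x))" using r A(4) by (simp add: ennreal_mult'[symmetric] flip: ennreal_plus)
  also have "... <= enn ((4*(g+c*x powr (1/p))) powr p)"
  proof (rule ennreal_leI)
   have v: "(c*x powr (1/p)) powr p = c powr p*x" using c A(4) p1 by (simp add: powr_mult powr_powr)
   have "g powr p+(c*x powr (1/p)) powr p <= (2*(g+c*x powr (1/p))) powr p" by (rule powr_add_ge) (use g c p1 in auto)
   hence "r+c powr p*x <= (2*(g+c*x powr (1/p))) powr p" using rg v by simp
   hence "2 powr p*(r+c powr p*x) <= 2 powr p*(2*(g+c*x powr (1/p))) powr p" by (intro mult_left_mono) auto
   also have "... = (2*(2*(g+c*x powr (1/p)))) powr p" using g c by (subst powr_mult[symmetric]) auto
   finally show "2 powr p*(r+c powr p*x) <= (4*(g+c*x powr (1/p))) powr p" by simp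
  qed
  finally have "epow (\<integral>\<^sup>+z. enn (\<bar>ind A z*(h z+c)\<bar> powr p) \<partial>M) (1/p) <= epow (enn ((4*(g+c*x powr (1/p))) powr p)) (1/p)" by (rule epow_mono) (use p in simp)
  also have "... = enn (4*(g+c*x powr (1/p)))" using g c p1 by (simp add: epow_def powr_powr)
  finally show ?thesis using False ep s by (simp add: Lnorm_def)
 qed
qed

lemma powr_tendsto_0: "0 < p==>((%t::real. t powr p) \<longlongrightarrow> 0) (at_right 0)"
 using tendsto_powr'[of "%t. t" 0 "at_right (0::real)" "%t. p" p] by (auto simp: eventually_at_filter)

section \<open>Oscillation of one coordinate near a point of the support\<close>

context vsp
begin

lemma strip_disjoint:
 fixes f :: "vec => vec" and a :: vec and r lo L :: real and i :: nat
 assumes L: "0 < L"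
 defines "A j \<equiv> {z : U Int cball a r. lo+real j*L < lk (f z) i & lk (f z) i < lo+real j*L+L}"
 shows "disjoint_family A" "A j <= U Int cball a r"
proof -
 have "A j Int A k = {}" if "j < k" for j k
 proof -
  have "(real j+1)*L <= real k*L" using that L by (intro mult_right_mono) auto
  thus ?thesis by (auto simp: A_def algebra_simps)
 qed
 thus "disjoint_family A" unfolding disjoint_family_on_def by (metis Int_commute nat_neq_iff)
 show "A j <= U Int cball a r" by (auto simp: A_def)
qed

lemma ball_facts: 
 assumes "nice_ball a (4*rho)"
 shows "U Int cball a (3*rho) : sets mu" "emeas mu (U Int cball a (3*rho)) < \<infinity>" "cball a \<epsilon> Int space cmu : sets cmu"
proof -
 show 1: "U Int cball a (3*rho) : sets mu" using opn_borel[OF U] by (simp add: in_sets_mu)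
 show "cball a \<epsilon> Int space cmu : sets cmu" using opn_borel[OF U] by (simp add: in_sets_mu)
 have c: "cball a (4*rho) Int Rn n <= U" "0 < rho" using assms by (auto simp: nice_ball_def)
 have "emeas mu (U Int cball a (3*rho)) <= emeas mu (cball a (4*rho) Int Rn n)" by (rule emeasure_mono) (use c opn_subset[OF U] in "auto simp: in_sets_mu")
 thus "emeas mu (U Int cball a (3*rho)) < \<infinity>" using mu_compact[OF compact_cball_Rn c(1)] by (rule order.strict_trans1)
qed

lemma Kc_eq: "0 < rho==>Kc rho = real n*real n*6*Lstp/5/rho" by (simp add: Kc_def power2_eq_square field_simps)

text \<open>Sum of the N strip estimates. The strip sets are disjoint, so the derivative of f is
  counted only once, and the error terms L K with L = d/N add up to d K b / N, where b is the mass
  of the ball. Letting N tend to infinity leaves d/4 <= Gamma g.\<close>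

lemma oscillation_1:
 assumes m: "m = 1" and a: "a : Sp" and \<epsilon>: "0 < \<epsilon>"
 shows "EX \<sigma>>0. ALL l f i z. continuous_on Sp f --> f : TV n l U V --> i < l --> z : Sp Int ball a \<sigma> -->
  enn \<bar>lk (f z) i - lk (f a) i\<bar> <= enn (4*\<Gamma>)*Lnorm (restr cmu (cball a \<epsilon>)) 1 (%z. hs_norm n (weak_deriv n l U V f z))"
proof -
 obtain r0 where r0: "0 < r0" "!!r. 0 < r==>r <= r0==>nice_ball a r" using nice_ball_exists[OF a] by blast
 \<comment> \<open>Keeps 4 rho among the radii of nice balls and the strip sets, of radius 3 rho,
   inside the ball of radius epsilon.\<close>
 define rho where "rho = min r0 \<epsilon>/4"
 have rho: "0 < rho" "4*rho <= r0" "3*rho <= \<epsilon>" using r0 \<epsilon> by (auto simp: rho_def min_def)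
 have nb: "nice_ball a (4*rho)" using r0(2)[of "4*rho"] rho by simp
 from strips[OF nb] obtain \<sigma> where \<sigma>: "0 < \<sigma>" "ALL l f i z. continuous_on Sp f --> z : Sp Int ball a \<sigma> --> lk (f z) i ~= lk (f a) i -->
  (ALL N::nat. 0 < N --> (ALL j<N. EX y:Sp Int ball a (2*rho). EX \<alpha> L. L = \<bar>lk (f z) i - lk (f a) i\<bar>/real N &
   \<alpha> = min (lk (f a) i) (lk (f z) i)+real j*L & lk (f y) i = \<alpha>+L/2 & (lk (f a) i <= \<alpha> \<or> \<alpha>+L <= lk (f a) i)))" by (elim exE conjE)
 have main: "enn \<bar>lk (f z) i - lk (f a) i\<bar> <= enn (4*\<Gamma>)*Lnorm (restr cmu (cball a \<epsilon>)) 1 (%z. hs_norm n (weak_deriv n l U V f z))"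
  if f: "continuous_on Sp f" "f : TV n l U V" and i: "i < l" and z: "z : Sp Int ball a \<sigma>" for l f i z
 proof (cases "lk (f z) i = lk (f a) i")
  case False
  define d where "d = \<bar>lk (f z) i - lk (f a) i\<bar>"
  have d: "0 < d" using False by (simp add: d_def)
  define h where "h z = hs_norm n (weak_deriv n l U V f z)" for z
  have h: "h : bmeas cmu" "!!z. 0 <= h z" using weak_deriv_facts[OF f(2)] by (auto simp: h_def[abs_def])
  define g where "g = Lnorm (restr cmu (cball a \<epsilon>)) 1 h"
  define B where "B = U Int cball a (3*rho)"
  note bf = ball_facts[OF nb]
  have Bm: "B : sets cmu" using bf(1) by (simp add: B_def)
  define b where "b = measure mu B"
  have b: "emeas cmu B = enn b" using bf by (simp add: b_def B_def emeasure_eq_ennreal_measure less_top[symmetric])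
  have iE: "(ind (cball a \<epsilon>) :: _ => ennreal) : bmeas cmu" using bf(3) by (simp add: borel_measurable_indicator_iff)
  have hg: "(\<integral>\<^sup>+z. enn (h z)*ind B z \<partial>cmu) <= g"
  proof -
   have "g = (\<integral>\<^sup>+z. enn (h z) \<partial>restr cmu (cball a \<epsilon>))" unfolding g_def by (rule Lnorm_1[OF h(2)])
   also have "... = (\<integral>\<^sup>+z. ind (cball a \<epsilon>) z*enn (h z) \<partial>cmu)" unfolding restr_def by (rule nn_integral_density[OF iE]) (use h in measurable)
   finally show ?thesis using rho by (simp only:) (rule nn_integral_mono, auto simp: B_def indicator_def)
  qed
  define K where "K = Kc rho"
  have K: "0 <= K" using rho Lstp(1) by (simp add: K_def Kc_eq)
  have est: "enn (d/4) <= enn \<Gamma>*(g+enn (d*K*b/real N))" if N: "0 < N" for N :: nat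
  proof -
   define L where "L = d/real N"
   define lo where "lo = min (lk (f a) i) (lk (f z) i)"
   have L: "0 < L" using d N by (simp add: L_def)
   define A where "A j = {z : U Int cball a (3*rho). lo+real j*L < lk (f z) i & lk (f z) i < lo+real j*L+L}" for j
   define J where "J j = (%z. ind (A j) z*(h z+L*K))" for j
   have s: "A j : sets cmu & J j : bmeas cmu & enn (L/4) <= enn \<Gamma>*(\<integral>\<^sup>+z. enn (J j z) \<partial>cmu)" if j: "j < N" for j
   proof -
    from \<sigma>(2)[rule_format, OF f(1) z False N j] obtain y where y: "y : Sp Int ball a (2*rho)" "lk (f y) i = lo+real j*L+L/2"
     "lk (f a) i <= lo+real j*L \<or> lo+real j*L+L <= lk (f a) i" by (auto simp: lo_def L_def d_def)
    show ?thesis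
     using strip_estimate(1-3)[OF nb f i L y A_def J_def[unfolded h_def K_def]] m by blast
   qed
   have "enn (d/4) = (\<Sum>j<N. enn (L/4))"
    using N d by (simp add: L_def ennreal_mult'[symmetric] flip: ennreal_of_nat_eq_real_of_nat) (simp add: ennreal_of_nat_eq_real_of_nat ennreal_mult'[symmetric])
   also have "... <= (\<Sum>j<N. enn \<Gamma>*(\<integral>\<^sup>+z. enn (J j z) \<partial>cmu))" by (rule sum_mono) (use s in auto)
   also have "... = enn \<Gamma>*(\<integral>\<^sup>+z. (\<Sum>j<N. enn (J j z)) \<partial>cmu)"
    unfolding sum_distrib_left[symmetric] by (subst nn_integral_sum) (use s measurable_compose[OF _ measurable_ennreal] in auto)
   also have "(\<integral>\<^sup>+z. (\<Sum>j<N. enn (J j z)) \<partial>cmu) <= (\<integral>\<^sup>+z. enn (h z)*ind B z+enn (L*K)*ind B z \<partial>cmu)"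
   proof (rule nn_integral_mono)
    fix z
    have dj: "disjoint_family_on A {..<N}" using strip_disjoint(1)[OF L] unfolding A_def by (rule disjoint_family_on_mono[OF subset_UNIV])
    have "(\<Sum>j<N. enn (J j z)) = enn (\<Sum>j<N. J j z)" by (rule sum_ennreal) (use h(2) L K in "auto simp: J_def")
    also have "(\<Sum>j<N. J j z) = ind (\<Union>j<N. A j) z*(h z+L*K)"
     unfolding J_def by (subst indicator_UN_disjoint[OF _ dj]) (auto simp: sum_distrib_right)
    also have "... <= ind B z*(h z+L*K)" by (rule mult_right_mono) (use h(2)[of z] L K in "auto simp: indicator_def B_def A_def")
    finally show "(\<Sum>j<N. enn (J j z)) <= enn (h z)*ind B z+enn (L*K)*ind B z"
     using h(2)[of z] L K by (auto simp: indicator_def ennreal_leI simp flip: ennreal_plus split: if_splits)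
   qed
   also have "... = (\<integral>\<^sup>+z. enn (h z)*ind B z \<partial>cmu)+(\<integral>\<^sup>+z. enn (L*K)*ind B z \<partial>cmu)" by (rule nn_integral_add) (use h Bm in measurable)
   also have "(\<integral>\<^sup>+z. enn (L*K)*ind B z \<partial>cmu) = enn (L*K)*enn b" using Bm b by (simp add: nn_integral_cmult_indicator)
   also have "... = enn (d*K*b/real N)" by (simp add: L_def b_def ennreal_mult''[symmetric])
   also have "(\<integral>\<^sup>+z. enn (h z)*ind B z \<partial>cmu) <= g" by (rule hg)
   finally show ?thesis by (simp add: mult_left_mono add_right_mono)
  qed
  show ?thesis unfolding h_def[abs_def, symmetric] d_def[symmetric] g_def[symmetric]
  proof (cases g)
   case top
   thus "enn d <= enn (4*\<Gamma>)*g" using \<Gamma>_pos by (simp add: ennreal_mult_top)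
  next
   case (real r)
   have "d/4 <= \<Gamma>*(r+d*K*b/real (Suc N))" for N
   proof -
    have nn: "0 <= d*K*b/real (Suc N)" using d K by (simp add: b_def)
    have "enn (d/4) <= enn (\<Gamma>*(r+d*K*b/real (Suc N)))"
     using est[of "Suc N"] real nn \<Gamma>_pos by (simp add: ennreal_mult' del: of_nat_Suc)
    thus ?thesis using real nn \<Gamma>_pos by (subst (asm) ennreal_le_iff) auto
   qed
   moreover have "(%N. \<Gamma>*(r+d*K*b*(1/real (Suc N)))) \<longlonglongrightarrow> \<Gamma>*(r+d*K*b*0)" by (intro tendsto_intros LIMSEQ_Suc[OF lim_1_over_n])
   ultimately have "d/4 <= \<Gamma>*(r+d*K*b*0)" by (intro LIMSEQ_le_const) auto
   hence "enn d <= enn (4*\<Gamma>*r)" by (intro ennreal_leI) simp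
   thus "enn d <= enn (4*\<Gamma>)*g" using real \<Gamma>_pos by (simp add: ennreal_mult)
  qed
 qed simp
 show ?thesis using \<sigma>(1) main by blast
qed


text \<open>Of N disjoint strip sets one has mass x <= M/N, where M is the mass of the ball. Its
  estimate reads L/4 <= 4 C0 x^e (g + L K x^(1/q)) with e = 1/m - 1/q, so the last term is 4 C0 K L
  x^(1/m). Taking N of size M (32 C0 K)^m makes this at most L/8 and leaves d = N L <= 32 C0 N M^e
  g. Here K = K1/rho and M <= C (3 rho)^b by \<open>growth\<close>, so the coefficient tends to zero
  with rho and can be brought below epsilon/2.\<close>

lemma oscillation_2:
 assumes m: "1 < m" and q: "enn (real m) < q" and a: "a : Sp" and \<epsilon>: "0 < \<epsilon>"
 shows "EX \<sigma>>0. ALL l f i z. continuous_on Sp f --> f : TV n l U V --> i < l --> z : Sp Int ball a \<sigma> -->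
  enn \<bar>lk (f z) i - lk (f a) i\<bar> <= enn (\<epsilon>/2)*Lnorm (restr cmu (cball a \<epsilon>)) q (%z. hs_norm n (weak_deriv n l U V f z))"
proof -
 define s where "s = enn2real (1/q)"
 have s: "0 <= s" "s < 1/real m"
 proof -
  show "s < 1/real m"
  proof (cases "q = \<infinity>")
   case False
   then obtain p where p: "q = enn p" "0 <= p" by (cases q) auto
   hence "real m < p" using q m by (simp add: ennreal_less_iff)
   moreover have "s = 1/p" using p calculation m by (simp add: s_def divide_ennreal[of 1 p, simplified])
   ultimately show ?thesis using m by (simp add: frac_less2)
  qed (use m in "simp add: s_def")
 qed (simp add: s_def)
 define e where "e = 1/real m - s"
 have e: "0 < e" "e <= 1/real m" using s by (auto simp: e_def)
 have e1: "e < 1" using e(2) m by (auto intro: le_less_trans)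
 \<comment> \<open>With this loss in the growth exponent, b - m + b e = e m (3/4 - e/4) is still
   positive; it is the smaller of the two powers of rho in \<open>T\<close>.\<close>
 define \<delta> where "\<delta> = e*real m/4"
 have em: "e*real m <= 1" using e(2) m by (simp add: field_simps)
 have \<delta>: "0 < \<delta>" "\<delta> < real m" using e e1 m by (auto simp: \<delta>_def)
 define b where "b = real m - \<delta>"
 have b: "0 < b" using \<delta> by (simp add: b_def)
 have ex1: "0 < b - real m+b*e"
 proof -
  have "b - real m+b*e = e*real m*(3/4 - e/4)" by (simp add: b_def \<delta>_def algebra_simps)
  thus ?thesis using e e1 m by simp
 qed
 define C0 where "C0 = \<Gamma> powr (1/e)"
 have C0: "0 < C0" using \<Gamma>_pos by (simp add: C0_def)
 define K1 where "K1 = real n*real n*6*Lstp/5"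
 have K1: "0 < K1" using m mn Lstp(1) by (simp add: K1_def)
 have aU: "a : U" using a Sp_U by blast
 from growth[OF m \<delta> aU] obtain C R where CR: "0 < C" "0 < R" "!!kp. 0 < kp ==> kp <= R==>emeas mu (cball a kp Int U) <= enn (C*kp powr b)" by (auto simp: b_def)
 obtain r0 where r0: "0 < r0" "!!r. 0 < r==>r <= r0==>nice_ball a r" using nice_ball_exists[OF a] by blast
 define Mb where "Mb t = C*(3*t) powr b" for t
 \<comment> \<open>Upper bound for 32 C0 N M^e at radius t; the summand 2 allows for rounding N up
   to a positive integer.\<close>
 define T where "T t = 32*C0*(Mb t*(32*C0*(K1/t)) powr real m+2)*Mb t powr e" for t
 have "eventually (%t. T t < \<epsilon>/2) (at_right 0)"
 proof -
  define c1 where "c1 = 32*C0*C*3 powr b*(32*C0*K1) powr real m*(C*3 powr b) powr e"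
  define c2 where "c2 = 64*C0*(C*3 powr b) powr e"
  have "((%t. c1*t powr (b - real m+b*e)+c2*t powr (b*e)) \<longlongrightarrow> c1*0+c2*0) (at_right 0)"
   using ex1 b e by (intro tendsto_intros powr_tendsto_0) auto
  hence "eventually (%t. c1*t powr (b - real m+b*e)+c2*t powr (b*e) < \<epsilon>/2) (at_right 0)" by (rule order_tendstoD) (use \<epsilon> in simp)
  moreover have "T t = c1*t powr (b - real m+b*e)+c2*t powr (b*e)" if t: "0 < t" for t
  proof -
   have "Mb t powr e = (C*3 powr b) powr e*t powr (b*e)" using t CR(1) by (simp add: Mb_def powr_mult powr_powr)
   moreover have "(32*C0*(K1/t)) powr real m = (32*C0*K1) powr real m*t powr (- real m)"
   proof -
    have "32*C0*(K1/t) = (32*C0*K1)*t powr (- 1)" using t by (simp add: powr_minus_divide)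
    thus ?thesis by (simp only: powr_mult powr_powr) simp
   qed
   moreover have "Mb t = C*3 powr b*t powr b" using t by (simp add: Mb_def powr_mult)
   moreover have "t powr (b - real m+b*e) = t powr b*t powr (- real m)*t powr (b*e)" by (simp flip: powr_add)
   ultimately show ?thesis unfolding T_def c1_def c2_def by (simp add: algebra_simps)
  qed
  ultimately show ?thesis by (auto simp: eventually_at_right_field)
 qed
 then obtain t0 where t0: "0 < t0" "!!t. 0 < t==>t < t0==>T t < \<epsilon>/2" by (auto simp: eventually_at_right_field)
 define rho where "rho = min (min r0 \<epsilon>) (min R t0)/4"
 have rho: "0 < rho" "4*rho <= r0" "3*rho <= \<epsilon>" "3*rho <= R" "rho < t0" using r0 \<epsilon> CR t0 by (auto simp: rho_def min_def)
 have Trho: "T rho < \<epsilon>/2" by (rule t0(2)[OF rho(1,5)])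
 have nb: "nice_ball a (4*rho)" using r0(2)[of "4*rho"] rho by simp
 from strips[OF nb] obtain \<sigma> where \<sigma>: "0 < \<sigma>" "ALL l f i z. continuous_on Sp f --> z : Sp Int ball a \<sigma> --> lk (f z) i ~= lk (f a) i -->
  (ALL N::nat. 0 < N --> (ALL j<N. EX y:Sp Int ball a (2*rho). EX \<alpha> L. L = \<bar>lk (f z) i - lk (f a) i\<bar>/real N &
   \<alpha> = min (lk (f a) i) (lk (f z) i)+real j*L & lk (f y) i = \<alpha>+L/2 & (lk (f a) i <= \<alpha> \<or> \<alpha>+L <= lk (f a) i)))" by (elim exE conjE)
 define B where "B = U Int cball a (3*rho)"
 note bf = ball_facts[OF nb]
 have Bm: "B : sets cmu" using bf(1) by (simp add: B_def)
 define M where "M = measure cmu B"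
 have Mf: "emeas cmu B < \<infinity>" using bf by (simp add: B_def)
 have M: "emeas cmu B = enn M" using Mf by (simp add: M_def emeasure_eq_ennreal_measure less_top[symmetric])
 have M0: "0 <= M" by (simp add: M_def)
 have MMb: "M <= Mb rho"
 proof -
  have "enn M <= enn (Mb rho)" using CR(3)[of "3*rho"] rho bf(1) M by (simp add: Mb_def B_def Int_commute)
  thus ?thesis using CR(1) by (subst (asm) ennreal_le_iff) (auto simp: Mb_def)
 qed
 define K where "K = K1/rho"
 have KK: "K = Kc rho" using rho(1) by (simp add: K_def Kc_eq K1_def)
 have K: "0 < K" using K1 rho(1) by (simp add: K_def)
 define N where "N = nat \<lceil>M*(32*C0*K) powr real m\<rceil>+1"
 have N0: "0 < N" by (simp add: N_def)
 have Nl: "M*(32*C0*K) powr real m <= real N" unfolding N_def by linarith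
 have Nu: "real N <= M*(32*C0*K) powr real m+2"
 proof -
  have "0 <= M*(32*C0*K) powr real m" using M0 by simp
  thus ?thesis unfolding N_def by linarith
 qed
 have bound: "32*C0*real N*M powr e <= \<epsilon>/2"
 proof -
  have "32*C0*real N*M powr e <= 32*C0*(Mb rho*(32*C0*K) powr real m+2)*Mb rho powr e"
  proof (intro mult_mono)
   show "real N <= Mb rho*(32*C0*K) powr real m+2"
    using Nu mult_right_mono[OF MMb, of "(32*C0*K) powr real m"] by simp
   show "M powr e <= Mb rho powr e" using MMb M0 e by (intro powr_mono2) auto
  qed (use C0 MMb M0 in auto)
  also have "... = T rho" by (simp add: T_def K_def)
  finally show ?thesis using Trho by simp
 qed
 have main: "enn \<bar>lk (f z) i - lk (f a) i\<bar> <= enn (\<epsilon>/2)*Lnorm (restr cmu (cball a \<epsilon>)) q (%z. hs_norm n (weak_deriv n l U V f z))"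
  if f: "continuous_on Sp f" "f : TV n l U V" and i: "i < l" and z: "z : Sp Int ball a \<sigma>" for l f i z
 proof (cases "lk (f z) i = lk (f a) i")
  case False
  define d where "d = \<bar>lk (f z) i - lk (f a) i\<bar>"
  have d: "0 < d" using False by (simp add: d_def)
  define h where "h z = hs_norm n (weak_deriv n l U V f z)" for z
  have h: "h : bmeas cmu" "!!z. 0 <= h z" using weak_deriv_facts[OF f(2)] by (auto simp: h_def[abs_def])
  define g where "g = Lnorm (restr cmu (cball a \<epsilon>)) q h"
  define L where "L = d/real N"
  define lo where "lo = min (lk (f a) i) (lk (f z) i)"
  have L: "0 < L" using d N0 by (simp add: L_def)
  define A where "A j = {z : U Int cball a (3*rho). lo+real j*L < lk (f z) i & lk (f z) i < lo+real j*L+L}" for j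
  define J where "J j = (%z. ind (A j) z*(h z+L*K))" for j
  have st: "A j : sets cmu & enn (L/4) <= enn C0*epow (emeas cmu (A j)) e*Lnorm cmu q (J j)" if j: "j < N" for j
  proof -
   from \<sigma>(2)[rule_format, OF f(1) z False N0 j] obtain y where y: "y : Sp Int ball a (2*rho)" "lk (f y) i = lo+real j*L+L/2"
    "lk (f a) i <= lo+real j*L \<or> lo+real j*L+L <= lk (f a) i" by (auto simp: lo_def L_def d_def)
   note se = strip_estimate[OF nb f i L y A_def J_def[unfolded h_def KK]]
   show ?thesis unfolding C0_def using se(1) se(4)[OF m q e_def[unfolded s_def]] by blast
  qed
  have AB: "A j <= B" for j by (auto simp: A_def B_def)
  have Af: "emeas cmu (A j) < \<infinity>" if "j < N" for j
   using emeasure_mono[OF AB Bm, of j] Mf by (rule order.strict_trans1)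
  \<comment> \<open>Pigeonhole principle: the disjoint strip sets share the mass M.\<close>
  have "EX j<N. measure cmu (A j) <= M/real N"
  proof (rule ccontr)
   assume "\<not> ?thesis"
   hence "(\<Sum>j<N. M/real N) < (\<Sum>j<N. measure cmu (A j))" using N0 by (intro sum_strict_mono) auto
   also have "... = measure cmu (\<Union>j<N. A j)"
   proof (rule measure_finite_Union[symmetric])
    show "disjoint_family_on A {..<N}" using strip_disjoint(1)[OF L] unfolding A_def by (rule disjoint_family_on_mono[OF subset_UNIV])
   qed (use st Af in "auto simp: less_top[symmetric]")
   also have "... <= M" unfolding M_def by (rule measure_mono_fmeasurable) (use AB st Bm Mf in "auto simp: fmeasurable_def")
   finally show False using N0 by simp
  qed
  then obtain j where j: "j < N" "measure cmu (A j) <= M/real N" by blast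
  define x where "x = measure cmu (A j)"
  have x: "emeas cmu (A j) = enn x" "0 <= x" using Af[OF j(1)] by (auto simp: x_def emeasure_eq_ennreal_measure less_top[symmetric])
  have est: "enn (L/4) <= enn (C0*x powr e)*Lnorm cmu q (J j)"
   using st[OF j(1)] x C0 by (simp add: epow_def ennreal_mult)
  \<comment> \<open>A null strip set would make the right-hand side of \<open>est\<close> zero, even
    against an infinite norm, since 0 times infinity is 0.\<close>
  have x0: "0 < x"
  proof (rule ccontr)
   assume "\<not> 0 < x"
   hence "x = 0" using x by simp
   thus False using est L by simp
  qed
  show ?thesis unfolding h_def[abs_def, symmetric] d_def[symmetric] g_def[symmetric]
  proof (cases g)
   case top
   thus "enn d <= enn (\<epsilon>/2)*g" using \<epsilon> by (simp add: ennreal_mult_top)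
  next
   case (real r)
   have "Lnorm cmu q (J j) <= enn (4*(r+L*K*x powr s))"
    unfolding J_def s_def
   proof (rule Lnorm_indicator_add[OF h])
    show "A j : sets cmu" using st j by blast
    show "A j <= cball a \<epsilon>" using rho(3) by (auto simp: A_def)
    show "cball a \<epsilon> Int space cmu : sets cmu" by (rule bf(3))
    have "1 <= enn (real m)" using m by (simp add: ennreal_ge_1)
    thus "1 <= q" using q by (meson less_imp_le order_trans)
    show "Lnorm (restr cmu (cball a \<epsilon>)) q h <= enn r" using real by (simp add: g_def)
   qed (use x x0 L K real in auto)
   hence "enn (L/4) <= enn (C0*x powr e)*enn (4*(r+L*K*x powr s))"
    using est by (meson mult_left_mono order_trans zero_le)
   also have "... = enn (C0*x powr e*(4*(r+L*K*x powr s)))" using C0 real L K by (simp add: ennreal_mult)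
   finally have 1: "L/4 <= C0*x powr e*(4*(r+L*K*x powr s))"
    using C0 real L K by (subst (asm) ennreal_le_iff) auto
   have es: "x powr e*x powr s = x powr (1/real m)" by (simp add: e_def flip: powr_add)
   have xm: "32*C0*K*x powr (1/real m) <= 1"
   proof -
    have "x*(32*C0*K) powr real m <= 1"
    proof -
     have "x*real N <= M" using j(2) N0 by (simp add: x_def field_simps)
     show ?thesis
     proof (rule ccontr)
      assume "\<not> ?thesis"
      hence gt: "1 < x*(32*C0*K) powr real m" by simp
      have "real N*1 < real N*(x*(32*C0*K) powr real m)" using N0 gt by (intro mult_strict_left_mono) auto
      also have "... = (x*real N)*(32*C0*K) powr real m" by simp
      also have "... <= M*(32*C0*K) powr real m" by (rule mult_right_mono[OF \<open>x*real N <= M\<close>]) simp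
      finally show False using Nl by simp
     qed
    qed
    hence "(x*(32*C0*K) powr real m) powr (1/real m) <= 1 powr (1/real m)" by (intro powr_mono2) (use x0 in auto)
    hence "x powr (1/real m)*(32*C0*K) <= 1" using m C0 K by (simp add: powr_mult powr_powr)
    thus ?thesis by (simp add: mult_ac)
   qed
   \<comment> \<open>Absorption: the exponents e and s add up to 1/m, and \<open>xm\<close> bounds
     the last term by L/8.\<close>
   have "C0*x powr e*(4*(r+L*K*x powr s)) = 4*C0*x powr e*r+L/8*(32*C0*K*(x powr e*x powr s))" by (simp add: algebra_simps)
   also have "... <= 4*C0*x powr e*r+L/8*1" unfolding es by (rule add_left_mono[OF mult_left_mono[OF xm]]) (use L in simp)
   finally have "L <= 32*C0*x powr e*r" using 1 by simp
   also have "... <= 32*C0*M powr e*r"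
   proof -
    have "x <= M" using measure_mono_fmeasurable[OF AB[of j]] st[OF j(1)] Bm Mf by (simp add: x_def M_def fmeasurable_def)
    hence "x powr e <= M powr e" using x e by (intro powr_mono2) auto
    thus ?thesis using C0 real by (intro mult_right_mono mult_left_mono) auto
   qed
   finally have "real N*L <= real N*(32*C0*M powr e*r)" by (rule mult_left_mono) simp
   hence "d <= 32*C0*real N*M powr e*r" using N0 by (simp add: L_def mult_ac)
   also have "... <= \<epsilon>/2*r" by (rule mult_right_mono[OF bound]) (use real in simp)
   finally have "enn d <= enn (\<epsilon>/2*r)" by (rule ennreal_leI)
   also have "... = enn (\<epsilon>/2)*g" unfolding real(2) by (rule ennreal_mult) (use \<epsilon> real(1) in auto)
   finally show "enn d <= enn (\<epsilon>/2)*g" .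
  qed
 qed simp
 show ?thesis using \<sigma>(1) main by blast
qed

end

section \<open>Uniform modulus of continuity on K\<close>

context vsp
begin

text \<open>A Lebesgue number for the balls of the local bounds puts two close points of K into one
  ball. The triangle inequality through its centre doubles c, and l coordinates with a common bound
  produce the factor sqrt(l). Since the local radii do not depend on f, neither does the Lebesgue
  number.\<close>

lemma modulus_of_continuity:
 fixes N :: "vec => nat => (vec => vec) => ennreal" and c :: ennreal
 assumes K: "compact K" "K <= U"
  and loc: "!!a. a : K==>a : Sp==>EX \<sigma>>0. ALL l f i z. continuous_on Sp f --> f : TV n l U V --> i < l --> z : Sp Int ball a \<sigma> -->
   enn \<bar>lk (f z) i - lk (f a) i\<bar> <= c*N a l f"
 shows "EX \<delta>>0. ALL l f z w. 1 <= l --> continuous_on Sp f --> f : TV n l U V --> z : K Int Sp --> w : K Int Sp --> dist z w < \<delta> -->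
  enn (dist (f z) (f w)) <= enn (sqrt (real l))*(2*c)*(SUP a\<in>K. N a l f)"
proof -
 have "EX \<sigma>>0. ALL l f i z. continuous_on Sp f --> f : TV n l U V --> i < l --> z : Sp Int ball a \<sigma> -->
   enn \<bar>lk (f z) i - lk (f a) i\<bar> <= c*N a l f" if a: "a : K" for a
 \<comment> \<open>A point off the support has a neighbourhood without points of the support, where
   the claim is vacuous.\<close>
 proof (cases "a : Sp")
  case False
  hence "a : Nsp" using a K(2) by (auto simp: Sp_eq)
  then obtain r where r: "0 < r" "cball a r Int Rn n <= Nsp" using opn_cball[OF Nsp_open(1)] by blast
  have "Sp Int ball a r = {}" using r(2) opn_mem[OF U] by (auto simp: Sp_eq subset_eq)
  thus ?thesis using r(1) by (intro exI[of _ r]) auto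
 qed (use loc a in blast)
 then obtain \<sigma> where \<sigma>: "!!a. a : K==>0 < \<sigma> a" "!!a l f i z. a : K==>continuous_on Sp f==>f : TV n l U V==>i < l==>z : Sp Int ball a (\<sigma> a) ==>
   enn \<bar>lk (f z) i - lk (f a) i\<bar> <= c*N a l f" by metis
 obtain \<delta> where \<delta>: "0 < \<delta>" "!!x. x : K==>EX G:(%a. ball a (\<sigma> a)) ` K. ball x \<delta> <= G"
 proof (rule Heine_Borel_lemma[OF K(1), of "(%a. ball a (\<sigma> a)) ` K"])
  show "K <= \<Union>((%a. ball a (\<sigma> a)) ` K)" using \<sigma>(1) by fastforce
 qed (use that in auto)
 have "enn (dist (f z) (f w)) <= enn (sqrt (real l))*(2*c)*(SUP a\<in>K. N a l f)"
  if l: "1 <= l" and f: "continuous_on Sp f" "f : TV n l U V" and z: "z : K Int Sp" and w: "w : K Int Sp" and d: "dist z w < \<delta>" for l f z w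
 proof -
  define S where "S = (SUP a\<in>K. N a l f)"
  obtain a where a: "a : K" "ball z \<delta> <= ball a (\<sigma> a)" using \<delta>(2)[of z] z by blast
  have zw: "z : Sp Int ball a (\<sigma> a)" "w : Sp Int ball a (\<sigma> a)" using subsetD[OF a(2), of z] subsetD[OF a(2), of w] z w d \<delta>(1) by auto
  have co: "enn \<bar>lk (f z) i - lk (f w) i\<bar> <= 2*c*S" if i: "i < l" for i
  proof -
   have "enn \<bar>lk (f z) i - lk (f w) i\<bar> <= enn (\<bar>lk (f z) i - lk (f a) i\<bar>+\<bar>lk (f w) i - lk (f a) i\<bar>)" by (rule ennreal_leI) simp
   also have "... <= c*N a l f+c*N a l f"
    unfolding ennreal_plus[OF abs_ge_zero abs_ge_zero] by (intro add_mono \<sigma>(2) a f i zw)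
   also have "... = 2*c*N a l f" by (simp add: mult_2 distrib_right)
   also have "... <= 2*c*S" unfolding S_def by (intro mult_left_mono SUP_upper a) simp
   finally show ?thesis .
  qed
  have "enn (dist (f z) (f w)) <= enn (sqrt (real l))*(2*c*S)"
  \<comment> \<open>If the bound for the coordinates is infinite, so is the right-hand side, because
    l >= 1.\<close>
  proof (cases "2*c*S")
   case top
   have "0 < sqrt (real l)" using l by simp
   thus ?thesis unfolding top by (simp add: ennreal_mult_top)
  next
   case (real t)
   have t: "\<bar>lk (f z) i - lk (f w) i\<bar> <= t" if "i < l" for i using co[OF that] real by (simp add: ennreal_le_iff)
   have "f ` U <= Rn l" using f(2)[unfolded TV_def mem_Collect_eq, THEN conjunct2, THEN conjunct1] .
   hence "f z - f w : Rn l" using zw Sp_U by (intro Rn_diff) auto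
   hence "dist (f z) (f w) = sqrt (\<Sum>i<l. (lk (f z) i - lk (f w) i)^2)" unfolding dist_norm by (subst norm_Rn) auto
   also have "... <= sqrt (\<Sum>i<l. t^2)" by (intro real_sqrt_le_mono sum_mono) (use t real(1) in "auto simp: abs_le_square_iff[symmetric]")
   also have "... = sqrt (real l)*t" using real(1) by (simp add: real_sqrt_mult)
   finally have "enn (dist (f z) (f w)) <= enn (sqrt (real l)*t)" by (rule ennreal_leI)
   thus ?thesis using real by (simp add: ennreal_mult)
  qed
  thus ?thesis by (simp add: S_def mult.assoc)
 qed
 thus ?thesis using \<delta>(1) by blast
qed

end

section \<open>Comparison of the constants in the two cases\<close>

theorem theorem12p1:
  fixes m n :: nat and U K :: "vec set" and V :: "(vec \<times> vec set) measure"
    and \<epsilon> \<Gamma>\<^sub>S\<^sub>P :: real and q lam :: ennreal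
  assumes "1 \<le> m" and "m \<le> n"
    and "openin (top_of_set (Rn n)) U"
    and "varifold n m U V"
    and "radon_var n U (first_var n V)"
    and "AE z in weight U V. has_mdens (weight U V) m z \<and> 1 \<le> mdens (weight U V) m z"
    and "1 < m \<Longrightarrow> mean_curv_hyp n U V (real m)"
    and "compact K" and "K \<subseteq> U"
    and "0 < \<epsilon>" and "ennreal \<epsilon> < eset_dist K (Rn n - U)"
    and "SP (2 * real n) \<Gamma>\<^sub>S\<^sub>P"
    and "(m = 1 \<and> q = 1 \<and>
           lam = ennreal (2 ^ (m + 5) / unit_ball_vol (real m) * \<Gamma>\<^sub>S\<^sub>P) *
             (SUP a\<in>K. mdens (weight U V) 1 a)) \<or>
         (1 < m \<and> ennreal (real m) < q \<and> lam = ennreal \<epsilon>)"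
  shows "\<exists>\<Gamma>::real. 0 < \<Gamma> \<and>
    (\<forall>(l::nat) f \<gamma>.
      1 \<le> l \<and> continuous_on (spt U (weight U V)) f \<and> f \<in> TV n l U V \<and>
      \<gamma> = (SUP a\<in>K. Lnorm (restr (completion (weight U V)) (cball a \<epsilon>)) q
              (\<lambda>z. hs_norm n (weak_deriv n l U V f z))) \<longrightarrow>
      (\<forall>z w. z \<in> K \<inter> spt U (weight U V) \<and> w \<in> K \<inter> spt U (weight U V) \<and>
         dist z w \<le> 1 / \<Gamma> \<longrightarrow>
         ennreal (dist (f z) (f w)) \<le> ennreal (sqrt (real l)) * lam * \<gamma>))"
proof -
 interpret vsp n m U V \<Gamma>\<^sub>S\<^sub>P by unfold_locales (use assms in auto)
 define N where "N a l f = Lnorm (restr cmu (cball a \<epsilon>)) q (%z. hs_norm n (weak_deriv n l U V f z))" for a l f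
 \<comment> \<open>Half of the constant to be reached, as both points are compared with the centre
   of a ball.\<close>
 define c where "c = (if m = 1 then enn (4*\<Gamma>\<^sub>S\<^sub>P) else enn (\<epsilon>/2))"
 have "EX \<sigma>>0. ALL l f i z. continuous_on Sp f --> f : TV n l U V --> i < l --> z : Sp Int ball a \<sigma> -->
   enn \<bar>lk (f z) i - lk (f a) i\<bar> <= c*N a l f" if a: "a : Sp" for a
  using assms(13)
 proof (elim disjE conjE)
  assume "m = 1" "q = 1"
  thus ?thesis using oscillation_1[OF _ a assms(10)] unfolding N_def c_def by simp
 next
  assume "1 < m" "enn (real m) < q"
  thus ?thesis using oscillation_2[OF _ _ a assms(10)] unfolding N_def c_def by simp
 qed
 then obtain \<delta> where \<delta>: "0 < \<delta>" "!!l f z w. 1 <= l==>continuous_on Sp f==>f : TV n l U V==>z : K Int Sp==>w : K Int Sp==>dist z w < \<delta> ==>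
  enn (dist (f z) (f w)) <= enn (sqrt (real l))*(2*c)*(SUP a\<in>K. N a l f)"
  using modulus_of_continuity[OF assms(8,9), of c N] by blast
 have two: "2*enn x = enn (2*x)" for x by (simp add: ennreal_mult' flip: ennreal_numeral)
 \<comment> \<open>For m = 1 one has 2^(m+5)/alpha(m) = 64/2 = 32, and the supremum of the densities
   is at least 1/4 since z lies in K and in the support; so 2c = 8 Gamma is at most
   \<open>lam\<close>. For m > 1 equality holds.\<close>
 have lam: "2*c <= lam" if z: "z : K Int Sp" for z
  using assms(13)
 proof (elim disjE conjE)
  assume m: "m = 1" and l: "lam = enn (2 ^ (m+5)/unit_ball_vol (real m)*\<Gamma>\<^sub>S\<^sub>P)*(SUP a\<in>K. mdens (weight U V) 1 a)"
  have "2*c = enn (2*(4*\<Gamma>\<^sub>S\<^sub>P))" using m two[of "4*\<Gamma>\<^sub>S\<^sub>P"] by (simp only: c_def if_True refl)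
  also have "... = enn (32*\<Gamma>\<^sub>S\<^sub>P)*enn (1/4)" using \<Gamma>_pos by (subst ennreal_mult[symmetric]) auto
  also have "... <= enn (32*\<Gamma>\<^sub>S\<^sub>P)*(SUP a\<in>K. mdens (weight U V) 1 a)"
  proof (rule mult_left_mono)
   have "enn (1/4) <= mdens (weight U V) 1 z" by (rule density_lower_bound[OF m]) (use z in simp)
   also have "... <= (SUP a\<in>K. mdens (weight U V) 1 a)" by (rule SUP_upper) (use z in simp)
   finally show "enn (1/4) <= (SUP a\<in>K. mdens (weight U V) 1 a)" .
  qed simp
  also have "... = lam" unfolding l by (simp add: m unit_ball_vol_1)
  finally show ?thesis .
 next
  assume m: "1 < m" and l: "lam = enn \<epsilon>"
  have "2*c = enn (2*(\<epsilon>/2))" using m unfolding two[symmetric] by (simp add: c_def)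
  thus ?thesis using l by simp
 qed
 show ?thesis
 \<comment> \<open>With 2/delta the condition allows |z - w| <= delta/2, which gives the strict
   inequality |z - w| < delta.\<close>
 proof (intro exI[of _ "2/\<delta>"] conjI allI impI)
  show "0 < 2/\<delta>" using \<delta>(1) by simp
  fix l :: nat and f \<gamma> z w
  assume f: "1 <= l & continuous_on Sp f & f : TV n l U V & \<gamma> = (SUP a\<in>K. Lnorm (restr cmu (cball a \<epsilon>)) q (%z. hs_norm n (weak_deriv n l U V f z)))"
   and zw: "z : K Int Sp & w : K Int Sp & dist z w <= 1/(2/\<delta>)"
  have \<gamma>: "\<gamma> = (SUP a\<in>K. N a l f)" using f by (simp add: N_def)
  have "dist z w < \<delta>" using zw \<delta>(1) by simp
  hence "enn (dist (f z) (f w)) <= enn (sqrt (real l))*(2*c)*\<gamma>" unfolding \<gamma> using f zw by (intro \<delta>(2)) auto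
  also have "... <= enn (sqrt (real l))*lam*\<gamma>" using lam[of z] zw by (intro mult_right_mono mult_left_mono) auto
  finally show "enn (dist (f z) (f w)) <= enn (sqrt (real l))*lam*\<gamma>" .
 qed
qed

end
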